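(* Let $b$ be a monoid in a Bénabou cosmos $\mathcal{V}$ and let $\mathcal{C}$ be a cocomplete $\mathcal{V}$-enriched category. 1. The assignment $${}_b\mathcal{C}\to\mathcal{V}\textit{-Funct}(\textit{Mod}_b,\mathcal{C}),\qquad X\mapsto (-\circledast X:\textit{Mod}_b\to\mathcal{C})$$ defines a fully faithful left adjoint functor from the category of left $b$-module objects in $\mathcal{C}$ to the category of $\mathcal{V}$-enriched functors $\textit{Mod}_b\to\mathcal{C}$. 2. The essential image of this functor is the coreflective full subcategory $\mathcal{V}\textit{-Funct}_{\textit{cocon}}(\textit{Mod}_b,\mathcal{C})$ of cocontinuous $\mathcal{V}$-enriched functors $\textit{Mod}_b\to\mathcal{C}$, and we have an adjoint equivalence of categories $${}_b\mathcal{C}\simeq\mathcal{V}\textit{-Funct}_{\textit{cocon}}(\textit{Mod}_b,\mathcal{C}).$$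
   Context: A Bénabou cosmos $(\mathcal{V},\otimes,c)$ is a closed symmetric monoidal category whose underlying category is complete and cocomplete. "Enriched" means enriched in $\mathcal{V}$; a morphism in an enriched category means a morphism of its underlying category; $I_X$ denotes an identity morphism. A cocomplete enriched category (having all small weighted colimits) is in particular tensored: $z\otimes X$ denotes the tensor of $X\in\mathcal{C}$ by $z\in\mathcal{V}$, i.e. $-\otimes X:\mathcal{V}\to\mathcal{C}$ is left enriched adjoint to $\mathcal{C}(X,-)$. For an enriched functor $\mathcal{F}:\mathcal{C}\to\mathcal{D}$ of tensored enriched categories, the tensorial strength $t^{\mathcal{F}}_{z,X}:z\otimes\mathcal{F}(X)\to\mathcal{F}(z\otimes X)$ corresponds to $z\to\mathcal{C}(X,z\otimes X)\to\mathcal{D}(\mathcal{F}(X),\mathcal{F}(z\otimes X))$ (adjunction unit followed by $\mathcal{F}$); the enrichment of a functor is equivalent to its strength. For a monoid $(b,u_b,m_b)$ in $\mathcal{V}$, $\textit{Mod}_b$ is the (complete, cocomplete) enriched category of right $b$-modules $(x,\gamma_x:x\otimes b\to x)$; $\textit{Mod}_b(x,y)$ is the equalizer of the two morphisms $\mathcal{V}(x,y)\rightrightarrows\mathcal{V}(x\otimes b,y)$ given by precomposition with $\gamma_x$, and by $-\otimes b$ followed by postcomposition with $\gamma_y$; the tensor $z\otimes x$ has action $I_z\otimes\gamma_x$. A left $b$-module object in $\mathcal{C}$ is an object $X$ with a morphism $\rho_X:b\otimes X\to X$ in $\mathcal{C}$ satisfying the unit and associativity relations of a left action; morphisms are morphisms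 in $\mathcal{C}$ compatible with the actions. These form the category ${}_b\mathcal{C}$. For $X\in{}_b\mathcal{C}$, the enriched functor $-\circledast X:\textit{Mod}_b\to\mathcal{C}$ sends $z$ to the coequalizer $\textit{cq}_{z,X}:z\otimes X\to z\circledast X$ of $\gamma_z\otimes I_X,\ I_z\otimes\rho_X:z\otimes b\otimes X\rightrightarrows z\otimes X$ in $\mathcal{C}$; its strength $w\otimes(z\circledast X)\cong(w\otimes z)\circledast X$ is the isomorphism induced by $w\otimes(z\otimes X)\cong(w\otimes z)\otimes X$. A morphism $X\to Y$ in ${}_b\mathcal{C}$ induces $-\circledast X\Rightarrow-\circledast Y$. $\mathcal{V}\textit{-Funct}(\textit{Mod}_b,\mathcal{C})$ is the category of enriched functors and enriched natural transformations. Cocontinuous means preserving small weighted colimits. *)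

theory Defs
  imports Main "HOL-Library.FuncSet"
begin

unbundle cardinal_syntax

section \<open>Ordinary categories\<close>

record ('o, 'a) cat =
  Obj :: "'o set"
  Arr :: "'a set"
  Dom :: "'a \<Rightarrow> 'o"
  Cod :: "'a \<Rightarrow> 'o"
  Ide :: "'o \<Rightarrow> 'a"
  Comp :: "'a \<Rightarrow> 'a \<Rightarrow> 'a"  (infixr "\<cdot>\<index>" 70)

definition hom :: "('o, 'a, 'm) cat_scheme \<Rightarrow> 'o \<Rightarrow> 'o \<Rightarrow> 'a set" where
  "hom C x y = {f \<in> Arr C. Dom C f = x \<and> Cod C f = y}"

locale category =
  fixes C :: "('o, 'a, 'm) cat_scheme" (structure)
  assumes dom_in: "f \<in> Arr C \<Longrightarrow> Dom C f \<in> Obj C"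
    and cod_in: "f \<in> Arr C \<Longrightarrow> Cod C f \<in> Obj C"
    and ide_in: "x \<in> Obj C \<Longrightarrow> Ide C x \<in> hom C x x"
    and comp_in: "\<lbrakk>f \<in> hom C x y; g \<in> hom C y z\<rbrakk> \<Longrightarrow> g \<cdot> f \<in> hom C x z"
    and comp_ide: "f \<in> hom C x y \<Longrightarrow> f \<cdot> Ide C x = f"
    and ide_comp: "f \<in> hom C x y \<Longrightarrow> Ide C y \<cdot> f = f"
    and comp_assoc: "\<lbrakk>f \<in> hom C w x; g \<in> hom C x y; h \<in> hom C y z\<rbrakk> \<Longrightarrow> (h \<cdot> g) \<cdot> f = h \<cdot> (g \<cdot> f)"

definition inverse_arrows :: "('o, 'a, 'm) cat_scheme \<Rightarrow> 'a \<Rightarrow> 'a \<Rightarrow> bool" where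
  "inverse_arrows C f g \<longleftrightarrow> f \<in> Arr C \<and> g \<in> hom C (Cod C f) (Dom C f) \<and>
     g \<cdot>\<^bsub>C\<^esub> f = Ide C (Dom C f) \<and> f \<cdot>\<^bsub>C\<^esub> g = Ide C (Cod C f)"

definition is_iso :: "('o, 'a, 'm) cat_scheme \<Rightarrow> 'a \<Rightarrow> bool" where
  "is_iso C f \<longleftrightarrow> (\<exists>g. inverse_arrows C f g)"

definition inv_arr :: "('o, 'a, 'm) cat_scheme \<Rightarrow> 'a \<Rightarrow> 'a" where
  "inv_arr C f = (THE g. inverse_arrows C f g)"

definition isomorphic :: "('o, 'a, 'm) cat_scheme \<Rightarrow> 'o \<Rightarrow> 'o \<Rightarrow> bool" where
  "isomorphic C x y \<longleftrightarrow> (\<exists>f \<in> hom C x y. is_iso C f)"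

record ('o, 'a, 'p, 'b) ftor =
  on_obj :: "'o \<Rightarrow> 'p"
  on_arr :: "'a \<Rightarrow> 'b"

locale ordinary_functor =
  C: category C + D: category D
  for C :: "('o, 'a, 'm) cat_scheme" and D :: "('p, 'b, 'n) cat_scheme" +
  fixes F :: "('o, 'a, 'p, 'b) ftor"
  assumes on_obj_in: "x \<in> Obj C \<Longrightarrow> on_obj F x \<in> Obj D"
    and on_arr_in: "f \<in> hom C x y \<Longrightarrow> on_arr F f \<in> hom D (on_obj F x) (on_obj F y)"
    and on_ide: "x \<in> Obj C \<Longrightarrow> on_arr F (Ide C x) = Ide D (on_obj F x)"
    and on_comp: "\<lbrakk>f \<in> hom C x y; g \<in> hom C y z\<rbrakk> \<Longrightarrow>
      on_arr F (g \<cdot>\<^bsub>C\<^esub> f) = on_arr F g \<cdot>\<^bsub>D\<^esub> on_arr F f"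

definition id_ftor :: "('o, 'a, 'o, 'a) ftor" where
  "id_ftor = \<lparr>on_obj = \<lambda>x. x, on_arr = \<lambda>f. f\<rparr>"

definition comp_ftor ::
  "('p, 'b, 'q, 'c) ftor \<Rightarrow> ('o, 'a, 'p, 'b) ftor \<Rightarrow> ('o, 'a, 'q, 'c) ftor" where
  "comp_ftor G F = \<lparr>on_obj = on_obj G \<circ> on_obj F, on_arr = on_arr G \<circ> on_arr F\<rparr>"

definition nat_trans :: "('o, 'a, 'm) cat_scheme \<Rightarrow> ('p, 'b, 'n) cat_scheme \<Rightarrow>
    ('o, 'a, 'p, 'b) ftor \<Rightarrow> ('o, 'a, 'p, 'b) ftor \<Rightarrow> ('o \<Rightarrow> 'b) \<Rightarrow> bool" where
  "nat_trans C D F G \<alpha> \<longleftrightarrow>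
     (\<forall>x \<in> Obj C. \<alpha> x \<in> hom D (on_obj F x) (on_obj G x)) \<and>
     (\<forall>x \<in> Obj C. \<forall>y \<in> Obj C. \<forall>f \<in> hom C x y. \<alpha> y \<cdot>\<^bsub>D\<^esub> on_arr F f = on_arr G f \<cdot>\<^bsub>D\<^esub> \<alpha> x)"

definition fully_faithful :: "('o, 'a, 'm) cat_scheme \<Rightarrow> ('p, 'b, 'n) cat_scheme \<Rightarrow>
    ('o, 'a, 'p, 'b) ftor \<Rightarrow> bool" where
  "fully_faithful C D F \<longleftrightarrow> (\<forall>x \<in> Obj C. \<forall>y \<in> Obj C.
     bij_betw (on_arr F) (hom C x y) (hom D (on_obj F x) (on_obj F y)))"

definition adjunction :: "('o, 'a, 'm) cat_scheme \<Rightarrow> ('p, 'b, 'n) cat_scheme \<Rightarrow>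
    ('o, 'a, 'p, 'b) ftor \<Rightarrow> ('p, 'b, 'o, 'a) ftor \<Rightarrow> ('o \<Rightarrow> 'a) \<Rightarrow> ('p \<Rightarrow> 'b) \<Rightarrow> bool" where
  "adjunction C D F G \<eta> \<epsilon> \<longleftrightarrow>
     ordinary_functor C D F \<and> ordinary_functor D C G \<and>
     nat_trans C C id_ftor (comp_ftor G F) \<eta> \<and> nat_trans D D (comp_ftor F G) id_ftor \<epsilon> \<and>
     (\<forall>x \<in> Obj C. \<epsilon> (on_obj F x) \<cdot>\<^bsub>D\<^esub> on_arr F (\<eta> x) = Ide D (on_obj F x)) \<and>
     (\<forall>y \<in> Obj D. on_arr G (\<epsilon> y) \<cdot>\<^bsub>C\<^esub> \<eta> (on_obj G y) = Ide C (on_obj G y))"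

definition left_adjoint :: "('o, 'a, 'm) cat_scheme \<Rightarrow> ('p, 'b, 'n) cat_scheme \<Rightarrow>
    ('o, 'a, 'p, 'b) ftor \<Rightarrow> bool" where
  "left_adjoint C D F \<longleftrightarrow> (\<exists>G \<eta> \<epsilon>. adjunction C D F G \<eta> \<epsilon>)"

definition adjoint_equivalence :: "('o, 'a, 'm) cat_scheme \<Rightarrow> ('p, 'b, 'n) cat_scheme \<Rightarrow>
    ('o, 'a, 'p, 'b) ftor \<Rightarrow> ('p, 'b, 'o, 'a) ftor \<Rightarrow> ('o \<Rightarrow> 'a) \<Rightarrow> ('p \<Rightarrow> 'b) \<Rightarrow> bool" where
  "adjoint_equivalence C D F G \<eta> \<epsilon> \<longleftrightarrow> adjunction C D F G \<eta> \<epsilon> \<and>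
     (\<forall>x \<in> Obj C. is_iso C (\<eta> x)) \<and> (\<forall>y \<in> Obj D. is_iso D (\<epsilon> y))"

definition ess_image :: "('o, 'a, 'm) cat_scheme \<Rightarrow> ('p, 'b, 'n) cat_scheme \<Rightarrow>
    ('o, 'a, 'p, 'b) ftor \<Rightarrow> 'p set" where
  "ess_image C D F = {y \<in> Obj D. \<exists>x \<in> Obj C. isomorphic D (on_obj F x) y}"

definition full_sub :: "('o, 'a, 'm) cat_scheme \<Rightarrow> 'o set \<Rightarrow> ('o, 'a, 'm) cat_scheme" where
  "full_sub C S = C\<lparr>Obj := Obj C \<inter> S, Arr := {f \<in> Arr C. Dom C f \<in> S \<and> Cod C f \<in> S}\<rparr>"

text \<open>The functor \<^term>\<open>id_ftor\<close> serves as the inclusion of the full subcategory on \<open>S\<close>.\<close>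

definition coreflective :: "('o, 'a, 'm) cat_scheme \<Rightarrow> 'o set \<Rightarrow> bool" where
  "coreflective C S \<longleftrightarrow> left_adjoint (full_sub C S) C id_ftor"

section \<open>Smallness, limits and colimits\<close>

text \<open>
  Size is measured by a type \<open>'u\<close>: a set is small when its cardinality is strictly below that of
  \<open>'u\<close>. When the cardinality of \<open>'u\<close> is inaccessible these are the small sets of a Grothendieck
  universe. Every small set injects into \<open>'u\<close>, so it is no loss to let indexing categories have
  their objects and arrows in \<open>'u\<close>. Nothing below needs closure properties of
  the universe beyond \<open>'u\<close> being infinite, which makes finite diagrams small. Local smallness is
  not imposed either. The argument of type \<open>'u itself\<close> only carries the type.
\<close>

definition small_cat :: "('u, 'u) cat \<Rightarrow> bool" where
  "small_cat J \<longleftrightarrow> category J \<and> |Obj J| <o |UNIV :: 'u set| \<and> |Arr J| <o |UNIV :: 'u set|"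

definition cone :: "('j, 'k, 'l) cat_scheme \<Rightarrow> ('o, 'a, 'm) cat_scheme \<Rightarrow>
    ('j, 'k, 'o, 'a) ftor \<Rightarrow> 'o \<Rightarrow> ('j \<Rightarrow> 'a) \<Rightarrow> bool" where
  "cone J C F c \<pi> \<longleftrightarrow> c \<in> Obj C \<and> (\<forall>j \<in> Obj J. \<pi> j \<in> hom C c (on_obj F j)) \<and>
     (\<forall>f \<in> Arr J. on_arr F f \<cdot>\<^bsub>C\<^esub> \<pi> (Dom J f) = \<pi> (Cod J f))"

definition is_limit :: "('j, 'k, 'l) cat_scheme \<Rightarrow> ('o, 'a, 'm) cat_scheme \<Rightarrow>
    ('j, 'k, 'o, 'a) ftor \<Rightarrow> 'o \<Rightarrow> ('j \<Rightarrow> 'a) \<Rightarrow> bool" where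
  "is_limit J C F c \<pi> \<longleftrightarrow> cone J C F c \<pi> \<and>
     (\<forall>d \<psi>. cone J C F d \<psi> \<longrightarrow> (\<exists>!h. h \<in> hom C d c \<and> (\<forall>j \<in> Obj J. \<pi> j \<cdot>\<^bsub>C\<^esub> h = \<psi> j)))"

definition cocone :: "('j, 'k, 'l) cat_scheme \<Rightarrow> ('o, 'a, 'm) cat_scheme \<Rightarrow>
    ('j, 'k, 'o, 'a) ftor \<Rightarrow> 'o \<Rightarrow> ('j \<Rightarrow> 'a) \<Rightarrow> bool" where
  "cocone J C F c \<iota> \<longleftrightarrow> c \<in> Obj C \<and> (\<forall>j \<in> Obj J. \<iota> j \<in> hom C (on_obj F j) c) \<and>
     (\<forall>f \<in> Arr J. \<iota> (Cod J f) \<cdot>\<^bsub>C\<^esub> on_arr F f = \<iota> (Dom J f))"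

definition is_colimit :: "('j, 'k, 'l) cat_scheme \<Rightarrow> ('o, 'a, 'm) cat_scheme \<Rightarrow>
    ('j, 'k, 'o, 'a) ftor \<Rightarrow> 'o \<Rightarrow> ('j \<Rightarrow> 'a) \<Rightarrow> bool" where
  "is_colimit J C F c \<iota> \<longleftrightarrow> cocone J C F c \<iota> \<and>
     (\<forall>d \<psi>. cocone J C F d \<psi> \<longrightarrow> (\<exists>!h. h \<in> hom C c d \<and> (\<forall>j \<in> Obj J. h \<cdot>\<^bsub>C\<^esub> \<iota> j = \<psi> j)))"

definition complete :: "'u itself \<Rightarrow> ('o, 'a, 'm) cat_scheme \<Rightarrow> bool" where
  "complete U C \<longleftrightarrow> (\<forall>(J :: ('u, 'u) cat) F. small_cat J \<and> ordinary_functor J C F \<longrightarrow>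
     (\<exists>c \<pi>. is_limit J C F c \<pi>))"

definition cocomplete :: "'u itself \<Rightarrow> ('o, 'a, 'm) cat_scheme \<Rightarrow> bool" where
  "cocomplete U C \<longleftrightarrow> (\<forall>(J :: ('u, 'u) cat) F. small_cat J \<and> ordinary_functor J C F \<longrightarrow>
     (\<exists>c \<iota>. is_colimit J C F c \<iota>))"

definition is_equalizer :: "('o, 'a, 'm) cat_scheme \<Rightarrow> 'a \<Rightarrow> 'a \<Rightarrow> 'a \<Rightarrow> bool" where
  "is_equalizer C f g i \<longleftrightarrow> i \<in> Arr C \<and> Cod C i = Dom C f \<and> f \<cdot>\<^bsub>C\<^esub> i = g \<cdot>\<^bsub>C\<^esub> i \<and>
     (\<forall>k \<in> Arr C. Cod C k = Dom C f \<and> f \<cdot>\<^bsub>C\<^esub> k = g \<cdot>\<^bsub>C\<^esub> k \<longrightarrow>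
       (\<exists>!h. h \<in> hom C (Dom C k) (Dom C i) \<and> i \<cdot>\<^bsub>C\<^esub> h = k))"

section \<open>Closed symmetric monoidal categories\<close>

text \<open>
  The tensor product is written \<open>\<odot>\<close> on objects and \<open>\<otimes>\<close> on arrows. The internal hom
  \<open>ihom V x y\<close>, the object \<open>V(x,y)\<close>, comes with the evaluation \<open>ihom V x y \<odot> x \<rightarrow> y\<close>.
\<close>

record ('o, 'a) smc = "('o, 'a) cat" +
  ten_obj :: "'o \<Rightarrow> 'o \<Rightarrow> 'o"  (infixr "\<odot>\<index>" 75)
  ten_arr :: "'a \<Rightarrow> 'a \<Rightarrow> 'a"  (infixr "\<otimes>\<index>" 75)
  unit_obj :: "'o"  ("\<one>\<index>")
  assoc :: "'o \<Rightarrow> 'o \<Rightarrow> 'o \<Rightarrow> 'a"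
  lunit :: "'o \<Rightarrow> 'a"
  runit :: "'o \<Rightarrow> 'a"
  symm :: "'o \<Rightarrow> 'o \<Rightarrow> 'a"
  ihom :: "'o \<Rightarrow> 'o \<Rightarrow> 'o"
  eval :: "'o \<Rightarrow> 'o \<Rightarrow> 'a"

locale closed_symmetric_monoidal = category V
  for V :: "('o, 'a, 'm) smc_scheme" (structure) +
  assumes ten_obj_in: "\<lbrakk>x \<in> Obj V; y \<in> Obj V\<rbrakk> \<Longrightarrow> x \<odot> y \<in> Obj V"
    and unit_in: "\<one> \<in> Obj V"
    and ten_arr_in: "\<lbrakk>f \<in> hom V x y; g \<in> hom V x' y'\<rbrakk> \<Longrightarrow> f \<otimes> g \<in> hom V (x \<odot> x') (y \<odot> y')"
    and ten_ide: "\<lbrakk>x \<in> Obj V; y \<in> Obj V\<rbrakk> \<Longrightarrow> Ide V x \<otimes> Ide V y = Ide V (x \<odot> y)"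
    and ten_comp: "\<lbrakk>f \<in> hom V x y; g \<in> hom V y z; f' \<in> hom V x' y'; g' \<in> hom V y' z'\<rbrakk> \<Longrightarrow>
      (g \<cdot> f) \<otimes> (g' \<cdot> f') = (g \<otimes> g') \<cdot> (f \<otimes> f')"
    and assoc_in: "\<lbrakk>x \<in> Obj V; y \<in> Obj V; z \<in> Obj V\<rbrakk> \<Longrightarrow>
      assoc V x y z \<in> hom V ((x \<odot> y) \<odot> z) (x \<odot> (y \<odot> z))"
    and assoc_iso: "\<lbrakk>x \<in> Obj V; y \<in> Obj V; z \<in> Obj V\<rbrakk> \<Longrightarrow> is_iso V (assoc V x y z)"
    and assoc_nat: "\<lbrakk>f \<in> hom V x x'; g \<in> hom V y y'; h \<in> hom V z z'\<rbrakk> \<Longrightarrow>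
      assoc V x' y' z' \<cdot> ((f \<otimes> g) \<otimes> h) = (f \<otimes> (g \<otimes> h)) \<cdot> assoc V x y z"
    and lunit_in: "x \<in> Obj V \<Longrightarrow> lunit V x \<in> hom V (\<one> \<odot> x) x"
    and lunit_iso: "x \<in> Obj V \<Longrightarrow> is_iso V (lunit V x)"
    and lunit_nat: "f \<in> hom V x y \<Longrightarrow> lunit V y \<cdot> (Ide V \<one> \<otimes> f) = f \<cdot> lunit V x"
    and runit_in: "x \<in> Obj V \<Longrightarrow> runit V x \<in> hom V (x \<odot> \<one>) x"
    and runit_iso: "x \<in> Obj V \<Longrightarrow> is_iso V (runit V x)"
    and runit_nat: "f \<in> hom V x y \<Longrightarrow> runit V y \<cdot> (f \<otimes> Ide V \<one>) = f \<cdot> runit V x"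
    and pentagon: "\<lbrakk>w \<in> Obj V; x \<in> Obj V; y \<in> Obj V; z \<in> Obj V\<rbrakk> \<Longrightarrow>
      assoc V w x (y \<odot> z) \<cdot> assoc V (w \<odot> x) y z =
      (Ide V w \<otimes> assoc V x y z) \<cdot> assoc V w (x \<odot> y) z \<cdot> (assoc V w x y \<otimes> Ide V z)"
    and triangle: "\<lbrakk>x \<in> Obj V; y \<in> Obj V\<rbrakk> \<Longrightarrow>
      (Ide V x \<otimes> lunit V y) \<cdot> assoc V x \<one> y = runit V x \<otimes> Ide V y"
    and symm_in: "\<lbrakk>x \<in> Obj V; y \<in> Obj V\<rbrakk> \<Longrightarrow> symm V x y \<in> hom V (x \<odot> y) (y \<odot> x)"
    and symm_nat: "\<lbrakk>f \<in> hom V x x'; g \<in> hom V y y'\<rbrakk> \<Longrightarrow>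
      symm V x' y' \<cdot> (f \<otimes> g) = (g \<otimes> f) \<cdot> symm V x y"
    and symm_symm: "\<lbrakk>x \<in> Obj V; y \<in> Obj V\<rbrakk> \<Longrightarrow> symm V y x \<cdot> symm V x y = Ide V (x \<odot> y)"
    and hexagon: "\<lbrakk>x \<in> Obj V; y \<in> Obj V; z \<in> Obj V\<rbrakk> \<Longrightarrow>
      assoc V y z x \<cdot> symm V x (y \<odot> z) \<cdot> assoc V x y z =
      (Ide V y \<otimes> symm V x z) \<cdot> assoc V y x z \<cdot> (symm V x y \<otimes> Ide V z)"
    and ihom_in: "\<lbrakk>x \<in> Obj V; y \<in> Obj V\<rbrakk> \<Longrightarrow> ihom V x y \<in> Obj V"
    and eval_in: "\<lbrakk>x \<in> Obj V; y \<in> Obj V\<rbrakk> \<Longrightarrow> eval V x y \<in> hom V (ihom V x y \<odot> x) y"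
    and eval_universal: "\<lbrakk>x \<in> Obj V; y \<in> Obj V; z \<in> Obj V; f \<in> hom V (z \<odot> x) y\<rbrakk> \<Longrightarrow>
      \<exists>!g. g \<in> hom V z (ihom V x y) \<and> eval V x y \<cdot> (g \<otimes> Ide V x) = f"

definition cosmos :: "'u itself \<Rightarrow> ('o, 'a, 'm) smc_scheme \<Rightarrow> bool" where
  "cosmos U V \<longleftrightarrow> closed_symmetric_monoidal V \<and> complete U V \<and> cocomplete U V"

text \<open>The transpose \<open>z \<rightarrow> ihom V x y\<close> of \<open>f : z \<odot> x \<rightarrow> y\<close>.\<close>

definition curry :: "('o, 'a, 'm) smc_scheme \<Rightarrow> 'o \<Rightarrow> 'o \<Rightarrow> 'o \<Rightarrow> 'a \<Rightarrow> 'a" where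
  "curry V z x y f =
     (THE g. g \<in> hom V z (ihom V x y) \<and> eval V x y \<cdot>\<^bsub>V\<^esub> (g \<otimes>\<^bsub>V\<^esub> Ide V x) = f)"

definition ihom_pre :: "('o, 'a, 'm) smc_scheme \<Rightarrow> 'a \<Rightarrow> 'o \<Rightarrow> 'a" where
  "ihom_pre V f y = curry V (ihom V (Cod V f) y) (Dom V f) y
     (eval V (Cod V f) y \<cdot>\<^bsub>V\<^esub> (Ide V (ihom V (Cod V f) y) \<otimes>\<^bsub>V\<^esub> f))"

definition ihom_post :: "('o, 'a, 'm) smc_scheme \<Rightarrow> 'o \<Rightarrow> 'a \<Rightarrow> 'a" where
  "ihom_post V x g = curry V (ihom V x (Dom V g)) x (Cod V g) (g \<cdot>\<^bsub>V\<^esub> eval V x (Dom V g))"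

text \<open>The morphism \<open>V(x,y) \<rightarrow> V(x \<odot> b, y \<odot> b)\<close> given by \<open>- \<odot> b\<close>.\<close>

definition ihom_ten :: "('o, 'a, 'm) smc_scheme \<Rightarrow> 'o \<Rightarrow> 'o \<Rightarrow> 'o \<Rightarrow> 'a" where
  "ihom_ten V b x y = curry V (ihom V x y) (x \<odot>\<^bsub>V\<^esub> b) (y \<odot>\<^bsub>V\<^esub> b)
     ((eval V x y \<otimes>\<^bsub>V\<^esub> Ide V b) \<cdot>\<^bsub>V\<^esub> inv_arr V (assoc V (ihom V x y) x b))"

section \<open>Enriched categories\<close>

text \<open>\<open>VComp C x y z : C(y,z) \<odot> C(x,y) \<rightarrow> C(x,z)\<close>.\<close>

record ('o, 'vo, 'va) vcat =
  VObj :: "'o set"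
  VHom :: "'o \<Rightarrow> 'o \<Rightarrow> 'vo"
  VId :: "'o \<Rightarrow> 'va"
  VComp :: "'o \<Rightarrow> 'o \<Rightarrow> 'o \<Rightarrow> 'va"

locale enriched_category = closed_symmetric_monoidal V
  for V :: "('vo, 'va, 'm) smc_scheme" (structure) +
  fixes C :: "('o, 'vo, 'va) vcat"
  assumes VHom_in: "\<lbrakk>x \<in> VObj C; y \<in> VObj C\<rbrakk> \<Longrightarrow> VHom C x y \<in> Obj V"
    and VId_in: "x \<in> VObj C \<Longrightarrow> VId C x \<in> hom V \<one> (VHom C x x)"
    and VComp_in: "\<lbrakk>x \<in> VObj C; y \<in> VObj C; z \<in> VObj C\<rbrakk> \<Longrightarrow>
      VComp C x y z \<in> hom V (VHom C y z \<odot> VHom C x y) (VHom C x z)"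
    and VComp_assoc: "\<lbrakk>w \<in> VObj C; x \<in> VObj C; y \<in> VObj C; z \<in> VObj C\<rbrakk> \<Longrightarrow>
      VComp C w x z \<cdot> (VComp C x y z \<otimes> Ide V (VHom C w x)) =
      VComp C w y z \<cdot> (Ide V (VHom C y z) \<otimes> VComp C w x y)
        \<cdot> assoc V (VHom C y z) (VHom C x y) (VHom C w x)"
    and VId_left: "\<lbrakk>x \<in> VObj C; y \<in> VObj C\<rbrakk> \<Longrightarrow>
      VComp C x y y \<cdot> (VId C y \<otimes> Ide V (VHom C x y)) = lunit V (VHom C x y)"
    and VId_right: "\<lbrakk>x \<in> VObj C; y \<in> VObj C\<rbrakk> \<Longrightarrow>
      VComp C x x y \<cdot> (Ide V (VHom C x y) \<otimes> VId C x) = runit V (VHom C x y)"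

definition el_comp :: "('vo, 'va, 'm) smc_scheme \<Rightarrow> ('o, 'vo, 'va) vcat \<Rightarrow>
    'o \<Rightarrow> 'o \<Rightarrow> 'o \<Rightarrow> 'va \<Rightarrow> 'va \<Rightarrow> 'va" where
  "el_comp V C x y z g f = VComp C x y z \<cdot>\<^bsub>V\<^esub> (g \<otimes>\<^bsub>V\<^esub> f) \<cdot>\<^bsub>V\<^esub> inv_arr V (lunit V \<one>\<^bsub>V\<^esub>)"

text \<open>
  The underlying category. An arrow \<open>x \<rightarrow> y\<close> is a triple \<open>(x, y, f)\<close> with \<open>f : \<one> \<rightarrow> C(x,y)\<close>.
\<close>

definition under :: "('vo, 'va, 'm) smc_scheme \<Rightarrow> ('o, 'vo, 'va) vcat \<Rightarrow>
    ('o, 'o \<times> 'o \<times> 'va) cat" where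
  "under V C = \<lparr>
     Obj = VObj C,
     Arr = {(x, y, f). x \<in> VObj C \<and> y \<in> VObj C \<and> f \<in> hom V \<one>\<^bsub>V\<^esub> (VHom C x y)},
     Dom = (\<lambda>(x, y, f). x),
     Cod = (\<lambda>(x, y, f). y),
     Ide = (\<lambda>x. (x, x, VId C x)),
     Comp = (\<lambda>(y', z, g) (x, y, f). (x, z, el_comp V C x y z g f))\<rparr>"

text \<open>For \<open>h : y \<rightarrow> z\<close> in the underlying category: \<open>C(x,h) : C(x,y) \<rightarrow> C(x,z)\<close> and
  \<open>C(h,x) : C(z,x) \<rightarrow> C(y,x)\<close>.\<close>

definition hom_post :: "('vo, 'va, 'm) smc_scheme \<Rightarrow> ('o, 'vo, 'va) vcat \<Rightarrow>
    'o \<Rightarrow> 'o \<times> 'o \<times> 'va \<Rightarrow> 'va" where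
  "hom_post V C x h = (case h of (y, z, f) \<Rightarrow>
     VComp C x y z \<cdot>\<^bsub>V\<^esub> (f \<otimes>\<^bsub>V\<^esub> Ide V (VHom C x y)) \<cdot>\<^bsub>V\<^esub> inv_arr V (lunit V (VHom C x y)))"

definition hom_pre :: "('vo, 'va, 'm) smc_scheme \<Rightarrow> ('o, 'vo, 'va) vcat \<Rightarrow>
    'o \<times> 'o \<times> 'va \<Rightarrow> 'o \<Rightarrow> 'va" where
  "hom_pre V C h x = (case h of (y, z, f) \<Rightarrow>
     VComp C y z x \<cdot>\<^bsub>V\<^esub> (Ide V (VHom C z x) \<otimes>\<^bsub>V\<^esub> f) \<cdot>\<^bsub>V\<^esub> inv_arr V (runit V (VHom C z x)))"

definition self_enriched :: "('vo, 'va, 'm) smc_scheme \<Rightarrow> ('vo, 'vo, 'va) vcat" where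
  "self_enriched V = \<lparr>
     VObj = Obj V,
     VHom = ihom V,
     VId = (\<lambda>x. curry V \<one>\<^bsub>V\<^esub> x x (lunit V x)),
     VComp = (\<lambda>x y z. curry V (ihom V y z \<odot>\<^bsub>V\<^esub> ihom V x y) x z
       (eval V y z \<cdot>\<^bsub>V\<^esub> (Ide V (ihom V y z) \<otimes>\<^bsub>V\<^esub> eval V x y)
         \<cdot>\<^bsub>V\<^esub> assoc V (ihom V y z) (ihom V x y) x))\<rparr>"

definition op_vcat :: "('vo, 'va, 'm) smc_scheme \<Rightarrow> ('o, 'vo, 'va) vcat \<Rightarrow> ('o, 'vo, 'va) vcat" where
  "op_vcat V C = \<lparr>
     VObj = VObj C,
     VHom = (\<lambda>x y. VHom C y x),
     VId = VId C,
     VComp = (\<lambda>x y z. VComp C z y x \<cdot>\<^bsub>V\<^esub> symm V (VHom C z y) (VHom C y x))\<rparr>"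

record ('o, 'p, 'va) vfun =
  f_obj :: "'o \<Rightarrow> 'p"
  f_hom :: "'o \<Rightarrow> 'o \<Rightarrow> 'va"

locale enriched_functor =
  A: enriched_category V A + B: enriched_category V B
  for V :: "('vo, 'va, 'm) smc_scheme" (structure)
    and A :: "('o, 'vo, 'va) vcat" and B :: "('p, 'vo, 'va) vcat" +
  fixes F :: "('o, 'p, 'va) vfun"
  assumes f_obj_in: "x \<in> VObj A \<Longrightarrow> f_obj F x \<in> VObj B"
    and f_hom_in: "\<lbrakk>x \<in> VObj A; y \<in> VObj A\<rbrakk> \<Longrightarrow>
      f_hom F x y \<in> hom V (VHom A x y) (VHom B (f_obj F x) (f_obj F y))"
    and f_hom_id: "x \<in> VObj A \<Longrightarrow> f_hom F x x \<cdot> VId A x = VId B (f_obj F x)"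
    and f_hom_comp: "\<lbrakk>x \<in> VObj A; y \<in> VObj A; z \<in> VObj A\<rbrakk> \<Longrightarrow>
      f_hom F x z \<cdot> VComp A x y z =
      VComp B (f_obj F x) (f_obj F y) (f_obj F z) \<cdot> (f_hom F y z \<otimes> f_hom F x y)"

definition op_vfun :: "('o, 'p, 'va) vfun \<Rightarrow> ('o, 'p, 'va) vfun" where
  "op_vfun F = \<lparr>f_obj = f_obj F, f_hom = (\<lambda>x y. f_hom F y x)\<rparr>"

definition comp_vfun :: "('vo, 'va, 'm) smc_scheme \<Rightarrow>
    ('p, 'q, 'va) vfun \<Rightarrow> ('o, 'p, 'va) vfun \<Rightarrow> ('o, 'q, 'va) vfun" where
  "comp_vfun V G F = \<lparr>f_obj = f_obj G \<circ> f_obj F,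
     f_hom = (\<lambda>x y. f_hom G (f_obj F x) (f_obj F y) \<cdot>\<^bsub>V\<^esub> f_hom F x y)\<rparr>"

text \<open>The representable enriched functor \<open>C(x,-) : C \<rightarrow> V\<close>.\<close>

definition rep :: "('vo, 'va, 'm) smc_scheme \<Rightarrow> ('o, 'vo, 'va) vcat \<Rightarrow> 'o \<Rightarrow> ('o, 'vo, 'va) vfun" where
  "rep V C x = \<lparr>f_obj = VHom C x,
     f_hom = (\<lambda>y z. curry V (VHom C y z) (VHom C x y) (VHom C x z) (VComp C x y z))\<rparr>"

definition enriched_nat_trans :: "('vo, 'va, 'm) smc_scheme \<Rightarrow>
    ('o, 'vo, 'va) vcat \<Rightarrow> ('p, 'vo, 'va) vcat \<Rightarrow>
    ('o, 'p, 'va) vfun \<Rightarrow> ('o, 'p, 'va) vfun \<Rightarrow> ('o \<Rightarrow> 'va) \<Rightarrow> bool" where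
  "enriched_nat_trans V A B F G \<alpha> \<longleftrightarrow>
     (\<forall>x \<in> VObj A. \<alpha> x \<in> hom V \<one>\<^bsub>V\<^esub> (VHom B (f_obj F x) (f_obj G x))) \<and>
     (\<forall>x \<in> VObj A. \<forall>y \<in> VObj A.
        VComp B (f_obj F x) (f_obj F y) (f_obj G y) \<cdot>\<^bsub>V\<^esub> (\<alpha> y \<otimes>\<^bsub>V\<^esub> f_hom F x y)
          \<cdot>\<^bsub>V\<^esub> inv_arr V (lunit V (VHom A x y)) =
        VComp B (f_obj F x) (f_obj G x) (f_obj G y) \<cdot>\<^bsub>V\<^esub> (f_hom G x y \<otimes>\<^bsub>V\<^esub> \<alpha> x)
          \<cdot>\<^bsub>V\<^esub> inv_arr V (runit V (VHom A x y)))"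

text \<open>
  Functors and transformations are functions on the whole object type, so in the functor
  category they are normalised to be undefined off the objects of \<open>A\<close>.
\<close>

definition vfunct :: "('vo, 'va, 'm) smc_scheme \<Rightarrow>
    ('o, 'vo, 'va) vcat \<Rightarrow> ('p, 'vo, 'va) vcat \<Rightarrow>
    (('o, 'p, 'va) vfun, ('o, 'p, 'va) vfun \<times> ('o, 'p, 'va) vfun \<times> ('o \<Rightarrow> 'va)) cat" where
  "vfunct V A B = (let
       Fs = {F. enriched_functor V A B F \<and> f_obj F \<in> extensional (VObj A) \<and>
              f_hom F \<in> extensional (VObj A) \<and> (\<forall>x \<in> VObj A. f_hom F x \<in> extensional (VObj A))}
     in \<lparr>
     Obj = Fs,
     Arr = {(F, G, \<alpha>). F \<in> Fs \<and> G \<in> Fs \<and> enriched_nat_trans V A B F G \<alpha> \<and>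
              \<alpha> \<in> extensional (VObj A)},
     Dom = (\<lambda>(F, G, \<alpha>). F),
     Cod = (\<lambda>(F, G, \<alpha>). G),
     Ide = (\<lambda>F. (F, F, \<lambda>x \<in> VObj A. VId B (f_obj F x))),
     Comp = (\<lambda>(G', H, \<beta>) (F, G, \<alpha>). (F, H, \<lambda>x \<in> VObj A.
              el_comp V B (f_obj F x) (f_obj G x) (f_obj H x) (\<beta> x) (\<alpha> x)))\<rparr>)"

section \<open>Weighted colimits\<close>

text \<open>
  The object \<open>[A,B](F,G)\<close> of enriched natural transformations is the end of \<open>B(F-,G-)\<close>, i.e. the
  universal enriched-natural (wedge) family \<open>\<nu> a : n \<rightarrow> B(F a, G a)\<close>. The wedge condition is
  given in transposed form, as an equality of two morphisms \<open>n \<odot> A(a,a') \<rightarrow> B(F a, G a')\<close>.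
\<close>

definition wedge :: "('vo, 'va, 'm) smc_scheme \<Rightarrow>
    ('o, 'vo, 'va) vcat \<Rightarrow> ('p, 'vo, 'va) vcat \<Rightarrow>
    ('o, 'p, 'va) vfun \<Rightarrow> ('o, 'p, 'va) vfun \<Rightarrow> 'vo \<Rightarrow> ('o \<Rightarrow> 'va) \<Rightarrow> bool" where
  "wedge V A B F G n \<nu> \<longleftrightarrow> n \<in> Obj V \<and>
     (\<forall>a \<in> VObj A. \<nu> a \<in> hom V n (VHom B (f_obj F a) (f_obj G a))) \<and>
     (\<forall>a \<in> VObj A. \<forall>a' \<in> VObj A.
        VComp B (f_obj F a) (f_obj F a') (f_obj G a') \<cdot>\<^bsub>V\<^esub> (\<nu> a' \<otimes>\<^bsub>V\<^esub> f_hom F a a') =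
        VComp B (f_obj F a) (f_obj G a) (f_obj G a') \<cdot>\<^bsub>V\<^esub> (f_hom G a a' \<otimes>\<^bsub>V\<^esub> \<nu> a)
          \<cdot>\<^bsub>V\<^esub> symm V n (VHom A a a'))"

definition is_nat_object :: "('vo, 'va, 'm) smc_scheme \<Rightarrow>
    ('o, 'vo, 'va) vcat \<Rightarrow> ('p, 'vo, 'va) vcat \<Rightarrow>
    ('o, 'p, 'va) vfun \<Rightarrow> ('o, 'p, 'va) vfun \<Rightarrow> 'vo \<Rightarrow> ('o \<Rightarrow> 'va) \<Rightarrow> bool" where
  "is_nat_object V A B F G n \<nu> \<longleftrightarrow> wedge V A B F G n \<nu> \<and>
     (\<forall>m \<mu>. wedge V A B F G m \<mu> \<longrightarrow>
        (\<exists>!h. h \<in> hom V m n \<and> (\<forall>a \<in> VObj A. \<nu> a \<cdot>\<^bsub>V\<^esub> h = \<mu> a)))"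

text \<open>The enriched functor \<open>C(D-,y)\<close> from the opposite of the domain of \<open>D\<close> to \<open>V\<close>.\<close>

definition hom_from :: "('vo, 'va, 'm) smc_scheme \<Rightarrow> ('o, 'vo, 'va) vcat \<Rightarrow>
    ('j, 'o, 'va) vfun \<Rightarrow> 'o \<Rightarrow> ('j, 'vo, 'va) vfun" where
  "hom_from V C D y = comp_vfun V (rep V (op_vcat V C) y) (op_vfun D)"

text \<open>
  \<open>c\<close> is the colimit of \<open>D : J \<rightarrow> C\<close> weighted by \<open>W\<close>, with unit \<open>\<kappa> : W \<Rightarrow> C(D-,c)\<close>: for each
  \<open>y\<close>, the morphisms \<open>C(c,y) \<rightarrow> V(W j, C(D j, y))\<close> induced by \<open>\<kappa>\<close> exhibit \<open>C(c,y)\<close> as the object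
  of enriched natural transformations \<open>W \<Rightarrow> C(D-,y)\<close>.
\<close>

definition is_weighted_colimit :: "('vo, 'va, 'm) smc_scheme \<Rightarrow>
    ('j, 'vo, 'va) vcat \<Rightarrow> ('o, 'vo, 'va) vcat \<Rightarrow>
    ('j, 'vo, 'va) vfun \<Rightarrow> ('j, 'o, 'va) vfun \<Rightarrow> 'o \<Rightarrow> ('j \<Rightarrow> 'va) \<Rightarrow> bool" where
  "is_weighted_colimit V J C W D c \<kappa> \<longleftrightarrow> c \<in> VObj C \<and>
     enriched_nat_trans V (op_vcat V J) (self_enriched V) W (hom_from V C D c) \<kappa> \<and>
     (\<forall>y \<in> VObj C. is_nat_object V (op_vcat V J) (self_enriched V) W (hom_from V C D y)
        (VHom C c y)
        (\<lambda>j. VComp (self_enriched V) (f_obj W j) (VHom C (f_obj D j) c) (VHom C (f_obj D j) y)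
               \<cdot>\<^bsub>V\<^esub> (f_hom (rep V C (f_obj D j)) c y \<otimes>\<^bsub>V\<^esub> \<kappa> j)
               \<cdot>\<^bsub>V\<^esub> inv_arr V (runit V (VHom C c y))))"

definition small_weighted_diagram :: "('vo, 'va, 'm) smc_scheme \<Rightarrow>
    ('u, 'vo, 'va) vcat \<Rightarrow> ('o, 'vo, 'va) vcat \<Rightarrow>
    ('u, 'vo, 'va) vfun \<Rightarrow> ('u, 'o, 'va) vfun \<Rightarrow> bool" where
  "small_weighted_diagram V J C W D \<longleftrightarrow>
     |VObj J| <o |UNIV :: 'u set| \<and> enriched_category V J \<and>
     enriched_functor V (op_vcat V J) (self_enriched V) W \<and> enriched_functor V J C D"

definition enriched_cocomplete :: "'u itself \<Rightarrow> ('vo, 'va, 'm) smc_scheme \<Rightarrow>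
    ('o, 'vo, 'va) vcat \<Rightarrow> bool" where
  "enriched_cocomplete U V C \<longleftrightarrow>
     (\<forall>(J :: ('u, 'vo, 'va) vcat) W D. small_weighted_diagram V J C W D \<longrightarrow>
        (\<exists>c \<kappa>. is_weighted_colimit V J C W D c \<kappa>))"

text \<open>
  The image under \<open>F\<close> of the unit \<open>\<kappa>\<close> of a weighted colimit of \<open>D\<close> is the composite
  \<open>W j \<rightarrow> C(D j, c) \<rightarrow> E(F (D j), F c)\<close>, again as an element of the internal hom.
\<close>

definition cocontinuous :: "'u itself \<Rightarrow> ('vo, 'va, 'm) smc_scheme \<Rightarrow>
    ('o, 'vo, 'va) vcat \<Rightarrow> ('p, 'vo, 'va) vcat \<Rightarrow> ('o, 'p, 'va) vfun \<Rightarrow> bool" where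
  "cocontinuous U V C E F \<longleftrightarrow>
     (\<forall>(J :: ('u, 'vo, 'va) vcat) W D c \<kappa>.
        small_weighted_diagram V J C W D \<and> is_weighted_colimit V J C W D c \<kappa> \<longrightarrow>
        is_weighted_colimit V J E W (comp_vfun V F D) (f_obj F c)
          (\<lambda>j. ihom_post V (f_obj W j) (f_hom F (f_obj D j) c) \<cdot>\<^bsub>V\<^esub> \<kappa> j))"

definition cocont_functors :: "'u itself \<Rightarrow> ('vo, 'va, 'm) smc_scheme \<Rightarrow>
    ('o, 'vo, 'va) vcat \<Rightarrow> ('p, 'vo, 'va) vcat \<Rightarrow> ('o, 'p, 'va) vfun set" where
  "cocont_functors U V A B = {F \<in> Obj (vfunct V A B). cocontinuous U V A B F}"

section \<open>Tensors and enriched coequalizers\<close>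

text \<open>
  \<open>t\<close> is the tensor of \<open>X\<close> by \<open>z\<close>, with \<open>\<eta> : z \<rightarrow> C(X,t)\<close> the unit at \<open>z\<close> of the enriched
  adjunction \<open>- \<otimes> X \<stileturn> C(X,-)\<close>: the induced morphisms \<open>C(t,Y) \<rightarrow> V(z, C(X,Y))\<close> are invertible.
\<close>

definition is_tensor :: "('vo, 'va, 'm) smc_scheme \<Rightarrow> ('o, 'vo, 'va) vcat \<Rightarrow>
    'vo \<Rightarrow> 'o \<Rightarrow> 'o \<Rightarrow> 'va \<Rightarrow> bool" where
  "is_tensor V C z X t \<eta> \<longleftrightarrow> t \<in> VObj C \<and> \<eta> \<in> hom V z (VHom C X t) \<and>
     (\<forall>Y \<in> VObj C. is_iso V (curry V (VHom C t Y) z (VHom C X Y)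
        (VComp C X t Y \<cdot>\<^bsub>V\<^esub> (Ide V (VHom C t Y) \<otimes>\<^bsub>V\<^esub> \<eta>))))"

definition tensor :: "('vo, 'va, 'm) smc_scheme \<Rightarrow> ('o, 'vo, 'va) vcat \<Rightarrow>
    'vo \<Rightarrow> 'o \<Rightarrow> 'o \<times> 'va" where
  "tensor V C z X = (SOME (t, \<eta>). is_tensor V C z X t \<eta>)"

definition tn_obj :: "('vo, 'va, 'm) smc_scheme \<Rightarrow> ('o, 'vo, 'va) vcat \<Rightarrow> 'vo \<Rightarrow> 'o \<Rightarrow> 'o" where
  "tn_obj V C z X = fst (tensor V C z X)"

definition tn_unit :: "('vo, 'va, 'm) smc_scheme \<Rightarrow> ('o, 'vo, 'va) vcat \<Rightarrow> 'vo \<Rightarrow> 'o \<Rightarrow> 'va" where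
  "tn_unit V C z X = snd (tensor V C z X)"

text \<open>The morphism \<open>z \<otimes> X \<rightarrow> Y\<close> of the underlying category corresponding to
  \<open>g : z \<rightarrow> C(X,Y)\<close>.\<close>

definition tn_transpose :: "('vo, 'va, 'm) smc_scheme \<Rightarrow> ('o, 'vo, 'va) vcat \<Rightarrow>
    'vo \<Rightarrow> 'o \<Rightarrow> 'o \<Rightarrow> 'va \<Rightarrow> 'o \<times> 'o \<times> 'va" where
  "tn_transpose V C z X Y g = (THE h. h \<in> hom (under V C) (tn_obj V C z X) Y \<and>
     hom_post V C X h \<cdot>\<^bsub>V\<^esub> tn_unit V C z X = g)"

text \<open>
  \<open>f \<otimes> X\<close> for \<open>f\<close> in \<open>V\<close>, \<open>z \<otimes> h\<close> for \<open>h\<close> in \<open>C\<close>, and the canonical isomorphisms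
  \<open>(w \<odot> z) \<otimes> X \<rightarrow> w \<otimes> (z \<otimes> X)\<close> and \<open>\<one> \<otimes> X \<rightarrow> X\<close>.
\<close>

definition tn_left :: "('vo, 'va, 'm) smc_scheme \<Rightarrow> ('o, 'vo, 'va) vcat \<Rightarrow>
    'va \<Rightarrow> 'o \<Rightarrow> 'o \<times> 'o \<times> 'va" where
  "tn_left V C f X = tn_transpose V C (Dom V f) X (tn_obj V C (Cod V f) X)
     (tn_unit V C (Cod V f) X \<cdot>\<^bsub>V\<^esub> f)"

definition tn_right :: "('vo, 'va, 'm) smc_scheme \<Rightarrow> ('o, 'vo, 'va) vcat \<Rightarrow>
    'vo \<Rightarrow> 'o \<times> 'o \<times> 'va \<Rightarrow> 'o \<times> 'o \<times> 'va" where
  "tn_right V C z h = (case h of (X, Y, f) \<Rightarrow> tn_transpose V C z X (tn_obj V C z Y)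
     (hom_pre V C h (tn_obj V C z Y) \<cdot>\<^bsub>V\<^esub> tn_unit V C z Y))"

definition tn_assoc :: "('vo, 'va, 'm) smc_scheme \<Rightarrow> ('o, 'vo, 'va) vcat \<Rightarrow>
    'vo \<Rightarrow> 'vo \<Rightarrow> 'o \<Rightarrow> 'o \<times> 'o \<times> 'va" where
  "tn_assoc V C w z X = (let
       zX = tn_obj V C z X;
       wzX = tn_obj V C w zX
     in tn_transpose V C (w \<odot>\<^bsub>V\<^esub> z) X wzX
          (VComp C X zX wzX \<cdot>\<^bsub>V\<^esub> (tn_unit V C w zX \<otimes>\<^bsub>V\<^esub> tn_unit V C z X)))"

definition tn_lunit :: "('vo, 'va, 'm) smc_scheme \<Rightarrow> ('o, 'vo, 'va) vcat \<Rightarrow> 'o \<Rightarrow> 'o \<times> 'o \<times> 'va" where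
  "tn_lunit V C X = tn_transpose V C \<one>\<^bsub>V\<^esub> X X (VId C X)"

text \<open>
  Coequalizers in an enriched category are conical colimits: \<open>C(-,Y)\<close> turns them into
  equalizers in \<open>V\<close>. In particular they are coequalizers in the underlying category.
\<close>

definition is_coequalizer :: "('vo, 'va, 'm) smc_scheme \<Rightarrow> ('o, 'vo, 'va) vcat \<Rightarrow>
    'o \<times> 'o \<times> 'va \<Rightarrow> 'o \<times> 'o \<times> 'va \<Rightarrow> 'o \<times> 'o \<times> 'va \<Rightarrow> bool" where
  "is_coequalizer V C f g q \<longleftrightarrow>
     q \<in> Arr (under V C) \<and> Dom (under V C) q = Cod (under V C) f \<and>
     (\<forall>Y \<in> VObj C. is_equalizer V (hom_pre V C f Y) (hom_pre V C g Y) (hom_pre V C q Y))"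

section \<open>Monoids and modules\<close>

record ('o, 'a) mon =
  m_obj :: "'o"
  m_unit :: "'a"
  m_mult :: "'a"

definition monoid_in :: "('vo, 'va, 'm) smc_scheme \<Rightarrow> ('vo, 'va) mon \<Rightarrow> bool" where
  "monoid_in V b \<longleftrightarrow> (let B = m_obj b; u = m_unit b; m = m_mult b in
     B \<in> Obj V \<and> u \<in> hom V \<one>\<^bsub>V\<^esub> B \<and> m \<in> hom V (B \<odot>\<^bsub>V\<^esub> B) B \<and>
     m \<cdot>\<^bsub>V\<^esub> (m \<otimes>\<^bsub>V\<^esub> Ide V B) = m \<cdot>\<^bsub>V\<^esub> (Ide V B \<otimes>\<^bsub>V\<^esub> m) \<cdot>\<^bsub>V\<^esub> assoc V B B B \<and>
     m \<cdot>\<^bsub>V\<^esub> (u \<otimes>\<^bsub>V\<^esub> Ide V B) = lunit V B \<and>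
     m \<cdot>\<^bsub>V\<^esub> (Ide V B \<otimes>\<^bsub>V\<^esub> u) = runit V B)"

text \<open>Right modules \<open>(x, \<gamma>)\<close> with \<open>\<gamma> : x \<odot> b \<rightarrow> x\<close>.\<close>

definition right_modules :: "('vo, 'va, 'm) smc_scheme \<Rightarrow> ('vo, 'va) mon \<Rightarrow> ('vo \<times> 'va) set" where
  "right_modules V b = (let B = m_obj b; u = m_unit b; m = m_mult b in
     {(x, \<gamma>). x \<in> Obj V \<and> \<gamma> \<in> hom V (x \<odot>\<^bsub>V\<^esub> B) x \<and>
        \<gamma> \<cdot>\<^bsub>V\<^esub> (\<gamma> \<otimes>\<^bsub>V\<^esub> Ide V B) = \<gamma> \<cdot>\<^bsub>V\<^esub> (Ide V x \<otimes>\<^bsub>V\<^esub> m) \<cdot>\<^bsub>V\<^esub> assoc V x B B \<and>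
        \<gamma> \<cdot>\<^bsub>V\<^esub> (Ide V x \<otimes>\<^bsub>V\<^esub> u) = runit V x})"

text \<open>The equalizer inclusion of the hom object of right modules into the internal hom of \<open>V\<close>.\<close>

definition mod_incl :: "('vo, 'va, 'm) smc_scheme \<Rightarrow> ('vo, 'va) mon \<Rightarrow>
    'vo \<times> 'va \<Rightarrow> 'vo \<times> 'va \<Rightarrow> 'va" where
  "mod_incl V b M N = (case M of (x, \<gamma>) \<Rightarrow> case N of (y, \<delta>) \<Rightarrow>
     (SOME i. is_equalizer V
        (ihom_pre V \<gamma> y)
        (ihom_post V (x \<odot>\<^bsub>V\<^esub> m_obj b) \<delta> \<cdot>\<^bsub>V\<^esub> ihom_ten V (m_obj b) x y) i))"

definition Mod :: "('vo, 'va, 'm) smc_scheme \<Rightarrow> ('vo, 'va) mon \<Rightarrow> ('vo \<times> 'va, 'vo, 'va) vcat" where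
  "Mod V b = (let H = (\<lambda>M N. Dom V (mod_incl V b M N)) in \<lparr>
     VObj = right_modules V b,
     VHom = H,
     VId = (\<lambda>M. THE f. f \<in> hom V \<one>\<^bsub>V\<^esub> (H M M) \<and>
        mod_incl V b M M \<cdot>\<^bsub>V\<^esub> f = VId (self_enriched V) (fst M)),
     VComp = (\<lambda>M N K. THE f. f \<in> hom V (H N K \<odot>\<^bsub>V\<^esub> H M N) (H M K) \<and>
        mod_incl V b M K \<cdot>\<^bsub>V\<^esub> f =
        VComp (self_enriched V) (fst M) (fst N) (fst K)
          \<cdot>\<^bsub>V\<^esub> (mod_incl V b N K \<otimes>\<^bsub>V\<^esub> mod_incl V b M N))\<rparr>)"

definition mod_tensor :: "('vo, 'va, 'm) smc_scheme \<Rightarrow> ('vo, 'va) mon \<Rightarrow>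
    'vo \<Rightarrow> 'vo \<times> 'va \<Rightarrow> 'vo \<times> 'va" where
  "mod_tensor V b w M = (case M of (x, \<gamma>) \<Rightarrow>
     (w \<odot>\<^bsub>V\<^esub> x, (Ide V w \<otimes>\<^bsub>V\<^esub> \<gamma>) \<cdot>\<^bsub>V\<^esub> assoc V w x (m_obj b)))"

text \<open>Left module objects \<open>(X, \<rho>)\<close> in \<open>C\<close>, with \<open>\<rho> : b \<otimes> X \<rightarrow> X\<close> in the underlying category.\<close>

definition left_module_objects :: "('vo, 'va, 'm) smc_scheme \<Rightarrow> ('o, 'vo, 'va) vcat \<Rightarrow>
    ('vo, 'va) mon \<Rightarrow> ('o \<times> 'o \<times> 'o \<times> 'va) set" where
  "left_module_objects V C b = (let B = m_obj b; u = m_unit b; m = m_mult b; C0 = under V C in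
     {(X, \<rho>). X \<in> VObj C \<and> \<rho> \<in> hom C0 (tn_obj V C B X) X \<and>
        \<rho> \<cdot>\<^bsub>C0\<^esub> tn_left V C u X = tn_lunit V C X \<and>
        \<rho> \<cdot>\<^bsub>C0\<^esub> tn_left V C m X = \<rho> \<cdot>\<^bsub>C0\<^esub> tn_right V C B \<rho> \<cdot>\<^bsub>C0\<^esub> tn_assoc V C B B X})"

definition LMod :: "('vo, 'va, 'm) smc_scheme \<Rightarrow> ('o, 'vo, 'va) vcat \<Rightarrow> ('vo, 'va) mon \<Rightarrow>
    ('o \<times> 'o \<times> 'o \<times> 'va,
     ('o \<times> 'o \<times> 'o \<times> 'va) \<times> ('o \<times> 'o \<times> 'o \<times> 'va) \<times> ('o \<times> 'o \<times> 'va)) cat" where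
  "LMod V C b = (let C0 = under V C in \<lparr>
     Obj = left_module_objects V C b,
     Arr = {(M, N, f). M \<in> left_module_objects V C b \<and> N \<in> left_module_objects V C b \<and>
        f \<in> hom C0 (fst M) (fst N) \<and> f \<cdot>\<^bsub>C0\<^esub> snd M = snd N \<cdot>\<^bsub>C0\<^esub> tn_right V C (m_obj b) f},
     Dom = (\<lambda>(M, N, f). M),
     Cod = (\<lambda>(M, N, f). N),
     Ide = (\<lambda>M. (M, M, Ide C0 (fst M))),
     Comp = (\<lambda>(N', K, g) (M, N, f). (M, K, g \<cdot>\<^bsub>C0\<^esub> f))\<rparr>)"

section \<open>The functor \<open>X \<mapsto> - \<circledast> X\<close>\<close>

text \<open>
  Below \<open>P = (X, \<rho>)\<close> is a left module object in \<open>C\<close> and \<open>Z = (z, \<gamma>)\<close> a right module.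
  \<open>cq\<close> is the coequalizer \<open>z \<otimes> X \<rightarrow> z \<circledast> X\<close>.
\<close>

definition cq :: "('vo, 'va, 'm) smc_scheme \<Rightarrow> ('o, 'vo, 'va) vcat \<Rightarrow> ('vo, 'va) mon \<Rightarrow>
    'o \<times> 'o \<times> 'o \<times> 'va \<Rightarrow> 'vo \<times> 'va \<Rightarrow> 'o \<times> 'o \<times> 'va" where
  "cq V C b P Z = (case P of (X, \<rho>) \<Rightarrow> case Z of (z, \<gamma>) \<Rightarrow>
     (SOME q. is_coequalizer V C
        (tn_left V C \<gamma> X)
        (tn_right V C z \<rho> \<cdot>\<^bsub>under V C\<^esub> tn_assoc V C z (m_obj b) X) q))"

definition cst_obj :: "('vo, 'va, 'm) smc_scheme \<Rightarrow> ('o, 'vo, 'va) vcat \<Rightarrow> ('vo, 'va) mon \<Rightarrow>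
    'o \<times> 'o \<times> 'o \<times> 'va \<Rightarrow> 'vo \<times> 'va \<Rightarrow> 'o" where
  "cst_obj V C b P Z = Cod (under V C) (cq V C b P Z)"

text \<open>\<open>f \<circledast> X\<close> for a morphism of right modules given by the morphism \<open>f\<close> in \<open>V\<close>.\<close>

definition cst_left :: "('vo, 'va, 'm) smc_scheme \<Rightarrow> ('o, 'vo, 'va) vcat \<Rightarrow> ('vo, 'va) mon \<Rightarrow>
    'o \<times> 'o \<times> 'o \<times> 'va \<Rightarrow> 'vo \<times> 'va \<Rightarrow> 'vo \<times> 'va \<Rightarrow> 'va \<Rightarrow> 'o \<times> 'o \<times> 'va" where
  "cst_left V C b P Z Z' f = (let C0 = under V C in
     (THE h. h \<in> hom C0 (cst_obj V C b P Z) (cst_obj V C b P Z') \<and>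
        h \<cdot>\<^bsub>C0\<^esub> cq V C b P Z = cq V C b P Z' \<cdot>\<^bsub>C0\<^esub> tn_left V C f (fst P)))"

definition cst_right :: "('vo, 'va, 'm) smc_scheme \<Rightarrow> ('o, 'vo, 'va) vcat \<Rightarrow> ('vo, 'va) mon \<Rightarrow>
    'o \<times> 'o \<times> 'o \<times> 'va \<Rightarrow> 'o \<times> 'o \<times> 'o \<times> 'va \<Rightarrow> 'o \<times> 'o \<times> 'va \<Rightarrow> 'vo \<times> 'va \<Rightarrow>
    'o \<times> 'o \<times> 'va" where
  "cst_right V C b P Q f Z = (let C0 = under V C in
     (THE h. h \<in> hom C0 (cst_obj V C b P Z) (cst_obj V C b Q Z) \<and>
        h \<cdot>\<^bsub>C0\<^esub> cq V C b P Z = cq V C b Q Z \<cdot>\<^bsub>C0\<^esub> tn_right V C (fst Z) f))"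

text \<open>The strength \<open>w \<otimes> (z \<circledast> X) \<rightarrow> (w \<odot> z) \<circledast> X\<close>, induced by
  \<open>w \<otimes> (z \<otimes> X) \<rightarrow> (w \<odot> z) \<otimes> X\<close>.\<close>

definition cst_strength :: "('vo, 'va, 'm) smc_scheme \<Rightarrow> ('o, 'vo, 'va) vcat \<Rightarrow> ('vo, 'va) mon \<Rightarrow>
    'o \<times> 'o \<times> 'o \<times> 'va \<Rightarrow> 'vo \<Rightarrow> 'vo \<times> 'va \<Rightarrow> 'o \<times> 'o \<times> 'va" where
  "cst_strength V C b P w Z = (let C0 = under V C in
     (THE t. t \<in> hom C0 (tn_obj V C w (cst_obj V C b P Z)) (cst_obj V C b P (mod_tensor V b w Z)) \<and>
        t \<cdot>\<^bsub>C0\<^esub> tn_right V C w (cq V C b P Z) =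
        cq V C b P (mod_tensor V b w Z) \<cdot>\<^bsub>C0\<^esub> inv_arr C0 (tn_assoc V C w (fst Z) (fst P))))"

text \<open>
  The enriched functor \<open>- \<circledast> X\<close>. With \<open>w\<close> the hom object from \<open>Z\<close> to \<open>Z'\<close>, its action on homs is
  recovered from the strength as the morphism \<open>w \<rightarrow> C(z \<circledast> X, z' \<circledast> X)\<close> corresponding to
  \<open>w \<otimes> (z \<circledast> X) \<rightarrow> (w \<odot> z) \<circledast> X \<rightarrow> z' \<circledast> X\<close>, the second map being induced by evaluation.
\<close>

definition cst :: "('vo, 'va, 'm) smc_scheme \<Rightarrow> ('o, 'vo, 'va) vcat \<Rightarrow> ('vo, 'va) mon \<Rightarrow>
    'o \<times> 'o \<times> 'o \<times> 'va \<Rightarrow> ('vo \<times> 'va, 'o, 'va) vfun" where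
  "cst V C b P = \<lparr>
     f_obj = (\<lambda>Z \<in> right_modules V b. cst_obj V C b P Z),
     f_hom = (\<lambda>Z \<in> right_modules V b. \<lambda>Z' \<in> right_modules V b. let
         w = VHom (Mod V b) Z Z';
         ev = eval V (fst Z) (fst Z') \<cdot>\<^bsub>V\<^esub> (mod_incl V b Z Z' \<otimes>\<^bsub>V\<^esub> Ide V (fst Z))
       in hom_post V C (cst_obj V C b P Z)
            (cst_left V C b P (mod_tensor V b w Z) Z' ev \<cdot>\<^bsub>under V C\<^esub> cst_strength V C b P w Z)
          \<cdot>\<^bsub>V\<^esub> tn_unit V C w (cst_obj V C b P Z))\<rparr>"

definition cst_functor :: "('vo, 'va, 'm) smc_scheme \<Rightarrow> ('o, 'vo, 'va) vcat \<Rightarrow> ('vo, 'va) mon \<Rightarrow>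
    ('o \<times> 'o \<times> 'o \<times> 'va,
     ('o \<times> 'o \<times> 'o \<times> 'va) \<times> ('o \<times> 'o \<times> 'o \<times> 'va) \<times> ('o \<times> 'o \<times> 'va),
     ('vo \<times> 'va, 'o, 'va) vfun,
     ('vo \<times> 'va, 'o, 'va) vfun \<times> ('vo \<times> 'va, 'o, 'va) vfun \<times> ('vo \<times> 'va \<Rightarrow> 'va)) ftor" where
  "cst_functor V C b = \<lparr>
     on_obj = cst V C b,
     on_arr = (\<lambda>(P, Q, f). (cst V C b P, cst V C b Q,
        \<lambda>Z \<in> right_modules V b. snd (snd (cst_right V C b P Q f Z))))\<rparr>"

end

(*
  Call an arrow f : w -> C(X,Y) an arrow of grade w from X to Y. Tensors, the coequalizer z (x)_b X
  and weighted colimits are all universal among graded arrows, and an enriched functor acts on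
  graded arrows preserving composition, so enriched statements become equations between graded
  arrows. A left module object X amounts to an endo-arrow r of X of grade b, and z (x)_b X is the
  universal target of an arrow k : X -> z (x)_b X of grade z with k r = k gamma; it is the colimit
  of r : b -> C weighted by the right module z, where b is regarded as a one-object enriched
  category. The same construction with the unit monoid gives the tensors.

  The right adjoint sends G to G(b): since every right module z is the colimit of b weighted by z,
  a transformation from - (x)_b X to G is determined by its restriction along X -> b (x)_b X, and
  - (x)_b G(b) -> G is invertible as soon as G preserves these colimits. Conversely - (x)_b X is
  enriched left adjoint to C(X,-) : C -> Mod_b, hence cocontinuous.
*)
theory Submission
  imports Defs
begin

section \<open>Categories and monoidal coherence\<close>

text \<open>The definitions pick tensors, coequalizers, hom objects and induced morphisms by
  \<open>SOME\<close> or \<open>THE\<close>, and phrase weighted colimits through internal homs.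
  Each of these is first characterised by its effect on graded arrows, and later arguments rest on
  that characterisation. The obstacle is bookkeeping: a composite of graded arrows has the tensor
  product of the grades as its grade, so the laws of composition hold only up to associators and
  unitors. The monoidal coherence at the start serves to remove these. Cocompleteness of
  \<open>C\<close> enters through one-object diagrams, whose weighted colimit has the universal
  property of the coequalizer directly; infinitude of \<open>'u\<close> makes these diagrams, and
  the parallel pair used for equalizers in \<open>V\<close>, small. G(b) is a left module object
  because multiplication is an endo-arrow of grade b of the regular module. Full faithfulness rests
  on the isomorphism of X with b (x)_b X. Coreflectivity and the equivalence are then formal, since
  a functor lies in the essential image of a fully faithful left adjoint exactly when its counit is
  invertible.\<close>

lemma in_hom [simp]: "f \<in> hom C x y \<longleftrightarrow> f \<in> Arr C \<and> Dom C f = x \<and> Cod C f = y"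
  by (auto simp: hom_def)

context category begin

lemma dom_cod_obj [simp]:
  assumes "f \<in> Arr C" shows "Dom C f \<in> Obj C" "Cod C f \<in> Obj C"
  using assms dom_in cod_in by auto

lemma ide_arr [simp]:
  assumes "x \<in> Obj C"
  shows "Ide C x \<in> Arr C" "Dom C (Ide C x) = x" "Cod C (Ide C x) = x"
  using ide_in[OF assms] by simp_all

lemma comp_arr [simp]:
  assumes "f \<in> Arr C" "g \<in> Arr C" "Cod C f = Dom C g"
  shows "g \<cdot> f \<in> Arr C" "Dom C (g \<cdot> f) = Dom C f" "Cod C (g \<cdot> f) = Cod C g"
  using comp_in[of f "Dom C f" "Cod C f" g "Cod C g"] assms by simp_all

lemma comp_ide_arr [simp]:
  assumes "f \<in> Arr C" "Dom C f = x" shows "f \<cdot> Ide C x = f"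
  using comp_ide[of f x "Cod C f"] assms by simp

lemma ide_comp_arr [simp]:
  assumes "f \<in> Arr C" "Cod C f = x" shows "Ide C x \<cdot> f = f"
  using ide_comp[of f "Dom C f" x] assms by simp

text \<open>As a simp rule this makes right-nested composites the normal form. Steps that need
  another bracketing delete the rule or state the bracketed term explicitly.\<close>

lemma comp_assoc_arr [simp]:
  assumes "f \<in> Arr C" "g \<in> Arr C" "h \<in> Arr C" "Cod C f = Dom C g" "Cod C g = Dom C h"
  shows "(h \<cdot> g) \<cdot> f = h \<cdot> g \<cdot> f"
  using comp_assoc[of f "Dom C f" "Cod C f" g "Cod C g" h "Cod C h"] assms by simp

lemma inverse_arrows_unique:
  assumes "inverse_arrows C f g" "inverse_arrows C f g'" shows "g = g'"
proof -
  have g: "f \<in> Arr C" "g \<in> Arr C" "Dom C g = Cod C f" "Cod C g = Dom C f"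
      "g \<cdot> f = Ide C (Dom C f)" "f \<cdot> g = Ide C (Cod C f)"
    and g': "g' \<in> Arr C" "Dom C g' = Cod C f" "Cod C g' = Dom C f"
      "g' \<cdot> f = Ide C (Dom C f)" "f \<cdot> g' = Ide C (Cod C f)"
    using assms by (auto simp: inverse_arrows_def)
  have "g = g \<cdot> f \<cdot> g'" using g g' by simp
  also have "\<dots> = (g \<cdot> f) \<cdot> g'" using g(1-4) g'(1-3) by simp
  also have "\<dots> = g'" using g g' by (simp del: comp_assoc_arr)
  finally show ?thesis .
qed

lemma inv_arrI: "inverse_arrows C f g \<Longrightarrow> inv_arr C f = g"
  unfolding inv_arr_def using inverse_arrows_unique by blast

lemma inverse_inv_arr: "is_iso C f \<Longrightarrow> inverse_arrows C f (inv_arr C f)"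
  unfolding is_iso_def using inv_arrI by metis

lemma inv_arr [simp]:
  assumes "is_iso C f"
  shows "inv_arr C f \<in> Arr C" "Dom C (inv_arr C f) = Cod C f" "Cod C (inv_arr C f) = Dom C f"
    "inv_arr C f \<cdot> f = Ide C (Dom C f)" "f \<cdot> inv_arr C f = Ide C (Cod C f)"
  using inverse_inv_arr[OF assms] by (auto simp: inverse_arrows_def)

lemma iso_arr: "is_iso C f \<Longrightarrow> f \<in> Arr C"
  by (auto simp: is_iso_def inverse_arrows_def)

text \<open>In a right-nested composite the pair to be cancelled is not a subterm, so the inverse
  laws are repeated with a tail \<open>g\<close>.\<close>

lemma inv_arr_comp [simp]:
  assumes "is_iso C f" "g \<in> Arr C"
  shows "Cod C g = Dom C f \<Longrightarrow> inv_arr C f \<cdot> f \<cdot> g = g"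
    and "Cod C g = Cod C f \<Longrightarrow> f \<cdot> inv_arr C f \<cdot> g = g"
proof -
  note f = iso_arr[OF assms(1)]
  show "inv_arr C f \<cdot> f \<cdot> g = g" if "Cod C g = Dom C f"
    using comp_assoc_arr[of g f "inv_arr C f"] assms f that by (simp del: comp_assoc_arr)
  show "f \<cdot> inv_arr C f \<cdot> g = g" if "Cod C g = Cod C f"
    using comp_assoc_arr[of g "inv_arr C f" f] assms f that by (simp del: comp_assoc_arr)
qed

lemma iso_inv_arr: "is_iso C f \<Longrightarrow> is_iso C (inv_arr C f)"
  using iso_arr[of f] by (auto simp: is_iso_def[of _ "inv_arr C f"] inverse_arrows_def intro!: exI[of _ f])

lemma iso_ide: "x \<in> Obj C \<Longrightarrow> is_iso C (Ide C x)"
  by (auto simp: is_iso_def inverse_arrows_def intro!: exI[of _ "Ide C x"])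

lemma iso_comp:
  assumes "is_iso C f" "is_iso C g" "Cod C f = Dom C g" shows "is_iso C (g \<cdot> f)"
  unfolding is_iso_def[of _ "g \<cdot> f"] inverse_arrows_def
  using assms iso_arr[OF assms(1)] iso_arr[OF assms(2)]
  by (intro exI[of _ "inv_arr C f \<cdot> inv_arr C g"]) simp

lemma iso_cancel_left:
  assumes "is_iso C f" "g \<in> Arr C" "h \<in> Arr C" "Cod C g = Dom C f" "Cod C h = Dom C f"
    "f \<cdot> g = f \<cdot> h"
  shows "g = h"
proof -
  have "g = inv_arr C f \<cdot> f \<cdot> g" using assms(1-5) by simp
  also have "\<dots> = h" unfolding assms(6) using assms(1-5) by simp
  finally show ?thesis .
qed

lemma iso_cancel_right:
  assumes "is_iso C f" "g \<in> Arr C" "h \<in> Arr C" "Dom C g = Cod C f" "Dom C h = Cod C f"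
    "g \<cdot> f = h \<cdot> f"
  shows "g = h"
proof -
  note f = iso_arr[OF assms(1)]
  have "g = (g \<cdot> f) \<cdot> inv_arr C f" using assms(1-5) f by simp
  also have "\<dots> = h" unfolding assms(6) using assms(1-5) f by simp
  finally show ?thesis .
qed

end

section \<open>Unit coherence of monoidal categories\<close>

context closed_symmetric_monoidal begin

abbreviation assoc' where "assoc' x y z \<equiv> inv_arr V (assoc V x y z)"
abbreviation lunit' where "lunit' x \<equiv> inv_arr V (lunit V x)"
abbreviation runit' where "runit' x \<equiv> inv_arr V (runit V x)"

declare ten_obj_in [simp] unit_in [simp] ihom_in [simp] ten_ide [simp]
  assoc_iso [simp] lunit_iso [simp] runit_iso [simp]

lemma assoc_arr [simp]:
  assumes "x \<in> Obj V" "y \<in> Obj V" "z \<in> Obj V"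
  shows "assoc V x y z \<in> Arr V" "Dom V (assoc V x y z) = (x \<odot> y) \<odot> z"
    "Cod V (assoc V x y z) = x \<odot> y \<odot> z"
  using assoc_in[OF assms] by simp_all

lemma lunit_arr [simp]:
  assumes "x \<in> Obj V"
  shows "lunit V x \<in> Arr V" "Dom V (lunit V x) = \<one> \<odot> x" "Cod V (lunit V x) = x"
  using lunit_in[OF assms] by simp_all

lemma runit_arr [simp]:
  assumes "x \<in> Obj V"
  shows "runit V x \<in> Arr V" "Dom V (runit V x) = x \<odot> \<one>" "Cod V (runit V x) = x"
  using runit_in[OF assms] by simp_all

lemma symm_arr [simp]:
  assumes "x \<in> Obj V" "y \<in> Obj V"
  shows "symm V x y \<in> Arr V" "Dom V (symm V x y) = x \<odot> y" "Cod V (symm V x y) = y \<odot> x"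
  using symm_in[OF assms] by simp_all

lemma eval_arr [simp]:
  assumes "x \<in> Obj V" "y \<in> Obj V"
  shows "eval V x y \<in> Arr V" "Dom V (eval V x y) = ihom V x y \<odot> x" "Cod V (eval V x y) = y"
  using eval_in[OF assms] by simp_all

lemma ten_arr [simp]:
  assumes "f \<in> Arr V" "g \<in> Arr V"
  shows "f \<otimes> g \<in> Arr V" "Dom V (f \<otimes> g) = Dom V f \<odot> Dom V g" "Cod V (f \<otimes> g) = Cod V f \<odot> Cod V g"
  using ten_arr_in[of f "Dom V f" "Cod V f" g "Dom V g" "Cod V g"] assms by simp_all

lemma interchange [simp]:
  assumes "f \<in> Arr V" "g \<in> Arr V" "f' \<in> Arr V" "g' \<in> Arr V" "Cod V f = Dom V g" "Cod V f' = Dom V g'"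
  shows "(g \<otimes> g') \<cdot> (f \<otimes> f') = (g \<cdot> f) \<otimes> (g' \<cdot> f')"
  using ten_comp[of f "Dom V f" "Cod V f" g "Cod V g" f' "Dom V f'" "Cod V f'" g' "Cod V g'"] assms
  by simp

text \<open>Same purpose as \<open>inv_arr_comp\<close>: the interchange law for two factors that
  are followed by a tail in right-nested form. \<open>assoc_nat_comp\<close> does this for
  naturality of the associator.\<close>

lemma interchange_comp [simp]:
  assumes "f \<in> Arr V" "g \<in> Arr V" "f' \<in> Arr V" "g' \<in> Arr V" "Cod V f = Dom V g" "Cod V f' = Dom V g'"
    "k \<in> Arr V" "Cod V k = Dom V f \<odot> Dom V f'"
  shows "(g \<otimes> g') \<cdot> (f \<otimes> f') \<cdot> k = ((g \<cdot> f) \<otimes> (g' \<cdot> f')) \<cdot> k"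
  using comp_assoc_arr[of k "f \<otimes> f'" "g \<otimes> g'"] assms by (simp del: comp_assoc_arr)

lemma assoc_nat_arr:
  assumes "f \<in> Arr V" "g \<in> Arr V" "h \<in> Arr V" "Cod V f = x" "Cod V g = y" "Cod V h = z"
  shows "assoc V x y z \<cdot> ((f \<otimes> g) \<otimes> h) = (f \<otimes> g \<otimes> h) \<cdot> assoc V (Dom V f) (Dom V g) (Dom V h)"
  using assoc_nat[of f "Dom V f" x g "Dom V g" y h "Dom V h" z] assms by simp

lemma assoc_nat_comp:
  assumes "f \<in> Arr V" "g \<in> Arr V" "h \<in> Arr V" "Cod V f = x" "Cod V g = y" "Cod V h = z"
    "k \<in> Arr V" "Cod V k = (Dom V f \<odot> Dom V g) \<odot> Dom V h"
  shows "assoc V x y z \<cdot> ((f \<otimes> g) \<otimes> h) \<cdot> k =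
    (f \<otimes> g \<otimes> h) \<cdot> assoc V (Dom V f) (Dom V g) (Dom V h) \<cdot> k"
proof -
  have "assoc V x y z \<cdot> ((f \<otimes> g) \<otimes> h) \<cdot> k = (assoc V x y z \<cdot> ((f \<otimes> g) \<otimes> h)) \<cdot> k"
    using assms by (subst comp_assoc_arr) auto
  also have "\<dots> = (f \<otimes> g \<otimes> h) \<cdot> assoc V (Dom V f) (Dom V g) (Dom V h) \<cdot> k"
    using assms by (subst assoc_nat_arr) auto
  finally show ?thesis .
qed

lemma symm_nat_arr:
  assumes "f \<in> Arr V" "g \<in> Arr V" "Cod V f = x" "Cod V g = y"
  shows "symm V x y \<cdot> (f \<otimes> g) = (g \<otimes> f) \<cdot> symm V (Dom V f) (Dom V g)"
  using symm_nat[of f "Dom V f" x g "Dom V g" y] assms by simp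

lemma lunit_nat_arr:
  assumes "f \<in> Arr V" "Cod V f = x"
  shows "lunit V x \<cdot> (Ide V \<one> \<otimes> f) = f \<cdot> lunit V (Dom V f)"
  using lunit_nat[of f "Dom V f" x] assms by simp

lemma runit_nat_arr:
  assumes "f \<in> Arr V" "Cod V f = x"
  shows "runit V x \<cdot> (f \<otimes> Ide V \<one>) = f \<cdot> runit V (Dom V f)"
  using runit_nat[of f "Dom V f" x] assms by simp

lemma ten_iso: 
  assumes "is_iso V f" "is_iso V g" shows "is_iso V (f \<otimes> g)"
  unfolding is_iso_def[of _ "f \<otimes> g"] inverse_arrows_def
  using assms iso_arr[OF assms(1)] iso_arr[OF assms(2)]
  by (intro exI[of _ "inv_arr V f \<otimes> inv_arr V g"]) simp

lemma symm_symm_arr [simp]: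
  assumes "x \<in> Obj V" "y \<in> Obj V"
  shows "symm V y x \<cdot> symm V x y = Ide V (x \<odot> y)"
    "k \<in> Arr V \<Longrightarrow> Cod V k = x \<odot> y \<Longrightarrow> symm V y x \<cdot> symm V x y \<cdot> k = k"
  using symm_symm[OF assms] comp_assoc_arr[of k "symm V x y" "symm V y x"] assms
  by (simp_all del: comp_assoc_arr)

lemma symm_iso [simp]: "x \<in> Obj V \<Longrightarrow> y \<in> Obj V \<Longrightarrow> is_iso V (symm V x y)"
  unfolding is_iso_def inverse_arrows_def by (intro exI[of _ "symm V y x"]) simp

text \<open>Tensoring with the unit is faithful because the unitor is a natural isomorphism.
  Coherence identities can thus be proved after tensoring with \<open>\<one>\<close>, where the
  pentagon and the triangle apply.\<close>

lemma ten_unit_left_cancel: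
  assumes "f \<in> Arr V" "g \<in> Arr V" "Dom V f = Dom V g" "Cod V f = Cod V g" "Ide V \<one> \<otimes> f = Ide V \<one> \<otimes> g"
  shows "f = g"
proof (rule iso_cancel_right[of "lunit V (Dom V f)"])
  show "f \<cdot> lunit V (Dom V f) = g \<cdot> lunit V (Dom V f)"
    using lunit_nat[of f "Dom V f" "Cod V f"] lunit_nat[of g "Dom V f" "Cod V f"] assms by simp
qed (use assms in simp_all)

lemma ten_unit_right_cancel:
  assumes "f \<in> Arr V" "g \<in> Arr V" "Dom V f = Dom V g" "Cod V f = Cod V g" "f \<otimes> Ide V \<one> = g \<otimes> Ide V \<one>"
  shows "f = g"
proof (rule iso_cancel_right[of "runit V (Dom V f)"])
  show "f \<cdot> runit V (Dom V f) = g \<cdot> runit V (Dom V f)"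
    using runit_nat[of f "Dom V f" "Cod V f"] runit_nat[of g "Dom V f" "Cod V f"] assms by simp
qed (use assms in simp_all)

text \<open>Kelly's derivation of a unit law from the pentagon and the triangle: both sides are
  tensored with \<open>\<one>\<close> and precomposed with an isomorphism, which leads to the
  pentagon with two unit entries.\<close>

lemma lunit_ten:
  assumes [simp]: "x \<in> Obj V" "y \<in> Obj V"
  shows "lunit V (x \<odot> y) \<cdot> assoc V \<one> x y = lunit V x \<otimes> Ide V y"
proof (rule ten_unit_left_cancel)
  \<comment> \<open>\<open>?k\<close> is the part of the pentagon for
    \<open>\<one>, \<one>, x, y\<close> that the left-hand side lacks. It is invertible and is
    cancelled at the end.\<close>
  let ?k = "assoc V \<one> (\<one> \<odot> x) y \<cdot> (assoc V \<one> \<one> x \<otimes> Ide V y)"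
  have "(Ide V \<one> \<otimes> (lunit V (x \<odot> y) \<cdot> assoc V \<one> x y)) \<cdot> ?k =
      (Ide V \<one> \<otimes> lunit V (x \<odot> y)) \<cdot> (Ide V \<one> \<otimes> assoc V \<one> x y) \<cdot> ?k" by simp
  also have "\<dots> = (Ide V \<one> \<otimes> lunit V (x \<odot> y)) \<cdot> assoc V \<one> \<one> (x \<odot> y) \<cdot> assoc V (\<one> \<odot> \<one>) x y"
    by (subst pentagon) (simp_all del: interchange_comp)
  also have "\<dots> = ((Ide V \<one> \<otimes> lunit V (x \<odot> y)) \<cdot> assoc V \<one> \<one> (x \<odot> y)) \<cdot> assoc V (\<one> \<odot> \<one>) x y"
    by simp
  also have "\<dots> = (runit V \<one> \<otimes> Ide V x \<otimes> Ide V y) \<cdot> assoc V (\<one> \<odot> \<one>) x y"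
    by (subst triangle) simp_all
  also have "\<dots> = assoc V \<one> x y \<cdot> ((runit V \<one> \<otimes> Ide V x) \<otimes> Ide V y)"
    by (subst assoc_nat_arr) simp_all
  also have "\<dots> = assoc V \<one> x y \<cdot> (((Ide V \<one> \<otimes> lunit V x) \<cdot> assoc V \<one> \<one> x) \<otimes> Ide V y)"
    by (subst triangle) simp_all
  also have "\<dots> = (assoc V \<one> x y \<cdot> ((Ide V \<one> \<otimes> lunit V x) \<otimes> Ide V y)) \<cdot> (assoc V \<one> \<one> x \<otimes> Ide V y)"
    by simp
  also have "\<dots> = (Ide V \<one> \<otimes> lunit V x \<otimes> Ide V y) \<cdot> ?k"
    by (subst assoc_nat_arr) simp_all
  finally show "Ide V \<one> \<otimes> (lunit V (x \<odot> y) \<cdot> assoc V \<one> x y) = Ide V \<one> \<otimes> lunit V x \<otimes> Ide V y"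
    by (rule iso_cancel_right[rotated -1]) (simp_all add: iso_comp ten_iso iso_ide)
qed simp_all

text \<open>The mirror image of \<open>lunit_ten\<close>, using the pentagon for
  \<open>x, y, \<one>, \<one>\<close>.\<close>

lemma runit_ten:
  assumes [simp]: "x \<in> Obj V" "y \<in> Obj V"
  shows "(Ide V x \<otimes> runit V y) \<cdot> assoc V x y \<one> = runit V (x \<odot> y)"
proof (rule ten_unit_right_cancel)
  let ?k = "assoc V x y \<one>"
  have "?k \<cdot> (((Ide V x \<otimes> runit V y) \<cdot> assoc V x y \<one>) \<otimes> Ide V \<one>) =
      (?k \<cdot> ((Ide V x \<otimes> runit V y) \<otimes> Ide V \<one>)) \<cdot> (assoc V x y \<one> \<otimes> Ide V \<one>)" by simp
  also have "\<dots> = (Ide V x \<otimes> runit V y \<otimes> Ide V \<one>) \<cdot> assoc V x (y \<odot> \<one>) \<one> \<cdot> (assoc V x y \<one> \<otimes> Ide V \<one>)"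
    by (subst assoc_nat_arr) simp_all
  also have "\<dots> = (Ide V x \<otimes> ((Ide V y \<otimes> lunit V \<one>) \<cdot> assoc V y \<one> \<one>)) \<cdot> assoc V x (y \<odot> \<one>) \<one> \<cdot> (assoc V x y \<one> \<otimes> Ide V \<one>)"
    using triangle[of y \<one>] by simp
  also have "\<dots> = (Ide V x \<otimes> Ide V y \<otimes> lunit V \<one>) \<cdot>
      (Ide V x \<otimes> assoc V y \<one> \<one>) \<cdot> assoc V x (y \<odot> \<one>) \<one> \<cdot> (assoc V x y \<one> \<otimes> Ide V \<one>)" by simp
  also have "\<dots> = (Ide V x \<otimes> Ide V y \<otimes> lunit V \<one>) \<cdot> assoc V x y (\<one> \<odot> \<one>) \<cdot> assoc V (x \<odot> y) \<one> \<one>"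
    by (subst pentagon) simp_all
  also have "\<dots> = ((Ide V x \<otimes> Ide V y \<otimes> lunit V \<one>) \<cdot> assoc V x y (\<one> \<odot> \<one>)) \<cdot> assoc V (x \<odot> y) \<one> \<one>"
    by (subst comp_assoc_arr) simp_all
  also have "\<dots> = (assoc V x y \<one> \<cdot> ((Ide V x \<otimes> Ide V y) \<otimes> lunit V \<one>)) \<cdot> assoc V (x \<odot> y) \<one> \<one>"
    by (simp add: assoc_nat_arr del: ten_ide)
  also have "\<dots> = ?k \<cdot> (runit V (x \<odot> y) \<otimes> Ide V \<one>)"
    using triangle[of "x \<odot> y" \<one>] by simp
  finally show "((Ide V x \<otimes> runit V y) \<cdot> assoc V x y \<one>) \<otimes> Ide V \<one> = runit V (x \<odot> y) \<otimes> Ide V \<one>"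
    by (rule iso_cancel_left[rotated -1]) simp_all
qed simp_all

text \<open>Naturality of the left unitor at itself gives \<open>Ide V \<one> \<otimes> lunit V
  \<one> = lunit V (\<one> \<odot> \<one>)\<close>. With this identification
  \<open>lunit_ten\<close> and the triangle express both unitors, tensored with
  \<open>\<one>\<close>, by the same composite.\<close>

lemma lunit_unit: "lunit V \<one> = runit V \<one>"
proof (rule ten_unit_right_cancel)
  have "lunit V \<one> \<cdot> (Ide V \<one> \<otimes> lunit V \<one>) = lunit V \<one> \<cdot> lunit V (\<one> \<odot> \<one>)"
    using lunit_nat_arr[of "lunit V \<one>" "\<one>"] by simp
  hence *: "Ide V \<one> \<otimes> lunit V \<one> = lunit V (\<one> \<odot> \<one>)"
    by (rule iso_cancel_left[OF lunit_iso, rotated -1]) simp_all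
  have "lunit V \<one> \<otimes> Ide V \<one> = lunit V (\<one> \<odot> \<one>) \<cdot> assoc V \<one> \<one> \<one>"
    by (rule lunit_ten[symmetric]) simp_all
  also have "\<dots> = runit V \<one> \<otimes> Ide V \<one>"
    unfolding *[symmetric] by (rule triangle) simp_all
  finally show "lunit V \<one> \<otimes> Ide V \<one> = runit V \<one> \<otimes> Ide V \<one>" .
qed simp_all

end

section \<open>Coherence of the symmetry\<close>

context closed_symmetric_monoidal begin
text \<open>The hexagon at \<open>x, \<one>, \<one>\<close> shows that
  \<open>p = lunit V x \<cdot> symm V x \<one>\<close> satisfies \<open>p \<cdot> (runit V x
  \<otimes> Ide V \<one>) = p \<cdot> (p \<otimes> Ide V \<one>)\<close>. As \<open>p\<close> is
  invertible it cancels, and then so does the unit factor.\<close>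

lemma lunit_symm:
  assumes [simp]: "x \<in> Obj V"
  shows "lunit V x \<cdot> symm V x \<one> = runit V x"
proof -
  define p where "p = lunit V x \<cdot> symm V x \<one>"
  have p [simp]: "p \<in> Arr V" "Dom V p = x \<odot> \<one>" "Cod V p = x" and p_iso: "is_iso V p"
    by (simp_all add: p_def iso_comp)
  have "p \<cdot> (runit V x \<otimes> Ide V \<one>) = lunit V x \<cdot> (symm V x \<one> \<cdot> (Ide V x \<otimes> lunit V \<one>)) \<cdot> assoc V x \<one> \<one>"
    using triangle[of x \<one>] by (simp add: p_def)
  also have "\<dots> = lunit V x \<cdot> (lunit V \<one> \<otimes> Ide V x) \<cdot> symm V x (\<one> \<odot> \<one>) \<cdot> assoc V x \<one> \<one>"
    by (subst symm_nat_arr) simp_all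
  also have "\<dots> = lunit V x \<cdot> ((Ide V \<one> \<otimes> lunit V x) \<cdot> assoc V \<one> \<one> x) \<cdot> symm V x (\<one> \<odot> \<one>) \<cdot> assoc V x \<one> \<one>"
    by (subst triangle) (simp_all add: lunit_unit)
  also have "\<dots> = lunit V x \<cdot> (Ide V \<one> \<otimes> lunit V x) \<cdot> assoc V \<one> \<one> x \<cdot> symm V x (\<one> \<odot> \<one>) \<cdot> assoc V x \<one> \<one>"
    by simp
  also have "\<dots> = lunit V x \<cdot> (Ide V \<one> \<otimes> p) \<cdot> assoc V \<one> x \<one> \<cdot> (symm V x \<one> \<otimes> Ide V \<one>)"
    by (subst hexagon) (simp_all add: p_def)
  also have "\<dots> = (lunit V x \<cdot> (Ide V \<one> \<otimes> p)) \<cdot> assoc V \<one> x \<one> \<cdot> (symm V x \<one> \<otimes> Ide V \<one>)"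
    by simp
  also have "\<dots> = p \<cdot> (lunit V (x \<odot> \<one>) \<cdot> assoc V \<one> x \<one>) \<cdot> (symm V x \<one> \<otimes> Ide V \<one>)"
    by (subst lunit_nat_arr) simp_all
  also have "\<dots> = p \<cdot> (p \<otimes> Ide V \<one>)"
    by (subst lunit_ten) (simp_all add: p_def)
  finally have "runit V x \<otimes> Ide V \<one> = p \<otimes> Ide V \<one>"
    by (rule iso_cancel_left[OF p_iso, rotated -1]) simp_all
  hence "runit V x = p" by (rule ten_unit_right_cancel[rotated -1]) simp_all
  thus ?thesis by (simp add: p_def)
qed

text \<open>The second hexagon. Composing the candidate with \<open>symm V z (x \<odot> y)\<close>
  and applying the axiom at \<open>z, x, y\<close> gives the identity, and the symmetry is its own
  inverse.\<close>

lemma hexagon_right: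
  assumes [simp]: "x \<in> Obj V" "y \<in> Obj V" "z \<in> Obj V"
  shows "assoc V z x y \<cdot> (symm V x z \<otimes> Ide V y) \<cdot> assoc' x z y \<cdot> (Ide V x \<otimes> symm V y z) \<cdot> assoc V x y z
    = symm V (x \<odot> y) z"
proof -
  let ?l = "assoc' x z y \<cdot> (Ide V x \<otimes> symm V y z)"
  define m where "m = assoc V z x y \<cdot> (symm V x z \<otimes> Ide V y) \<cdot> ?l \<cdot> assoc V x y z"
  have m: "m \<in> Arr V" "Dom V m = (x \<odot> y) \<odot> z" "Cod V m = z \<odot> x \<odot> y" by (simp_all add: m_def)
  have "assoc V x y z \<cdot> symm V z (x \<odot> y) \<cdot> m =
     (assoc V x y z \<cdot> symm V z (x \<odot> y) \<cdot> assoc V z x y) \<cdot> (symm V x z \<otimes> Ide V y) \<cdot> ?l \<cdot> assoc V x y z"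
    unfolding m_def by simp
  also have "\<dots> = ((Ide V x \<otimes> symm V z y) \<cdot> assoc V x z y \<cdot> (symm V z x \<otimes> Ide V y)) \<cdot>
     (symm V x z \<otimes> Ide V y) \<cdot> ?l \<cdot> assoc V x y z"
    using hexagon[of z x y] by simp
  also have "\<dots> = assoc V x y z" by simp
  finally have *: "assoc V x y z \<cdot> symm V z (x \<odot> y) \<cdot> m = assoc V x y z \<cdot> Ide V ((x \<odot> y) \<odot> z)" by simp
  have "symm V z (x \<odot> y) \<cdot> m = Ide V ((x \<odot> y) \<odot> z)"
    by (rule iso_cancel_left[OF _ _ _ _ _ *]) (simp_all add: m)
  hence "symm V (x \<odot> y) z \<cdot> symm V z (x \<odot> y) \<cdot> m = symm V (x \<odot> y) z" by simp
  thus ?thesis by (simp add: m) (simp add: m_def)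
qed

text \<open>Two ways to reverse a threefold product agree: moving \<open>x\<close> past
  \<open>y \<odot> z\<close> and then exchanging \<open>y\<close> and \<open>z\<close>, or moving
  \<open>x \<odot> y\<close> past \<open>z\<close> and then exchanging \<open>x\<close> and
  \<open>y\<close>. This is what contravariance costs, both for opposite categories and for right
  modules as weights.\<close>

lemma reverse:
  assumes [simp]: "x \<in> Obj V" "y \<in> Obj V" "z \<in> Obj V"
  shows "assoc V z y x \<cdot> (symm V y z \<otimes> Ide V x) \<cdot> symm V x (y \<odot> z) \<cdot> assoc V x y z =
    (Ide V z \<otimes> symm V x y) \<cdot> symm V (x \<odot> y) z"
proof -
  have "assoc' y z x \<cdot> (assoc V y z x \<cdot> symm V x (y \<odot> z) \<cdot> assoc V x y z) =
     assoc' y z x \<cdot> (Ide V y \<otimes> symm V x z) \<cdot> assoc V y x z \<cdot> (symm V x y \<otimes> Ide V z)"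
    by (subst hexagon) simp_all
  hence "symm V x (y \<odot> z) \<cdot> assoc V x y z =
     assoc' y z x \<cdot> (Ide V y \<otimes> symm V x z) \<cdot> assoc V y x z \<cdot> (symm V x y \<otimes> Ide V z)"
    by simp
  hence "assoc V z y x \<cdot> (symm V y z \<otimes> Ide V x) \<cdot> symm V x (y \<odot> z) \<cdot> assoc V x y z =
     (assoc V z y x \<cdot> (symm V y z \<otimes> Ide V x) \<cdot> assoc' y z x \<cdot> (Ide V y \<otimes> symm V x z) \<cdot> assoc V y x z)
        \<cdot> (symm V x y \<otimes> Ide V z)"
    by simp
  also have "\<dots> = symm V (y \<odot> x) z \<cdot> (symm V x y \<otimes> Ide V z)"
    by (subst hexagon_right) simp_all
  also have "\<dots> = (Ide V z \<otimes> symm V x y) \<cdot> symm V (x \<odot> y) z"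
    by (subst symm_nat_arr) simp_all
  finally show ?thesis .
qed

end

section \<open>Internal homs\<close>

lemma finite_card_less:
  assumes "finite A" "infinite B" shows "|A| <o |B|"
  using assms by (intro finite_ordLess_infinite) (auto simp: Field_card_of card_of_well_order_on)

context category begin

text \<open>A Yoneda argument: composition with \<open>\<phi>\<close> is bijective on arrows from
  every source, so the lift of the identity is a two-sided inverse.\<close>

lemma iso_if_unique_lift:
  assumes \<phi>: "\<phi> \<in> Arr C"
    and ex: "\<And>f. f \<in> Arr C \<Longrightarrow> Cod C f = Cod C \<phi> \<Longrightarrow> \<exists>g. g \<in> hom C (Dom C f) (Dom C \<phi>) \<and> \<phi> \<cdot> g = f"
    and inj: "\<And>g h. g \<in> Arr C \<Longrightarrow> h \<in> Arr C \<Longrightarrow> Dom C g = Dom C h \<Longrightarrow> Cod C g = Dom C \<phi> \<Longrightarrow>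
      Cod C h = Dom C \<phi> \<Longrightarrow> \<phi> \<cdot> g = \<phi> \<cdot> h \<Longrightarrow> g = h"
  shows "is_iso C \<phi>"
proof -
  obtain g where g: "g \<in> hom C (Cod C \<phi>) (Dom C \<phi>)" "\<phi> \<cdot> g = Ide C (Cod C \<phi>)"
    using ex[of "Ide C (Cod C \<phi>)"] \<phi> by auto
  have "\<phi> \<cdot> g \<cdot> \<phi> = (\<phi> \<cdot> g) \<cdot> \<phi>" using g(1) \<phi> by simp
  also have "\<dots> = \<phi> \<cdot> Ide C (Dom C \<phi>)" unfolding g(2) using \<phi> by simp
  finally have "g \<cdot> \<phi> = Ide C (Dom C \<phi>)"
    by (rule inj[rotated -1]) (use g(1) \<phi> in simp_all)
  thus ?thesis using g \<phi> unfolding is_iso_def inverse_arrows_def by (intro exI[of _ g]) simp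
qed

lemma complete_imp_equalizer:
  assumes "infinite (UNIV :: 'u set)" "complete TYPE('u) C"
    and fg: "f \<in> Arr C" "g \<in> Arr C" "Dom C f = Dom C g" "Cod C f = Cod C g"
  shows "\<exists>i. is_equalizer C f g i"
proof -
  obtain A :: "'u set" where "finite A" "card A = 4"
    using infinite_arbitrarily_large[OF assms(1)] by blast
  then obtain xs :: "'u list" where xs: "distinct xs" "length xs = 4"
    by (metis distinct_card finite_distinct_list)
  then obtain p q r s :: 'u where dist: "distinct [p, q, r, s]"
    by (auto simp: numeral_eq_Suc length_Suc_conv)
  \<comment> \<open>The parallel pair inside \<open>'u\<close>: the four chosen elements are its
    arrows. \<open>p\<close> and \<open>q\<close> serve both as objects and as their identities,
    \<open>r\<close> and \<open>s\<close> are the two parallel arrows.\<close>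
  define J :: "('u, 'u) cat" where "J = \<lparr>Obj = {p, q}, Arr = {p, q, r, s},
    Dom = (\<lambda>x. if x = q then q else p), Cod = (\<lambda>x. if x = p then p else q), Ide = (\<lambda>x. x),
    Comp = (\<lambda>y x. if x = p \<or> x = q then y else x)\<rparr>"
  define F where "F = \<lparr>on_obj = (\<lambda>x. if x = p then Dom C f else Cod C f),
    on_arr = (\<lambda>x. if x = p then Ide C (Dom C f) else if x = q then Ide C (Cod C f)
      else if x = r then f else g)\<rparr>"
  have J: "category J"
    using dist by unfold_locales (auto simp: J_def split: if_splits)
  have "ordinary_functor J C F"
    using dist J fg category_axioms
    by (auto simp: ordinary_functor_def ordinary_functor_axioms_def F_def J_def split: if_splits)
  moreover have "small_cat J"
    using J assms(1) by (auto simp: small_cat_def J_def intro!: finite_card_less)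
  ultimately obtain c \<pi> where lim: "is_limit J C F c \<pi>"
    using assms(2) unfolding complete_def by blast
  have qp: "q \<noteq> p" "r \<noteq> p" "r \<noteq> q" "s \<noteq> p" "s \<noteq> q" "s \<noteq> r" using dist by auto
  have cone_iff: "cone J C F d \<psi> \<longleftrightarrow> d \<in> Obj C \<and> \<psi> p \<in> hom C d (Dom C f) \<and> \<psi> q \<in> hom C d (Cod C f)
      \<and> f \<cdot> \<psi> p = \<psi> q \<and> g \<cdot> \<psi> p = \<psi> q" for d \<psi>
    using qp fg by (auto simp: cone_def J_def F_def)
  have c: "c \<in> Obj C" "\<pi> p \<in> hom C c (Dom C f)" "f \<cdot> \<pi> p = \<pi> q" "g \<cdot> \<pi> p = \<pi> q"
    using lim by (auto simp: is_limit_def cone_iff)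
  have "\<exists>!h. h \<in> hom C (Dom C k) (Dom C (\<pi> p)) \<and> \<pi> p \<cdot> h = k"
    if k: "k \<in> Arr C" "Cod C k = Dom C f" "f \<cdot> k = g \<cdot> k" for k
  proof -
    define \<psi> where "\<psi> x = (if x = p then k else f \<cdot> k)" for x
    have "cone J C F (Dom C k) \<psi>"
      using k fg qp by (auto simp: cone_iff \<psi>_def)
    then have ex1: "\<exists>!h. h \<in> hom C (Dom C k) c \<and> (\<forall>j \<in> Obj J. \<pi> j \<cdot> h = \<psi> j)"
      using lim by (simp add: is_limit_def)
    have "(h \<in> hom C (Dom C k) c \<and> (\<forall>j \<in> Obj J. \<pi> j \<cdot> h = \<psi> j)) \<longleftrightarrow>
       (h \<in> hom C (Dom C k) (Dom C (\<pi> p)) \<and> \<pi> p \<cdot> h = k)" for h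
      using c k fg qp by (auto simp: J_def \<psi>_def c(3)[symmetric])
    thus ?thesis using ex1 by simp
  qed
  thus ?thesis using c by (intro exI[of _ "\<pi> p"]) (simp add: is_equalizer_def)
qed

end

section \<open>Currying and the self-enrichment\<close>

context closed_symmetric_monoidal begin

lemma assoc'_nat_arr:
  assumes "f \<in> Arr V" "g \<in> Arr V" "h \<in> Arr V" "Cod V f = x" "Cod V g = y" "Cod V h = z"
  shows "assoc' x y z \<cdot> (f \<otimes> g \<otimes> h) = ((f \<otimes> g) \<otimes> h) \<cdot> assoc' (Dom V f) (Dom V g) (Dom V h)"
proof (rule iso_cancel_left[of "assoc V x y z"])
  have "assoc V x y z \<cdot> ((f \<otimes> g) \<otimes> h) \<cdot> assoc' (Dom V f) (Dom V g) (Dom V h) =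
     (f \<otimes> g \<otimes> h) \<cdot> assoc V (Dom V f) (Dom V g) (Dom V h) \<cdot> assoc' (Dom V f) (Dom V g) (Dom V h)"
    using assms by (intro assoc_nat_comp) auto
  thus "assoc V x y z \<cdot> assoc' x y z \<cdot> (f \<otimes> g \<otimes> h) =
      assoc V x y z \<cdot> ((f \<otimes> g) \<otimes> h) \<cdot> assoc' (Dom V f) (Dom V g) (Dom V h)"
    using assms by auto
qed (use assms in auto)

text \<open>The inverse of \<open>curry\<close>. Equations between morphisms into an internal hom
  are proved by comparing their \<open>unc\<close> and applying \<open>unc_inj\<close>.\<close>

definition unc :: "'o \<Rightarrow> 'o \<Rightarrow> 'a \<Rightarrow> 'a" where
  "unc x y f = eval V x y \<cdot> (f \<otimes> Ide V x)"

lemma unc_arr [simp]: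
  assumes "f \<in> Arr V" "Cod V f = ihom V x y" "x \<in> Obj V" "y \<in> Obj V"
  shows "unc x y f \<in> Arr V" "Dom V (unc x y f) = Dom V f \<odot> x" "Cod V (unc x y f) = y"
  using assms by (auto simp: unc_def)

lemma curry_unc [simp]:
  assumes "f \<in> Arr V" "Dom V f = z \<odot> x" "Cod V f = y" "x \<in> Obj V" "z \<in> Obj V"
  shows "curry V z x y f \<in> Arr V" "Dom V (curry V z x y f) = z" "Cod V (curry V z x y f) = ihom V x y"
    "unc x y (curry V z x y f) = f"
  using theI'[OF eval_universal[of x y z f]] assms by (auto simp: unc_def curry_def)

lemma unc_inj:
  assumes "f \<in> Arr V" "g \<in> Arr V" "Dom V f = Dom V g" "Cod V f = ihom V x y" "Cod V g = ihom V x y"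
    "x \<in> Obj V" "y \<in> Obj V" "unc x y f = unc x y g"
  shows "f = g"
proof -
  have "\<exists>!h. h \<in> hom V (Dom V g) (ihom V x y) \<and> eval V x y \<cdot> (h \<otimes> Ide V x) = unc x y g"
    using assms by (intro eval_universal) auto
  thus ?thesis using assms by (auto simp: unc_def)
qed

lemma unc_comp:
  assumes "f \<in> Arr V" "s \<in> Arr V" "Cod V s = Dom V f" "Cod V f = ihom V x y" "x \<in> Obj V" "y \<in> Obj V"
  shows "unc x y (f \<cdot> s) = unc x y f \<cdot> (s \<otimes> Ide V x)"
  using assms by (simp add: unc_def)

text \<open>The calculation rule for the self-enrichment: uncurried, composition substitutes one
  evaluation into another, up to one associator. It reduces the axioms of an enriched category to
  the pentagon, \<open>lunit_ten\<close> and the triangle.\<close>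

lemma unc_self_comp:
  assumes "g \<in> Arr V" "f \<in> Arr V" "Cod V g = ihom V y z" "Cod V f = ihom V x y"
    "x \<in> Obj V" "y \<in> Obj V" "z \<in> Obj V"
  shows "unc x z (VComp (self_enriched V) x y z \<cdot> (g \<otimes> f)) =
    unc y z g \<cdot> (Ide V (Dom V g) \<otimes> unc x y f) \<cdot> assoc V (Dom V g) (Dom V f) x"
proof -
  have "unc x z (VComp (self_enriched V) x y z \<cdot> (g \<otimes> f)) =
     (eval V y z \<cdot> (Ide V (ihom V y z) \<otimes> eval V x y) \<cdot> assoc V (ihom V y z) (ihom V x y) x) \<cdot> ((g \<otimes> f) \<otimes> Ide V x)"
    using assms by (subst unc_comp) (auto simp: self_enriched_def)
  also have "\<dots> = unc y z g \<cdot> (Ide V (Dom V g) \<otimes> unc x y f) \<cdot> assoc V (Dom V g) (Dom V f) x"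
    using assms by (simp add: assoc_nat_arr unc_def)
  finally show ?thesis .
qed

lemma self_comp_arr [simp]:
  assumes "x \<in> Obj V" "y \<in> Obj V" "z \<in> Obj V"
  shows "VComp (self_enriched V) x y z \<in> Arr V"
    "Dom V (VComp (self_enriched V) x y z) = ihom V y z \<odot> ihom V x y"
    "Cod V (VComp (self_enriched V) x y z) = ihom V x z"
  using assms by (simp_all add: self_enriched_def)

lemma self_simps [simp]: "VObj (self_enriched V) = Obj V" "VHom (self_enriched V) = ihom V"
  by (simp_all add: self_enriched_def)

lemma self_id_arr [simp]:
  assumes "x \<in> Obj V"
  shows "VId (self_enriched V) x \<in> Arr V" "Dom V (VId (self_enriched V) x) = \<one>"
    "Cod V (VId (self_enriched V) x) = ihom V x x" "unc x x (VId (self_enriched V) x) = lunit V x"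
  using assms by (simp_all add: self_enriched_def)

lemma unc_ide: "x \<in> Obj V \<Longrightarrow> y \<in> Obj V \<Longrightarrow> unc x y (Ide V (ihom V x y)) = eval V x y"
  by (simp add: unc_def)

lemma pentagon_arr:
  assumes "w \<in> Obj V" "x \<in> Obj V" "y \<in> Obj V" "z \<in> Obj V"
  shows "(Ide V w \<otimes> assoc V x y z) \<cdot> assoc V w (x \<odot> y) z \<cdot> (assoc V w x y \<otimes> Ide V z) =
     assoc V w x (y \<odot> z) \<cdot> assoc V (w \<odot> x) y z"
  using pentagon assms by simp

lemma unc_self_comp_id:
  assumes "x \<in> Obj V" "y \<in> Obj V" "z \<in> Obj V"
  shows "unc x z (VComp (self_enriched V) x y z) =
    eval V y z \<cdot> (Ide V (ihom V y z) \<otimes> eval V x y) \<cdot> assoc V (ihom V y z) (ihom V x y) x"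
  using unc_self_comp[of "Ide V (ihom V y z)" "Ide V (ihom V x y)" y z x] assms by (simp add: unc_ide)

lemma enriched_self: "enriched_category V (self_enriched V)"
proof (intro enriched_category.intro enriched_category_axioms.intro closed_symmetric_monoidal_axioms, goal_cases)
  case (4 w x y z)
  hence [simp]: "w \<in> Obj V" "x \<in> Obj V" "y \<in> Obj V" "z \<in> Obj V" by simp_all
  let ?S = "self_enriched V" and ?wx = "ihom V w x" and ?xy = "ihom V x y" and ?yz = "ihom V y z"
  have "unc w z (VComp ?S w x z \<cdot> (VComp ?S x y z \<otimes> Ide V ?wx)) =
     (eval V y z \<cdot> (Ide V ?yz \<otimes> eval V x y) \<cdot> assoc V ?yz ?xy x) \<cdot>
       (Ide V (?yz \<odot> ?xy) \<otimes> eval V w x) \<cdot> assoc V (?yz \<odot> ?xy) ?wx w"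
    by (subst unc_self_comp) (simp_all add: unc_self_comp_id unc_ide)
  also have "\<dots> = eval V y z \<cdot> (Ide V ?yz \<otimes> eval V x y) \<cdot>
       (assoc V ?yz ?xy x \<cdot> ((Ide V ?yz \<otimes> Ide V ?xy) \<otimes> eval V w x)) \<cdot> assoc V (?yz \<odot> ?xy) ?wx w"
    by simp
  also have "\<dots> = eval V y z \<cdot> (Ide V ?yz \<otimes> eval V x y) \<cdot> (Ide V ?yz \<otimes> Ide V ?xy \<otimes> eval V w x) \<cdot>
       assoc V ?yz ?xy (?wx \<odot> w) \<cdot> assoc V (?yz \<odot> ?xy) ?wx w"
    by (subst assoc_nat_arr) simp_all
  also have "\<dots> = eval V y z \<cdot> (Ide V ?yz \<otimes> (eval V x y \<cdot> (Ide V ?xy \<otimes> eval V w x) \<cdot> assoc V ?xy ?wx w)) \<cdot>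
       assoc V ?yz (?xy \<odot> ?wx) w \<cdot> (assoc V ?yz ?xy ?wx \<otimes> Ide V w)"
    by (subst pentagon) simp_all
  also have "\<dots> = unc w z (VComp ?S w y z \<cdot> (Ide V ?yz \<otimes> VComp ?S w x y)) \<cdot> (assoc V ?yz ?xy ?wx \<otimes> Ide V w)"
    by (subst unc_self_comp) (simp_all add: unc_self_comp_id unc_ide)
  also have "\<dots> = unc w z ((VComp ?S w y z \<cdot> (Ide V ?yz \<otimes> VComp ?S w x y)) \<cdot> assoc V ?yz ?xy ?wx)"
    by (rule unc_comp[symmetric]) simp_all
  finally have "VComp ?S w x z \<cdot> (VComp ?S x y z \<otimes> Ide V ?wx) =
    (VComp ?S w y z \<cdot> (Ide V ?yz \<otimes> VComp ?S w x y)) \<cdot> assoc V ?yz ?xy ?wx"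
    by (rule unc_inj[rotated -1]) simp_all
  thus ?case by simp
next
  case (5 x y)
  hence [simp]: "x \<in> Obj V" "y \<in> Obj V" by simp_all
  let ?S = "self_enriched V" and ?xy = "ihom V x y"
  have "unc x y (VComp ?S x y y \<cdot> (VId ?S y \<otimes> Ide V ?xy)) =
     (lunit V y \<cdot> (Ide V \<one> \<otimes> eval V x y)) \<cdot> assoc V \<one> ?xy x"
    by (subst unc_self_comp) (simp_all add: unc_ide)
  also have "\<dots> = eval V x y \<cdot> (lunit V (?xy \<odot> x) \<cdot> assoc V \<one> ?xy x)"
    by (subst lunit_nat_arr) simp_all
  also have "\<dots> = unc x y (lunit V ?xy)"
    by (subst lunit_ten) (simp_all add: unc_def)
  finally have "VComp ?S x y y \<cdot> (VId ?S y \<otimes> Ide V ?xy) = lunit V ?xy"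
    by (rule unc_inj[rotated -1]) simp_all
  thus ?case by simp
next
  case (6 x y)
  hence [simp]: "x \<in> Obj V" "y \<in> Obj V" by simp_all
  let ?S = "self_enriched V" and ?xy = "ihom V x y"
  have "unc x y (VComp ?S x x y \<cdot> (Ide V ?xy \<otimes> VId ?S x)) =
     eval V x y \<cdot> ((Ide V ?xy \<otimes> lunit V x) \<cdot> assoc V ?xy \<one> x)"
    by (subst unc_self_comp) (simp_all add: unc_ide)
  also have "\<dots> = unc x y (runit V ?xy)"
    by (subst triangle) (simp_all add: unc_def)
  finally have "VComp ?S x x y \<cdot> (Ide V ?xy \<otimes> VId ?S x) = runit V ?xy"
    by (rule unc_inj[rotated -1]) simp_all
  thus ?case by simp
qed auto

section \<open>Functoriality of the internal hom, uncurried\<close>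

lemma ihom_arr [simp]:
  assumes "g \<in> Arr V" "x \<in> Obj V"
  shows "ihom_post V x g \<in> Arr V" "Dom V (ihom_post V x g) = ihom V x (Dom V g)"
    "Cod V (ihom_post V x g) = ihom V x (Cod V g)"
    "ihom_pre V g x \<in> Arr V" "Dom V (ihom_pre V g x) = ihom V (Cod V g) x"
    "Cod V (ihom_pre V g x) = ihom V (Dom V g) x"
  using assms by (simp_all add: ihom_post_def ihom_pre_def)

lemma ihom_ten_arr [simp]:
  assumes "b \<in> Obj V" "x \<in> Obj V" "y \<in> Obj V"
  shows "ihom_ten V b x y \<in> Arr V" "Dom V (ihom_ten V b x y) = ihom V x y"
    "Cod V (ihom_ten V b x y) = ihom V (x \<odot> b) (y \<odot> b)"
  using assms by (simp_all add: ihom_ten_def)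

lemma unc_ihom_post:
  assumes "g \<in> Arr V" "x \<in> Obj V" "f \<in> Arr V" "Cod V f = ihom V x (Dom V g)" "Cod V g = y"
  shows "unc x y (ihom_post V x g \<cdot> f) = g \<cdot> unc x (Dom V g) f"
proof -
  have "unc x y (ihom_post V x g) = g \<cdot> eval V x (Dom V g)"
    using assms by (auto simp: ihom_post_def)
  thus ?thesis
    using assms by (subst unc_comp) (auto simp: unc_def)
qed

lemma unc_ihom_pre:
  assumes "g \<in> Arr V" "y \<in> Obj V" "f \<in> Arr V" "Cod V f = ihom V (Cod V g) y" "Dom V g = x"
  shows "unc x y (ihom_pre V g y \<cdot> f) = unc (Cod V g) y f \<cdot> (Ide V (Dom V f) \<otimes> g)"
proof -
  have "unc x y (ihom_pre V g y) = eval V (Cod V g) y \<cdot> (Ide V (ihom V (Cod V g) y) \<otimes> g)"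
    using assms by (auto simp: ihom_pre_def)
  thus ?thesis
    using assms by (subst unc_comp) (auto simp: unc_def)
qed

lemma unc_ihom_ten:
  assumes "b \<in> Obj V" "x \<in> Obj V" "y \<in> Obj V" "f \<in> Arr V" "Cod V f = ihom V x y"
  shows "unc (x \<odot> b) (y \<odot> b) (ihom_ten V b x y \<cdot> f) = (unc x y f \<otimes> Ide V b) \<cdot> assoc' (Dom V f) x b"
proof -
  have 1: "unc (x \<odot> b) (y \<odot> b) (ihom_ten V b x y) = (eval V x y \<otimes> Ide V b) \<cdot> assoc' (ihom V x y) x b"
    using assms by (auto simp: ihom_ten_def)
  have "unc (x \<odot> b) (y \<odot> b) (ihom_ten V b x y \<cdot> f) =
     (eval V x y \<otimes> Ide V b) \<cdot> assoc' (ihom V x y) x b \<cdot> (f \<otimes> Ide V x \<otimes> Ide V b)"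
    using assms 1 by (subst unc_comp) auto
  also have "\<dots> = (unc x y f \<otimes> Ide V b) \<cdot> assoc' (Dom V f) x b"
    using assms by (subst assoc'_nat_arr) (auto simp: unc_def)
  finally show ?thesis .
qed

end

section \<open>The opposite enriched category\<close>

context enriched_category begin

lemma hom_obj [simp]: "x \<in> VObj C \<Longrightarrow> y \<in> VObj C \<Longrightarrow> VHom C x y \<in> Obj V"
  by (rule VHom_in)

lemma id_arr [simp]:
  assumes "x \<in> VObj C"
  shows "VId C x \<in> Arr V" "Dom V (VId C x) = \<one>" "Cod V (VId C x) = VHom C x x"
  using VId_in[OF assms] by simp_all

lemma vcomp_arr [simp]:
  assumes "x \<in> VObj C" "y \<in> VObj C" "z \<in> VObj C"
  shows "VComp C x y z \<in> Arr V" "Dom V (VComp C x y z) = VHom C y z \<odot> VHom C x y"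
    "Cod V (VComp C x y z) = VHom C x z"
  using VComp_in[OF assms] by simp_all

lemma op_simps [simp]: "VObj (op_vcat V C) = VObj C" "VHom (op_vcat V C) x y = VHom C y x"
  "VId (op_vcat V C) = VId C"
  "VComp (op_vcat V C) x y z = VComp C z y x \<cdot> symm V (VHom C z y) (VHom C y x)"
  by (simp_all add: op_vcat_def)

text \<open>Associativity in the opposite reads the three hom objects in reverse order, and
  \<open>reverse\<close> converts one way of reversing them into the other. The two unit laws are
  exchanged, with \<open>lunit_symm\<close> comparing the unitors.\<close>

lemma enriched_op: "enriched_category V (op_vcat V C)"
proof (intro enriched_category.intro enriched_category_axioms.intro closed_symmetric_monoidal_axioms, goal_cases)
  case (4 w x y z)
  hence [simp]: "w \<in> VObj C" "x \<in> VObj C" "y \<in> VObj C" "z \<in> VObj C" by simp_all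
  let ?a = "VHom C z y" and ?b = "VHom C y x" and ?c = "VHom C x w"
  have "(VComp C z x w \<cdot> symm V (VHom C z x) ?c) \<cdot> ((VComp C z y x \<cdot> symm V ?a ?b) \<otimes> Ide V ?c) =
     VComp C z x w \<cdot> (symm V (VHom C z x) ?c \<cdot> (VComp C z y x \<otimes> Ide V ?c)) \<cdot> (symm V ?a ?b \<otimes> Ide V ?c)"
    by simp
  also have "\<dots> = VComp C z x w \<cdot> (Ide V ?c \<otimes> VComp C z y x) \<cdot> (symm V (?b \<odot> ?a) ?c \<cdot> (symm V ?a ?b \<otimes> Ide V ?c))"
    by (subst symm_nat_arr) simp_all
  also have "\<dots> = VComp C z x w \<cdot> (Ide V ?c \<otimes> VComp C z y x) \<cdot> (Ide V ?c \<otimes> symm V ?a ?b) \<cdot> symm V (?a \<odot> ?b) ?c"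
    by (subst symm_nat_arr) simp_all
  also have "\<dots> = VComp C z x w \<cdot> (Ide V ?c \<otimes> VComp C z y x) \<cdot>
     assoc V ?c ?b ?a \<cdot> (symm V ?b ?c \<otimes> Ide V ?a) \<cdot> symm V ?a (?b \<odot> ?c) \<cdot> assoc V ?a ?b ?c"
    by (subst reverse) simp_all
  also have "\<dots> = (VComp C z x w \<cdot> (Ide V ?c \<otimes> VComp C z y x) \<cdot> assoc V ?c ?b ?a) \<cdot>
      (symm V ?b ?c \<otimes> Ide V ?a) \<cdot> symm V ?a (?b \<odot> ?c) \<cdot> assoc V ?a ?b ?c"
    by simp
  also have "\<dots> = VComp C z y w \<cdot> (VComp C y x w \<otimes> Ide V ?a) \<cdot>
      ((symm V ?b ?c \<otimes> Ide V ?a) \<cdot> symm V ?a (?b \<odot> ?c)) \<cdot> assoc V ?a ?b ?c"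
    by (subst VComp_assoc[symmetric]) simp_all
  also have "\<dots> = VComp C z y w \<cdot> (VComp C y x w \<otimes> Ide V ?a) \<cdot>
      (symm V ?a (?c \<odot> ?b) \<cdot> (Ide V ?a \<otimes> symm V ?b ?c)) \<cdot> assoc V ?a ?b ?c"
    by (subst symm_nat_arr) simp_all
  also have "\<dots> = VComp C z y w \<cdot> ((VComp C y x w \<otimes> Ide V ?a) \<cdot> symm V ?a (?c \<odot> ?b)) \<cdot>
      (Ide V ?a \<otimes> symm V ?b ?c) \<cdot> assoc V ?a ?b ?c"
    by simp
  also have "\<dots> = VComp C z y w \<cdot> (symm V ?a (VHom C y w) \<cdot> (Ide V ?a \<otimes> VComp C y x w)) \<cdot>
      (Ide V ?a \<otimes> symm V ?b ?c) \<cdot> assoc V ?a ?b ?c"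
    by (subst symm_nat_arr) simp_all
  finally show ?case by simp
next
  case (5 x y)
  hence [simp]: "x \<in> VObj C" "y \<in> VObj C" by simp_all
  let ?a = "VHom C y x"
  have "VComp C y y x \<cdot> (symm V (VHom C y y) ?a \<cdot> (VId C y \<otimes> Ide V ?a)) =
     (VComp C y y x \<cdot> (Ide V ?a \<otimes> VId C y)) \<cdot> symm V \<one> ?a"
    by (subst symm_nat_arr) simp_all
  also have "\<dots> = runit V ?a \<cdot> symm V \<one> ?a" by (subst VId_right) simp_all
  also have "\<dots> = lunit V ?a" by (subst lunit_symm[symmetric]) simp_all
  finally show ?case by simp
next
  case (6 x y)
  hence [simp]: "x \<in> VObj C" "y \<in> VObj C" by simp_all
  let ?a = "VHom C y x"
  have "VComp C y x x \<cdot> (symm V ?a (VHom C x x) \<cdot> (Ide V ?a \<otimes> VId C x)) =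
     (VComp C y x x \<cdot> (VId C x \<otimes> Ide V ?a)) \<cdot> symm V ?a \<one>"
    by (subst symm_nat_arr) simp_all
  also have "\<dots> = lunit V ?a \<cdot> symm V ?a \<one>" by (subst VId_left) simp_all
  also have "\<dots> = runit V ?a" by (subst lunit_symm) simp_all
  finally show ?case by simp
qed auto

end

section \<open>Graded arrows\<close>

text \<open>
  An arrow of grade \<open>w\<close> from \<open>x\<close> to \<open>y\<close> is a triple \<open>(x, y, f)\<close> with \<open>f : w \<rightarrow> C(x,y)\<close>; the
  underlying category consists of the arrows of grade \<open>\<one>\<close>. \<open>gre\<close> precomposes \<open>f\<close>, and \<open>gpost\<close> and
  \<open>gpre\<close> compose with an arrow of grade \<open>\<one>\<close> and then drop the unit from the grade.
\<close>

definition gdom :: "'o \<times> 'o \<times> 'va \<Rightarrow> 'o" where "gdom p = fst p"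
definition gcod :: "'o \<times> 'o \<times> 'va \<Rightarrow> 'o" where "gcod p = fst (snd p)"
definition gmor :: "'o \<times> 'o \<times> 'va \<Rightarrow> 'va" where "gmor p = snd (snd p)"

abbreviation gr :: "('vo, 'va, 'm) smc_scheme \<Rightarrow> 'o \<times> 'o \<times> 'va \<Rightarrow> 'vo" where
  "gr V p \<equiv> Dom V (gmor p)"

definition garr :: "('vo, 'va, 'm) smc_scheme \<Rightarrow> ('o, 'vo, 'va) vcat \<Rightarrow> 'o \<times> 'o \<times> 'va \<Rightarrow> bool" where
  "garr V C p \<longleftrightarrow> gdom p \<in> VObj C \<and> gcod p \<in> VObj C \<and> gmor p \<in> Arr V \<and>
     Cod V (gmor p) = VHom C (gdom p) (gcod p)"

definition gcomp :: "('vo, 'va, 'm) smc_scheme \<Rightarrow> ('o, 'vo, 'va) vcat \<Rightarrow>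
    'o \<times> 'o \<times> 'va \<Rightarrow> 'o \<times> 'o \<times> 'va \<Rightarrow> 'o \<times> 'o \<times> 'va" where
  "gcomp V C p q = (gdom q, gcod p, VComp C (gdom q) (gcod q) (gcod p) \<cdot>\<^bsub>V\<^esub> (gmor p \<otimes>\<^bsub>V\<^esub> gmor q))"

definition gre :: "('vo, 'va, 'm) smc_scheme \<Rightarrow> 'o \<times> 'o \<times> 'va \<Rightarrow> 'va \<Rightarrow> 'o \<times> 'o \<times> 'va" where
  "gre V p s = (gdom p, gcod p, gmor p \<cdot>\<^bsub>V\<^esub> s)"

definition gid :: "('o, 'vo, 'va) vcat \<Rightarrow> 'o \<Rightarrow> 'o \<times> 'o \<times> 'va" where
  "gid C x = (x, x, VId C x)"

text \<open>The generic arrow from \<open>x\<close> to \<open>y\<close>: by \<open>gen_gmor\<close>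
  each arrow from \<open>x\<close> to \<open>y\<close> is its restriction along its own morphism.
  Statements stable under restriction are therefore tested on it alone.\<close>

definition gen :: "('vo, 'va, 'm) smc_scheme \<Rightarrow> ('o, 'vo, 'va) vcat \<Rightarrow> 'o \<Rightarrow> 'o \<Rightarrow> 'o \<times> 'o \<times> 'va" where
  "gen V C x y = (x, y, Ide V (VHom C x y))"

definition gpost :: "('vo, 'va, 'm) smc_scheme \<Rightarrow> ('o, 'vo, 'va) vcat \<Rightarrow>
    'o \<times> 'o \<times> 'va \<Rightarrow> 'o \<times> 'o \<times> 'va \<Rightarrow> 'o \<times> 'o \<times> 'va" where
  "gpost V C h p = gre V (gcomp V C h p) (inv_arr V (lunit V (gr V p)))"

definition gpre :: "('vo, 'va, 'm) smc_scheme \<Rightarrow> ('o, 'vo, 'va) vcat \<Rightarrow>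
    'o \<times> 'o \<times> 'va \<Rightarrow> 'o \<times> 'o \<times> 'va \<Rightarrow> 'o \<times> 'o \<times> 'va" where
  "gpre V C p h = gre V (gcomp V C p h) (inv_arr V (runit V (gr V p)))"

lemma g_simps [simp]: "gdom (x, y, f) = x" "gcod (x, y, f) = y" "gmor (x, y, f) = f"
  by (simp_all add: gdom_def gcod_def gmor_def)

lemma g_triple [simp]: "(gdom p, gcod p, gmor p) = p"
  by (cases p) simp

lemma g_eqI: "gdom p = gdom q \<Longrightarrow> gcod p = gcod q \<Longrightarrow> gmor p = gmor q \<Longrightarrow> p = q"
  by (cases p; cases q) simp

lemma gcomp_simps [simp]: "gdom (gcomp V C p q) = gdom q" "gcod (gcomp V C p q) = gcod p"
  "gdom (gre V p s) = gdom p" "gcod (gre V p s) = gcod p" "gmor (gre V p s) = gmor p \<cdot>\<^bsub>V\<^esub> s"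
  "gdom (gid C x) = x" "gcod (gid C x) = x" "gmor (gid C x) = VId C x"
  "gdom (gen V C x y) = x" "gcod (gen V C x y) = y" "gmor (gen V C x y) = Ide V (VHom C x y)"
  "gdom (gpost V C p q) = gdom q" "gcod (gpost V C p q) = gcod p"
  "gdom (gpre V C p q) = gdom q" "gcod (gpre V C p q) = gcod p"
  by (simp_all add: gcomp_def gre_def gid_def gen_def gpost_def gpre_def)

context closed_symmetric_monoidal begin

lemma lunit'_nat:
  assumes "s \<in> Arr V" "Cod V s = x"
  shows "lunit' x \<cdot> s = (Ide V \<one> \<otimes> s) \<cdot> lunit' (Dom V s)"
proof (rule iso_cancel_left[of "lunit V x"])
  have "lunit V x \<cdot> (Ide V \<one> \<otimes> s) \<cdot> lunit' (Dom V s) = (lunit V x \<cdot> (Ide V \<one> \<otimes> s)) \<cdot> lunit' (Dom V s)"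
    using assms by (subst comp_assoc_arr) auto
  also have "\<dots> = lunit V x \<cdot> lunit' x \<cdot> s"
    using assms by (subst lunit_nat_arr) auto
  finally show "lunit V x \<cdot> lunit' x \<cdot> s = lunit V x \<cdot> (Ide V \<one> \<otimes> s) \<cdot> lunit' (Dom V s)" by simp
qed (use assms in auto)

lemma runit'_nat:
  assumes "s \<in> Arr V" "Cod V s = x"
  shows "runit' x \<cdot> s = (s \<otimes> Ide V \<one>) \<cdot> runit' (Dom V s)"
proof (rule iso_cancel_left[of "runit V x"])
  have "runit V x \<cdot> (s \<otimes> Ide V \<one>) \<cdot> runit' (Dom V s) = (runit V x \<cdot> (s \<otimes> Ide V \<one>)) \<cdot> runit' (Dom V s)"
    using assms by (subst comp_assoc_arr) auto
  also have "\<dots> = runit V x \<cdot> runit' x \<cdot> s"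
    using assms by (subst runit_nat_arr) auto
  finally show "runit V x \<cdot> runit' x \<cdot> s = runit V x \<cdot> (s \<otimes> Ide V \<one>) \<cdot> runit' (Dom V s)" by simp
qed (use assms in auto)

lemma assoc_lunit':
  assumes [simp]: "x \<in> Obj V" "y \<in> Obj V"
  shows "assoc V \<one> x y \<cdot> (lunit' x \<otimes> Ide V y) = lunit' (x \<odot> y)"
proof (rule iso_cancel_left[of "lunit V (x \<odot> y)"])
  have "(lunit V (x \<odot> y) \<cdot> assoc V \<one> x y) \<cdot> (lunit' x \<otimes> Ide V y) = lunit V (x \<odot> y) \<cdot> lunit' (x \<odot> y)"
    by (subst lunit_ten) simp_all
  thus "lunit V (x \<odot> y) \<cdot> assoc V \<one> x y \<cdot> (lunit' x \<otimes> Ide V y) = lunit V (x \<odot> y) \<cdot> lunit' (x \<odot> y)"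
    by simp
qed simp_all

lemma assoc_runit'_lunit':
  assumes [simp]: "x \<in> Obj V" "y \<in> Obj V"
  shows "assoc V x \<one> y \<cdot> (runit' x \<otimes> Ide V y) = Ide V x \<otimes> lunit' y"
proof (rule iso_cancel_left[of "Ide V x \<otimes> lunit V y"])
  have "((Ide V x \<otimes> lunit V y) \<cdot> assoc V x \<one> y) \<cdot> (runit' x \<otimes> Ide V y) =
      (Ide V x \<otimes> lunit V y) \<cdot> (Ide V x \<otimes> lunit' y)"
    by (subst triangle) simp_all
  thus "(Ide V x \<otimes> lunit V y) \<cdot> assoc V x \<one> y \<cdot> (runit' x \<otimes> Ide V y) =
      (Ide V x \<otimes> lunit V y) \<cdot> (Ide V x \<otimes> lunit' y)"
    by simp
qed (simp_all add: ten_iso iso_ide)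

lemma assoc_runit':
  assumes [simp]: "x \<in> Obj V" "y \<in> Obj V"
  shows "assoc V x y \<one> \<cdot> runit' (x \<odot> y) = Ide V x \<otimes> runit' y"
proof (rule iso_cancel_left[of "Ide V x \<otimes> runit V y"])
  have "((Ide V x \<otimes> runit V y) \<cdot> assoc V x y \<one>) \<cdot> runit' (x \<odot> y) =
      (Ide V x \<otimes> runit V y) \<cdot> (Ide V x \<otimes> runit' y)"
    by (subst runit_ten) simp_all
  thus "(Ide V x \<otimes> runit V y) \<cdot> assoc V x y \<one> \<cdot> runit' (x \<odot> y) =
      (Ide V x \<otimes> runit V y) \<cdot> (Ide V x \<otimes> runit' y)"
    by simp
qed (simp_all add: ten_iso iso_ide)

end

section \<open>Calculus of graded arrows\<close>

context enriched_category begin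

lemma garr_simps [simp]:
  assumes "garr V C p"
  shows "gdom p \<in> VObj C" "gcod p \<in> VObj C" "gmor p \<in> Arr V" "Cod V (gmor p) = VHom C (gdom p) (gcod p)"
  using assms by (auto simp: garr_def)

lemma garr_triple [simp]: "garr V C (x, y, f) \<longleftrightarrow> x \<in> VObj C \<and> y \<in> VObj C \<and> f \<in> Arr V \<and> Cod V f = VHom C x y"
  by (simp add: garr_def)

lemma garr_gcomp [simp]:
  assumes "garr V C p" "garr V C q" "gcod q = gdom p"
  shows "garr V C (gcomp V C p q)" "gr V (gcomp V C p q) = gr V p \<odot> gr V q"
  using assms by (simp_all add: gcomp_def)

lemma garr_gre [simp]:
  assumes "garr V C p" "s \<in> Arr V" "Cod V s = gr V p"
  shows "garr V C (gre V p s)" "gr V (gre V p s) = Dom V s"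
  using assms by (simp_all add: gre_def)

lemma garr_gid [simp]:
  assumes "x \<in> VObj C" shows "garr V C (gid C x)" "gr V (gid C x) = \<one>"
  using assms by (simp_all add: gid_def)

lemma garr_gen [simp]:
  assumes "x \<in> VObj C" "y \<in> VObj C" shows "garr V C (gen V C x y)" "gr V (gen V C x y) = VHom C x y"
  using assms by (simp_all add: gen_def)

lemma gre_ide: "garr V C p \<Longrightarrow> gr V p = w \<Longrightarrow> gre V p (Ide V w) = p"
  by (rule g_eqI) auto

lemma gre_gre [simp]:
  assumes "garr V C p" "s \<in> Arr V" "Cod V s = gr V p" "t \<in> Arr V" "Cod V t = Dom V s"
  shows "gre V (gre V p s) t = gre V p (s \<cdot> t)"
  using assms by (intro g_eqI) auto

lemma gen_gmor: "garr V C p \<Longrightarrow> gre V (gen V C (gdom p) (gcod p)) (gmor p) = p"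
  by (rule g_eqI) auto

lemma gre_iso_cancel:
  assumes "garr V C p" "garr V C q" "is_iso V s" "Cod V s = gr V p" "gr V q = gr V p"
    "gre V p s = gre V q s"
  shows "p = q"
proof (rule g_eqI)
  have "gmor p \<cdot> s = gmor q \<cdot> s" using arg_cong[OF assms(6), of gmor] by simp
  thus "gmor p = gmor q"
    by (rule iso_cancel_right[OF assms(3), rotated -1]) (use assms(1-5) arg_cong[OF assms(6), of gdom]
        arg_cong[OF assms(6), of gcod] in simp_all)
qed (use arg_cong[OF assms(6), of gdom] arg_cong[OF assms(6), of gcod] in simp_all)

lemma gcomp_gre_left [simp]:
  assumes "garr V C p" "garr V C q" "gcod q = gdom p" "s \<in> Arr V" "Cod V s = gr V p"
  shows "gcomp V C (gre V p s) q = gre V (gcomp V C p q) (s \<otimes> Ide V (gr V q))"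
  using assms by (intro g_eqI) (simp_all add: gcomp_def)

lemma gcomp_gre_right [simp]:
  assumes "garr V C p" "garr V C q" "gcod q = gdom p" "s \<in> Arr V" "Cod V s = gr V q"
  shows "gcomp V C p (gre V q s) = gre V (gcomp V C p q) (Ide V (gr V p) \<otimes> s)"
  using assms by (intro g_eqI) (simp_all add: gcomp_def)

text \<open>Naturality of the associator moves it from the hom objects, where the associativity
  axiom has it, to the grades.\<close>

lemma gcomp_assoc:
  assumes "garr V C p" "garr V C q" "garr V C r" "gcod q = gdom p" "gcod r = gdom q"
  shows "gcomp V C (gcomp V C p q) r =
    gre V (gcomp V C p (gcomp V C q r)) (assoc V (gr V p) (gr V q) (gr V r))"
proof (rule g_eqI)
  obtain w x y z f g h where pqr: "p = (y, z, h)" "q = (x, y, g)" "r = (w, x, f)"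
    using assms(4,5) by (cases p; cases q; cases r) auto
  have [simp]: "w \<in> VObj C" "x \<in> VObj C" "y \<in> VObj C" "z \<in> VObj C" "f \<in> Arr V" "g \<in> Arr V" "h \<in> Arr V"
    "Cod V f = VHom C w x" "Cod V g = VHom C x y" "Cod V h = VHom C y z"
    using assms unfolding pqr by auto
  have "gmor (gcomp V C (gcomp V C p q) r) =
      (VComp C w x z \<cdot> (VComp C x y z \<otimes> Ide V (VHom C w x))) \<cdot> ((h \<otimes> g) \<otimes> f)"
    by (simp add: gcomp_def pqr)
  also have "\<dots> = VComp C w y z \<cdot> (Ide V (VHom C y z) \<otimes> VComp C w x y)
        \<cdot> (assoc V (VHom C y z) (VHom C x y) (VHom C w x) \<cdot> ((h \<otimes> g) \<otimes> f))"
    by (subst VComp_assoc) simp_all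
  also have "\<dots> = gmor (gre V (gcomp V C p (gcomp V C q r)) (assoc V (gr V p) (gr V q) (gr V r)))"
    by (subst assoc_nat_arr) (simp_all add: gcomp_def pqr)
  finally show "gmor (gcomp V C (gcomp V C p q) r) =
     gmor (gre V (gcomp V C p (gcomp V C q r)) (assoc V (gr V p) (gr V q) (gr V r)))" .
qed (use assms in auto)

lemma gcomp_gid:
  assumes "garr V C p" "gcod p = y" shows "gcomp V C (gid C y) p = gre V p (lunit V (gr V p))"
proof (rule g_eqI)
  have "gmor (gcomp V C (gid C y) p) =
     (VComp C (gdom p) y y \<cdot> (VId C y \<otimes> Ide V (VHom C (gdom p) y))) \<cdot> (Ide V \<one> \<otimes> gmor p)"
    using assms by (auto simp: gcomp_def)
  also have "\<dots> = lunit V (VHom C (gdom p) y) \<cdot> (Ide V \<one> \<otimes> gmor p)"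
    using assms by (subst VId_left) auto
  also have "\<dots> = gmor (gre V p (lunit V (gr V p)))"
    using assms by (subst lunit_nat_arr) auto
  finally show "gmor (gcomp V C (gid C y) p) = gmor (gre V p (lunit V (gr V p)))" .
qed (use assms in auto)

lemma gcomp_gid_right:
  assumes "garr V C p" "gdom p = x" shows "gcomp V C p (gid C x) = gre V p (runit V (gr V p))"
proof (rule g_eqI)
  have "gmor (gcomp V C p (gid C x)) =
     (VComp C x x (gcod p) \<cdot> (Ide V (VHom C x (gcod p)) \<otimes> VId C x)) \<cdot> (gmor p \<otimes> Ide V \<one>)"
    using assms by (auto simp: gcomp_def)
  also have "\<dots> = runit V (VHom C x (gcod p)) \<cdot> (gmor p \<otimes> Ide V \<one>)"
    using assms by (subst VId_right) auto
  also have "\<dots> = gmor (gre V p (runit V (gr V p)))"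
    using assms by (subst runit_nat_arr) auto
  finally show "gmor (gcomp V C p (gid C x)) = gmor (gre V p (runit V (gr V p)))" .
qed (use assms in auto)

lemma garr_gpost [simp]:
  assumes "garr V C h" "gr V h = \<one>" "garr V C p" "gcod p = gdom h"
  shows "garr V C (gpost V C h p)" "gr V (gpost V C h p) = gr V p"
  using assms by (simp_all add: gpost_def del: gcomp_simps(5))

lemma garr_gpre [simp]:
  assumes "garr V C h" "gr V h = \<one>" "garr V C p" "gcod h = gdom p"
  shows "garr V C (gpre V C p h)" "gr V (gpre V C p h) = gr V p"
  using assms by (simp_all add: gpre_def del: gcomp_simps(5))

lemma gpost_gre [simp]:
  assumes "garr V C h" "gr V h = \<one>" "garr V C p" "gcod p = gdom h" "s \<in> Arr V" "Cod V s = gr V p"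
  shows "gpost V C h (gre V p s) = gre V (gpost V C h p) s"
  using assms by (simp add: gpost_def lunit'_nat)

lemma gpre_gre [simp]:
  assumes "garr V C h" "gr V h = \<one>" "garr V C p" "gcod h = gdom p" "s \<in> Arr V" "Cod V s = gr V p"
  shows "gpre V C (gre V p s) h = gre V (gpre V C p h) s"
  using assms by (simp add: gpre_def runit'_nat)

text \<open>In this law and the next two, one factor has grade \<open>\<one>\<close>, so the
  associator meets a unitor. \<open>assoc_lunit'\<close>, \<open>assoc_runit'_lunit'\<close> and
  \<open>assoc_runit'\<close> merge the two into a single unitor, and no associator is left.\<close>

lemma gcomp_gpost:
  assumes "garr V C h" "gr V h = \<one>" "garr V C p" "gcod p = gdom h" "garr V C q" "gcod q = gdom p"
  shows "gcomp V C (gpost V C h p) q = gpost V C h (gcomp V C p q)"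
  using assms by (simp add: gpost_def gcomp_assoc assoc_lunit')

lemma gcomp_gpre:
  assumes "garr V C h" "gr V h = \<one>" "garr V C p" "gcod h = gdom p" "garr V C q" "gcod q = gdom h"
  shows "gcomp V C (gpre V C p h) q = gcomp V C p (gpost V C h q)"
  using assms by (simp add: gpost_def gpre_def gcomp_assoc assoc_runit'_lunit')

lemma gpre_gcomp:
  assumes "garr V C h" "gr V h = \<one>" "garr V C p" "gcod q = gdom p" "garr V C q" "gcod h = gdom q"
  shows "gpre V C (gcomp V C p q) h = gcomp V C p (gpre V C q h)"
  using assms by (simp add: gpre_def gcomp_assoc assoc_runit')

lemma gpost_gpost:
  assumes "garr V C h" "gr V h = \<one>" "garr V C k" "gr V k = \<one>" "gcod k = gdom h" "garr V C p" "gcod p = gdom k"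
  shows "gpost V C (gpost V C h k) p = gpost V C h (gpost V C k p)"
  using assms gcomp_gpost[of h k p] by (simp add: gpost_def[of V C _ p])

lemma gpost_gpre:
  assumes "garr V C h" "gr V h = \<one>" "garr V C k" "gr V k = \<one>" "gcod k = gdom p" "garr V C p" "gcod p = gdom h"
  shows "gpost V C h (gpre V C p k) = gpre V C (gpost V C h p) k"
  using assms gcomp_gpost[of h p k] by (simp add: gpre_def[of V C _ k])

lemma gpre_gpre:
  assumes "garr V C h" "gr V h = \<one>" "garr V C k" "gr V k = \<one>" "gcod k = gdom h" "garr V C p" "gcod h = gdom p"
  shows "gpre V C (gpre V C p h) k = gpre V C p (gpost V C h k)"
proof -
  have "gpre V C (gpre V C p h) k = gre V (gcomp V C (gpre V C p h) k) (runit' (gr V p))"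
    using assms by (simp add: gpre_def[of V C _ k])
  thus ?thesis using assms gcomp_gpre[of h p k] by (simp add: gpre_def[of V C p "gpost V C h k"])
qed

text \<open>Between arrows of grade \<open>\<one>\<close> the two ways of dropping a unit coincide
  because \<open>lunit_unit\<close> identifies the unitors at \<open>\<one>\<close>.\<close>

lemma gpost_eq_gpre:
  assumes "gr V h = \<one>" "gr V k = \<one>"
  shows "gpost V C h k = gpre V C h k"
  using assms by (simp add: gpost_def gpre_def lunit_unit)

lemma gpost_gid: "garr V C p \<Longrightarrow> gcod p = y \<Longrightarrow> gpost V C (gid C y) p = p"
  by (auto simp: gpost_def gcomp_gid gre_ide)

lemma gpre_gid: "garr V C p \<Longrightarrow> gdom p = x \<Longrightarrow> gpre V C p (gid C x) = p"
  by (auto simp: gpre_def gcomp_gid_right gre_ide)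

section \<open>The underlying category in graded terms\<close>

lemma under_simps [simp]: "Obj (under V C) = VObj C"
  "h \<in> Arr (under V C) \<longleftrightarrow> garr V C h \<and> gr V h = \<one>"
  "Dom (under V C) h = gdom h" "Cod (under V C) h = gcod h" "Ide (under V C) x = gid C x"
  by (cases h, auto simp: under_def gid_def)+

lemma under_comp [simp]:
  assumes "garr V C h" "gr V h = \<one>" "garr V C k" "gr V k = \<one>" "gcod k = gdom h"
  shows "h \<cdot>\<^bsub>under V C\<^esub> k = gpost V C h k"
proof -
  obtain x y z f g where hk: "h = (y, z, g)" "k = (x, y, f)"
    using assms(5) by (cases h; cases k) auto
  show ?thesis
    using assms unfolding hk
    by (simp add: under_def gpost_def gcomp_def gre_def el_comp_def)
qed

lemma category_under: "category (under V C)"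
  by unfold_locales
    (auto simp: gpost_gpost gpost_gid gpost_eq_gpre[of _ "gid C _"] gpre_gid)

lemma hom_post_eq:
  assumes "garr V C h" "gr V h = \<one>" "x \<in> VObj C"
  shows "hom_post V C x h = gmor (gpost V C h (gen V C x (gdom h)))"
  using assms by (cases h) (simp add: hom_post_def gpost_def gcomp_def)

lemma hom_pre_eq:
  assumes "garr V C h" "gr V h = \<one>" "x \<in> VObj C"
  shows "hom_pre V C h x = gmor (gpre V C (gen V C (gcod h) x) h)"
  using assms by (cases h) (simp add: hom_pre_def gpre_def gcomp_def)

text \<open>Turns the morphisms \<open>C(x,h)\<close>, which occur in transposes and in the hom
  action of \<open>cst\<close>, into composition of graded arrows. \<open>hom_pre\<close> does the
  same for \<open>C(h,x)\<close>, and hence for coequalizers.\<close>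

lemma hom_post:
  assumes "garr V C h" "gr V h = \<one>" "x \<in> VObj C"
  shows "hom_post V C x h \<in> Arr V" "Dom V (hom_post V C x h) = VHom C x (gdom h)"
    "Cod V (hom_post V C x h) = VHom C x (gcod h)"
    "garr V C p \<Longrightarrow> gdom p = x \<Longrightarrow> gcod p = gdom h \<Longrightarrow> hom_post V C x h \<cdot> gmor p = gmor (gpost V C h p)"
proof -
  show "hom_post V C x h \<in> Arr V" "Dom V (hom_post V C x h) = VHom C x (gdom h)"
    "Cod V (hom_post V C x h) = VHom C x (gcod h)"
    using assms by (simp_all add: hom_post_eq)
  assume p: "garr V C p" "gdom p = x" "gcod p = gdom h"
  have "gpost V C h p = gpost V C h (gre V (gen V C x (gdom h)) (gmor p))"
    using gen_gmor[OF p(1)] p by simp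
  also have "\<dots> = gre V (gpost V C h (gen V C x (gdom h))) (gmor p)"
    using assms p by simp
  finally show "hom_post V C x h \<cdot> gmor p = gmor (gpost V C h p)"
    using assms by (simp add: hom_post_eq)
qed

lemma hom_pre:
  assumes "garr V C h" "gr V h = \<one>" "x \<in> VObj C"
  shows "hom_pre V C h x \<in> Arr V" "Dom V (hom_pre V C h x) = VHom C (gcod h) x"
    "Cod V (hom_pre V C h x) = VHom C (gdom h) x"
    "garr V C p \<Longrightarrow> gdom p = gcod h \<Longrightarrow> gcod p = x \<Longrightarrow> hom_pre V C h x \<cdot> gmor p = gmor (gpre V C p h)"
proof -
  show "hom_pre V C h x \<in> Arr V" "Dom V (hom_pre V C h x) = VHom C (gcod h) x"
    "Cod V (hom_pre V C h x) = VHom C (gdom h) x"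
    using assms by (simp_all add: hom_pre_eq)
  assume p: "garr V C p" "gdom p = gcod h" "gcod p = x"
  have "gpre V C p h = gpre V C (gre V (gen V C (gcod h) x) (gmor p)) h"
    using gen_gmor[OF p(1)] p by simp
  also have "\<dots> = gre V (gpre V C (gen V C (gcod h) x) h) (gmor p)"
    using assms p by simp
  finally show "hom_pre V C h x \<cdot> gmor p = gmor (gpre V C p h)"
    using assms by (simp add: hom_pre_eq)
qed

end

section \<open>Enriched functors and transformations\<close>

text \<open>Graded arrows are triples that are quantified over as single variables. These rules
  would split such quantifiers into components and leave the form on which the calculus
  works.\<close>

declare split_paired_All [simp del] split_paired_Ex [simp del]

lemma (in enriched_category) gpost_gid_right:
  assumes "garr V C p" "gr V p = \<one>" "gdom p = x"
  shows "gpost V C p (gid C x) = p"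
proof -
  have "gpost V C p (gid C x) = gpre V C p (gid C x)"
    using assms garr_simps(1)[OF assms(1)] by (intro gpost_eq_gpre) simp_all
  thus ?thesis using assms by (simp add: gpre_gid)
qed

definition fapp :: "('vo, 'va, 'm) smc_scheme \<Rightarrow> ('o, 'p, 'va) vfun \<Rightarrow> 'o \<times> 'o \<times> 'va \<Rightarrow> 'p \<times> 'p \<times> 'va" where
  "fapp V F p = (f_obj F (gdom p), f_obj F (gcod p), f_hom F (gdom p) (gcod p) \<cdot>\<^bsub>V\<^esub> gmor p)"

lemma fapp_simps [simp]: "gdom (fapp V F p) = f_obj F (gdom p)" "gcod (fapp V F p) = f_obj F (gcod p)"
  by (simp_all add: fapp_def)

definition component :: "('o, 'p, 'va) vfun \<Rightarrow> ('o, 'p, 'va) vfun \<Rightarrow> ('o \<Rightarrow> 'va) \<Rightarrow> 'o \<Rightarrow> 'p \<times> 'p \<times> 'va" where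
  "component F G \<alpha> x = (f_obj F x, f_obj G x, \<alpha> x)"

lemma component_simps [simp]: "gdom (component F G \<alpha> x) = f_obj F x" "gcod (component F G \<alpha> x) = f_obj G x"
  by (simp_all add: component_def)

lemma component_mor: "gmor (component F G \<alpha> x) = \<alpha> x"
  by (simp add: component_def)

context enriched_functor begin

lemma fobj [simp]: "x \<in> VObj A \<Longrightarrow> f_obj F x \<in> VObj B"
  by (rule f_obj_in)

lemma fhom [simp]:
  assumes "x \<in> VObj A" "y \<in> VObj A"
  shows "f_hom F x y \<in> Arr V" "Dom V (f_hom F x y) = VHom A x y"
    "Cod V (f_hom F x y) = VHom B (f_obj F x) (f_obj F y)"
  using f_hom_in[OF assms] by simp_all

lemma garr_fapp [simp]:
  assumes "garr V A p" shows "garr V B (fapp V F p)" "gr V (fapp V F p) = gr V p"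
  using assms by (simp_all add: fapp_def)

lemma fapp_gre [simp]:
  assumes "garr V A p" "s \<in> Arr V" "Cod V s = gr V p"
  shows "fapp V F (gre V p s) = gre V (fapp V F p) s"
  using assms by (intro g_eqI) (simp_all add: fapp_def)

lemma fapp_gid [simp]: "x \<in> VObj A \<Longrightarrow> fapp V F (gid A x) = gid B (f_obj F x)"
  by (rule g_eqI) (simp_all add: fapp_def f_hom_id)

lemma fapp_gcomp:
  assumes "garr V A p" "garr V A q" "gcod q = gdom p"
  shows "fapp V F (gcomp V A p q) = gcomp V B (fapp V F p) (fapp V F q)"
proof (rule g_eqI)
  obtain x y z f g where pq: "p = (y, z, g)" "q = (x, y, f)"
    using assms(3) by (cases p; cases q) auto
  have [simp]: "x \<in> VObj A" "y \<in> VObj A" "z \<in> VObj A" "f \<in> Arr V" "g \<in> Arr V"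
    "Cod V f = VHom A x y" "Cod V g = VHom A y z"
    using assms unfolding pq by auto
  have "gmor (fapp V F (gcomp V A p q)) = (f_hom F x z \<cdot> VComp A x y z) \<cdot> (g \<otimes> f)"
    by (simp add: pq fapp_def gcomp_def)
  also have "\<dots> = gmor (gcomp V B (fapp V F p) (fapp V F q))"
    by (subst f_hom_comp) (simp_all add: pq fapp_def gcomp_def)
  finally show "gmor (fapp V F (gcomp V A p q)) = gmor (gcomp V B (fapp V F p) (fapp V F q))" .
qed simp_all

lemma fapp_eq_gen:
  assumes "garr V A p"
  shows "fapp V F p = gre V (fapp V F (gen V A (gdom p) (gcod p))) (gmor p)"
proof -
  have "fapp V F p = fapp V F (gre V (gen V A (gdom p) (gcod p)) (gmor p))"
    using A.gen_gmor[OF assms] by simp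
  thus ?thesis using assms by simp
qed

end

text \<open>On generic arrows, and after dropping source and target, preservation of units and
  composites is literally the pair of axioms of an enriched functor.\<close>

lemma enriched_functorI:
  assumes "enriched_category V A" "enriched_category V B"
    and ob: "\<And>x. x \<in> VObj A \<Longrightarrow> f_obj F x \<in> VObj B"
    and ho: "\<And>x y. x \<in> VObj A \<Longrightarrow> y \<in> VObj A \<Longrightarrow> f_hom F x y \<in> hom V (VHom A x y) (VHom B (f_obj F x) (f_obj F y))"
    and id: "\<And>x. x \<in> VObj A \<Longrightarrow> fapp V F (gid A x) = gid B (f_obj F x)"
    and comp: "\<And>x y z. x \<in> VObj A \<Longrightarrow> y \<in> VObj A \<Longrightarrow> z \<in> VObj A \<Longrightarrow>
      fapp V F (gcomp V A (gen V A y z) (gen V A x y)) =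
      gcomp V B (fapp V F (gen V A y z)) (fapp V F (gen V A x y))"
  shows "enriched_functor V A B F"
proof -
  interpret A: enriched_category V A by fact
  interpret B: enriched_category V B by fact
  show ?thesis
  proof
    fix x y z assume [simp]: "x \<in> VObj A" "y \<in> VObj A" "z \<in> VObj A"
    show "f_obj F x \<in> VObj B" by (rule ob) simp
    show "f_hom F x y \<in> hom V (VHom A x y) (VHom B (f_obj F x) (f_obj F y))" by (rule ho) simp_all
    show "f_hom F x x \<cdot>\<^bsub>V\<^esub> VId A x = VId B (f_obj F x)"
      using arg_cong[OF id[of x], of gmor] by (simp add: fapp_def)
    show "f_hom F x z \<cdot>\<^bsub>V\<^esub> VComp A x y z = VComp B (f_obj F x) (f_obj F y) (f_obj F z) \<cdot>\<^bsub>V\<^esub> (f_hom F y z \<otimes>\<^bsub>V\<^esub> f_hom F x y)"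
      using arg_cong[OF comp[of x y z], of gmor] ho[of y z] ho[of x y] by (simp add: fapp_def gcomp_def)
  qed
qed

text \<open>The defining equation between morphisms out of \<open>A(x,y)\<close> is naturality at
  the generic arrow from \<open>x\<close> to \<open>y\<close>; restriction extends it to arrows of
  every grade.\<close>

lemma enriched_nat_trans_iff:
  assumes "enriched_functor V A B F" "enriched_functor V A B G"
  shows "enriched_nat_trans V A B F G \<alpha> \<longleftrightarrow>
    (\<forall>x \<in> VObj A. garr V B (component F G \<alpha> x) \<and> gr V (component F G \<alpha> x) = \<one>\<^bsub>V\<^esub>) \<and>
    (\<forall>p. garr V A p \<longrightarrow> gpost V B (component F G \<alpha> (gcod p)) (fapp V F p) =
       gpre V B (fapp V G p) (component F G \<alpha> (gdom p)))"
    (is "_ \<longleftrightarrow> ?a \<and> ?b")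
proof -
  interpret F: enriched_functor V A B F by fact
  interpret G: enriched_functor V A B G by fact
  have a: "(\<forall>x \<in> VObj A. \<alpha> x \<in> hom V \<one>\<^bsub>V\<^esub> (VHom B (f_obj F x) (f_obj G x))) \<longleftrightarrow> ?a"
    by (auto simp: component_def)
  let ?eq = "\<lambda>p. gpost V B (component F G \<alpha> (gcod p)) (fapp V F p) =
       gpre V B (fapp V G p) (component F G \<alpha> (gdom p))"
  have b: "(VComp B (f_obj F x) (f_obj F y) (f_obj G y) \<cdot>\<^bsub>V\<^esub> (\<alpha> y \<otimes>\<^bsub>V\<^esub> f_hom F x y)
          \<cdot>\<^bsub>V\<^esub> inv_arr V (lunit V (VHom A x y)) =
        VComp B (f_obj F x) (f_obj G x) (f_obj G y) \<cdot>\<^bsub>V\<^esub> (f_hom G x y \<otimes>\<^bsub>V\<^esub> \<alpha> x)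
          \<cdot>\<^bsub>V\<^esub> inv_arr V (runit V (VHom A x y))) \<longleftrightarrow> ?eq (gen V A x y)"
    if "?a" "x \<in> VObj A" "y \<in> VObj A" for x y
  proof -
    have "\<alpha> x \<in> Arr V" "Dom V (\<alpha> x) = \<one>\<^bsub>V\<^esub>" "Cod V (\<alpha> x) = VHom B (f_obj F x) (f_obj G x)"
       "\<alpha> y \<in> Arr V" "Dom V (\<alpha> y) = \<one>\<^bsub>V\<^esub>" "Cod V (\<alpha> y) = VHom B (f_obj F y) (f_obj G y)"
      using that by (auto simp: component_def)
    thus ?thesis using that
      by (simp add: gpost_def gpre_def gre_def gcomp_def fapp_def component_def)
  qed
  have c: "?eq p" if "?a" "garr V A p" "?eq (gen V A (gdom p) (gcod p))" for p
  proof -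
    have "gpost V B (component F G \<alpha> (gcod p)) (fapp V F p) =
       gre V (gpost V B (component F G \<alpha> (gcod p)) (fapp V F (gen V A (gdom p) (gcod p)))) (gmor p)"
      using that(1,2) by (subst F.fapp_eq_gen) simp_all
    also have "\<dots> = gre V (gpre V B (fapp V G (gen V A (gdom p) (gcod p))) (component F G \<alpha> (gdom p))) (gmor p)"
      using that(3) by simp
    also have "\<dots> = gpre V B (fapp V G p) (component F G \<alpha> (gdom p))"
      using that(1,2) by (subst (2) G.fapp_eq_gen) simp_all
    finally show ?thesis .
  qed
  show ?thesis
  proof
    assume *: "enriched_nat_trans V A B F G \<alpha>"
    then have **: ?a using a by (simp add: enriched_nat_trans_def)
    have "?eq p" if "garr V A p" for p
      using c[OF ** that] b[OF **, of "gdom p" "gcod p"] * that by (simp add: enriched_nat_trans_def)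
    with ** show "?a \<and> ?b" by blast
  next
    assume *: "?a \<and> ?b"
    have "?eq (gen V A x y)" if "x \<in> VObj A" "y \<in> VObj A" for x y
      using * F.A.garr_gen(1)[OF that] by (metis gcomp_simps(9,10))
    then show "enriched_nat_trans V A B F G \<alpha>"
      using a b * by (simp add: enriched_nat_trans_def)
  qed
qed

text \<open>The object set that \<open>vfunct\<close> binds in a local \<open>let\<close>, named so
  that simplification rules can refer to it.\<close>

definition vfunctors :: "('vo, 'va, 'm) smc_scheme \<Rightarrow> ('o, 'vo, 'va) vcat \<Rightarrow> ('p, 'vo, 'va) vcat \<Rightarrow> ('o, 'p, 'va) vfun set" where
  "vfunctors V A B = {F. enriched_functor V A B F \<and> f_obj F \<in> extensional (VObj A) \<and>
              f_hom F \<in> extensional (VObj A) \<and> (\<forall>x \<in> VObj A. f_hom F x \<in> extensional (VObj A))}"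

lemma vfunct_simps [simp]:
  "Obj (vfunct V A B) = vfunctors V A B"
  "(F, G, \<alpha>) \<in> Arr (vfunct V A B) \<longleftrightarrow> F \<in> vfunctors V A B \<and> G \<in> vfunctors V A B \<and>
     enriched_nat_trans V A B F G \<alpha> \<and> \<alpha> \<in> extensional (VObj A)"
  "Dom (vfunct V A B) a = fst a" "Cod (vfunct V A B) a = fst (snd a)"
  "Ide (vfunct V A B) F = (F, F, \<lambda>x \<in> VObj A. VId B (f_obj F x))"
  "(G', H, \<beta>) \<cdot>\<^bsub>vfunct V A B\<^esub> (F, G, \<alpha>) = (F, H, \<lambda>x \<in> VObj A.
              el_comp V B (f_obj F x) (f_obj G x) (f_obj H x) (\<beta> x) (\<alpha> x))"
  by (simp_all add: vfunct_def vfunctors_def Let_def split_beta)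

lemma vfunctors_functor: "F \<in> vfunctors V A B \<Longrightarrow> enriched_functor V A B F"
  by (simp add: vfunctors_def)

section \<open>The category of enriched functors\<close>

locale vfunct_ctx = A: enriched_category V A + B: enriched_category V B
  for V :: "('vo, 'va, 'm) smc_scheme" (structure)
    and A :: "('o, 'vo, 'va) vcat" and B :: "('p, 'vo, 'va) vcat"
begin

lemma natD:
  assumes "enriched_functor V A B F" "enriched_functor V A B G" "enriched_nat_trans V A B F G \<alpha>"
  shows "x \<in> VObj A \<Longrightarrow> garr V B (component F G \<alpha> x)" "x \<in> VObj A \<Longrightarrow> gr V (component F G \<alpha> x) = \<one>"
    "garr V A p \<Longrightarrow> gpost V B (component F G \<alpha> (gcod p)) (fapp V F p) =
       gpre V B (fapp V G p) (component F G \<alpha> (gdom p))"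
  using assms(3) unfolding enriched_nat_trans_iff[OF assms(1,2)] by blast+

lemma component_comp:
  assumes F: "enriched_functor V A B F" and G: "enriched_functor V A B G" and H: "enriched_functor V A B H"
    and \<alpha>: "enriched_nat_trans V A B F G \<alpha>" and \<beta>: "enriched_nat_trans V A B G H \<beta>" and x: "x \<in> VObj A"
  shows "el_comp V B (f_obj F x) (f_obj G x) (f_obj H x) (\<beta> x) (\<alpha> x) =
    gmor (gpost V B (component G H \<beta> x) (component F G \<alpha> x))"
  using natD(1,2)[OF F G \<alpha> x] natD(1,2)[OF G H \<beta> x] x
    enriched_functor.f_obj_in[OF F x] enriched_functor.f_obj_in[OF G x] enriched_functor.f_obj_in[OF H x]
  by (simp add: el_comp_def gpost_def gcomp_def component_def)

lemma nat_trans_id: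
  assumes F: "enriched_functor V A B F" 
  shows "enriched_nat_trans V A B F F (\<lambda>x \<in> VObj A. VId B (f_obj F x))"
proof -
  interpret F: enriched_functor V A B F by fact
  have c: "component F F (\<lambda>x \<in> VObj A. VId B (f_obj F x)) x = gid B (f_obj F x)" if "x \<in> VObj A" for x
    using that by (simp add: component_def gid_def)
  show ?thesis unfolding enriched_nat_trans_iff[OF F F]
    by (auto simp: c B.gpost_gid B.gpre_gid)
qed

lemma nat_trans_comp:
  assumes F: "enriched_functor V A B F" and G: "enriched_functor V A B G" and H: "enriched_functor V A B H"
    and \<alpha>: "enriched_nat_trans V A B F G \<alpha>" and \<beta>: "enriched_nat_trans V A B G H \<beta>"
  shows "enriched_nat_trans V A B F H (\<lambda>x \<in> VObj A.
              el_comp V B (f_obj F x) (f_obj G x) (f_obj H x) (\<beta> x) (\<alpha> x))"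
proof -
  interpret F: enriched_functor V A B F by fact
  interpret G: enriched_functor V A B G by fact
  interpret H: enriched_functor V A B H by fact
  note [simp] = natD(1,2)[OF F G \<alpha>] natD(1,2)[OF G H \<beta>]
  have c: "component F H (\<lambda>x \<in> VObj A. el_comp V B (f_obj F x) (f_obj G x) (f_obj H x) (\<beta> x) (\<alpha> x)) x =
      gpost V B (component G H \<beta> x) (component F G \<alpha> x)" if "x \<in> VObj A" for x
    using that by (intro g_eqI) (simp_all add: component_comp[OF assms] component_mor)
  have "gpost V B (gpost V B (component G H \<beta> (gcod p)) (component F G \<alpha> (gcod p))) (fapp V F p) =
      gpre V B (fapp V H p) (gpost V B (component G H \<beta> (gdom p)) (component F G \<alpha> (gdom p)))"
    if p: "garr V A p" for p
  proof -
    have "gpost V B (gpost V B (component G H \<beta> (gcod p)) (component F G \<alpha> (gcod p))) (fapp V F p) =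
       gpost V B (component G H \<beta> (gcod p)) (gpre V B (fapp V G p) (component F G \<alpha> (gdom p)))"
      using p by (simp add: B.gpost_gpost natD(3)[OF F G \<alpha>])
    also have "\<dots> = gpre V B (gpre V B (fapp V H p) (component G H \<beta> (gdom p))) (component F G \<alpha> (gdom p))"
      using p by (simp add: B.gpost_gpre natD(3)[OF G H \<beta>])
    also have "\<dots> = gpre V B (fapp V H p) (gpost V B (component G H \<beta> (gdom p)) (component F G \<alpha> (gdom p)))"
      using p by (simp add: B.gpre_gpre)
    finally show ?thesis .
  qed
  thus ?thesis unfolding enriched_nat_trans_iff[OF F H] by (simp add: c)
qed

lemma category_vfunct: "category (vfunct V A B)"
proof
  fix f F G assume f: "f \<in> hom (vfunct V A B) F G"
  obtain \<alpha> where f_eq: "f = (F, G, \<alpha>)" using f by (cases f) auto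
  have fac: "enriched_functor V A B F" "enriched_functor V A B G" "enriched_nat_trans V A B F G \<alpha>"
     "\<alpha> \<in> extensional (VObj A)"
    using f unfolding f_eq by (auto simp: vfunctors_functor)
  interpret F: enriched_functor V A B F by fact
  interpret G: enriched_functor V A B G by fact
  have [simp]: "component F F (\<lambda>x \<in> VObj A. VId B (f_obj F x)) x = gid B (f_obj F x)"
    "component G G (\<lambda>x \<in> VObj A. VId B (f_obj G x)) x = gid B (f_obj G x)" if "x \<in> VObj A" for x
    using that by (simp_all add: component_def gid_def)
  note [simp] = natD(1,2)[OF fac(1-3)]
  have "el_comp V B (f_obj F x) (f_obj F x) (f_obj G x) (\<alpha> x) (VId B (f_obj F x)) = gmor (component F G \<alpha> x)"
    "el_comp V B (f_obj F x) (f_obj G x) (f_obj G x) (VId B (f_obj G x)) (\<alpha> x) = gmor (component F G \<alpha> x)"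
    if x: "x \<in> VObj A" for x
    using component_comp[OF fac(1,1,2) nat_trans_id[OF fac(1)] fac(3) x]
      component_comp[OF fac(1,2,2) fac(3) nat_trans_id[OF fac(2)] x] x
    by (simp_all add: B.gpost_gid_right B.gpost_gid)
  then have "(\<lambda>x \<in> VObj A. el_comp V B (f_obj F x) (f_obj F x) (f_obj G x) (\<alpha> x) ((\<lambda>x \<in> VObj A. VId B (f_obj F x)) x)) = \<alpha>"
    "(\<lambda>x \<in> VObj A. el_comp V B (f_obj F x) (f_obj G x) (f_obj G x) ((\<lambda>x \<in> VObj A. VId B (f_obj G x)) x) (\<alpha> x)) = \<alpha>"
    using fac(4) by (auto simp: fun_eq_iff extensional_def component_mor)
  then show "f \<cdot>\<^bsub>vfunct V A B\<^esub> Ide (vfunct V A B) F = f" "Ide (vfunct V A B) G \<cdot>\<^bsub>vfunct V A B\<^esub> f = f"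
    by (simp_all add: f_eq)
next
  fix f g h F G H K
  assume fgh: "f \<in> hom (vfunct V A B) F G" "g \<in> hom (vfunct V A B) G H" "h \<in> hom (vfunct V A B) H K"
  obtain \<alpha> \<beta> \<gamma> where eq: "f = (F, G, \<alpha>)" "g = (G, H, \<beta>)" "h = (H, K, \<gamma>)"
    using fgh by (cases f; cases g; cases h) auto
  have fac: "enriched_functor V A B F" "enriched_functor V A B G" "enriched_functor V A B H"
     "enriched_functor V A B K"
    "enriched_nat_trans V A B F G \<alpha>" "enriched_nat_trans V A B G H \<beta>" "enriched_nat_trans V A B H K \<gamma>"
    using fgh unfolding eq by (auto simp: vfunctors_functor)
  have c: "component F H (\<lambda>x \<in> VObj A. el_comp V B (f_obj F x) (f_obj G x) (f_obj H x) (\<beta> x) (\<alpha> x)) x =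
      gpost V B (component G H \<beta> x) (component F G \<alpha> x)" 
      "component G K (\<lambda>x \<in> VObj A. el_comp V B (f_obj G x) (f_obj H x) (f_obj K x) (\<gamma> x) (\<beta> x)) x =
      gpost V B (component H K \<gamma> x) (component G H \<beta> x)" if "x \<in> VObj A" for x
    using that by (intro g_eqI; simp add: component_comp[OF fac(1,2,3,5,6)]
        component_comp[OF fac(2,3,4,6,7)] component_mor)+
  have "el_comp V B (f_obj F x) (f_obj G x) (f_obj K x)
       ((\<lambda>x \<in> VObj A. el_comp V B (f_obj G x) (f_obj H x) (f_obj K x) (\<gamma> x) (\<beta> x)) x) (\<alpha> x) =
     el_comp V B (f_obj F x) (f_obj H x) (f_obj K x) (\<gamma> x)
       ((\<lambda>x \<in> VObj A. el_comp V B (f_obj F x) (f_obj G x) (f_obj H x) (\<beta> x) (\<alpha> x)) x)"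
    if x: "x \<in> VObj A" for x
    using natD(1,2)[OF fac(1,2,5) x] natD(1,2)[OF fac(2,3,6) x] natD(1,2)[OF fac(3,4,7) x]
    by (simp only: component_comp[OF fac(1,2,4,5) nat_trans_comp[OF fac(2,3,4,6,7)] x]
        component_comp[OF fac(1,3,4) nat_trans_comp[OF fac(1,2,3,5,6)] fac(7) x] c[OF x])
      (simp add: B.gpost_gpost)
  thus "(h \<cdot>\<^bsub>vfunct V A B\<^esub> g) \<cdot>\<^bsub>vfunct V A B\<^esub> f = h \<cdot>\<^bsub>vfunct V A B\<^esub> g \<cdot>\<^bsub>vfunct V A B\<^esub> f"
    by (auto simp: eq intro!: restrict_ext)
next
  fix f g F G H
  assume fg: "f \<in> hom (vfunct V A B) F G" "g \<in> hom (vfunct V A B) G H"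
  obtain \<alpha> \<beta> where eq: "f = (F, G, \<alpha>)" "g = (G, H, \<beta>)"
    using fg by (cases f; cases g) auto
  show "g \<cdot>\<^bsub>vfunct V A B\<^esub> f \<in> hom (vfunct V A B) F H"
    using fg unfolding eq by (auto intro!: nat_trans_comp simp: vfunctors_functor)
next
  fix F assume "F \<in> Obj (vfunct V A B)"
  then show "Ide (vfunct V A B) F \<in> hom (vfunct V A B) F F"
    by (auto intro!: nat_trans_id simp: vfunctors_functor)
qed auto

text \<open>Pointwise inverses are automatically natural: insert the component at the source of
  \<open>p\<close> followed by its inverse, and apply naturality of \<open>\<alpha>\<close> in the
  middle.\<close>

lemma vfunct_iso:
  assumes FG: "F \<in> vfunctors V A B" "G \<in> vfunctors V A B" and \<alpha>: "enriched_nat_trans V A B F G \<alpha>"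
    "\<alpha> \<in> extensional (VObj A)"
    and inv: "\<And>x. x \<in> VObj A \<Longrightarrow> \<exists>k. garr V B k \<and> gr V k = \<one> \<and> gdom k = f_obj G x \<and> gcod k = f_obj F x \<and>
      gpost V B k (component F G \<alpha> x) = gid B (f_obj F x) \<and>
      gpost V B (component F G \<alpha> x) k = gid B (f_obj G x)"
  shows "is_iso (vfunct V A B) (F, G, \<alpha>)"
proof -
  note F = vfunctors_functor[OF FG(1)] and G = vfunctors_functor[OF FG(2)]
  interpret F: enriched_functor V A B F by (rule F)
  interpret G: enriched_functor V A B G by (rule G)
  obtain k where k: "\<And>x. x \<in> VObj A \<Longrightarrow> garr V B (k x) \<and> gr V (k x) = \<one> \<and> gdom (k x) = f_obj G x \<and> gcod (k x) = f_obj F x \<and>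
      gpost V B (k x) (component F G \<alpha> x) = gid B (f_obj F x) \<and>
      gpost V B (component F G \<alpha> x) (k x) = gid B (f_obj G x)"
    using inv by metis
  define \<beta> where "\<beta> = (\<lambda>x \<in> VObj A. gmor (k x))"
  have \<beta>: "component G F \<beta> x = k x" if "x \<in> VObj A" for x
    using k[OF that] that by (intro g_eqI) (simp_all add: \<beta>_def component_mor)
  note [simp] = natD(1,2)[OF F G \<alpha>(1)]
  have [simp]: "garr V B (k x)" "gr V (k x) = \<one>" "gdom (k x) = f_obj G x" "gcod (k x) = f_obj F x" if "x \<in> VObj A" for x
    using k that by auto
  have "gpost V B (k (gcod p)) (fapp V G p) = gpre V B (fapp V F p) (k (gdom p))" if p: "garr V A p" for p
  proof -
    have "gpost V B (k (gcod p)) (fapp V G p) =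
        gpre V B (gpost V B (k (gcod p)) (fapp V G p)) (gid B (f_obj G (gdom p)))"
      using p by (subst B.gpre_gid) simp_all
    also have "\<dots> = gpre V B (gpre V B (gpost V B (k (gcod p)) (fapp V G p)) (component F G \<alpha> (gdom p))) (k (gdom p))"
      using p k[of "gdom p"] by (subst B.gpre_gpre) simp_all
    also have "gpre V B (gpost V B (k (gcod p)) (fapp V G p)) (component F G \<alpha> (gdom p)) =
        gpost V B (k (gcod p)) (gpost V B (component F G \<alpha> (gcod p)) (fapp V F p))"
      using p by (simp add: natD(3)[OF F G \<alpha>(1)] B.gpost_gpre)
    also have "\<dots> = fapp V F p"
      using p k[of "gcod p"] by (subst B.gpost_gpost[symmetric]) (simp_all add: B.gpost_gid)
    finally show ?thesis .
  qed
  then have nat: "enriched_nat_trans V A B G F \<beta>"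
    unfolding enriched_nat_trans_iff[OF G F] by (simp add: \<beta>)
  have "inverse_arrows (vfunct V A B) (F, G, \<alpha>) (G, F, \<beta>)"
    using FG \<alpha> nat k
    by (auto simp: inverse_arrows_def component_comp[OF F G F] component_comp[OF G F G] F G \<beta>
        intro!: restrict_ext) (simp_all add: \<beta>_def)
  thus ?thesis by (auto simp: is_iso_def)
qed

lemma vfunct_isoD:
  assumes "is_iso (vfunct V A B) (F, G, \<alpha>)" and x: "x \<in> VObj A"
  obtains k where "garr V B k" "gr V k = \<one>" "gdom k = f_obj G x" "gcod k = f_obj F x"
      "gpost V B k (component F G \<alpha> x) = gid B (f_obj F x)"
      "gpost V B (component F G \<alpha> x) k = gid B (f_obj G x)"
proof -
  obtain g where "inverse_arrows (vfunct V A B) (F, G, \<alpha>) g"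
    using assms by (auto simp: is_iso_def)
  then obtain \<beta> where g: "inverse_arrows (vfunct V A B) (F, G, \<alpha>) (G, F, \<beta>)"
    by (cases g) (auto simp: inverse_arrows_def)
  then have fac: "enriched_functor V A B F" "enriched_functor V A B G"
    "enriched_nat_trans V A B F G \<alpha>" "enriched_nat_trans V A B G F \<beta>"
    by (auto simp: inverse_arrows_def vfunctors_functor)
  have "(\<lambda>x \<in> VObj A. el_comp V B (f_obj F x) (f_obj G x) (f_obj F x) (\<beta> x) (\<alpha> x)) = (\<lambda>x \<in> VObj A. VId B (f_obj F x))"
    "(\<lambda>x \<in> VObj A. el_comp V B (f_obj G x) (f_obj F x) (f_obj G x) (\<alpha> x) (\<beta> x)) = (\<lambda>x \<in> VObj A. VId B (f_obj G x))"
    using g by (auto simp: inverse_arrows_def)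
  from this[THEN fun_cong, of x] x
  have "gmor (gpost V B (component G F \<beta> x) (component F G \<alpha> x)) = VId B (f_obj F x)"
    "gmor (gpost V B (component F G \<alpha> x) (component G F \<beta> x)) = VId B (f_obj G x)"
    using fac by (auto simp: component_comp)
  hence "gpost V B (component G F \<beta> x) (component F G \<alpha> x) = gid B (f_obj F x)"
    "gpost V B (component F G \<alpha> x) (component G F \<beta> x) = gid B (f_obj G x)"
    by (auto intro: g_eqI)
  thus ?thesis using that[of "component G F \<beta> x"] natD(1,2)[OF fac(2,1,4) x] by simp
qed

end

section \<open>Weighted colimits\<close>

text \<open>Transports unique existence between raw morphisms and graded arrows. The third
  assumption makes \<open>F\<close> injective, and the second says that \<open>F\<close> reaches
  every solution of \<open>Q\<close>.\<close>

lemma ex1_transfer: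
  assumes "\<And>h. P h \<longleftrightarrow> Q (F h)" "\<And>q. Q q \<Longrightarrow> F (G q) = q" "\<And>h. G (F h) = h"
  shows "(\<exists>!h. P h) \<longleftrightarrow> (\<exists>!q. Q q)"
  using assms by metis

lemma (in category) iso_cancel_right_iff:
  assumes "is_iso C f" "g \<in> Arr C" "h \<in> Arr C" "Dom C g = Cod C f" "Dom C h = Cod C f"
  shows "g \<cdot> f = h \<cdot> f \<longleftrightarrow> g = h"
  using iso_cancel_right[OF assms] by blast

context closed_symmetric_monoidal begin

lemma symm_lunit':
  assumes [simp]: "x \<in> Obj V"
  shows "symm V \<one> x \<cdot> lunit' x = runit' x"
proof (rule iso_cancel_left[of "lunit V x \<cdot> symm V x \<one>"])
  show "(lunit V x \<cdot> symm V x \<one>) \<cdot> symm V \<one> x \<cdot> lunit' x = (lunit V x \<cdot> symm V x \<one>) \<cdot> runit' x"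
    by (subst (2) lunit_symm) simp_all
qed (simp_all add: iso_comp)

text \<open>The weight as a right action \<open>W j \<odot> J(i,j) \<rightarrow> W i\<close>. The
  symmetry puts the weight on the left, where the grade of a cocone leg stands when the leg is
  composed with an arrow of the diagram.\<close>

definition wact :: "('j, 'o, 'a) vcat \<Rightarrow> ('j, 'o, 'a) vfun \<Rightarrow> 'j \<Rightarrow> 'j \<Rightarrow> 'a" where
  "wact J W i j = unc (f_obj W j) (f_obj W i) (f_hom W j i) \<cdot> symm V (f_obj W j) (VHom J i j)"

end

text \<open>The two conditions differ by precomposition with the inverse of the left unitor, and
  \<open>symm_lunit'\<close> accounts for the symmetry in the wedge condition.\<close>

lemma (in enriched_category) enriched_nat_trans_iff_wedge:
  fixes A :: "('j, 'vo, 'va) vcat"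
  assumes "\<And>x y. x \<in> VObj A \<Longrightarrow> y \<in> VObj A \<Longrightarrow> VHom A x y \<in> Obj V"
    and "\<And>x. x \<in> VObj A \<Longrightarrow> f_obj F x \<in> VObj C" "\<And>x. x \<in> VObj A \<Longrightarrow> f_obj G x \<in> VObj C"
    and "\<And>x y. x \<in> VObj A \<Longrightarrow> y \<in> VObj A \<Longrightarrow> f_hom F x y \<in> hom V (VHom A x y) (VHom C (f_obj F x) (f_obj F y))"
    and "\<And>x y. x \<in> VObj A \<Longrightarrow> y \<in> VObj A \<Longrightarrow> f_hom G x y \<in> hom V (VHom A x y) (VHom C (f_obj G x) (f_obj G y))"
  shows "enriched_nat_trans V A C F G \<alpha> \<longleftrightarrow> wedge V A C F G \<one> \<alpha>"
proof -
  have "(VComp C (f_obj F x) (f_obj F y) (f_obj G y) \<cdot> (\<alpha> y \<otimes> f_hom F x y) \<cdot> lunit' (VHom A x y) =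
        VComp C (f_obj F x) (f_obj G x) (f_obj G y) \<cdot> (f_hom G x y \<otimes> \<alpha> x) \<cdot> runit' (VHom A x y)) \<longleftrightarrow>
     (VComp C (f_obj F x) (f_obj F y) (f_obj G y) \<cdot> (\<alpha> y \<otimes> f_hom F x y) =
        VComp C (f_obj F x) (f_obj G x) (f_obj G y) \<cdot> (f_hom G x y \<otimes> \<alpha> x) \<cdot> symm V \<one> (VHom A x y))"
    (is "?l \<longleftrightarrow> ?r")
    if "\<forall>x \<in> VObj A. \<alpha> x \<in> hom V \<one> (VHom C (f_obj F x) (f_obj G x))" and xy: "x \<in> VObj A" "y \<in> VObj A" for x y
  proof -
    note [simp] = assms(1)[OF xy] assms(2,3)[OF xy(1)] assms(2,3)[OF xy(2)]
    have [simp]: "\<alpha> x \<in> Arr V" "Dom V (\<alpha> x) = \<one>" "Cod V (\<alpha> x) = VHom C (f_obj F x) (f_obj G x)"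
      "\<alpha> y \<in> Arr V" "Dom V (\<alpha> y) = \<one>" "Cod V (\<alpha> y) = VHom C (f_obj F y) (f_obj G y)"
      "f_hom F x y \<in> Arr V" "Dom V (f_hom F x y) = VHom A x y" "Cod V (f_hom F x y) = VHom C (f_obj F x) (f_obj F y)"
      "f_hom G x y \<in> Arr V" "Dom V (f_hom G x y) = VHom A x y" "Cod V (f_hom G x y) = VHom C (f_obj G x) (f_obj G y)"
      using that assms(4,5)[OF xy] by auto
    let ?L = "VComp C (f_obj F x) (f_obj F y) (f_obj G y) \<cdot> (\<alpha> y \<otimes> f_hom F x y)"
    let ?R = "VComp C (f_obj F x) (f_obj G x) (f_obj G y) \<cdot> (f_hom G x y \<otimes> \<alpha> x) \<cdot> symm V \<one> (VHom A x y)"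
    have "?l \<longleftrightarrow> ?L \<cdot> lunit' (VHom A x y) = ?R \<cdot> lunit' (VHom A x y)"
      by (simp add: symm_lunit')
    also have "\<dots> \<longleftrightarrow> ?r"
      by (rule iso_cancel_right_iff) (simp_all add: iso_inv_arr)
    finally show ?thesis .
  qed
  thus ?thesis by (auto simp: enriched_nat_trans_def wedge_def)
qed

section \<open>The wedge condition without internal composition\<close>

context enriched_category begin

lemma rep_op_arr [simp]:
  assumes "x \<in> VObj C" "x' \<in> VObj C" "y \<in> VObj C"
  shows "f_hom (rep V (op_vcat V C) y) x x' \<in> Arr V"
    "Dom V (f_hom (rep V (op_vcat V C) y) x x') = VHom C x' x"
    "Cod V (f_hom (rep V (op_vcat V C) y) x x') = ihom V (VHom C x y) (VHom C x' y)"
  using assms by (simp_all add: rep_def)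

lemma unc_rep_op:
  assumes [simp]: "x \<in> VObj C" "x' \<in> VObj C" "y \<in> VObj C"
    and [simp]: "d \<in> Arr V" "Cod V d = VHom C x' x"
  shows "unc (VHom C x y) (VHom C x' y) (f_hom (rep V (op_vcat V C) y) x x' \<cdot> d) =
       VComp C x' x y \<cdot> (Ide V (VHom C x y) \<otimes> d) \<cdot> symm V (Dom V d) (VHom C x y)"
proof -
  have "unc (VHom C x y) (VHom C x' y) (f_hom (rep V (op_vcat V C) y) x x') =
      VComp C x' x y \<cdot> symm V (VHom C x' x) (VHom C x y)"
    by (simp add: rep_def)
  thus ?thesis
    by (simp add: unc_comp symm_nat_arr)
qed

text \<open>Both sides of the wedge condition end in an internal hom out of \<open>w\<close>.
  Uncurrying them and rearranging the source to \<open>(n \<odot> w) \<odot> j\<close> removes the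
  composition of the self-enrichment and leaves composition in \<open>C\<close>.\<close>

lemma wedge_condition_iff:
  assumes [simp]: "x \<in> VObj C" "x' \<in> VObj C" "y \<in> VObj C" "w \<in> Obj V" "w' \<in> Obj V"
    and [simp]: "\<nu> \<in> Arr V" "Dom V \<nu> = n" "Cod V \<nu> = ihom V w (VHom C x y)"
    and [simp]: "\<nu>' \<in> Arr V" "Dom V \<nu>' = n" "Cod V \<nu>' = ihom V w' (VHom C x' y)"
    and [simp]: "f \<in> Arr V" "Dom V f = j" "Cod V f = ihom V w w'"
    and [simp]: "d \<in> Arr V" "Dom V d = j" "Cod V d = VHom C x' x"
  shows "VComp (self_enriched V) w w' (VHom C x' y) \<cdot> (\<nu>' \<otimes> f) =
      VComp (self_enriched V) w (VHom C x y) (VHom C x' y) \<cdot>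
        ((f_hom (rep V (op_vcat V C) y) x x' \<cdot> d) \<otimes> \<nu>) \<cdot> symm V n j \<longleftrightarrow>
    VComp C x' x y \<cdot> (unc w (VHom C x y) \<nu> \<otimes> d) =
      unc w' (VHom C x' y) \<nu>' \<cdot> (Ide V n \<otimes> (unc w w' f \<cdot> symm V w j)) \<cdot> assoc V n w j"
    (is "?L = ?R \<longleftrightarrow> ?l = ?r")
proof -
  have [simp]: "n \<in> Obj V" "j \<in> Obj V" using dom_cod_obj(1)[of \<nu>] dom_cod_obj(1)[of f] by simp_all
  \<comment> \<open>The isomorphism that exchanges \<open>w\<close> and \<open>j\<close>. On the
    left side it produces the action of \<open>j\<close> on \<open>w\<close>; on the right side it
    completes the composite in \<open>hexagon_right\<close>, after which the symmetries
    cancel.\<close>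
  define s where "s = assoc' n j w \<cdot> (Ide V n \<otimes> symm V w j) \<cdot> assoc V n w j"
  have s [simp]: "s \<in> Arr V" "Dom V s = (n \<odot> w) \<odot> j" "Cod V s = (n \<odot> j) \<odot> w" "is_iso V s"
    by (simp_all add: s_def iso_comp ten_iso iso_ide iso_inv_arr)
  let ?u = "unc w (VHom C x' y)"
  have "?u ?L = unc w' (VHom C x' y) \<nu>' \<cdot> (Ide V n \<otimes> unc w w' f) \<cdot> assoc V n j w"
    by (subst unc_self_comp) simp_all
  then have L: "?u ?L \<cdot> s = ?r" by (simp add: s_def)
  have "?u ?R = ?u (VComp (self_enriched V) w (VHom C x y) (VHom C x' y) \<cdot>
        ((f_hom (rep V (op_vcat V C) y) x x' \<cdot> d) \<otimes> \<nu>)) \<cdot> (symm V n j \<otimes> Ide V w)"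
    by (subst unc_comp[symmetric]) simp_all
  also have "\<dots> = (VComp C x' x y \<cdot> (Ide V (VHom C x y) \<otimes> d) \<cdot> symm V j (VHom C x y)) \<cdot>
       (Ide V j \<otimes> unc w (VHom C x y) \<nu>) \<cdot> assoc V j n w \<cdot> (symm V n j \<otimes> Ide V w)"
    by (subst unc_self_comp) (simp_all add: unc_rep_op)
  also have "\<dots> = VComp C x' x y \<cdot> (Ide V (VHom C x y) \<otimes> d) \<cdot>
       (symm V j (VHom C x y) \<cdot> (Ide V j \<otimes> unc w (VHom C x y) \<nu>)) \<cdot> assoc V j n w \<cdot> (symm V n j \<otimes> Ide V w)"
    by simp
  also have "\<dots> = VComp C x' x y \<cdot> (unc w (VHom C x y) \<nu> \<otimes> d) \<cdot> symm V j (n \<odot> w) \<cdot>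
       assoc V j n w \<cdot> (symm V n j \<otimes> Ide V w)"
    by (subst symm_nat_arr) simp_all
  finally have "?u ?R \<cdot> s = VComp C x' x y \<cdot> (unc w (VHom C x y) \<nu> \<otimes> d) \<cdot> symm V j (n \<odot> w) \<cdot>
       (assoc V j n w \<cdot> (symm V n j \<otimes> Ide V w) \<cdot> assoc' n j w \<cdot> (Ide V n \<otimes> symm V w j) \<cdot> assoc V n w j)"
    by (simp add: s_def)
  also have "\<dots> = ?l"
    by (subst hexagon_right) simp_all
  finally have R: "?u ?R \<cdot> s = ?l" .
  have "?L = ?R \<longleftrightarrow> ?u ?L = ?u ?R"
    by (rule iffI, simp, rule unc_inj[of _ _ w "VHom C x' y"]) simp_all
  also have "\<dots> \<longleftrightarrow> ?u ?L \<cdot> s = ?u ?R \<cdot> s"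
    by (rule iso_cancel_right_iff[symmetric]) simp_all
  finally show ?thesis unfolding L R by auto
qed

end

section \<open>Weighted colimits as universal graded cocones\<close>

locale weighted_diagram = C: enriched_category V C + J: enriched_category V J +
  W: enriched_functor V "op_vcat V J" "self_enriched V" W + D: enriched_functor V J C D
  for V :: "('vo, 'va, 'm) smc_scheme" (structure) and C :: "('o, 'vo, 'va) vcat"
    and J :: "('j, 'vo, 'va) vcat" and W :: "('j, 'vo, 'va) vfun" and D :: "('j, 'o, 'va) vfun"
begin

lemma W_obj [simp]: "j \<in> VObj J \<Longrightarrow> f_obj W j \<in> Obj V"
  using W.fobj by simp

lemma W_hom [simp]:
  assumes "i \<in> VObj J" "j \<in> VObj J"
  shows "f_hom W j i \<in> Arr V" "Dom V (f_hom W j i) = VHom J i j"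
    "Cod V (f_hom W j i) = ihom V (f_obj W j) (f_obj W i)"
  using W.fhom[of j i] assms by simp_all

abbreviation act where "act \<equiv> C.wact J W"

lemma act_arr [simp]:
  assumes "i \<in> VObj J" "j \<in> VObj J"
  shows "act i j \<in> Arr V" "Dom V (act i j) = f_obj W j \<odot> VHom J i j" "Cod V (act i j) = f_obj W i"
  using assms by (simp_all add: C.wact_def)

text \<open>Cocones with vertex \<open>y\<close> for the weight \<open>m \<odot> W\<close>.\<close>

definition family :: "'vo \<Rightarrow> 'o \<Rightarrow> ('j \<Rightarrow> 'o \<times> 'o \<times> 'va) \<Rightarrow> bool" where
  "family m y f \<longleftrightarrow> m \<in> Obj V \<and> y \<in> VObj C \<and>
     (\<forall>j \<in> VObj J. garr V C (f j) \<and> gdom (f j) = f_obj D j \<and> gcod (f j) = y \<and> gr V (f j) = m \<odot> f_obj W j) \<and>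
     (\<forall>i \<in> VObj J. \<forall>j \<in> VObj J. gcomp V C (f j) (fapp V D (gen V J i j)) =
        gre V (f i) ((Ide V m \<otimes> act i j) \<cdot> assoc V m (f_obj W j) (VHom J i j)))"

text \<open>The factorisation is required for families of arbitrary grade \<open>m\<close>. This
  makes the universal property an enriched one; the grade \<open>\<one>\<close> alone would express
  the ordinary one.\<close>

definition gcolim :: "'o \<Rightarrow> ('j \<Rightarrow> 'o \<times> 'o \<times> 'va) \<Rightarrow> bool" where
  "gcolim c k \<longleftrightarrow> c \<in> VObj C \<and>
     (\<forall>j \<in> VObj J. garr V C (k j) \<and> gdom (k j) = f_obj D j \<and> gcod (k j) = c \<and> gr V (k j) = f_obj W j) \<and>
     (\<forall>i \<in> VObj J. \<forall>j \<in> VObj J. gcomp V C (k j) (fapp V D (gen V J i j)) = gre V (k i) (act i j)) \<and>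
     (\<forall>m y f. family m y f \<longrightarrow> (\<exists>!h. garr V C h \<and> gdom h = c \<and> gcod h = y \<and> gr V h = m \<and>
        (\<forall>j \<in> VObj J. gcomp V C h (k j) = f j)))"

lemma hom_from_simps:
  "f_obj (hom_from V C D y) j = VHom C (f_obj D j) y"
  "f_hom (hom_from V C D y) j i = f_hom (rep V (op_vcat V C) y) (f_obj D j) (f_obj D i) \<cdot> f_hom D i j"
  by (simp_all add: hom_from_def comp_vfun_def op_vfun_def) (simp add: rep_def)

lemma wedge_iff_family:
  assumes y: "y \<in> VObj C"
  shows "wedge V (op_vcat V J) (self_enriched V) W (hom_from V C D y) m \<nu> \<longleftrightarrow>
    (\<forall>j \<in> VObj J. \<nu> j \<in> hom V m (ihom V (f_obj W j) (VHom C (f_obj D j) y))) \<and>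
    family m y (\<lambda>j. (f_obj D j, y, C.unc (f_obj W j) (VHom C (f_obj D j) y) (\<nu> j)))"
proof -
  have "VComp (self_enriched V) (f_obj W j) (f_obj W i) (VHom C (f_obj D i) y) \<cdot> (\<nu> i \<otimes> f_hom W j i) =
      VComp (self_enriched V) (f_obj W j) (VHom C (f_obj D j) y) (VHom C (f_obj D i) y) \<cdot>
        ((f_hom (rep V (op_vcat V C) y) (f_obj D j) (f_obj D i) \<cdot> f_hom D i j) \<otimes> \<nu> j) \<cdot> symm V m (VHom J i j) \<longleftrightarrow>
     gcomp V C (f_obj D j, y, C.unc (f_obj W j) (VHom C (f_obj D j) y) (\<nu> j)) (fapp V D (gen V J i j)) =
     gre V (f_obj D i, y, C.unc (f_obj W i) (VHom C (f_obj D i) y) (\<nu> i))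
        ((Ide V m \<otimes> act i j) \<cdot> assoc V m (f_obj W j) (VHom J i j))"
    if "\<forall>j \<in> VObj J. \<nu> j \<in> hom V m (ihom V (f_obj W j) (VHom C (f_obj D j) y))" "i \<in> VObj J" "j \<in> VObj J" for i j
  proof -
    have [simp]: "\<nu> i \<in> Arr V" "Dom V (\<nu> i) = m" "Cod V (\<nu> i) = ihom V (f_obj W i) (VHom C (f_obj D i) y)"
      "\<nu> j \<in> Arr V" "Dom V (\<nu> j) = m" "Cod V (\<nu> j) = ihom V (f_obj W j) (VHom C (f_obj D j) y)"
      using that by auto
    show ?thesis using that(2,3) y
      by (subst C.wedge_condition_iff) (simp_all add: gcomp_def fapp_def gre_def C.wact_def)
  qed
  moreover have "m \<in> Obj V \<and> garr V C (f_obj D j, y, C.unc (f_obj W j) (VHom C (f_obj D j) y) (\<nu> j))"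
    if "wedge V (op_vcat V J) (self_enriched V) W (hom_from V C D y) m \<nu>" "j \<in> VObj J" for j
    using that y by (simp add: wedge_def hom_from_simps)
  ultimately show ?thesis using y
    unfolding wedge_def family_def hom_from_simps J.op_simps C.self_simps
    by (simp cong: conj_cong) blast
qed

text \<open>The legs of the cocone: the unit \<open>\<kappa> j\<close> names a morphism
  \<open>W j \<rightarrow> C(D j, c)\<close>, recovered by uncurrying and removing the unit object.
  As an arrow from \<open>D j\<close> to \<open>c\<close> it has grade \<open>W j\<close>.\<close>

definition kap :: "'o \<Rightarrow> ('j \<Rightarrow> 'va) \<Rightarrow> 'j \<Rightarrow> 'o \<times> 'o \<times> 'va" where
  "kap c \<kappa> j = (f_obj D j, c, C.unc (f_obj W j) (VHom C (f_obj D j) c) (\<kappa> j) \<cdot> C.lunit' (f_obj W j))"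

lemma kap_simps [simp]: "gdom (kap c \<kappa> j) = f_obj D j" "gcod (kap c \<kappa> j) = c"
  by (simp_all add: kap_def)

text \<open>A wedge with apex \<open>\<one>\<close> has legs of grade
  \<open>\<one> \<odot> W j\<close>. By \<open>lunit_ten\<close> and naturality the unitor passes
  through the action, and being invertible it is then cancelled.\<close>

lemma nat_trans_iff_kap:
  assumes c: "c \<in> VObj C"
  shows "enriched_nat_trans V (op_vcat V J) (self_enriched V) W (hom_from V C D c) \<kappa> \<longleftrightarrow>
    (\<forall>j \<in> VObj J. \<kappa> j \<in> hom V \<one> (ihom V (f_obj W j) (VHom C (f_obj D j) c))) \<and>
    (\<forall>i \<in> VObj J. \<forall>j \<in> VObj J. gcomp V C (kap c \<kappa> j) (fapp V D (gen V J i j)) = gre V (kap c \<kappa> i) (act i j))"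
proof -
  have "enriched_nat_trans V (op_vcat V J) (self_enriched V) W (hom_from V C D c) \<kappa> \<longleftrightarrow>
     wedge V (op_vcat V J) (self_enriched V) W (hom_from V C D c) \<one> \<kappa>"
    using c by (intro enriched_category.enriched_nat_trans_iff_wedge[OF C.enriched_self])
      (auto simp: hom_from_simps)
  moreover have "gcomp V C (f_obj D j, c, C.unc (f_obj W j) (VHom C (f_obj D j) c) (\<kappa> j)) (fapp V D (gen V J i j)) =
     gre V (f_obj D i, c, C.unc (f_obj W i) (VHom C (f_obj D i) c) (\<kappa> i))
        ((Ide V \<one> \<otimes> act i j) \<cdot> assoc V \<one> (f_obj W j) (VHom J i j)) \<longleftrightarrow>
     gcomp V C (kap c \<kappa> j) (fapp V D (gen V J i j)) = gre V (kap c \<kappa> i) (act i j)" (is "?l \<longleftrightarrow> ?r")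
    if "\<forall>j \<in> VObj J. \<kappa> j \<in> hom V \<one> (ihom V (f_obj W j) (VHom C (f_obj D j) c))" "i \<in> VObj J" "j \<in> VObj J" for i j
  proof -
    have k [simp]: "garr V C (kap c \<kappa> a)" "gr V (kap c \<kappa> a) = f_obj W a"
      "(f_obj D a, c, C.unc (f_obj W a) (VHom C (f_obj D a) c) (\<kappa> a)) = gre V (kap c \<kappa> a) (lunit V (f_obj W a))"
      if "a \<in> VObj J" for a
      using that c \<open>\<forall>j \<in> VObj J. _\<close> by (auto simp: kap_def gre_def)
    have "gre V (gre V (kap c \<kappa> i) (lunit V (f_obj W i))) ((Ide V \<one> \<otimes> act i j) \<cdot> assoc V \<one> (f_obj W j) (VHom J i j)) =
       gre V (kap c \<kappa> i) ((lunit V (f_obj W i) \<cdot> (Ide V \<one> \<otimes> act i j)) \<cdot> assoc V \<one> (f_obj W j) (VHom J i j))"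
      using that by simp
    also have "\<dots> = gre V (kap c \<kappa> i) (act i j \<cdot> (lunit V (f_obj W j \<odot> VHom J i j) \<cdot> assoc V \<one> (f_obj W j) (VHom J i j)))"
      using that by (subst C.lunit_nat_arr) simp_all
    also have "\<dots> = gre V (gre V (kap c \<kappa> i) (act i j)) (lunit V (f_obj W j) \<otimes> Ide V (VHom J i j))"
      using that by (subst C.lunit_ten) simp_all
    finally have "?l \<longleftrightarrow> gre V (gcomp V C (kap c \<kappa> j) (fapp V D (gen V J i j))) (lunit V (f_obj W j) \<otimes> Ide V (VHom J i j))
      = gre V (gre V (kap c \<kappa> i) (act i j)) (lunit V (f_obj W j) \<otimes> Ide V (VHom J i j))"
      using that by simp
    also have "\<dots> \<longleftrightarrow> ?r"
      using C.gre_iso_cancel[of "gcomp V C (kap c \<kappa> j) (fapp V D (gen V J i j))" "gre V (kap c \<kappa> i) (act i j)"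
          "lunit V (f_obj W j) \<otimes> Ide V (VHom J i j)"] that
      by (auto simp: C.ten_iso C.iso_ide simp del: C.gre_gre)
    finally show ?thesis .
  qed
  ultimately show ?thesis
    using c by (auto simp: wedge_iff_family family_def)
qed

text \<open>The morphisms \<open>C(c,y) \<rightarrow> V(W j, C(D j, y))\<close> that occur unnamed
  in \<open>is_weighted_colimit\<close>.\<close>

definition comparison :: "'o \<Rightarrow> ('j \<Rightarrow> 'va) \<Rightarrow> 'o \<Rightarrow> 'j \<Rightarrow> 'va" where
  "comparison c \<kappa> y j = VComp (self_enriched V) (f_obj W j) (VHom C (f_obj D j) c) (VHom C (f_obj D j) y)
               \<cdot> (f_hom (rep V C (f_obj D j)) c y \<otimes> \<kappa> j) \<cdot> C.runit' (VHom C c y)"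

text \<open>The second part is the bridge to graded arrows: applying the comparison morphism to
  \<open>h\<close> amounts to composing \<open>h\<close> with a leg. Its proof uncurries and lets
  the two unitors meet in \<open>assoc_runit'_lunit'\<close>.\<close>

lemma comparison:
  assumes cy: "c \<in> VObj C" "y \<in> VObj C" and j: "j \<in> VObj J"
    and \<kappa>: "\<kappa> j \<in> hom V \<one> (ihom V (f_obj W j) (VHom C (f_obj D j) c))"
  shows "comparison c \<kappa> y j \<in> hom V (VHom C c y) (ihom V (f_obj W j) (VHom C (f_obj D j) y))"
    "garr V C h \<Longrightarrow> gdom h = c \<Longrightarrow> gcod h = y \<Longrightarrow>
      (f_obj D j, y, C.unc (f_obj W j) (VHom C (f_obj D j) y) (comparison c \<kappa> y j \<cdot> gmor h)) = gcomp V C h (kap c \<kappa> j)"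
proof -
  note [simp] = cy j
  have [simp]: "\<kappa> j \<in> Arr V" "Dom V (\<kappa> j) = \<one>" "Cod V (\<kappa> j) = ihom V (f_obj W j) (VHom C (f_obj D j) c)"
    using \<kappa> by simp_all
  let ?r = "f_hom (rep V C (f_obj D j)) c y" and ?w = "f_obj W j" and ?x = "f_obj D j"
  have r [simp]: "?r \<in> Arr V" "Dom V ?r = VHom C c y" "Cod V ?r = ihom V (VHom C ?x c) (VHom C ?x y)"
    "C.unc (VHom C ?x c) (VHom C ?x y) ?r = VComp C ?x c y"
    by (simp_all add: rep_def)
  show *: "comparison c \<kappa> y j \<in> hom V (VHom C c y) (ihom V (f_obj W j) (VHom C (f_obj D j) y))"
    by (simp add: comparison_def)
  have "C.unc ?w (VHom C ?x y) (comparison c \<kappa> y j) =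
     C.unc ?w (VHom C ?x y) (VComp (self_enriched V) ?w (VHom C ?x c) (VHom C ?x y) \<cdot> (?r \<otimes> \<kappa> j)) \<cdot>
       (C.runit' (VHom C c y) \<otimes> Ide V ?w)"
    by (subst C.unc_comp[symmetric]) (simp_all add: comparison_def)
  also have "\<dots> = VComp C ?x c y \<cdot> (Ide V (VHom C c y) \<otimes> C.unc ?w (VHom C ?x c) (\<kappa> j)) \<cdot>
      (assoc V (VHom C c y) \<one> ?w \<cdot> (C.runit' (VHom C c y) \<otimes> Ide V ?w))"
    by (subst C.unc_self_comp) simp_all
  also have "\<dots> = VComp C ?x c y \<cdot> (Ide V (VHom C c y) \<otimes> gmor (kap c \<kappa> j))"
    by (subst C.assoc_runit'_lunit') (simp_all add: kap_def)
  finally have u: "C.unc ?w (VHom C ?x y) (comparison c \<kappa> y j) = VComp C ?x c y \<cdot> (Ide V (VHom C c y) \<otimes> gmor (kap c \<kappa> j))" .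
  assume h: "garr V C h" "gdom h = c" "gcod h = y"
  show "(?x, y, C.unc ?w (VHom C ?x y) (comparison c \<kappa> y j \<cdot> gmor h)) = gcomp V C h (kap c \<kappa> j)"
    using h * u by (subst C.unc_comp) (auto simp: gcomp_def kap_def)
qed

text \<open>Associativity of graded composition produces exactly the associator in the definition of
  \<open>family\<close>.\<close>

lemma family_induced:
  assumes k: "\<forall>j \<in> VObj J. garr V C (k j) \<and> gdom (k j) = f_obj D j \<and> gcod (k j) = c \<and> gr V (k j) = f_obj W j"
    "\<forall>i \<in> VObj J. \<forall>j \<in> VObj J. gcomp V C (k j) (fapp V D (gen V J i j)) = gre V (k i) (act i j)"
    and h: "garr V C h" "gdom h = c"
  shows "family (gr V h) (gcod h) (\<lambda>j. gcomp V C h (k j))"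
  using assms by (auto simp: family_def C.gcomp_assoc)

text \<open>Morphisms \<open>m \<rightarrow> C(c,y)\<close> are the arrows of grade \<open>m\<close>
  from \<open>c\<close> to \<open>y\<close>, wedges with apex \<open>m\<close> are the families by
  \<open>wedge_iff_family\<close>, and \<open>comparison\<close> matches the two notions of
  factorisation. Representing the wedges is therefore the universal property of the legs.\<close>

theorem weighted_colimit_iff:
  "is_weighted_colimit V J C W D c \<kappa> \<longleftrightarrow>
    (\<forall>j \<in> VObj J. \<kappa> j \<in> hom V \<one> (ihom V (f_obj W j) (VHom C (f_obj D j) c))) \<and> gcolim c (kap c \<kappa>)"
proof (cases "c \<in> VObj C \<and> (\<forall>j \<in> VObj J. \<kappa> j \<in> hom V \<one> (ihom V (f_obj W j) (VHom C (f_obj D j) c))) \<and>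
    (\<forall>i \<in> VObj J. \<forall>j \<in> VObj J. gcomp V C (kap c \<kappa> j) (fapp V D (gen V J i j)) = gre V (kap c \<kappa> i) (act i j))")
  case False
  thus ?thesis by (auto simp: is_weighted_colimit_def nat_trans_iff_kap gcolim_def)
next
  case True
  hence c [simp]: "c \<in> VObj C"
    and \<kappa>: "\<And>j. j \<in> VObj J \<Longrightarrow> \<kappa> j \<in> hom V \<one> (ihom V (f_obj W j) (VHom C (f_obj D j) c))"
    and nat: "\<forall>i \<in> VObj J. \<forall>j \<in> VObj J. gcomp V C (kap c \<kappa> j) (fapp V D (gen V J i j)) = gre V (kap c \<kappa> i) (act i j)"
    by blast+
  have kap: "\<forall>j \<in> VObj J. garr V C (kap c \<kappa> j) \<and> gdom (kap c \<kappa> j) = f_obj D j \<and> gcod (kap c \<kappa> j) = c \<and> gr V (kap c \<kappa> j) = f_obj W j"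
    using \<kappa> by (auto simp: kap_def)
  define E where "E m y f \<longleftrightarrow> (\<exists>!h. garr V C h \<and> gdom h = c \<and> gcod h = y \<and> gr V h = m \<and>
        (\<forall>j \<in> VObj J. gcomp V C h (kap c \<kappa> j) = f j))" for m y f
  \<comment> \<open>\<open>is_weighted_colimit\<close> has one universal property for each vertex,
    while \<open>gcolim\<close> quantifies over vertices inside; \<open>U y\<close> is the share of
    the vertex \<open>y\<close>.\<close>
  define U where "U y = (\<forall>m f. family m y f \<longrightarrow> E m y f)" for y
  have "gcolim c (kap c \<kappa>) \<longleftrightarrow> (\<forall>m y f. family m y f \<longrightarrow> E m y f)"
    using kap nat by (simp add: gcolim_def E_def)
  moreover have "family m y f \<Longrightarrow> y \<in> VObj C" for m y f by (simp add: family_def)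
  ultimately have gU: "gcolim c (kap c \<kappa>) \<longleftrightarrow> (\<forall>y \<in> VObj C. U y)"
    unfolding U_def by blast
  have "is_nat_object V (op_vcat V J) (self_enriched V) W (hom_from V C D y) (VHom C c y) (comparison c \<kappa> y) \<longleftrightarrow> U y"
    if y [simp]: "y \<in> VObj C" for y
  proof -
    have cmp: "comparison c \<kappa> y j \<in> hom V (VHom C c y) (ihom V (f_obj W j) (VHom C (f_obj D j) y))" if "j \<in> VObj J" for j
      using comparison(1)[where \<kappa> = \<kappa>, OF c y that \<kappa>[OF that]] .
    let ?wedge = "wedge V (op_vcat V J) (self_enriched V) W (hom_from V C D y)"
    let ?f = "\<lambda>\<mu> j. (f_obj D j, y, C.unc (f_obj W j) (VHom C (f_obj D j) y) (\<mu> j))"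
    have eq: "comparison c \<kappa> y j \<cdot> h = \<mu> j \<longleftrightarrow> gcomp V C (c, y, h) (kap c \<kappa> j) = ?f \<mu> j"
      if "h \<in> hom V m (VHom C c y)" "\<mu> j \<in> hom V m (ihom V (f_obj W j) (VHom C (f_obj D j) y))" "j \<in> VObj J" for h m \<mu> j
    proof -
      have "gcomp V C (c, y, h) (kap c \<kappa> j) = ?f \<mu> j \<longleftrightarrow>
        C.unc (f_obj W j) (VHom C (f_obj D j) y) (comparison c \<kappa> y j \<cdot> h) = C.unc (f_obj W j) (VHom C (f_obj D j) y) (\<mu> j)"
        using comparison(2)[where \<kappa> = \<kappa>, OF c y that(3) \<kappa>[OF that(3)], where h = "(c, y, h)"] that y by (auto dest: sym)
      thus ?thesis
        using C.unc_inj[of "comparison c \<kappa> y j \<cdot> h" "\<mu> j" "f_obj W j" "VHom C (f_obj D j) y"] cmp[of j] that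
        by auto
    qed
    have w0: "?wedge (VHom C c y) (comparison c \<kappa> y)"
    proof -
      have fam: "family (VHom C c y) y (\<lambda>j. gcomp V C (gen V C c y) (kap c \<kappa> j))"
        using family_induced[OF kap nat, of "gen V C c y"] by simp
      have "?f (comparison c \<kappa> y) j = gcomp V C (gen V C c y) (kap c \<kappa> j)" if "j \<in> VObj J" for j
        using comparison(2)[where \<kappa> = \<kappa>, OF c y that \<kappa>[OF that], where h = "gen V C c y"] cmp[OF that] by simp
      hence "family (VHom C c y) y (?f (comparison c \<kappa> y))"
        using fam by (simp add: family_def)
      thus ?thesis using cmp by (subst wedge_iff_family) auto
    qed
    have ex1: "(\<exists>!h. h \<in> hom V m (VHom C c y) \<and> (\<forall>j \<in> VObj J. comparison c \<kappa> y j \<cdot> h = \<mu> j)) \<longleftrightarrow>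
       (\<exists>!h. garr V C h \<and> gdom h = c \<and> gcod h = y \<and> gr V h = m \<and> (\<forall>j \<in> VObj J. gcomp V C h (kap c \<kappa> j) = ?f \<mu> j))"
      if \<mu>: "\<forall>j \<in> VObj J. \<mu> j \<in> hom V m (ihom V (f_obj W j) (VHom C (f_obj D j) y))" for m \<mu>
    proof -
      let ?P = "\<lambda>h. h \<in> hom V m (VHom C c y) \<and> (\<forall>j \<in> VObj J. comparison c \<kappa> y j \<cdot> h = \<mu> j)"
      let ?Q = "\<lambda>h. garr V C h \<and> gdom h = c \<and> gcod h = y \<and> gr V h = m \<and> (\<forall>j \<in> VObj J. gcomp V C h (kap c \<kappa> j) = ?f \<mu> j)"
      have PQ: "?P h \<longleftrightarrow> ?Q (c, y, h)" for h
        using eq[of h m] \<mu> by auto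
      have "(c, y, gmor q) = q" if "?Q q" for q
        using that g_triple[of q] by auto
      thus ?thesis
        using PQ by (intro ex1_transfer[where F = "\<lambda>h. (c, y, h)" and G = gmor]) simp_all
    qed
    show ?thesis
    proof
      assume *: "is_nat_object V (op_vcat V J) (self_enriched V) W (hom_from V C D y) (VHom C c y) (comparison c \<kappa> y)"
      show "U y" unfolding U_def E_def
      proof (intro allI impI)
        fix m f assume f: "family m y f"
        \<comment> \<open>Currying turns the family back into a wedge, to which the universal
          property of the hom object applies.\<close>
        define \<mu> where "\<mu> j = curry V m (f_obj W j) (VHom C (f_obj D j) y) (gmor (f j))" for j
        have \<mu>: "\<mu> j \<in> hom V m (ihom V (f_obj W j) (VHom C (f_obj D j) y))" "?f \<mu> j = f j" if "j \<in> VObj J" for j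
          using f that g_triple[of "f j"] by (auto simp: family_def \<mu>_def)
        have "family m y (?f \<mu>)" using f by (simp add: family_def \<mu>)
        hence "?wedge m \<mu>" using \<mu> by (subst wedge_iff_family) auto
        hence "\<exists>!h. h \<in> hom V m (VHom C c y) \<and> (\<forall>j \<in> VObj J. comparison c \<kappa> y j \<cdot> h = \<mu> j)"
          using * by (simp add: is_nat_object_def del: in_hom)
        hence "\<exists>!h. garr V C h \<and> gdom h = c \<and> gcod h = y \<and> gr V h = m \<and> (\<forall>j \<in> VObj J. gcomp V C h (kap c \<kappa> j) = ?f \<mu> j)"
          using ex1[of \<mu> m] \<mu>(1) by blast
        thus "\<exists>!h. garr V C h \<and> gdom h = c \<and> gcod h = y \<and> gr V h = m \<and> (\<forall>j \<in> VObj J. gcomp V C h (kap c \<kappa> j) = f j)"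
          using \<mu>(2) by simp
      qed
    next
      assume U: "U y"
      show "is_nat_object V (op_vcat V J) (self_enriched V) W (hom_from V C D y) (VHom C c y) (comparison c \<kappa> y)"
        unfolding is_nat_object_def
      proof (intro conjI w0 allI impI)
        fix m \<mu> assume "?wedge m \<mu>"
        hence \<mu>: "\<forall>j \<in> VObj J. \<mu> j \<in> hom V m (ihom V (f_obj W j) (VHom C (f_obj D j) y))" "family m y (?f \<mu>)"
          by (simp_all add: wedge_iff_family)
        show "\<exists>!h. h \<in> hom V m (VHom C c y) \<and> (\<forall>j \<in> VObj (op_vcat V J). comparison c \<kappa> y j \<cdot> h = \<mu> j)"
          using ex1[OF \<mu>(1)] U \<mu>(2) unfolding U_def E_def J.op_simps by blast
      qed
    qed
  qed
  thus ?thesis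
    using True unfolding is_weighted_colimit_def nat_trans_iff_kap[OF c] gU comparison_def by (simp add: comparison_def)
qed

end

section \<open>Module-weighted colimits\<close>

text \<open>A morphism of monoids from \<open>b\<close> to the endomorphism monoid of an object,
  written as an endo-arrow of grade \<open>b\<close>.\<close>

definition gaction :: "('vo, 'va, 'm) smc_scheme \<Rightarrow> ('o, 'vo, 'va) vcat \<Rightarrow> ('vo, 'va) mon \<Rightarrow> 'o \<times> 'o \<times> 'va \<Rightarrow> bool" where
  "gaction V C b r \<longleftrightarrow> garr V C r \<and> gcod r = gdom r \<and> gr V r = m_obj b \<and>
     gre V r (m_unit b) = gid C (gdom r) \<and> gcomp V C r r = gre V r (m_mult b)"

text \<open>
  For \<open>r\<close> an endo-arrow of \<open>X\<close> of grade \<open>b\<close> and \<open>\<gamma> : z \<odot> b \<rightarrow> z\<close>, the target of \<open>k\<close> is \<open>z \<circledast> X\<close>;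
  \<open>tuniv\<close> is the case of a tensor.
\<close>

definition buniv :: "('vo, 'va, 'm) smc_scheme \<Rightarrow> ('o, 'vo, 'va) vcat \<Rightarrow> 'o \<times> 'o \<times> 'va \<Rightarrow> 'va \<Rightarrow> 'o \<times> 'o \<times> 'va \<Rightarrow> bool" where
  "buniv V C r \<gamma> k \<longleftrightarrow> garr V C k \<and> gdom k = gdom r \<and> gcomp V C k r = gre V k \<gamma> \<and>
     (\<forall>m f. m \<in> Obj V \<and> garr V C f \<and> gdom f = gdom r \<and> gr V f = m \<odot>\<^bsub>V\<^esub> gr V k \<and>
        gcomp V C f r = gre V f ((Ide V m \<otimes>\<^bsub>V\<^esub> \<gamma>) \<cdot>\<^bsub>V\<^esub> assoc V m (gr V k) (gr V r)) \<longrightarrow>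
        (\<exists>!h. garr V C h \<and> gdom h = gcod k \<and> gcod h = gcod f \<and> gr V h = m \<and> gcomp V C h k = f))"

definition tuniv :: "('vo, 'va, 'm) smc_scheme \<Rightarrow> ('o, 'vo, 'va) vcat \<Rightarrow> 'o \<times> 'o \<times> 'va \<Rightarrow> bool" where
  "tuniv V C k \<longleftrightarrow> garr V C k \<and>
     (\<forall>m f. m \<in> Obj V \<and> garr V C f \<and> gdom f = gdom k \<and> gr V f = m \<odot>\<^bsub>V\<^esub> gr V k \<longrightarrow>
        (\<exists>!h. garr V C h \<and> gdom h = gcod k \<and> gcod h = gcod f \<and> gr V h = m \<and> gcomp V C h k = f))"

text \<open>The only object is \<open>undefined\<close>, an unspecified element, since a small
  diagram has its objects in the type \<open>'u\<close>.\<close>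

definition one_obj :: "('vo, 'va) mon \<Rightarrow> ('u, 'vo, 'va) vcat" where
  "one_obj b = \<lparr>VObj = {undefined}, VHom = (\<lambda>_ _. m_obj b), VId = (\<lambda>_. m_unit b), VComp = (\<lambda>_ _ _. m_mult b)\<rparr>"

definition action_functor :: "'o \<times> 'o \<times> 'va \<Rightarrow> ('u, 'o, 'va) vfun" where
  "action_functor r = \<lparr>f_obj = (\<lambda>_. gdom r), f_hom = (\<lambda>_ _. gmor r)\<rparr>"

text \<open>A right module as a contravariant functor on the one-object category. The symmetry puts
  \<open>b\<close> first before currying; \<open>weight_action\<close> shows that the symmetry in
  \<open>wact\<close> undoes it.\<close>

definition module_weight :: "('vo, 'va, 'm) smc_scheme \<Rightarrow> ('vo, 'va) mon \<Rightarrow> 'vo \<times> 'va \<Rightarrow> ('u, 'vo, 'va) vfun" where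
  "module_weight V b Z = \<lparr>f_obj = (\<lambda>_. fst Z), f_hom = (\<lambda>_ _. curry V (m_obj b) (fst Z) (fst Z)
     (snd Z \<cdot>\<^bsub>V\<^esub> symm V (m_obj b) (fst Z)))\<rparr>"

lemma diagram_simps [simp]: "f_obj (action_functor r) j = gdom r" "f_hom (action_functor r) i j = gmor r"
  "f_obj (module_weight V b Z) j = fst Z" "f_hom (module_weight V b Z) i j =
    curry V (m_obj b) (fst Z) (fst Z) (snd Z \<cdot>\<^bsub>V\<^esub> symm V (m_obj b) (fst Z))"
  by (simp_all add: action_functor_def module_weight_def)

lemma one_obj_simps [simp]: "VObj (one_obj b) = {undefined}" "VHom (one_obj b) i j = m_obj b"
  "VId (one_obj b) i = m_unit b" "VComp (one_obj b) i j k = m_mult b"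
  by (simp_all add: one_obj_def)

lemma comp_vfun_simps [simp]: "f_obj (comp_vfun V G F) x = f_obj G (f_obj F x)"
  "f_hom (comp_vfun V G F) x y = f_hom G (f_obj F x) (f_obj F y) \<cdot>\<^bsub>V\<^esub> f_hom F x y"
  by (simp_all add: comp_vfun_def)

lemma enriched_comp_vfun:
  assumes "enriched_functor V A B F" "enriched_functor V B C G"
  shows "enriched_functor V A C (comp_vfun V G F)"
proof -
  interpret F: enriched_functor V A B F by fact
  interpret G: enriched_functor V B C G by fact
  have fapp: "fapp V (comp_vfun V G F) p = fapp V G (fapp V F p)" if "garr V A p" for p
    using that by (simp add: fapp_def)
  show ?thesis
    by (rule enriched_functorI[OF F.A.enriched_category_axioms G.B.enriched_category_axioms])
      (simp_all add: fapp F.fapp_gcomp G.fapp_gcomp)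
qed

lemma fapp_comp_vfun:
  assumes "enriched_functor V A B F" "enriched_functor V B C G" "garr V A p"
  shows "fapp V (comp_vfun V G F) p = fapp V G (fapp V F p)"
proof -
  interpret F: enriched_functor V A B F by fact
  interpret G: enriched_functor V B C G by fact
  show ?thesis using assms(3) by (simp add: fapp_def)
qed

section \<open>Right modules as weights on a one-object category\<close>

locale monoid_ctx = closed_symmetric_monoidal V
  for V :: "('vo, 'va, 'm) smc_scheme" (structure) +
  fixes b :: "('vo, 'va) mon"
  assumes monoid: "monoid_in V b"
begin

abbreviation "B \<equiv> m_obj b"
abbreviation "u \<equiv> m_unit b"
abbreviation "m \<equiv> m_mult b"

lemma monoid_arr [simp]: "B \<in> Obj V" "u \<in> Arr V" "Dom V u = \<one>" "Cod V u = B"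
  "m \<in> Arr V" "Dom V m = B \<odot> B" "Cod V m = B"
  using monoid by (simp_all add: monoid_in_def Let_def)

lemma monoid_laws: "m \<cdot> (m \<otimes> Ide V B) = m \<cdot> (Ide V B \<otimes> m) \<cdot> assoc V B B B"
  "m \<cdot> (u \<otimes> Ide V B) = lunit V B" "m \<cdot> (Ide V B \<otimes> u) = runit V B"
  using monoid by (simp_all add: monoid_in_def Let_def)

lemma modulesI:
  assumes "z \<in> Obj V" "\<gamma> \<in> hom V (z \<odot> B) z"
    "\<gamma> \<cdot> (\<gamma> \<otimes> Ide V B) = \<gamma> \<cdot> (Ide V z \<otimes> m) \<cdot> assoc V z B B" "\<gamma> \<cdot> (Ide V z \<otimes> u) = runit V z"
  shows "(z, \<gamma>) \<in> right_modules V b"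
  using assms by (simp add: right_modules_def Let_def)

lemma module_arr [simp]:
  assumes "Z \<in> right_modules V b"
  shows "fst Z \<in> Obj V" "snd Z \<in> Arr V" "Dom V (snd Z) = fst Z \<odot> B" "Cod V (snd Z) = fst Z"
  using assms by (auto simp: right_modules_def Let_def)

lemma module_laws:
  assumes "Z \<in> right_modules V b"
  shows "snd Z \<cdot> (snd Z \<otimes> Ide V B) = snd Z \<cdot> (Ide V (fst Z) \<otimes> m) \<cdot> assoc V (fst Z) B B"
    "snd Z \<cdot> (Ide V (fst Z) \<otimes> u) = runit V (fst Z)"
  using assms by (auto simp: right_modules_def Let_def)

lemma regular_module: "(B, m) \<in> right_modules V b"
  using monoid_laws by (intro modulesI) simp_all

lemma enriched_one_obj: "enriched_category V (one_obj b)"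
  using monoid_laws by unfold_locales simp_all

text \<open>After uncurrying, contravariant functoriality is the module law with its three factors
  reversed, and \<open>reverse\<close> links the two. The unit law passes through
  \<open>lunit_symm\<close>.\<close>

lemma enriched_module_weight:
  assumes Z: "Z \<in> right_modules V b"
  shows "enriched_functor V (op_vcat V (one_obj b)) (self_enriched V) (module_weight V b Z)"
proof -
  define z \<gamma> where "z = fst Z" and "\<gamma> = snd Z"
  have [simp]: "z \<in> Obj V" "\<gamma> \<in> Arr V" "Dom V \<gamma> = z \<odot> B" "Cod V \<gamma> = z"
    using Z by (simp_all add: z_def \<gamma>_def)
  have laws: "\<gamma> \<cdot> (\<gamma> \<otimes> Ide V B) = \<gamma> \<cdot> (Ide V z \<otimes> m) \<cdot> assoc V z B B" "\<gamma> \<cdot> (Ide V z \<otimes> u) = runit V z"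
    using module_laws[OF Z] by (simp_all add: z_def \<gamma>_def)
  interpret O: enriched_category V "one_obj b" by (rule enriched_one_obj)
  let ?c = "curry V B z z (\<gamma> \<cdot> symm V B z)"
  have "unc z z (?c \<cdot> u) = \<gamma> \<cdot> (symm V B z \<cdot> (u \<otimes> Ide V z))"
    by (subst unc_comp) simp_all
  also have "\<dots> = (\<gamma> \<cdot> (Ide V z \<otimes> u)) \<cdot> symm V \<one> z"
    by (subst symm_nat_arr) simp_all
  also have "\<dots> = (lunit V z \<cdot> symm V z \<one>) \<cdot> symm V \<one> z"
    unfolding laws by (subst lunit_symm) simp_all
  also have "\<dots> = unc z z (VId (self_enriched V) z)" by simp
  finally have id: "?c \<cdot> u = VId (self_enriched V) z"
    by (rule unc_inj[rotated -1]) simp_all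
  have "unc z z (VComp (self_enriched V) z z z \<cdot> (?c \<otimes> ?c)) =
     \<gamma> \<cdot> (symm V B z \<cdot> (Ide V B \<otimes> (\<gamma> \<cdot> symm V B z))) \<cdot> assoc V B B z"
    by (subst unc_self_comp) simp_all
  also have "\<dots> = (\<gamma> \<cdot> (\<gamma> \<otimes> Ide V B)) \<cdot> (symm V B z \<otimes> Ide V B) \<cdot> symm V B (B \<odot> z) \<cdot> assoc V B B z"
    by (subst symm_nat_arr) simp_all
  also have "\<dots> = \<gamma> \<cdot> (Ide V z \<otimes> m) \<cdot>
      (assoc V z B B \<cdot> (symm V B z \<otimes> Ide V B) \<cdot> symm V B (B \<odot> z) \<cdot> assoc V B B z)"
    unfolding laws by simp
  also have "\<dots> = \<gamma> \<cdot> ((Ide V z \<otimes> (m \<cdot> symm V B B)) \<cdot> symm V (B \<odot> B) z)"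
    by (subst reverse) simp_all
  also have "\<dots> = \<gamma> \<cdot> (symm V B z \<cdot> ((m \<cdot> symm V B B) \<otimes> Ide V z))"
    by (subst symm_nat_arr) simp_all
  also have "\<dots> = unc z z (?c \<cdot> m \<cdot> symm V B B)"
    by (subst unc_comp) simp_all
  finally have comp: "?c \<cdot> m \<cdot> symm V B B = VComp (self_enriched V) z z z \<cdot> (?c \<otimes> ?c)"
    by (rule unc_inj[rotated -1, OF sym]) simp_all
  show ?thesis
    by (intro enriched_functor.intro O.enriched_op enriched_self enriched_functor_axioms.intro)
      (simp_all add: z_def[symmetric] \<gamma>_def[symmetric] id comp)
qed

lemma weight_action:
  assumes Z: "Z \<in> right_modules V b"
  shows "wact (one_obj b) (module_weight V b Z) i j = snd Z"
  using Z by (simp add: wact_def)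

end

lemma (in enriched_category) enriched_action_functor:
  assumes "monoid_in V b" "gaction V C b r"
  shows "enriched_functor V (one_obj b) C (action_functor r)"
proof -
  interpret monoid_ctx V b using assms(1) by unfold_locales
  have r: "garr V C r" "gcod r = gdom r" "gr V r = B"
     "gre V r u = gid C (gdom r)" "gcomp V C r r = gre V r m"
    using assms(2) by (simp_all add: gaction_def)
  have "gmor r \<cdot> u = VId C (gdom r)" "gmor r \<cdot> m = VComp C (gdom r) (gdom r) (gdom r) \<cdot> (gmor r \<otimes> gmor r)"
    using arg_cong[OF r(4), of gmor] arg_cong[OF r(5), of gmor] r(2) by (simp_all add: gcomp_def)
  thus ?thesis
    using r(1-3) by (intro enriched_functor.intro enriched_one_obj enriched_category_axioms enriched_functor_axioms.intro)
      simp_all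
qed

text \<open>A family over a single object is its value there; a constant function realises any
  prescribed value.\<close>

lemma all_eval: "(\<forall>m f. Q m (f a)) \<longleftrightarrow> (\<forall>m x. Q m x)"
proof (intro iffI allI)
  fix m x assume *: "\<forall>m f. Q m (f a)"
  show "Q m x" using *[rule_format, of m "\<lambda>_. x"] .
qed simp

section \<open>Colimits of one-object diagrams\<close>

locale one_object_diagram = C: enriched_category V C + monoid_ctx V b
  for V :: "('vo, 'va, 'm) smc_scheme" (structure) and C :: "('o, 'vo, 'va) vcat" and b :: "('vo, 'va) mon" +
  fixes Z :: "'vo \<times> 'va" and r :: "'o \<times> 'o \<times> 'va"
  assumes Z: "Z \<in> right_modules V b" and r: "gaction V C b r"
begin

sublocale weighted_diagram V C "one_obj b" "module_weight V b Z" "action_functor r"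
  by (intro weighted_diagram.intro C.enriched_category_axioms enriched_one_obj enriched_module_weight Z
      C.enriched_action_functor r monoid)

lemma r_arr [simp]: "garr V C r" "gcod r = gdom r" "gr V r = B"
  using r by (simp_all add: gaction_def)

lemma small:
  assumes "infinite (UNIV :: 'u set)"
  shows "small_weighted_diagram V (one_obj b :: ('u, 'vo, 'va) vcat) C (module_weight V b Z) (action_functor r)"
  unfolding small_weighted_diagram_def
  by (intro conjI enriched_one_obj enriched_module_weight Z C.enriched_action_functor r monoid finite_card_less assms) simp

text \<open>A single object leaves one leg and one compatibility equation, and this equation is the
  balancing condition.\<close>

lemma gcolim_iff_buniv:
  "gcolim c k \<longleftrightarrow> buniv V C r (snd Z) (k undefined) \<and> gcod (k undefined) = c \<and> gr V (k undefined) = fst Z"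
proof -
  have D: "fapp V (action_functor r) (gen V (one_obj b) undefined undefined) = r"
    by (rule g_eqI) (simp_all add: fapp_def)
  have fam: "family m y f \<longleftrightarrow> m \<in> Obj V \<and> garr V C (f undefined) \<and> gdom (f undefined) = gdom r \<and> gcod (f undefined) = y \<and>
       gr V (f undefined) = m \<odot> fst Z \<and>
       gcomp V C (f undefined) r = gre V (f undefined) ((Ide V m \<otimes> snd Z) \<cdot> assoc V m (fst Z) B)" for m y f
    using C.garr_simps(2) by (auto simp: family_def D weight_action[OF Z])
  show ?thesis
  proof (cases "garr V C (k undefined) \<and> gdom (k undefined) = gdom r \<and> gcod (k undefined) = c \<and> gr V (k undefined) = fst Z")
    case True
    then show ?thesis
      using C.garr_simps(2)[of "k undefined"]
      unfolding gcolim_def buniv_def fam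
      by (simp add: D weight_action[OF Z]) (intro impI conj_cong refl all_eval)
  next
    case False
    then show ?thesis
      by (auto simp: gcolim_def buniv_def)
  qed
qed

lemma colimit_imp_buniv:
  assumes "is_weighted_colimit V (one_obj b) C (module_weight V b Z) (action_functor r) c \<kappa>"
  shows "buniv V C r (snd Z) (kap c \<kappa> undefined)" "gr V (kap c \<kappa> undefined) = fst Z"
  using assms unfolding weighted_colimit_iff gcolim_iff_buniv by blast+

lemma buniv_exists:
  assumes "infinite (UNIV :: 'u set)" "enriched_cocomplete TYPE('u) V C"
  shows "\<exists>k. buniv V C r (snd Z) k \<and> gr V k = fst Z"
proof -
  obtain c and \<kappa> :: "'u \<Rightarrow> 'va"
    where "is_weighted_colimit V (one_obj b) C (module_weight V b Z) (action_functor r) c \<kappa>"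
    using small[OF assms(1)] assms(2) unfolding enriched_cocomplete_def by blast
  hence "buniv V C r (snd Z) (kap c \<kappa> undefined) \<and> gr V (kap c \<kappa> undefined) = fst Z"
    unfolding weighted_colimit_iff gcolim_iff_buniv by blast
  thus ?thesis by blast
qed

end

text \<open>Cocontinuity speaks of weighted colimits, so \<open>k\<close> is presented as the unit
  of one, its image is taken there, and the result is read back as a universal balanced
  arrow.\<close>

lemma cocontinuous_buniv:
  fixes C :: "('o, 'vo, 'va) vcat" and E :: "('p, 'vo, 'va) vcat"
  assumes inf: "infinite (UNIV :: 'u set)" and G: "enriched_functor V C E G"
    and cocont: "cocontinuous TYPE('u) V C E G"
    and b: "monoid_in V b" and Z: "Z \<in> right_modules V b" and r: "gaction V C b r"
    and k: "buniv V C r (snd Z) k" "gr V k = fst Z"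
  shows "buniv V E (fapp V G r) (snd Z) (fapp V G k)"
proof -
  interpret G: enriched_functor V C E G by fact
  interpret D: one_object_diagram V C b Z r
    by (intro one_object_diagram.intro monoid_ctx.intro one_object_diagram_axioms.intro monoid_ctx_axioms.intro
        G.A.enriched_category_axioms G.A.closed_symmetric_monoidal_axioms b Z r)
  have r': "gaction V E b (fapp V G r)"
    using r D.r_arr by (simp add: gaction_def G.fapp_gcomp[symmetric] G.fapp_gre[symmetric] del: G.fapp_gre)
  interpret D': one_object_diagram V E b Z "fapp V G r"
    by (intro one_object_diagram.intro monoid_ctx.intro one_object_diagram_axioms.intro monoid_ctx_axioms.intro
        G.B.enriched_category_axioms G.A.closed_symmetric_monoidal_axioms b Z r')
  have karr: "garr V C k" "gdom k = gdom r" using k(1) by (auto simp: buniv_def)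
  \<comment> \<open>\<open>k\<close> with a unit object inserted and then curried: the family whose
    \<open>kap\<close> is \<open>k\<close> again.\<close>
  define \<kappa> :: "'u \<Rightarrow> 'va" where "\<kappa> = (\<lambda>_. curry V \<one>\<^bsub>V\<^esub> (fst Z) (VHom C (gdom r) (gcod k)) (gmor k \<cdot>\<^bsub>V\<^esub> lunit V (fst Z)))"
  have kap: "D.kap (gcod k) \<kappa> undefined = k"
    using karr k(2) G.A.closed_symmetric_monoidal_axioms Z
    by (intro g_eqI) (simp_all add: D.kap_def \<kappa>_def)
  have "is_weighted_colimit V (one_obj b) C (module_weight V b Z) (action_functor r) (gcod k) \<kappa>"
    unfolding D.weighted_colimit_iff D.gcolim_iff_buniv kap
    using k karr Z by (simp add: \<kappa>_def)
  hence "is_weighted_colimit V (one_obj b) E (module_weight V b Z) (comp_vfun V G (action_functor r)) (f_obj G (gcod k))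
    (\<lambda>j. ihom_post V (f_obj (module_weight V b Z) j) (f_hom G (f_obj (action_functor r) j) (gcod k)) \<cdot>\<^bsub>V\<^esub> \<kappa> j)"
    (is "is_weighted_colimit _ _ _ _ _ _ ?\<kappa>'")
    using cocont D.small[OF inf] unfolding cocontinuous_def by blast
  \<comment> \<open>The two functors are equal on the nose, both being constant functions of the
    index.\<close>
  moreover have "comp_vfun V G (action_functor r :: ('u, 'o, 'va) vfun) = action_functor (fapp V G r)"
    by (simp add: comp_vfun_def action_functor_def fapp_def comp_def D.r_arr)
  ultimately have *: "is_weighted_colimit V (one_obj b) E (module_weight V b Z) (action_functor (fapp V G r)) (f_obj G (gcod k)) ?\<kappa>'"
    by simp
  have "D'.kap (f_obj G (gcod k)) ?\<kappa>' undefined = fapp V G k"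
  proof (rule g_eqI)
    have "G.A.unc (fst Z) (VHom E (f_obj G (gdom r)) (f_obj G (gcod k)))
       (ihom_post V (fst Z) (f_hom G (gdom r) (gcod k)) \<cdot>\<^bsub>V\<^esub> \<kappa> undefined) =
       f_hom G (gdom r) (gcod k) \<cdot>\<^bsub>V\<^esub> G.A.unc (fst Z) (VHom C (gdom r) (gcod k)) (\<kappa> undefined)"
      using karr k(2) Z by (subst G.A.unc_ihom_post) (simp_all add: \<kappa>_def)
    thus "gmor (D'.kap (f_obj G (gcod k)) ?\<kappa>' undefined) = gmor (fapp V G k)"
      using karr k(2) Z by (simp add: D'.kap_def \<kappa>_def) (simp add: fapp_def)
  qed (simp_all add: karr D'.kap_def)
  thus ?thesis using D'.colimit_imp_buniv(1)[OF *] by simp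
qed

text \<open>A left adjoint preserves weighted colimits. The adjunction is given by universal arrows
  \<open>e y\<close> against arrows of every grade, so transposition is a bijection on graded arrows
  and carries families over the composite of \<open>D\<close> with \<open>F\<close> to families over
  \<open>D\<close>.\<close>

lemma cocontinuousI:
  fixes A :: "('o, 'vo, 'va) vcat" and C :: "('p, 'vo, 'va) vcat"
  assumes F: "enriched_functor V A C F"
    and R: "\<And>y. y \<in> VObj C \<Longrightarrow> R y \<in> VObj A"
    and e: "\<And>y. y \<in> VObj C \<Longrightarrow> garr V C (e y) \<and> gr V (e y) = \<one>\<^bsub>V\<^esub> \<and> gdom (e y) = f_obj F (R y) \<and> gcod (e y) = y"
    and univ: "\<And>y x g. y \<in> VObj C \<Longrightarrow> x \<in> VObj A \<Longrightarrow> garr V C g \<Longrightarrow> gdom g = f_obj F x \<Longrightarrow> gcod g = y \<Longrightarrow>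
      \<exists>!h. garr V A h \<and> gdom h = x \<and> gcod h = R y \<and> gr V h = gr V g \<and> gpost V C (e y) (fapp V F h) = g"
  shows "cocontinuous TYPE('u) V A C F"
  unfolding cocontinuous_def
proof (intro allI impI, elim conjE)
  fix J :: "('u, 'vo, 'va) vcat" and W D c \<kappa>
  assume sm: "small_weighted_diagram V J A W D" and colim: "is_weighted_colimit V J A W D c \<kappa>"
  interpret F: enriched_functor V A C F by fact
  have D: "enriched_functor V J A D" and W: "enriched_functor V (op_vcat V J) (self_enriched V) W" and J: "enriched_category V J"
    using sm by (simp_all add: small_weighted_diagram_def)
  note FD = enriched_comp_vfun[OF D F]
  interpret D: weighted_diagram V A J W D
    by (intro weighted_diagram.intro F.A.enriched_category_axioms J W D)
  interpret D': weighted_diagram V C J W "comp_vfun V F D"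
    by (intro weighted_diagram.intro F.B.enriched_category_axioms J W FD)
  let ?\<kappa>' = "\<lambda>j. ihom_post V (f_obj W j) (f_hom F (f_obj D j) c) \<cdot>\<^bsub>V\<^esub> \<kappa> j"
  have \<kappa>: "\<kappa> j \<in> hom V \<one>\<^bsub>V\<^esub> (ihom V (f_obj W j) (VHom A (f_obj D j) c))" if "j \<in> VObj J" for j
    using colim that unfolding D.weighted_colimit_iff by blast
  have gc: "D.gcolim c (D.kap c \<kappa>)"
    using colim unfolding D.weighted_colimit_iff by blast
  hence [simp]: "c \<in> VObj A"
    and k [simp]: "\<And>j. j \<in> VObj J \<Longrightarrow> garr V A (D.kap c \<kappa> j)" "\<And>j. j \<in> VObj J \<Longrightarrow> gr V (D.kap c \<kappa> j) = f_obj W j"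
    and knat: "\<And>i j. i \<in> VObj J \<Longrightarrow> j \<in> VObj J \<Longrightarrow> gcomp V A (D.kap c \<kappa> j) (fapp V D (gen V J i j)) = gre V (D.kap c \<kappa> i) (D.act i j)"
    and kuniv: "\<And>m y f. D.family m y f \<Longrightarrow> (\<exists>!h. garr V A h \<and> gdom h = c \<and> gcod h = y \<and> gr V h = m \<and>
        (\<forall>j \<in> VObj J. gcomp V A h (D.kap c \<kappa> j) = f j))"
    unfolding D.gcolim_def by blast+
  have fD [simp]: "fapp V (comp_vfun V F D) (gen V J i j) = fapp V F (fapp V D (gen V J i j))"
    if "i \<in> VObj J" "j \<in> VObj J" for i j
    using that by (intro fapp_comp_vfun[OF D F]) simp
  have kap: "D'.kap (f_obj F c) ?\<kappa>' j = fapp V F (D.kap c \<kappa> j)" if "j \<in> VObj J" for j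
  proof (rule g_eqI)
    have "F.A.unc (f_obj W j) (VHom C (f_obj F (f_obj D j)) (f_obj F c)) (?\<kappa>' j) =
       f_hom F (f_obj D j) c \<cdot>\<^bsub>V\<^esub> F.A.unc (f_obj W j) (VHom A (f_obj D j) c) (\<kappa> j)"
      using that \<kappa>[OF that] by (subst F.A.unc_ihom_post) simp_all
    thus "gmor (D'.kap (f_obj F c) ?\<kappa>' j) = gmor (fapp V F (D.kap c \<kappa> j))"
      using that \<kappa>[OF that] by (simp add: D'.kap_def D.kap_def) (simp add: fapp_def)
  qed simp_all
  have gc': "D'.gcolim (f_obj F c) (\<lambda>j. fapp V F (D.kap c \<kappa> j))"
    unfolding D'.gcolim_def
  proof (intro conjI ballI allI impI)
    fix i j assume [simp]: "i \<in> VObj J" "j \<in> VObj J"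
    show "gcomp V C (fapp V F (D.kap c \<kappa> j)) (fapp V (comp_vfun V F D) (gen V J i j)) = gre V (fapp V F (D.kap c \<kappa> i)) (D.act i j)"
      using knat[of i j] by (simp add: F.fapp_gcomp[symmetric])
  next
    fix m y f assume f: "D'.family m y f"
    hence [simp]: "m \<in> Obj V" "y \<in> VObj C"
      and f1 [simp]: "\<And>j. j \<in> VObj J \<Longrightarrow> garr V C (f j)" "\<And>j. j \<in> VObj J \<Longrightarrow> gdom (f j) = f_obj F (f_obj D j)"
        "\<And>j. j \<in> VObj J \<Longrightarrow> gcod (f j) = y" "\<And>j. j \<in> VObj J \<Longrightarrow> gr V (f j) = m \<odot>\<^bsub>V\<^esub> f_obj W j"
      and fnat: "\<And>i j. i \<in> VObj J \<Longrightarrow> j \<in> VObj J \<Longrightarrow> gcomp V C (f j) (fapp V F (fapp V D (gen V J i j))) =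
        gre V (f i) ((Ide V m \<otimes>\<^bsub>V\<^esub> D.act i j) \<cdot>\<^bsub>V\<^esub> assoc V m (f_obj W j) (VHom J i j))"
      by (simp_all add: D'.family_def)
    note [simp] = R[of y] e[of y]
    \<comment> \<open>Transposition is injective at every grade. This serves twice: for
      compatibility of the transposed legs and for uniqueness of the factorisation.\<close>
    have uniq: "g = h" if "garr V A g" "garr V A h" "gdom g = gdom h" "gcod g = R y" "gcod h = R y" "gr V g = gr V h"
      "gpost V C (e y) (fapp V F g) = gpost V C (e y) (fapp V F h)" for g h
    proof -
      have "\<exists>!p. garr V A p \<and> gdom p = gdom h \<and> gcod p = R y \<and> gr V p = gr V (gpost V C (e y) (fapp V F h)) \<and>
          gpost V C (e y) (fapp V F p) = gpost V C (e y) (fapp V F h)"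
        using that by (intro univ) simp_all
      thus ?thesis using that by auto
    qed
    have ex: "\<exists>h. garr V A h \<and> gdom h = f_obj D j \<and> gcod h = R y \<and> gr V h = gr V (f j) \<and>
        gpost V C (e y) (fapp V F h) = f j" if "j \<in> VObj J" for j
      using univ[of y "f_obj D j" "f j"] that by auto
    have "\<exists>g. \<forall>j \<in> VObj J. garr V A (g j) \<and> gdom (g j) = f_obj D j \<and> gcod (g j) = R y \<and> gr V (g j) = gr V (f j) \<and>
        gpost V C (e y) (fapp V F (g j)) = f j"
      using ex by (intro bchoice ballI)
    then obtain g where g [simp]: "\<And>j. j \<in> VObj J \<Longrightarrow> garr V A (g j)" "\<And>j. j \<in> VObj J \<Longrightarrow> gdom (g j) = f_obj D j"
        "\<And>j. j \<in> VObj J \<Longrightarrow> gcod (g j) = R y" "\<And>j. j \<in> VObj J \<Longrightarrow> gr V (g j) = m \<odot>\<^bsub>V\<^esub> f_obj W j"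
        and ge: "\<And>j. j \<in> VObj J \<Longrightarrow> gpost V C (e y) (fapp V F (g j)) = f j"
      by fastforce
    \<comment> \<open>The transposed legs form a family because their transposes back do and
      transposition is injective.\<close>
    have "gcomp V A (g j) (fapp V D (gen V J i j)) =
        gre V (g i) ((Ide V m \<otimes>\<^bsub>V\<^esub> D.act i j) \<cdot>\<^bsub>V\<^esub> assoc V m (f_obj W j) (VHom J i j))"
      if [simp]: "i \<in> VObj J" "j \<in> VObj J" for i j
    proof (rule uniq)
      have "gpost V C (e y) (fapp V F (gcomp V A (g j) (fapp V D (gen V J i j)))) =
         gcomp V C (gpost V C (e y) (fapp V F (g j))) (fapp V F (fapp V D (gen V J i j)))"
        by (simp add: F.fapp_gcomp F.B.gcomp_gpost)
      also have "\<dots> = gre V (gpost V C (e y) (fapp V F (g i))) ((Ide V m \<otimes>\<^bsub>V\<^esub> D.act i j) \<cdot>\<^bsub>V\<^esub> assoc V m (f_obj W j) (VHom J i j))"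
        by (simp add: ge fnat)
      also have "\<dots> = gpost V C (e y) (fapp V F (gre V (g i) ((Ide V m \<otimes>\<^bsub>V\<^esub> D.act i j) \<cdot>\<^bsub>V\<^esub> assoc V m (f_obj W j) (VHom J i j))))"
        by simp
      finally show "gpost V C (e y) (fapp V F (gcomp V A (g j) (fapp V D (gen V J i j)))) = \<dots>" .
    qed simp_all
    hence "D.family m (R y) g" by (simp add: D.family_def)
    then obtain h where h [simp]: "garr V A h" "gdom h = c" "gcod h = R y" "gr V h = m"
      and hk: "\<And>j. j \<in> VObj J \<Longrightarrow> gcomp V A h (D.kap c \<kappa> j) = g j"
      and h_uniq: "\<And>h'. garr V A h' \<Longrightarrow> gdom h' = c \<Longrightarrow> gcod h' = R y \<Longrightarrow> gr V h' = m \<Longrightarrow>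
         (\<And>j. j \<in> VObj J \<Longrightarrow> gcomp V A h' (D.kap c \<kappa> j) = g j) \<Longrightarrow> h' = h"
      using kuniv[of m "R y" g] by blast
    have comp: "gcomp V C (gpost V C (e y) (fapp V F p)) (fapp V F (D.kap c \<kappa> j)) = gpost V C (e y) (fapp V F (gcomp V A p (D.kap c \<kappa> j)))"
      if "j \<in> VObj J" "garr V A p" "gdom p = c" "gcod p = R y" for j p
      using that by (simp add: F.fapp_gcomp F.B.gcomp_gpost)
    show "\<exists>!h. garr V C h \<and> gdom h = f_obj F c \<and> gcod h = y \<and> gr V h = m \<and> (\<forall>j \<in> VObj J. gcomp V C h (fapp V F (D.kap c \<kappa> j)) = f j)"
    proof (rule ex1I[of _ "gpost V C (e y) (fapp V F h)"])
      show "garr V C (gpost V C (e y) (fapp V F h)) \<and> gdom (gpost V C (e y) (fapp V F h)) = f_obj F c \<and>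
          gcod (gpost V C (e y) (fapp V F h)) = y \<and> gr V (gpost V C (e y) (fapp V F h)) = m \<and>
          (\<forall>j \<in> VObj J. gcomp V C (gpost V C (e y) (fapp V F h)) (fapp V F (D.kap c \<kappa> j)) = f j)"
        by (simp add: comp hk ge)
    next
      fix p assume p: "garr V C p \<and> gdom p = f_obj F c \<and> gcod p = y \<and> gr V p = m \<and> (\<forall>j \<in> VObj J. gcomp V C p (fapp V F (D.kap c \<kappa> j)) = f j)"
      obtain q where q [simp]: "garr V A q" "gdom q = c" "gcod q = R y" "gr V q = m" and qp: "gpost V C (e y) (fapp V F q) = p"
        using univ[of y c p] p by auto
      have "q = h"
      proof (rule h_uniq)
        fix j assume [simp]: "j \<in> VObj J"
        show "gcomp V A q (D.kap c \<kappa> j) = g j"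
          using comp[of j q] p by (intro uniq) (simp_all add: qp ge)
      qed simp_all
      thus "p = gpost V C (e y) (fapp V F h)" using qp by simp
    qed
  qed simp_all
  show "is_weighted_colimit V J C W (comp_vfun V F D) (f_obj F c) ?\<kappa>'"
    unfolding D'.weighted_colimit_iff
  proof
    show "\<forall>j \<in> VObj J. ?\<kappa>' j \<in> hom V \<one>\<^bsub>V\<^esub> (ihom V (f_obj W j) (VHom C (f_obj (comp_vfun V F D) j) (f_obj F c)))"
      using \<kappa> by simp
    show "D'.gcolim (f_obj F c) (D'.kap (f_obj F c) ?\<kappa>')"
      using gc' kap unfolding D'.gcolim_def by simp
  qed
qed

section \<open>Tensors\<close>

context enriched_category begin

text \<open>Right cancellability against arrows of every grade. Universal arrows have it, so
  equations between arrows out of a tensor or out of \<open>z \<circledast> X\<close> are checked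
  after composing with the universal arrow.\<close>

definition gepi :: "'o \<times> 'o \<times> 'va \<Rightarrow> bool" where
  "gepi k \<longleftrightarrow> garr V C k \<and> (\<forall>f g. garr V C f \<and> garr V C g \<and> gdom f = gcod k \<and> gdom g = gcod k \<and>
     gcod f = gcod g \<and> gr V f = gr V g \<and> gcomp V C f k = gcomp V C g k \<longrightarrow> f = g)"

lemma gepiD:
  assumes "gepi k" "garr V C f" "garr V C g" "gdom f = gcod k" "gdom g = gcod k"
    "gcod f = gcod g" "gr V f = gr V g" "gcomp V C f k = gcomp V C g k"
  shows "f = g"
  using assms unfolding gepi_def by blast

text \<open>Lets a universal property at grade \<open>\<one>\<close>, where the composite has grade
  \<open>\<one> \<odot> z\<close>, be used in the form without the unit.\<close>

lemma gcomp_unit_iff: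
  assumes "garr V C k" "garr V C h" "gr V h = \<one>" "gdom h = gcod k"
    "garr V C g" "gr V g = gr V k"
  shows "gcomp V C h k = gre V g (lunit V (gr V k)) \<longleftrightarrow> gpost V C h k = g"
proof
  assume "gcomp V C h k = gre V g (lunit V (gr V k))"
  thus "gpost V C h k = g" using assms by (simp add: gpost_def gre_ide)
next
  assume "gpost V C h k = g"
  thus "gcomp V C h k = gre V g (lunit V (gr V k))"
    using assms by (auto simp: gpost_def gre_ide)
qed

lemma gepi_post:
  assumes "gepi k" "garr V C f" "garr V C g" "gdom f = gcod k" "gdom g = gcod k"
    "gcod f = gcod g" "gr V f = \<one>" "gr V g = \<one>" "gpost V C f k = gpost V C g k"
  shows "f = g"
proof (rule gepiD[OF assms(1)])
  have k: "garr V C k" using assms(1) by (simp add: gepi_def)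
  have "gcomp V C f k = gre V (gpost V C g k) (lunit V (gr V k))"
    using k assms by (subst gcomp_unit_iff) simp_all
  also have "\<dots> = gcomp V C g k"
    using k assms by (subst eq_commute, subst gcomp_unit_iff) simp_all
  finally show "gcomp V C f k = gcomp V C g k" .
qed (use assms in simp_all)

lemma tuniv_gepi:
  assumes "tuniv V C k" shows "gepi k"
proof -
  have k: "garr V C k" using assms by (simp add: tuniv_def)
  show ?thesis
    unfolding gepi_def
  proof (intro conjI k allI impI, elim conjE)
    fix f g assume *: "garr V C f" "garr V C g" "gdom f = gcod k" "gdom g = gcod k"
     "gcod f = gcod g" "gr V f = gr V g" "gcomp V C f k = gcomp V C g k"
    have "gr V g \<in> Obj V \<and> garr V C (gcomp V C g k) \<and> gdom (gcomp V C g k) = gdom k \<and>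
        gr V (gcomp V C g k) = gr V g \<odot> gr V k"
      using * k by simp
    hence "\<exists>!h. garr V C h \<and> gdom h = gcod k \<and> gcod h = gcod (gcomp V C g k) \<and> gr V h = gr V g \<and> gcomp V C h k = gcomp V C g k"
      using assms unfolding tuniv_def by blast
    thus "f = g" using * by auto
  qed
qed

lemma tuniv_lift:
  assumes "tuniv V C k" "m \<in> Obj V" "garr V C f" "gdom f = gdom k" "gr V f = m \<odot> gr V k"
  obtains h where "garr V C h" "gdom h = gcod k" "gcod h = gcod f" "gr V h = m" "gcomp V C h k = f"
  using assms unfolding tuniv_def by blast

lemma tuniv_lift_post:
  assumes "tuniv V C k" "garr V C f" "gdom f = gdom k" "gr V f = gr V k"
  obtains h where "garr V C h" "gdom h = gcod k" "gcod h = gcod f" "gr V h = \<one>" "gpost V C h k = f"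
proof -
  have k: "garr V C k" using assms(1) by (simp add: tuniv_def)
  have k': "gr V k \<in> Obj V" using k by simp
  obtain h where "garr V C h" "gdom h = gcod k" "gcod h = gcod (gre V f (lunit V (gr V k)))" "gr V h = \<one>"
    "gcomp V C h k = gre V f (lunit V (gr V k))"
    by (rule tuniv_lift[OF assms(1) unit_in, of "gre V f (lunit V (gr V k))"]) (use k' assms in simp_all)
  thus ?thesis using that[of h] gcomp_unit_iff[of k h f] k assms by simp
qed

lemma buniv_gepi:
  assumes k: "buniv V C r \<gamma> k" and r: "garr V C r" "gcod r = gdom r"
    and \<gamma>: "\<gamma> \<in> hom V (gr V k \<odot> gr V r) (gr V k)"
  shows "gepi k"
proof -
  have karr: "garr V C k" "gdom k = gdom r" "gcomp V C k r = gre V k \<gamma>" using k by (simp_all add: buniv_def)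
  show ?thesis
    unfolding gepi_def
  proof (intro conjI karr allI impI, elim conjE)
    fix f g assume *: "garr V C f" "garr V C g" "gdom f = gcod k" "gdom g = gcod k"
     "gcod f = gcod g" "gr V f = gr V g" "gcomp V C f k = gcomp V C g k"
    \<comment> \<open>A composite with \<open>k\<close> is automatically balanced, so the universal
      property applies to it and its factorisation is unique.\<close>
    have "gcomp V C (gcomp V C g k) r = gre V (gcomp V C g k) ((Ide V (gr V g) \<otimes> \<gamma>) \<cdot> assoc V (gr V g) (gr V k) (gr V r))"
      using * karr r \<gamma> by (simp add: gcomp_assoc)
    hence "gr V g \<in> Obj V \<and> garr V C (gcomp V C g k) \<and> gdom (gcomp V C g k) = gdom r \<and>
        gr V (gcomp V C g k) = gr V g \<odot> gr V k \<and>
        gcomp V C (gcomp V C g k) r = gre V (gcomp V C g k) ((Ide V (gr V g) \<otimes> \<gamma>) \<cdot> assoc V (gr V g) (gr V k) (gr V r))"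
      using * karr by simp
    hence "\<exists>!h. garr V C h \<and> gdom h = gcod k \<and> gcod h = gcod (gcomp V C g k) \<and> gr V h = gr V g \<and> gcomp V C h k = gcomp V C g k"
      using k unfolding buniv_def by blast
    thus "f = g" using * by auto
  qed
qed

lemma buniv_lift:
  assumes "buniv V C r \<gamma> k" "m \<in> Obj V" "garr V C f" "gdom f = gdom r" "gr V f = m \<odot> gr V k"
    "gcomp V C f r = gre V f ((Ide V m \<otimes> \<gamma>) \<cdot> assoc V m (gr V k) (gr V r))"
  obtains h where "garr V C h" "gdom h = gcod k" "gcod h = gcod f" "gr V h = m" "gcomp V C h k = f"
  using assms unfolding buniv_def by blast

text \<open>The case \<open>m = \<one>\<close> of the universal property. Inserting the unit into
  the grade keeps the arrow balanced, by \<open>lunit_ten\<close> and naturality of the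
  unitor.\<close>

lemma buniv_lift_post:
  assumes k: "buniv V C r \<gamma> k" and r: "garr V C r" "gcod r = gdom r"
    and \<gamma>: "\<gamma> \<in> hom V (gr V k \<odot> gr V r) (gr V k)"
    and f: "garr V C f" "gdom f = gdom r" "gr V f = gr V k" "gcomp V C f r = gre V f \<gamma>"
  obtains h where "garr V C h" "gdom h = gcod k" "gcod h = gcod f" "gr V h = \<one>" "gpost V C h k = f"
proof -
  have karr: "garr V C k" "gdom k = gdom r" using k by (simp_all add: buniv_def)
  have z [simp]: "gr V k \<in> Obj V" "gr V r \<in> Obj V" using karr r by simp_all
  let ?z = "gr V k" and ?B = "gr V r"
  have "gcomp V C (gre V f (lunit V ?z)) r = gre V f (\<gamma> \<cdot> (lunit V ?z \<otimes> Ide V ?B))"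
    using f r \<gamma> by simp
  also have "\<gamma> \<cdot> (lunit V ?z \<otimes> Ide V ?B) = \<gamma> \<cdot> (lunit V (?z \<odot> ?B) \<cdot> assoc V \<one> ?z ?B)"
    by (subst lunit_ten) simp_all
  also have "\<dots> = (\<gamma> \<cdot> lunit V (?z \<odot> ?B)) \<cdot> assoc V \<one> ?z ?B"
    using \<gamma> by simp
  also have "\<dots> = (lunit V ?z \<cdot> (Ide V \<one> \<otimes> \<gamma>)) \<cdot> assoc V \<one> ?z ?B"
    using \<gamma> by (subst lunit_nat_arr) simp_all
  finally have bal: "gcomp V C (gre V f (lunit V ?z)) r = gre V (gre V f (lunit V ?z)) ((Ide V \<one> \<otimes> \<gamma>) \<cdot> assoc V \<one> ?z ?B)"
    using f \<gamma> by simp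
  obtain h where "garr V C h" "gdom h = gcod k" "gcod h = gcod (gre V f (lunit V ?z))" "gr V h = \<one>"
    "gcomp V C h k = gre V f (lunit V ?z)"
    by (rule buniv_lift[OF k unit_in _ _ _ bal]) (use f in simp_all)
  thus ?thesis using that[of h] gcomp_unit_iff[of k h f] karr f by simp
qed

text \<open>The morphism \<open>\<phi> Y\<close> is invertible iff composition with it is bijective
  on morphisms from each object \<open>m\<close>, and a morphism from \<open>m\<close> into its
  source is an arrow of grade \<open>m\<close>.\<close>

lemma is_tensor_iff:
  assumes [simp]: "z \<in> Obj V" "X \<in> VObj C"
  shows "is_tensor V C z X t \<eta> \<longleftrightarrow> tuniv V C (X, t, \<eta>) \<and> Dom V \<eta> = z"
proof (cases "t \<in> VObj C \<and> \<eta> \<in> hom V z (VHom C X t)")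
  case False
  thus ?thesis by (auto simp: is_tensor_def tuniv_def)
next
  case True
  hence [simp]: "t \<in> VObj C" "\<eta> \<in> Arr V" "Dom V \<eta> = z" "Cod V \<eta> = VHom C X t" by simp_all
  let ?k = "(X, t, \<eta>)"
  define \<phi> where "\<phi> Y = curry V (VHom C t Y) z (VHom C X Y) (VComp C X t Y \<cdot> (Ide V (VHom C t Y) \<otimes> \<eta>))" for Y
  have \<phi> [simp]: "\<phi> Y \<in> Arr V" "Dom V (\<phi> Y) = VHom C t Y" "Cod V (\<phi> Y) = ihom V z (VHom C X Y)" if "Y \<in> VObj C" for Y
    using that by (simp_all add: \<phi>_def)
  have unc: "unc z (VHom C X (gcod h)) (\<phi> (gcod h) \<cdot> gmor h) = gmor (gcomp V C h ?k)" if "garr V C h" "gdom h = t" for h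
    using that by (subst unc_comp) (simp_all add: \<phi>_def gcomp_def)
  have eq: "\<phi> (gcod f) \<cdot> gmor h = curry V m z (VHom C X (gcod f)) (gmor f) \<longleftrightarrow> gcomp V C h ?k = f"
    if "garr V C h" "gdom h = t" "gcod h = gcod f" "gr V h = m" "garr V C f" "gdom f = X" "gr V f = m \<odot> z" "m \<in> Obj V" for f h m
  proof
    assume "\<phi> (gcod f) \<cdot> gmor h = curry V m z (VHom C X (gcod f)) (gmor f)"
    hence "unc z (VHom C X (gcod f)) (\<phi> (gcod h) \<cdot> gmor h) = gmor f" using that by simp
    thus "gcomp V C h ?k = f" using unc[of h] that by (intro g_eqI) simp_all
  next
    assume *: "gcomp V C h ?k = f"
    show "\<phi> (gcod f) \<cdot> gmor h = curry V m z (VHom C X (gcod f)) (gmor f)"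
      by (rule unc_inj[of _ _ z "VHom C X (gcod f)"])
        (use that unc[of h] * garr_simps(2)[OF that(5)] in simp_all)
  qed
  have "is_tensor V C z X t \<eta> \<longleftrightarrow> (\<forall>Y \<in> VObj C. is_iso V (\<phi> Y))"
    by (simp add: is_tensor_def \<phi>_def)
  also have "\<dots> \<longleftrightarrow> tuniv V C ?k"
  proof
    assume iso: "\<forall>Y \<in> VObj C. is_iso V (\<phi> Y)"
    show "tuniv V C ?k" unfolding tuniv_def
    proof (intro conjI allI impI, simp, elim conjE)
      fix m f assume f: "m \<in> Obj V" "garr V C f" "gdom f = gdom ?k" "gr V f = m \<odot> gr V ?k"
      let ?c = "curry V m z (VHom C X (gcod f)) (gmor f)"
      let ?h = "(t, gcod f, inv_arr V (\<phi> (gcod f)) \<cdot> ?c)"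
      have i: "is_iso V (\<phi> (gcod f))" using iso f by simp
      show "\<exists>!h. garr V C h \<and> gdom h = gcod ?k \<and> gcod h = gcod f \<and> gr V h = m \<and> gcomp V C h ?k = f"
      proof (rule ex1I[of _ ?h])
        have 1: "garr V C ?h" "gr V ?h = m" using f i by simp_all
        moreover have "gcomp V C ?h ?k = f"
          using eq[of ?h f m] f i 1 by simp
        ultimately show "garr V C ?h \<and> gdom ?h = gcod ?k \<and> gcod ?h = gcod f \<and> gr V ?h = m \<and> gcomp V C ?h ?k = f"
          by simp
      next
        fix h assume h: "garr V C h \<and> gdom h = gcod ?k \<and> gcod h = gcod f \<and> gr V h = m \<and> gcomp V C h ?k = f"
        hence "\<phi> (gcod f) \<cdot> gmor h = ?c" using eq[of h f m] f by simp
        hence "gmor h = inv_arr V (\<phi> (gcod f)) \<cdot> ?c"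
          using h f inv_arr_comp(1)[OF i, of "gmor h"] by simp
        thus "h = ?h" using h by (intro g_eqI) simp_all
      qed
    qed
  next
    assume k: "tuniv V C ?k"
    show "\<forall>Y \<in> VObj C. is_iso V (\<phi> Y)"
    proof
      fix Y assume [simp]: "Y \<in> VObj C"
      show "is_iso V (\<phi> Y)"
      proof (rule iso_if_unique_lift)
        fix f assume f: "f \<in> Arr V" "Cod V f = Cod V (\<phi> Y)"
        let ?f = "(X, Y, unc z (VHom C X Y) f)"
        obtain h where h: "garr V C h" "gdom h = t" "gcod h = Y" "gr V h = Dom V f" "gcomp V C h ?k = ?f"
          by (rule tuniv_lift[OF k, of "Dom V f" ?f]) (use f in simp_all)
        have "\<phi> Y \<cdot> gmor h = f"
          by (rule unc_inj[of _ _ z "VHom C X Y"]) (use h unc[of h] f in simp_all)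
        thus "\<exists>g. g \<in> hom V (Dom V f) (Dom V (\<phi> Y)) \<and> \<phi> Y \<cdot> g = f"
          using h by (intro exI[of _ "gmor h"]) simp
      next
        fix g h assume gh: "g \<in> Arr V" "h \<in> Arr V" "Dom V g = Dom V h" "Cod V g = Dom V (\<phi> Y)"
          "Cod V h = Dom V (\<phi> Y)" "\<phi> Y \<cdot> g = \<phi> Y \<cdot> h"
        have u: "gmor (gcomp V C (t, Y, p) ?k) = unc z (VHom C X Y) (\<phi> Y \<cdot> p)"
          if "p \<in> Arr V" "Cod V p = VHom C t Y" for p
          using unc[of "(t, Y, p)"] that by simp
        have "gmor (gcomp V C (t, Y, g) ?k) = gmor (gcomp V C (t, Y, h) ?k)"
          by (subst (1 2) u) (use gh(1-5) in \<open>simp_all add: gh(6)\<close>)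
        hence "gcomp V C (t, Y, g) ?k = gcomp V C (t, Y, h) ?k"
          by (rule g_eqI[rotated -1]) simp_all
        hence "(t, Y, g) = (t, Y, h)"
          by (rule gepiD[OF tuniv_gepi[OF k], rotated -1]) (use gh(1-5) in simp_all)
        thus "g = h" by simp
      qed simp
    qed
  qed
  finally show ?thesis by simp
qed

end

definition unit_monoid :: "('vo, 'va, 'm) smc_scheme \<Rightarrow> ('vo, 'va) mon" where
  "unit_monoid V = \<lparr>m_obj = \<one>\<^bsub>V\<^esub>, m_unit = Ide V \<one>\<^bsub>V\<^esub>, m_mult = lunit V \<one>\<^bsub>V\<^esub>\<rparr>"

lemma (in closed_symmetric_monoidal) unit_monoid: "monoid_in V (unit_monoid V)"
  using triangle[of \<one> \<one>] by (simp add: unit_monoid_def monoid_in_def Let_def lunit_unit)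

lemma (in closed_symmetric_monoidal) unit_module:
  "z \<in> Obj V \<Longrightarrow> (z, runit V z) \<in> right_modules V (unit_monoid V)"
  using triangle[of z \<one>] by (simp add: unit_monoid_def right_modules_def Let_def)

lemma (in enriched_category) unit_action:
  "X \<in> VObj C \<Longrightarrow> gaction V C (unit_monoid V) (gid C X)"
  by (simp add: unit_monoid_def gaction_def gcomp_gid gre_ide)

text \<open>Over the unit monoid every arrow is balanced, by \<open>gcomp_gid_right\<close> and
  \<open>runit_ten\<close>, so the module-weighted colimit is a tensor.\<close>

lemma (in enriched_category) tensor_exists:
  assumes "infinite (UNIV :: 'u set)" "enriched_cocomplete TYPE('u) V C" "z \<in> Obj V" "X \<in> VObj C"
  shows "\<exists>t \<eta>. is_tensor V C z X t \<eta>"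
proof -
  interpret one_object_diagram V C "unit_monoid V" "(z, runit V z)" "gid C X"
    by (intro one_object_diagram.intro monoid_ctx.intro one_object_diagram_axioms.intro monoid_ctx_axioms.intro
        enriched_category_axioms closed_symmetric_monoidal_axioms unit_monoid unit_module unit_action assms)
  obtain k where k: "buniv V C (gid C X) (runit V z) k" "gr V k = z"
    using buniv_exists[OF assms(1,2)] by auto
  have k': "garr V C k" "gdom k = X" using k by (simp_all add: buniv_def)
  have "gcomp V C f (gid C X) = gre V f ((Ide V m \<otimes> runit V z) \<cdot> assoc V m z \<one>)"
    if "m \<in> Obj V" "garr V C f" "gdom f = X" "gr V f = m \<odot> z" for m f
    using that assms by (simp add: gcomp_gid_right runit_ten)
  hence "tuniv V C k"
    using k k' assms(4) unfolding tuniv_def buniv_def by simp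
  hence "is_tensor V C z X (gcod k) (gmor k)"
    using is_tensor_iff[OF assms(3,4), of "gcod k" "gmor k"] k k' g_triple[of k] by simp
  thus ?thesis by blast
qed


section \<open>Canonical morphisms between tensors\<close>

locale tensored = enriched_category V C
  for V :: "('vo, 'va, 'm) smc_scheme" (structure) and C :: "('o, 'vo, 'va) vcat" +
  assumes tensors: "z \<in> Obj V \<Longrightarrow> X \<in> VObj C \<Longrightarrow> \<exists>t \<eta>. is_tensor V C z X t \<eta>"
begin

text \<open>The unit of the tensor adjunction, seen as the universal arrow of grade \<open>z\<close>
  out of \<open>X\<close>.\<close>

definition eta :: "'vo \<Rightarrow> 'o \<Rightarrow> 'o \<times> 'o \<times> 'va" where
  "eta z X = (X, tn_obj V C z X, tn_unit V C z X)"

lemma eta_simps [simp]: "gdom (eta z X) = X" "gcod (eta z X) = tn_obj V C z X"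
  by (simp_all add: eta_def)

lemma gmor_eta: "gmor (eta z X) = tn_unit V C z X"
  by (simp add: eta_def)

lemma eta:
  assumes "z \<in> Obj V" "X \<in> VObj C"
  shows "tuniv V C (eta z X)" "garr V C (eta z X)" "gr V (eta z X) = z" "tn_obj V C z X \<in> VObj C"
proof -
  have "is_tensor V C z X (tn_obj V C z X) (tn_unit V C z X)"
  proof -
    have "\<exists>p. case p of (t, \<eta>) \<Rightarrow> is_tensor V C z X t \<eta>"
      using tensors[OF assms] by auto
    from someI_ex[OF this] have "case tensor V C z X of (t, \<eta>) \<Rightarrow> is_tensor V C z X t \<eta>"
      unfolding tensor_def .
    thus ?thesis
      unfolding tn_obj_def tn_unit_def by (cases "tensor V C z X") simp
  qed
  thus t: "tuniv V C (eta z X)" "gr V (eta z X) = z"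
    using is_tensor_iff[OF assms] by (simp_all add: eta_def)
  thus g: "garr V C (eta z X)" by (simp add: tuniv_def)
  show "tn_obj V C z X \<in> VObj C" using garr_simps(2)[OF g] by simp
qed

lemmas [simp] = eta(2-4)
lemmas eta_epi = tuniv_gepi[OF eta(1)]

text \<open>Replaces the \<open>THE\<close> in \<open>tn_transpose\<close> by its defining property.
  The canonical morphisms of tensors that follow are all transposes and obtain their
  characterisation from here.\<close>

lemma transpose:
  assumes g: "garr V C g" "gr V g = z" "gdom g = X" "gcod g = Y"
  defines "h \<equiv> tn_transpose V C z X Y (gmor g)"
  shows "garr V C h" "gr V h = \<one>" "gdom h = tn_obj V C z X" "gcod h = Y" "gpost V C h (eta z X) = g"
proof -
  have zX [simp]: "z \<in> Obj V" "X \<in> VObj C" "Y \<in> VObj C"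
    using g dom_cod_obj(1)[of "gmor g"] garr_simps(1,2)[OF g(1)] garr_simps(3)[OF g(1)] by simp_all
  let ?P = "\<lambda>h. h \<in> hom (under V C) (tn_obj V C z X) Y \<and> hom_post V C X h \<cdot> tn_unit V C z X = gmor g"
  let ?Q = "\<lambda>h. garr V C h \<and> gr V h = \<one> \<and> gdom h = tn_obj V C z X \<and> gcod h = Y \<and> gpost V C h (eta z X) = g"
  have PQ: "?P h \<longleftrightarrow> ?Q h" for h
  proof (cases "garr V C h \<and> gr V h = \<one> \<and> gdom h = tn_obj V C z X \<and> gcod h = Y")
    case True
    hence "hom_post V C X h \<cdot> tn_unit V C z X = gmor (gpost V C h (eta z X))"
      using hom_post(4)[of h X "eta z X"] by (simp add: gmor_eta)
    moreover have "gmor (gpost V C h (eta z X)) = gmor g \<longleftrightarrow> gpost V C h (eta z X) = g"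
      using True g by (auto intro: g_eqI)
    ultimately show ?thesis using True by simp
  qed auto
  obtain h0 where "garr V C h0" "gdom h0 = gcod (eta z X)" "gcod h0 = gcod g" "gr V h0 = \<one>"
      "gpost V C h0 (eta z X) = g"
    by (rule tuniv_lift_post[OF eta(1)[OF zX(1,2)] g(1)]) (use g in simp_all)
  hence "?Q h0" using g by simp
  moreover have "h = h'" if "?Q h" "?Q h'" for h h'
    by (rule gepi_post[OF eta_epi[OF zX(1,2)]]) (use that in simp_all)
  ultimately have "\<exists>!h. ?Q h" by blast
  hence "\<exists>!h. ?P h" using PQ by blast
  from theI'[OF this] have "?Q h"
    unfolding PQ h_def tn_transpose_def .
  thus "garr V C h" "gr V h = \<one>" "gdom h = tn_obj V C z X" "gcod h = Y" "gpost V C h (eta z X) = g"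
    by blast+
qed

lemma tn_left:
  assumes "f \<in> Arr V" "X \<in> VObj C" "Dom V f = z"
  shows "garr V C (tn_left V C f X)" "gr V (tn_left V C f X) = \<one>" "gdom (tn_left V C f X) = tn_obj V C z X"
    "gcod (tn_left V C f X) = tn_obj V C (Cod V f) X"
    "gpost V C (tn_left V C f X) (eta z X) = gre V (eta (Cod V f) X) f"
proof -
  have "tn_left V C f X = tn_transpose V C z X (tn_obj V C (Cod V f) X) (gmor (gre V (eta (Cod V f) X) f))"
    using assms by (simp add: tn_left_def gmor_eta)
  thus "garr V C (tn_left V C f X)" "gr V (tn_left V C f X) = \<one>" "gdom (tn_left V C f X) = tn_obj V C z X"
    "gcod (tn_left V C f X) = tn_obj V C (Cod V f) X"
    "gpost V C (tn_left V C f X) (eta z X) = gre V (eta (Cod V f) X) f"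
    using transpose[of "gre V (eta (Cod V f) X) f" z X "tn_obj V C (Cod V f) X"] assms by simp_all
qed

lemma tn_right:
  assumes "garr V C h" "gr V h = \<one>" "gdom h = X" "z \<in> Obj V"
  shows "garr V C (tn_right V C z h)" "gr V (tn_right V C z h) = \<one>" "gdom (tn_right V C z h) = tn_obj V C z X"
    "gcod (tn_right V C z h) = tn_obj V C z (gcod h)"
    "gpost V C (tn_right V C z h) (eta z X) = gpre V C (eta z (gcod h)) h"
proof -
  have X: "X \<in> VObj C" using assms by auto
  have "gmor (gpre V C (eta z (gcod h)) h) = hom_pre V C h (tn_obj V C z (gcod h)) \<cdot> tn_unit V C z (gcod h)"
    using hom_pre(4)[of h "tn_obj V C z (gcod h)" "eta z (gcod h)"] assms by (simp add: gmor_eta)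
  hence "tn_right V C z h = tn_transpose V C z X (tn_obj V C z (gcod h)) (gmor (gpre V C (eta z (gcod h)) h))"
    using assms(3) by (cases h) (simp add: tn_right_def)
  thus "garr V C (tn_right V C z h)" "gr V (tn_right V C z h) = \<one>" "gdom (tn_right V C z h) = tn_obj V C z X"
    "gcod (tn_right V C z h) = tn_obj V C z (gcod h)"
    "gpost V C (tn_right V C z h) (eta z X) = gpre V C (eta z (gcod h)) h"
    using transpose[of "gpre V C (eta z (gcod h)) h" z X "tn_obj V C z (gcod h)"] assms by simp_all
qed

lemma tn_assoc:
  assumes "w \<in> Obj V" "z \<in> Obj V" "X \<in> VObj C"
  shows "garr V C (tn_assoc V C w z X)" "gr V (tn_assoc V C w z X) = \<one>"
    "gdom (tn_assoc V C w z X) = tn_obj V C (w \<odot> z) X"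
    "gcod (tn_assoc V C w z X) = tn_obj V C w (tn_obj V C z X)"
    "gpost V C (tn_assoc V C w z X) (eta (w \<odot> z) X) = gcomp V C (eta w (tn_obj V C z X)) (eta z X)"
proof -
  let ?g = "gcomp V C (eta w (tn_obj V C z X)) (eta z X)"
  have "tn_assoc V C w z X = tn_transpose V C (w \<odot> z) X (tn_obj V C w (tn_obj V C z X)) (gmor ?g)"
    by (simp add: tn_assoc_def gcomp_def gmor_eta Let_def)
  thus "garr V C (tn_assoc V C w z X)" "gr V (tn_assoc V C w z X) = \<one>"
    "gdom (tn_assoc V C w z X) = tn_obj V C (w \<odot> z) X"
    "gcod (tn_assoc V C w z X) = tn_obj V C w (tn_obj V C z X)"
    "gpost V C (tn_assoc V C w z X) (eta (w \<odot> z) X) = ?g"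
    using transpose[of ?g "w \<odot> z" X "tn_obj V C w (tn_obj V C z X)"] assms by simp_all
qed

lemma tn_lunit:
  assumes "X \<in> VObj C"
  shows "garr V C (tn_lunit V C X)" "gr V (tn_lunit V C X) = \<one>"
    "gdom (tn_lunit V C X) = tn_obj V C \<one> X" "gcod (tn_lunit V C X) = X"
    "gpost V C (tn_lunit V C X) (eta \<one> X) = gid C X"
proof -
  have "tn_lunit V C X = tn_transpose V C \<one> X X (gmor (gid C X))"
    by (simp add: tn_lunit_def)
  thus "garr V C (tn_lunit V C X)" "gr V (tn_lunit V C X) = \<one>"
    "gdom (tn_lunit V C X) = tn_obj V C \<one> X" "gcod (tn_lunit V C X) = X"
    "gpost V C (tn_lunit V C X) (eta \<one> X) = gid C X"
    using transpose[of "gid C X" \<one> X X] assms by simp_all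
qed

lemma eta_eta_epi:
  assumes [simp]: "w \<in> Obj V" "z \<in> Obj V" "X \<in> VObj C"
    and f: "garr V C f" "garr V C g" "gdom f = tn_obj V C w (tn_obj V C z X)" "gdom g = gdom f" "gcod f = gcod g"
      "gr V f = \<one>" "gr V g = \<one>"
    and eq: "gpost V C f (gcomp V C (eta w (tn_obj V C z X)) (eta z X)) =
      gpost V C g (gcomp V C (eta w (tn_obj V C z X)) (eta z X))"
  shows "f = g"
proof (rule gepi_post[OF eta_epi[of w "tn_obj V C z X"]])
  show "gpost V C f (eta w (tn_obj V C z X)) = gpost V C g (eta w (tn_obj V C z X))"
    by (rule gepiD[OF eta_epi[of z X]]) (use f eq in \<open>simp_all add: gcomp_gpost\<close>)
qed (use f in simp_all)

text \<open>The inverse is built by two lifts: \<open>eta (w \<odot> z) X\<close> factors through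
  \<open>eta z X\<close> with grade \<open>w\<close>, and this factor is then transposed. Both
  composites are identities because universal arrows can be cancelled.\<close>

lemma tn_assoc_iso:
  assumes [simp]: "w \<in> Obj V" "z \<in> Obj V" "X \<in> VObj C"
  shows "inv_arr (under V C) (tn_assoc V C w z X) \<in> Arr (under V C)"
    "gdom (inv_arr (under V C) (tn_assoc V C w z X)) = tn_obj V C w (tn_obj V C z X)"
    "gcod (inv_arr (under V C) (tn_assoc V C w z X)) = tn_obj V C (w \<odot> z) X"
    "gpost V C (inv_arr (under V C) (tn_assoc V C w z X)) (gcomp V C (eta w (tn_obj V C z X)) (eta z X)) =
      eta (w \<odot> z) X"
proof -
  interpret U: category "under V C" by (rule category_under)
  let ?zX = "tn_obj V C z X" and ?a = "tn_assoc V C w z X"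
  let ?e = "gcomp V C (eta w ?zX) (eta z X)"
  note a [simp] = tn_assoc(1-4)[OF assms]
  note a_eta = tn_assoc(5)[OF assms]
  obtain g where g [simp]: "garr V C g" "gdom g = ?zX" "gcod g = tn_obj V C (w \<odot> z) X" "gr V g = w"
    and ge: "gcomp V C g (eta z X) = eta (w \<odot> z) X"
    by (rule tuniv_lift[OF eta(1)[of z X], of w "eta (w \<odot> z) X"]) simp_all
  obtain k where k [simp]: "garr V C k" "gdom k = tn_obj V C w ?zX" "gcod k = tn_obj V C (w \<odot> z) X" "gr V k = \<one>"
    and ke: "gpost V C k (eta w ?zX) = g"
    by (rule tuniv_lift_post[OF eta(1)[of w ?zX], of g]) simp_all
  have kee: "gpost V C k ?e = eta (w \<odot> z) X"
    by (simp add: gcomp_gpost[symmetric] ke ge)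
  have 1: "gpost V C k ?a = gid C (tn_obj V C (w \<odot> z) X)"
    by (rule gepi_post[OF eta_epi[of "w \<odot> z" X]]) (simp_all add: gpost_gpost a_eta kee gpost_gid)
  have 2: "gpost V C ?a k = gid C (tn_obj V C w ?zX)"
    by (rule eta_eta_epi[of w z X]) (simp_all add: gpost_gpost a_eta kee gpost_gid)
  have "inverse_arrows (under V C) ?a k"
    using 1 2 by (simp add: inverse_arrows_def)
  hence "inv_arr (under V C) ?a = k" by (rule U.inv_arrI)
  thus "inv_arr (under V C) ?a \<in> Arr (under V C)" "gdom (inv_arr (under V C) ?a) = tn_obj V C w ?zX"
    "gcod (inv_arr (under V C) ?a) = tn_obj V C (w \<odot> z) X" "gpost V C (inv_arr (under V C) ?a) ?e = eta (w \<odot> z) X"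
    using kee by simp_all
qed

definition mact :: "('vo, 'va) mon \<Rightarrow> 'o \<times> 'o \<times> 'o \<times> 'va \<Rightarrow> 'o \<times> 'o \<times> 'va" where
  "mact b P = gpost V C (snd P) (eta (m_obj b) (fst P))"

text \<open>Each module law equates morphisms out of a tensor and is tested on the universal arrow
  there, at \<open>\<one>\<close> for the unit and at \<open>B \<odot> B\<close> for associativity.
  It then becomes a law of \<open>gaction\<close>.\<close>

lemma left_module_iff:
  assumes b: "monoid_in V b"
  shows "(X, \<rho>) \<in> left_module_objects V C b \<longleftrightarrow> X \<in> VObj C \<and> garr V C \<rho> \<and> gr V \<rho> = \<one> \<and>
    gdom \<rho> = tn_obj V C (m_obj b) X \<and> gcod \<rho> = X \<and> gaction V C b (mact b (X, \<rho>))"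
proof (cases "X \<in> VObj C \<and> garr V C \<rho> \<and> gr V \<rho> = \<one> \<and> gdom \<rho> = tn_obj V C (m_obj b) X \<and> gcod \<rho> = X")
  case False
  thus ?thesis by (auto simp: left_module_objects_def Let_def)
next
  case True
  interpret monoid_ctx V b using b by unfold_locales
  interpret U: category "under V C" by (rule category_under)
  have [simp]: "X \<in> VObj C" "garr V C \<rho>" "gr V \<rho> = \<one>" "gdom \<rho> = tn_obj V C B X" "gcod \<rho> = X"
    using True by simp_all
  let ?r = "gpost V C \<rho> (eta B X)"
  note l = tn_left[OF monoid_arr(2) _ monoid_arr(3), of X] tn_left[OF monoid_arr(5) _ monoid_arr(6), of X]
  note [simp] = l(1-4) l(6-9) tn_assoc(1-4)[of B B X] tn_right(1-4)[of \<rho> "tn_obj V C B X" B] tn_lunit(1-4)[of X]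
  have u: "gpost V C \<rho> (tn_left V C u X) = tn_lunit V C X \<longleftrightarrow> gre V ?r u = gid C X"
  proof -
    have "gpost V C (gpost V C \<rho> (tn_left V C u X)) (eta \<one> X) = gre V ?r u"
      by (simp add: gpost_gpost l(5))
    moreover have "gpost V C (tn_lunit V C X) (eta \<one> X) = gid C X" by (rule tn_lunit) simp
    ultimately show ?thesis
      using gepi_post[OF eta_epi[of \<one> X], of "gpost V C \<rho> (tn_left V C u X)" "tn_lunit V C X"] by auto
  qed
  have m: "gpost V C \<rho> (tn_left V C m X) = gpost V C \<rho> (gpost V C (tn_right V C B \<rho>) (tn_assoc V C B B X)) \<longleftrightarrow>
     gcomp V C ?r ?r = gre V ?r m" (is "?f = ?g \<longleftrightarrow> _")
  proof -
    have 1: "gpost V C ?f (eta (B \<odot> B) X) = gre V ?r m"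
      by (simp add: gpost_gpost l(10))
    have "gpost V C ?g (eta (B \<odot> B) X) =
       gpost V C \<rho> (gcomp V C (gpost V C (tn_right V C B \<rho>) (eta B (tn_obj V C B X))) (eta B X))"
      by (simp add: gpost_gpost tn_assoc(5) gcomp_gpost)
    also have "\<dots> = gcomp V C ?r ?r"
      by (simp add: tn_right(5) gcomp_gpre gcomp_gpost)
    finally have 2: "gpost V C ?g (eta (B \<odot> B) X) = gcomp V C ?r ?r" .
    show ?thesis
      using gepi_post[OF eta_epi[of "B \<odot> B" X], of ?f ?g] 1 2 by auto
  qed
  show ?thesis
    using u m by (simp add: left_module_objects_def Let_def gaction_def mact_def)
qed

end

section \<open>Coequalizers and left module objects\<close>

abbreviation (in monoid_ctx) "RM \<equiv> right_modules V b"

text \<open>The pentagon and \<open>runit_ten\<close> carry the two module laws of \<open>Z\<close>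
  through the factor \<open>w\<close>.\<close>

lemma (in monoid_ctx) mod_tensor_module:
  assumes Z: "Z \<in> right_modules V b" and [simp]: "w \<in> Obj V"
  shows "mod_tensor V b w Z \<in> right_modules V b"
proof -
  define z \<gamma> where "z = fst Z" and "\<gamma> = snd Z"
  have [simp]: "z \<in> Obj V" "\<gamma> \<in> Arr V" "Dom V \<gamma> = z \<odot> B" "Cod V \<gamma> = z"
    using Z by (simp_all add: z_def \<gamma>_def)
  have laws: "\<gamma> \<cdot> (\<gamma> \<otimes> Ide V B) = \<gamma> \<cdot> (Ide V z \<otimes> m) \<cdot> assoc V z B B" "\<gamma> \<cdot> (Ide V z \<otimes> u) = runit V z"
    using module_laws[OF Z] by (simp_all add: z_def \<gamma>_def)
  let ?g = "(Ide V w \<otimes> \<gamma>) \<cdot> assoc V w z B"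
  have "?g \<cdot> (?g \<otimes> Ide V B) = (Ide V w \<otimes> \<gamma>) \<cdot> (assoc V w z B \<cdot> ((Ide V w \<otimes> \<gamma>) \<otimes> Ide V B)) \<cdot> (assoc V w z B \<otimes> Ide V B)"
    by simp
  also have "\<dots> = (Ide V w \<otimes> (\<gamma> \<cdot> (\<gamma> \<otimes> Ide V B))) \<cdot> assoc V w (z \<odot> B) B \<cdot> (assoc V w z B \<otimes> Ide V B)"
    by (subst assoc_nat_arr) simp_all
  also have "\<dots> = (Ide V w \<otimes> (\<gamma> \<cdot> (Ide V z \<otimes> m))) \<cdot>
      ((Ide V w \<otimes> assoc V z B B) \<cdot> assoc V w (z \<odot> B) B \<cdot> (assoc V w z B \<otimes> Ide V B))"
    unfolding laws by simp
  also have "\<dots> = (Ide V w \<otimes> \<gamma>) \<cdot> ((Ide V w \<otimes> Ide V z \<otimes> m) \<cdot> assoc V w z (B \<odot> B)) \<cdot> assoc V (w \<odot> z) B B"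
    by (subst pentagon_arr) simp_all
  also have "\<dots> = (Ide V w \<otimes> \<gamma>) \<cdot> (assoc V w z B \<cdot> ((Ide V w \<otimes> Ide V z) \<otimes> m)) \<cdot> assoc V (w \<odot> z) B B"
    by (subst assoc_nat_arr) simp_all
  finally have 1: "?g \<cdot> (?g \<otimes> Ide V B) = ?g \<cdot> (Ide V (w \<odot> z) \<otimes> m) \<cdot> assoc V (w \<odot> z) B B"
    by simp
  have "?g \<cdot> (Ide V (w \<odot> z) \<otimes> u) = (Ide V w \<otimes> \<gamma>) \<cdot> (assoc V w z B \<cdot> ((Ide V w \<otimes> Ide V z) \<otimes> u))"
    by simp
  also have "\<dots> = (Ide V w \<otimes> (\<gamma> \<cdot> (Ide V z \<otimes> u))) \<cdot> assoc V w z \<one>"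
    by (subst assoc_nat_arr) simp_all
  also have "\<dots> = runit V (w \<odot> z)"
    unfolding laws by (rule runit_ten) simp_all
  finally have 2: "?g \<cdot> (Ide V (w \<odot> z) \<otimes> u) = runit V (w \<odot> z)" .
  have "mod_tensor V b w Z = (w \<odot> z, ?g)"
    by (simp add: mod_tensor_def z_def \<gamma>_def split_beta)
  thus ?thesis using 1 2 by (auto intro!: modulesI)
qed

lemma mod_tensor_simps [simp]: "fst (mod_tensor V b w Z) = w \<odot>\<^bsub>V\<^esub> fst Z"
  "snd (mod_tensor V b w Z) = (Ide V w \<otimes>\<^bsub>V\<^esub> snd Z) \<cdot>\<^bsub>V\<^esub> assoc V w (fst Z) (m_obj b)"
  by (simp_all add: mod_tensor_def split_beta)

text \<open>Existence of \<open>z \<circledast> X\<close> is assumed in the form in which weighted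
  colimits supply it; \<open>coequalizer_iff\<close> converts it to coequalizers.\<close>

locale bmod = tensored V C + monoid_ctx V b
  for V :: "('vo, 'va, 'm) smc_scheme" (structure) and C :: "('o, 'vo, 'va) vcat" and b :: "('vo, 'va) mon" +
  assumes coeqs: "gaction V C b r \<Longrightarrow> Z \<in> right_modules V b \<Longrightarrow> \<exists>k. buniv V C r (snd Z) k \<and> gr V k = fst Z"
begin

abbreviation "LM \<equiv> left_module_objects V C b"
abbreviation act where "act P \<equiv> mact b P"

lemma left_module:
  assumes "P \<in> LM"
  shows "fst P \<in> VObj C" "garr V C (snd P)" "gr V (snd P) = \<one>" "gdom (snd P) = tn_obj V C B (fst P)"
    "gcod (snd P) = fst P" "gaction V C b (act P)" "garr V C (act P)" "gdom (act P) = fst P"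
    "gcod (act P) = fst P" "gr V (act P) = B"
    "gre V (act P) u = gid C (fst P)" "gcomp V C (act P) (act P) = gre V (act P) m"
proof -
  have *: "fst P \<in> VObj C \<and> garr V C (snd P) \<and> gr V (snd P) = \<one> \<and>
    gdom (snd P) = tn_obj V C (m_obj b) (fst P) \<and> gcod (snd P) = fst P \<and> gaction V C b (act P)"
    using left_module_iff[OF monoid, of "fst P" "snd P"] assms by simp
  thus "fst P \<in> VObj C" "garr V C (snd P)" "gr V (snd P) = \<one>" "gdom (snd P) = tn_obj V C B (fst P)"
    "gcod (snd P) = fst P" and a: "gaction V C b (act P)"
    by blast+
  show d: "gdom (act P) = fst P" by (simp add: mact_def)
  show "garr V C (act P)" "gcod (act P) = fst P" "gr V (act P) = B"
    "gre V (act P) u = gid C (fst P)" "gcomp V C (act P) (act P) = gre V (act P) m"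
    using a d unfolding gaction_def by simp_all
qed

lemmas [simp] = left_module(1-5,7-10)

text \<open>Composed with the universal arrow of the tensor of \<open>X\<close> by
  \<open>z \<odot> b\<close>, the parallel morphisms become \<open>eta\<close> restricted along the
  action of \<open>z\<close> and \<open>eta\<close> composed with the action arrow of
  \<open>X\<close>. An arrow out of the tensor therefore equalizes them exactly when its composite
  with \<open>eta\<close> is balanced.\<close>

lemma coequalizer_iff:
  assumes P [simp]: "P \<in> LM" and Z [simp]: "Z \<in> RM"
  shows "is_coequalizer V C (tn_left V C (snd Z) (fst P))
      (tn_right V C (fst Z) (snd P) \<cdot>\<^bsub>under V C\<^esub> tn_assoc V C (fst Z) B (fst P)) q \<longleftrightarrow>
    garr V C q \<and> gr V q = \<one> \<and> gdom q = tn_obj V C (fst Z) (fst P) \<and>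
    buniv V C (act P) (snd Z) (gpost V C q (eta (fst Z) (fst P)))"
proof -
  define X \<rho> z \<gamma> where "X = fst P" and "\<rho> = snd P" and "z = fst Z" and "\<gamma> = snd Z"
  have [simp]: "X \<in> VObj C" "garr V C \<rho>" "gr V \<rho> = \<one>" "gdom \<rho> = tn_obj V C B X" "gcod \<rho> = X"
    "z \<in> Obj V" "\<gamma> \<in> Arr V" "Dom V \<gamma> = z \<odot> B" "Cod V \<gamma> = z"
    by (simp_all add: X_def \<rho>_def z_def \<gamma>_def)
  let ?r = "act P" and ?\<eta> = "eta z X" and ?X2 = "tn_obj V C (z \<odot> B) X"
  have r [simp]: "garr V C ?r" "gdom ?r = X" "gcod ?r = X" "gr V ?r = B" by (simp_all add: X_def)
  have r_def: "gpost V C \<rho> (eta B X) = ?r" by (simp add: mact_def \<rho>_def X_def)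
  define f g where "f = tn_left V C \<gamma> X" and "g = gpost V C (tn_right V C z \<rho>) (tn_assoc V C z B X)"
  note l = tn_left[of \<gamma> X "z \<odot> B"] and tr = tn_right[of \<rho> "tn_obj V C B X" z] and ta = tn_assoc[of z B X]
  note [simp] = l(1-4) tr(1-4) ta(1-4)
  have under: "tn_right V C (fst Z) (snd P) \<cdot>\<^bsub>under V C\<^esub> tn_assoc V C (fst Z) B (fst P) = g"
    unfolding g_def X_def[symmetric] \<rho>_def[symmetric] z_def[symmetric] by (rule under_comp) simp_all
  have f [simp]: "garr V C f" "gr V f = \<one>" "gdom f = ?X2" "gcod f = tn_obj V C z X"
    and f\<eta>: "gpost V C f (eta (z \<odot> B) X) = gre V ?\<eta> \<gamma>"
    by (simp_all add: f_def l(5))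
  have g [simp]: "garr V C g" "gr V g = \<one>" "gdom g = ?X2" "gcod g = tn_obj V C z X"
    by (simp_all add: g_def)
  have "gpost V C g (eta (z \<odot> B) X) = gcomp V C (gpost V C (tn_right V C z \<rho>) (eta z (tn_obj V C B X))) (eta B X)"
    by (simp add: g_def gpost_gpost ta(5) gcomp_gpost)
  also have "\<dots> = gcomp V C ?\<eta> ?r"
    by (simp add: tr(5) gcomp_gpre r_def)
  finally have g\<eta>: "gpost V C g (eta (z \<odot> B) X) = gcomp V C ?\<eta> ?r" .
  \<comment> \<open>The criterion at every grade. The associator in the balancing condition arises
    because \<open>p\<close>, \<open>eta\<close> and the action arrow contribute three
    grades.\<close>
  have bal: "gpre V C p f = gpre V C p g \<longleftrightarrow>
      gcomp V C (gcomp V C p ?\<eta>) ?r = gre V (gcomp V C p ?\<eta>) ((Ide V (gr V p) \<otimes> \<gamma>) \<cdot> assoc V (gr V p) z B)"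
    if [simp]: "garr V C p" "gdom p = tn_obj V C z X" for p
  proof -
    have "gpre V C p f = gpre V C p g \<longleftrightarrow> gcomp V C (gpre V C p f) (eta (z \<odot> B) X) = gcomp V C (gpre V C p g) (eta (z \<odot> B) X)"
      using gepiD[OF eta_epi[of "z \<odot> B" X], of "gpre V C p f" "gpre V C p g"] by auto
    also have "\<dots> \<longleftrightarrow> gre V (gcomp V C p ?\<eta>) (Ide V (gr V p) \<otimes> \<gamma>) = gcomp V C p (gcomp V C ?\<eta> ?r)"
      by (simp add: gcomp_gpre f\<eta> g\<eta>)
    also have "\<dots> \<longleftrightarrow> gre V (gre V (gcomp V C p ?\<eta>) (Ide V (gr V p) \<otimes> \<gamma>)) (assoc V (gr V p) z B) =
        gre V (gcomp V C p (gcomp V C ?\<eta> ?r)) (assoc V (gr V p) z B)"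
      using gre_iso_cancel[of "gre V (gcomp V C p ?\<eta>) (Ide V (gr V p) \<otimes> \<gamma>)" "gcomp V C p (gcomp V C ?\<eta> ?r)" "assoc V (gr V p) z B"]
      by (auto simp del: gre_gre)
    also have "\<dots> \<longleftrightarrow> gcomp V C (gcomp V C p ?\<eta>) ?r = gre V (gcomp V C p ?\<eta>) ((Ide V (gr V p) \<otimes> \<gamma>) \<cdot> assoc V (gr V p) z B)"
      by (subst gcomp_assoc) auto
    finally show ?thesis .
  qed
  show ?thesis
  proof (cases "garr V C q \<and> gr V q = \<one> \<and> gdom q = tn_obj V C z X")
    case False
    thus ?thesis unfolding under
      by (auto simp: is_coequalizer_def X_def[symmetric] \<gamma>_def[symmetric] z_def[symmetric] f_def[symmetric])
  next
    case True
    hence q [simp]: "garr V C q" "gr V q = \<one>" "gdom q = tn_obj V C z X" by simp_all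
    have c [simp]: "gcod q \<in> VObj C" by (rule garr_simps) simp
    let ?k = "gpost V C q ?\<eta>"
    have hp [simp]: "hom_pre V C f Y \<in> Arr V" "Dom V (hom_pre V C f Y) = VHom C (tn_obj V C z X) Y"
      "hom_pre V C g Y \<in> Arr V" "Dom V (hom_pre V C g Y) = VHom C (tn_obj V C z X) Y"
      "hom_pre V C q Y \<in> Arr V" "Dom V (hom_pre V C q Y) = VHom C (gcod q) Y"
      "Cod V (hom_pre V C q Y) = VHom C (tn_obj V C z X) Y" if "Y \<in> VObj C" for Y
      using that hom_pre(1-3)[of f Y] hom_pre(1-3)[of g Y] hom_pre(1-3)[of q Y] by simp_all
    have hp_eq: "hom_pre V C f (gcod p) \<cdot> gmor p = hom_pre V C g (gcod p) \<cdot> gmor p \<longleftrightarrow> gpre V C p f = gpre V C p g"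
      if "garr V C p" "gdom p = tn_obj V C z X" for p
      using hom_pre(4)[of f "gcod p" p] hom_pre(4)[of g "gcod p" p] that by (auto intro: g_eqI)
    \<comment> \<open>Unique factorisation of \<open>p\<close> through \<open>q\<close>: the common
      form of the equalizers in \<open>V\<close> and of the universal property in
      \<open>C\<close>.\<close>
    define E where "E p \<longleftrightarrow> (\<exists>!h. garr V C h \<and> gdom h = gcod q \<and> gcod h = gcod p \<and> gr V h = gr V p \<and> gpre V C h q = p)" for p
    have E_iff: "(\<exists>!h. h \<in> hom V (Dom V \<kappa>) (Dom V (hom_pre V C q Y)) \<and> hom_pre V C q Y \<cdot> h = \<kappa>) \<longleftrightarrow> E (tn_obj V C z X, Y, \<kappa>)"
      if \<kappa>: "\<kappa> \<in> Arr V" "Cod V \<kappa> = VHom C (tn_obj V C z X) Y" and [simp]: "Y \<in> VObj C" for \<kappa> Y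
      unfolding E_def
    proof (rule ex1_transfer[where F = "\<lambda>h. (gcod q, Y, h)" and G = gmor])
      fix h
      have "hom_pre V C q Y \<cdot> h = gmor (gpre V C (gcod q, Y, h) q)" if "h \<in> Arr V" "Cod V h = VHom C (gcod q) Y"
        using hom_pre(4)[of q Y "(gcod q, Y, h)"] that by simp
      moreover have "gpre V C (gcod q, Y, h) q = (tn_obj V C z X, Y, \<kappa>) \<longleftrightarrow> gmor (gpre V C (gcod q, Y, h) q) = \<kappa>"
        by (auto intro: g_eqI)
      ultimately show "h \<in> hom V (Dom V \<kappa>) (Dom V (hom_pre V C q Y)) \<and> hom_pre V C q Y \<cdot> h = \<kappa> \<longleftrightarrow>
        garr V C (gcod q, Y, h) \<and> gdom (gcod q, Y, h) = gcod q \<and> gcod (gcod q, Y, h) = gcod (tn_obj V C z X, Y, \<kappa>) \<and>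
        gr V (gcod q, Y, h) = gr V (tn_obj V C z X, Y, \<kappa>) \<and> gpre V C (gcod q, Y, h) q = (tn_obj V C z X, Y, \<kappa>)"
        by auto
    next
      fix h assume "garr V C h \<and> gdom h = gcod q \<and> gcod h = gcod (tn_obj V C z X, Y, \<kappa>) \<and>
        gr V h = gr V (tn_obj V C z X, Y, \<kappa>) \<and> gpre V C h q = (tn_obj V C z X, Y, \<kappa>)"
      thus "(gcod q, Y, gmor h) = h" using g_triple[of h] by simp
    qed simp
    let ?coeq = "\<forall>Y \<in> VObj C. is_equalizer V (hom_pre V C f Y) (hom_pre V C g Y) (hom_pre V C q Y)"
    have eq_iff: "?coeq \<longleftrightarrow> (\<forall>Y \<in> VObj C. hom_pre V C f Y \<cdot> hom_pre V C q Y = hom_pre V C g Y \<cdot> hom_pre V C q Y) \<and>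
      (\<forall>p. garr V C p \<and> gdom p = tn_obj V C z X \<and> gpre V C p f = gpre V C p g \<longrightarrow> E p)"
    proof -
      have "is_equalizer V (hom_pre V C f Y) (hom_pre V C g Y) (hom_pre V C q Y) \<longleftrightarrow>
         hom_pre V C f Y \<cdot> hom_pre V C q Y = hom_pre V C g Y \<cdot> hom_pre V C q Y \<and>
         (\<forall>\<kappa> \<in> Arr V. Cod V \<kappa> = VHom C (tn_obj V C z X) Y \<and> hom_pre V C f Y \<cdot> \<kappa> = hom_pre V C g Y \<cdot> \<kappa> \<longrightarrow> E (tn_obj V C z X, Y, \<kappa>))"
        if [simp]: "Y \<in> VObj C" for Y
        unfolding is_equalizer_def using E_iff by (simp del: in_hom cong: conj_cong)
      moreover have "(\<forall>Y \<in> VObj C. \<forall>\<kappa> \<in> Arr V. Cod V \<kappa> = VHom C (tn_obj V C z X) Y \<and> hom_pre V C f Y \<cdot> \<kappa> = hom_pre V C g Y \<cdot> \<kappa> \<longrightarrow> E (tn_obj V C z X, Y, \<kappa>))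
        \<longleftrightarrow> (\<forall>p. garr V C p \<and> gdom p = tn_obj V C z X \<and> gpre V C p f = gpre V C p g \<longrightarrow> E p)" (is "?l \<longleftrightarrow> ?r")
      proof
        assume l: ?l
        show ?r
        proof (intro allI impI, elim conjE)
          fix p assume p: "garr V C p" "gdom p = tn_obj V C z X" "gpre V C p f = gpre V C p g"
          hence "hom_pre V C f (gcod p) \<cdot> gmor p = hom_pre V C g (gcod p) \<cdot> gmor p" using hp_eq by blast
          moreover have "gmor p \<in> Arr V" "Cod V (gmor p) = VHom C (tn_obj V C z X) (gcod p)" "gcod p \<in> VObj C"
            using p(1,2) by simp_all
          ultimately have "E (tn_obj V C z X, gcod p, gmor p)" using l by blast
          thus "E p" using g_triple[of p] p(2) by simp
        qed
      next
        assume r: ?r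
        show ?l
        proof (intro ballI impI, elim conjE)
          fix Y \<kappa> assume *: "Y \<in> VObj C" "\<kappa> \<in> Arr V" "Cod V \<kappa> = VHom C (tn_obj V C z X) Y"
            "hom_pre V C f Y \<cdot> \<kappa> = hom_pre V C g Y \<cdot> \<kappa>"
          hence "gpre V C (tn_obj V C z X, Y, \<kappa>) f = gpre V C (tn_obj V C z X, Y, \<kappa>) g"
            using hp_eq[of "(tn_obj V C z X, Y, \<kappa>)"] by simp
          thus "E (tn_obj V C z X, Y, \<kappa>)" using r * by simp
        qed
      qed
      ultimately show ?thesis by blast
    qed
    have k_iff: "(\<forall>Y \<in> VObj C. hom_pre V C f Y \<cdot> hom_pre V C q Y = hom_pre V C g Y \<cdot> hom_pre V C q Y) \<longleftrightarrow>
      gcomp V C ?k ?r = gre V ?k \<gamma>"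
    proof -
      have 1: "hom_pre V C f Y \<cdot> hom_pre V C q Y = hom_pre V C g Y \<cdot> hom_pre V C q Y \<longleftrightarrow>
          gpre V C (gpre V C (gen V C (gcod q) Y) q) f = gpre V C (gpre V C (gen V C (gcod q) Y) q) g"
        if "Y \<in> VObj C" for Y
        using hp_eq[of "gpre V C (gen V C (gcod q) Y) q"] hom_pre_eq[of q Y] that by simp
      have "gpost V C q f = gpost V C q g \<longleftrightarrow> gpost V C (gpost V C q f) (eta (z \<odot> B) X) = gpost V C (gpost V C q g) (eta (z \<odot> B) X)"
        using gepi_post[OF eta_epi[of "z \<odot> B" X], of "gpost V C q f" "gpost V C q g"] by auto
      also have "\<dots> \<longleftrightarrow> gre V ?k \<gamma> = gcomp V C ?k ?r"
        by (simp add: gpost_gpost f\<eta> g\<eta> gcomp_gpost)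
      finally have 2: "gpost V C q f = gpost V C q g \<longleftrightarrow> gcomp V C ?k ?r = gre V ?k \<gamma>" by auto
      show ?thesis
      proof
        assume "\<forall>Y \<in> VObj C. hom_pre V C f Y \<cdot> hom_pre V C q Y = hom_pre V C g Y \<cdot> hom_pre V C q Y"
        \<comment> \<open>The Yoneda step: \<open>Y\<close> is taken to be the target of
          \<open>q\<close>, and the generic endo-arrow is then restricted to the identity.\<close>
        hence "gpre V C (gpre V C (gen V C (gcod q) (gcod q)) q) f = gpre V C (gpre V C (gen V C (gcod q) (gcod q)) q) g"
          using 1 by simp
        hence "gre V (gpre V C (gpre V C (gen V C (gcod q) (gcod q)) q) f) (VId C (gcod q)) =
           gre V (gpre V C (gpre V C (gen V C (gcod q) (gcod q)) q) g) (VId C (gcod q))" by simp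
        moreover have "gre V (gen V C (gcod q) (gcod q)) (VId C (gcod q)) = gid C (gcod q)"
          by (rule g_eqI) simp_all
        ultimately have "gpre V C (gpre V C (gid C (gcod q)) q) f = gpre V C (gpre V C (gid C (gcod q)) q) g"
          by (simp flip: gpre_gre)
        moreover have "gpre V C (gid C (gcod q)) q = q"
          using gpost_eq_gpre[of "gid C (gcod q)" q] by (simp add: gpost_gid)
        ultimately show "gcomp V C ?k ?r = gre V ?k \<gamma>"
          unfolding 2[symmetric] by (simp add: gpost_eq_gpre)
      next
        assume "gcomp V C ?k ?r = gre V ?k \<gamma>"
        hence "gpost V C q f = gpost V C q g" using 2 by blast
        thus "\<forall>Y \<in> VObj C. hom_pre V C f Y \<cdot> hom_pre V C q Y = hom_pre V C g Y \<cdot> hom_pre V C q Y"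
          using 1 by (simp add: gpre_gpre)
      qed
    qed
    have E_lift: "E p \<longleftrightarrow> (\<exists>!h. garr V C h \<and> gdom h = gcod ?k \<and> gcod h = gcod p \<and> gr V h = gr V p \<and> gcomp V C h ?k = gcomp V C p ?\<eta>)"
      if p: "garr V C p" "gdom p = tn_obj V C z X" for p
    proof -
      have "gpre V C h q = p \<longleftrightarrow> gcomp V C h ?k = gcomp V C p ?\<eta>"
        if "garr V C h" "gdom h = gcod q" "gcod h = gcod p" "gr V h = gr V p" for h
        using gepiD[OF eta_epi[of z X], of "gpre V C h q" p] p that by (auto simp: gcomp_gpre)
      thus ?thesis unfolding E_def by (auto cong: conj_cong)
    qed
    \<comment> \<open>Arrows \<open>p\<close> out of the tensor correspond to arrows out of
      \<open>X\<close> through the universal property of \<open>eta\<close>, and \<open>bal\<close>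
      matches the side conditions.\<close>
    have univ_iff: "(\<forall>p. garr V C p \<and> gdom p = tn_obj V C z X \<and> gpre V C p f = gpre V C p g \<longrightarrow> E p) \<longleftrightarrow>
      (\<forall>m f. m \<in> Obj V \<and> garr V C f \<and> gdom f = X \<and> gr V f = m \<odot> z \<and>
        gcomp V C f ?r = gre V f ((Ide V m \<otimes> \<gamma>) \<cdot> assoc V m z B) \<longrightarrow>
        (\<exists>!h. garr V C h \<and> gdom h = gcod ?k \<and> gcod h = gcod f \<and> gr V h = m \<and> gcomp V C h ?k = f))" (is "?l \<longleftrightarrow> ?r'")
    proof
      assume l: ?l
      show ?r'
      proof (intro allI impI, elim conjE)
        fix m f' assume f': "m \<in> Obj V" "garr V C f'" "gdom f' = X" "gr V f' = m \<odot> z"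
          "gcomp V C f' ?r = gre V f' ((Ide V m \<otimes> \<gamma>) \<cdot> assoc V m z B)"
        obtain p where p: "garr V C p" "gdom p = gcod ?\<eta>" "gcod p = gcod f'" "gr V p = m" "gcomp V C p ?\<eta> = f'"
          by (rule tuniv_lift[OF eta(1)[of z X], of m f']) (use f' in simp_all)
        have "gpre V C p f = gpre V C p g" using p f' bal[of p] by simp
        hence "E p" using l p by simp
        thus "\<exists>!h. garr V C h \<and> gdom h = gcod ?k \<and> gcod h = gcod f' \<and> gr V h = m \<and> gcomp V C h ?k = f'"
          using E_lift[of p] p by simp
      qed
    next
      assume r': ?r'
      show ?l
      proof (intro allI impI, elim conjE)
        fix p assume p: "garr V C p" "gdom p = tn_obj V C z X" "gpre V C p f = gpre V C p g"
        have "\<exists>!h. garr V C h \<and> gdom h = gcod ?k \<and> gcod h = gcod (gcomp V C p ?\<eta>) \<and> gr V h = gr V p \<and> gcomp V C h ?k = gcomp V C p ?\<eta>"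
          using p bal[of p] by (intro r'[rule_format]) simp
        thus "E p" using E_lift[of p] p by simp
      qed
    qed
    have "buniv V C ?r \<gamma> ?k \<longleftrightarrow> ?coeq"
      unfolding eq_iff k_iff univ_iff by (simp add: buniv_def)
    thus ?thesis unfolding under
      by (simp add: is_coequalizer_def X_def[symmetric] \<gamma>_def[symmetric] z_def[symmetric] f_def[symmetric])
  qed
qed

end

section \<open>The universal balanced arrow and the morphisms it induces\<close>

context bmod begin

text \<open>The coequalizer morphism transposed to an arrow
  \<open>X \<rightarrow> z \<circledast> X\<close> of grade \<open>z\<close>; it is the universal
  balanced arrow.\<close>

definition K :: "'o \<times> 'o \<times> 'o \<times> 'va \<Rightarrow> 'vo \<times> 'va \<Rightarrow> 'o \<times> 'o \<times> 'va" where
  "K P Z = gpost V C (cq V C b P Z) (eta (fst Z) (fst P))"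

text \<open>A universal balanced arrow \<open>k\<close> is the transpose of a morphism
  \<open>q\<close> out of the tensor, and \<open>coequalizer_iff\<close> makes \<open>q\<close> a
  coequalizer. The choice made by \<open>SOME\<close> then satisfies the same criterion.\<close>

lemma cq:
  assumes P [simp]: "P \<in> LM" and Z [simp]: "Z \<in> RM"
  shows "garr V C (cq V C b P Z)" "gr V (cq V C b P Z) = \<one>" "gdom (cq V C b P Z) = tn_obj V C (fst Z) (fst P)"
    "gcod (cq V C b P Z) = cst_obj V C b P Z" "buniv V C (act P) (snd Z) (K P Z)"
proof -
  let ?coeq = "is_coequalizer V C (tn_left V C (snd Z) (fst P))
      (tn_right V C (fst Z) (snd P) \<cdot>\<^bsub>under V C\<^esub> tn_assoc V C (fst Z) B (fst P))"
  obtain k where k: "buniv V C (act P) (snd Z) k" "gr V k = fst Z"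
    using coeqs[OF left_module(6)[OF P] Z] by blast
  have k': "garr V C k" "gdom k = fst P" using k by (simp_all add: buniv_def)
  obtain q where "garr V C q" "gdom q = gcod (eta (fst Z) (fst P))" "gcod q = gcod k" "gr V q = \<one>"
    "gpost V C q (eta (fst Z) (fst P)) = k"
    by (rule tuniv_lift_post[OF eta(1)[of "fst Z" "fst P"], of k]) (use k k' in simp_all)
  hence "?coeq q" using k by (subst coequalizer_iff) simp_all
  hence "?coeq (SOME q. ?coeq q)" by (rule someI)
  hence "?coeq (cq V C b P Z)" by (simp add: cq_def split_beta)
  thus "garr V C (cq V C b P Z)" "gr V (cq V C b P Z) = \<one>" "gdom (cq V C b P Z) = tn_obj V C (fst Z) (fst P)"
    "buniv V C (act P) (snd Z) (K P Z)"
    unfolding coequalizer_iff[OF P Z] K_def by blast+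
  show "gcod (cq V C b P Z) = cst_obj V C b P Z" by (simp add: cst_obj_def)
qed

lemmas [simp] = cq(1-4)

lemma K_arr [simp]:
  assumes "P \<in> LM" "Z \<in> RM"
  shows "garr V C (K P Z)" "gdom (K P Z) = fst P" "gcod (K P Z) = cst_obj V C b P Z" "gr V (K P Z) = fst Z"
  using assms by (simp_all add: K_def)

lemma cst_obj_in [simp]:
  assumes "P \<in> LM" "Z \<in> RM" shows "cst_obj V C b P Z \<in> VObj C"
  using garr_simps(2)[OF K_arr(1)[OF assms]] assms by simp

lemma K_balanced: "P \<in> LM \<Longrightarrow> Z \<in> RM \<Longrightarrow> gcomp V C (K P Z) (act P) = gre V (K P Z) (snd Z)"
  using cq(5)[of P Z] by (simp add: buniv_def)

lemma K_epi: "P \<in> LM \<Longrightarrow> Z \<in> RM \<Longrightarrow> gepi (K P Z)"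
  by (rule buniv_gepi[OF cq(5)]) simp_all

lemma K_lift:
  assumes "P \<in> LM" "Z \<in> RM" "w \<in> Obj V" "garr V C f" "gdom f = fst P" "gr V f = w \<odot> fst Z"
    "gcomp V C f (act P) = gre V f ((Ide V w \<otimes> snd Z) \<cdot> assoc V w (fst Z) B)"
  obtains h where "garr V C h" "gdom h = cst_obj V C b P Z" "gcod h = gcod f" "gr V h = w" "gcomp V C h (K P Z) = f"
  by (rule buniv_lift[OF cq(5)[OF assms(1,2)], of w f]) (use assms in simp_all)

lemma K_lift_post:
  assumes "P \<in> LM" "Z \<in> RM" "garr V C f" "gdom f = fst P" "gr V f = fst Z"
    "gcomp V C f (act P) = gre V f (snd Z)"
  obtains h where "garr V C h" "gdom h = cst_obj V C b P Z" "gcod h = gcod f" "gr V h = \<one>" "gpost V C h (K P Z) = f"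
  by (rule buniv_lift_post[OF cq(5)[OF assms(1,2)], of f]) (use assms in simp_all)

text \<open>\<open>f \<circledast> X\<close> and \<open>z \<circledast> f\<close> are both defined
  by \<open>THE\<close> as factorisations through \<open>cq\<close>. Composed with
  \<open>eta\<close>, the defining condition speaks about \<open>K\<close>, where existence and
  uniqueness are known.\<close>

lemma the_by_K:
  assumes P [simp]: "P \<in> LM" and Z [simp]: "Z \<in> RM" and Y: "Y \<in> VObj C"
    and e: "garr V C e" "gr V e = \<one>" "gdom e = tn_obj V C (fst Z) (fst P)" "gcod e = Y"
      "gpost V C e (eta (fst Z) (fst P)) = f"
    and f: "gcomp V C f (act P) = gre V f (snd Z)"
  defines "h \<equiv> (THE h. h \<in> hom (under V C) (cst_obj V C b P Z) Y \<and> h \<cdot>\<^bsub>under V C\<^esub> cq V C b P Z = e)"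
  shows "garr V C h" "gr V h = \<one>" "gdom h = cst_obj V C b P Z" "gcod h = Y" "gpost V C h (K P Z) = f"
proof -
  have f' [simp]: "garr V C f" "gdom f = fst P" "gr V f = fst Z" "gcod f = Y"
    using e by (auto simp flip: e(5))
  let ?P = "\<lambda>h. h \<in> hom (under V C) (cst_obj V C b P Z) Y \<and> h \<cdot>\<^bsub>under V C\<^esub> cq V C b P Z = e"
  let ?Q = "\<lambda>h. garr V C h \<and> gr V h = \<one> \<and> gdom h = cst_obj V C b P Z \<and> gcod h = Y \<and> gpost V C h (K P Z) = f"
  have PQ: "?P h \<longleftrightarrow> ?Q h" for h
  proof (cases "garr V C h \<and> gr V h = \<one> \<and> gdom h = cst_obj V C b P Z \<and> gcod h = Y")
    case True
    have "gpost V C h (cq V C b P Z) = e \<longleftrightarrow> gpost V C (gpost V C h (cq V C b P Z)) (eta (fst Z) (fst P)) = f"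
      using gepi_post[OF eta_epi[of "fst Z" "fst P"], of "gpost V C h (cq V C b P Z)" e] e True by auto
    also have "\<dots> \<longleftrightarrow> gpost V C h (K P Z) = f"
      using True by (simp add: gpost_gpost K_def)
    finally show ?thesis using True by simp
  qed auto
  obtain h0 where "garr V C h0" "gdom h0 = cst_obj V C b P Z" "gcod h0 = gcod f" "gr V h0 = \<one>" "gpost V C h0 (K P Z) = f"
    by (rule K_lift_post[OF P Z _ _ _ f]) simp_all
  hence "?Q h0" by simp
  moreover have "h = h'" if "?Q h" "?Q h'" for h h'
    by (rule gepi_post[OF K_epi[OF P Z]]) (use that in simp_all)
  ultimately have "\<exists>!h. ?Q h" by blast
  hence "\<exists>!h. ?P h" using PQ by blast
  from theI'[OF this] have "?Q h" unfolding PQ h_def .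
  thus "garr V C h" "gr V h = \<one>" "gdom h = cst_obj V C b P Z" "gcod h = Y" "gpost V C h (K P Z) = f"
    by blast+
qed

lemma cst_left:
  assumes P [simp]: "P \<in> LM" and Z [simp]: "Z \<in> RM" "Z' \<in> RM"
    and f [simp]: "f \<in> Arr V" "Dom V f = fst Z" "Cod V f = fst Z'"
    and mor: "f \<cdot> snd Z = snd Z' \<cdot> (f \<otimes> Ide V B)"
  shows "garr V C (cst_left V C b P Z Z' f)" "gr V (cst_left V C b P Z Z' f) = \<one>"
    "gdom (cst_left V C b P Z Z' f) = cst_obj V C b P Z" "gcod (cst_left V C b P Z Z' f) = cst_obj V C b P Z'"
    "gpost V C (cst_left V C b P Z Z' f) (K P Z) = gre V (K P Z') f"
proof -
  let ?e = "gpost V C (cq V C b P Z') (tn_left V C f (fst P))"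
  note l = tn_left[of f "fst P" "fst Z"]
  have e: "garr V C ?e" "gr V ?e = \<one>" "gdom ?e = tn_obj V C (fst Z) (fst P)" "gcod ?e = cst_obj V C b P Z'"
    "gpost V C ?e (eta (fst Z) (fst P)) = gre V (K P Z') f"
    using l by (simp_all add: gpost_gpost K_def)
  have f: "gcomp V C (gre V (K P Z') f) (act P) = gre V (gre V (K P Z') f) (snd Z)"
    by (simp add: K_balanced mor)
  have eq: "cst_left V C b P Z Z' f =
     (THE h. h \<in> hom (under V C) (cst_obj V C b P Z) (cst_obj V C b P Z') \<and> h \<cdot>\<^bsub>under V C\<^esub> cq V C b P Z = ?e)"
    using l unfolding cst_left_def Let_def by (subst (2) under_comp) simp_all
  show "garr V C (cst_left V C b P Z Z' f)" "gr V (cst_left V C b P Z Z' f) = \<one>"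
    "gdom (cst_left V C b P Z Z' f) = cst_obj V C b P Z" "gcod (cst_left V C b P Z Z' f) = cst_obj V C b P Z'"
    "gpost V C (cst_left V C b P Z Z' f) (K P Z) = gre V (K P Z') f"
    unfolding eq using the_by_K[OF P Z(1) cst_obj_in[OF P Z(2)] e f] by blast+
qed

text \<open>Compatibility is phrased with the action arrows; \<open>lmor_iff\<close> identifies the
  result with the morphisms of \<open>LMod\<close>.\<close>

definition lmor :: "'o \<times> 'o \<times> 'o \<times> 'va \<Rightarrow> 'o \<times> 'o \<times> 'o \<times> 'va \<Rightarrow> 'o \<times> 'o \<times> 'va \<Rightarrow> bool" where
  "lmor P Q f \<longleftrightarrow> P \<in> LM \<and> Q \<in> LM \<and> garr V C f \<and> gr V f = \<one> \<and> gdom f = fst P \<and> gcod f = fst Q \<and>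
     gpost V C f (act P) = gpre V C (act Q) f"

lemma lmorD:
  assumes "lmor P Q f"
  shows "P \<in> LM" "Q \<in> LM" "garr V C f" "gr V f = \<one>" "gdom f = fst P" "gcod f = fst Q"
     "gpost V C f (act P) = gpre V C (act Q) f"
  using assms by (simp_all add: lmor_def)

lemma cst_right:
  assumes lm: "lmor P Q f" and Z [simp]: "Z \<in> RM"
  shows "garr V C (cst_right V C b P Q f Z)" "gr V (cst_right V C b P Q f Z) = \<one>"
    "gdom (cst_right V C b P Q f Z) = cst_obj V C b P Z" "gcod (cst_right V C b P Q f Z) = cst_obj V C b Q Z"
    "gpost V C (cst_right V C b P Q f Z) (K P Z) = gpre V C (K Q Z) f"
proof -
  note f [simp] = lmorD(1-6)[OF lm]
  let ?e = "gpost V C (cq V C b Q Z) (tn_right V C (fst Z) f)"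
  note tr = tn_right[of f "fst P" "fst Z"]
  have e: "garr V C ?e" "gr V ?e = \<one>" "gdom ?e = tn_obj V C (fst Z) (fst P)" "gcod ?e = cst_obj V C b Q Z"
    "gpost V C ?e (eta (fst Z) (fst P)) = gpre V C (K Q Z) f"
    using tr by (simp_all add: gpost_gpost gpost_gpre K_def)
  have bal: "gcomp V C (gpre V C (K Q Z) f) (act P) = gre V (gpre V C (K Q Z) f) (snd Z)"
    by (simp add: gcomp_gpre lmorD(7)[OF lm] gpre_gcomp[symmetric] K_balanced)
  have eq: "cst_right V C b P Q f Z =
     (THE h. h \<in> hom (under V C) (cst_obj V C b P Z) (cst_obj V C b Q Z) \<and> h \<cdot>\<^bsub>under V C\<^esub> cq V C b P Z = ?e)"
    using tr unfolding cst_right_def Let_def by (subst (2) under_comp) simp_all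
  show "garr V C (cst_right V C b P Q f Z)" "gr V (cst_right V C b P Q f Z) = \<one>"
    "gdom (cst_right V C b P Q f Z) = cst_obj V C b P Z" "gcod (cst_right V C b P Q f Z) = cst_obj V C b Q Z"
    "gpost V C (cst_right V C b P Q f Z) (K P Z) = gpre V C (K Q Z) f"
    unfolding eq using the_by_K[OF f(1) Z cst_obj_in[OF f(2) Z] e bal] by blast+
qed

text \<open>On \<open>eta w\<close> composed with \<open>eta z\<close>, the inverse associator gives
  \<open>eta (w \<odot> z)\<close>. The strength is thus the only morphism that takes
  \<open>eta w\<close> composed with \<open>K P Z\<close> to
  \<open>K P (mod_tensor V b w Z)\<close>.\<close>

lemma cst_strength:
  assumes P [simp]: "P \<in> LM" and Z [simp]: "Z \<in> RM" and w [simp]: "w \<in> Obj V"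
  shows "garr V C (cst_strength V C b P w Z)" "gr V (cst_strength V C b P w Z) = \<one>"
    "gdom (cst_strength V C b P w Z) = tn_obj V C w (cst_obj V C b P Z)"
    "gcod (cst_strength V C b P w Z) = cst_obj V C b P (mod_tensor V b w Z)"
    "gcomp V C (gpost V C (cst_strength V C b P w Z) (eta w (cst_obj V C b P Z))) (K P Z) = K P (mod_tensor V b w Z)"
proof -
  define c where "c = cst_obj V C b P Z"
  define wZ where "wZ = mod_tensor V b w Z"
  have c [simp]: "c \<in> VObj C" by (simp add: c_def)
  have wZ [simp]: "wZ \<in> RM" "fst wZ = w \<odot> fst Z" "snd wZ = (Ide V w \<otimes> snd Z) \<cdot> assoc V w (fst Z) B"
    using mod_tensor_module[OF Z w] by (simp_all add: wZ_def)
  define X z where "X = fst P" and "z = fst Z"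
  have [simp]: "X \<in> VObj C" "z \<in> Obj V" by (simp_all add: X_def z_def)
  have q [simp]: "garr V C (cq V C b P Z)" "gr V (cq V C b P Z) = \<one>" "gdom (cq V C b P Z) = tn_obj V C z X" "gcod (cq V C b P Z) = c"
    "garr V C (cq V C b P wZ)" "gr V (cq V C b P wZ) = \<one>" "gdom (cq V C b P wZ) = tn_obj V C (w \<odot> z) X"
    "gcod (cq V C b P wZ) = cst_obj V C b P wZ"
    by (simp_all add: X_def z_def c_def)
  note tr = tn_right[of "cq V C b P Z" "tn_obj V C z X" w]
  note ti = tn_assoc_iso[of w z X]
  have i [simp]: "garr V C (inv_arr (under V C) (tn_assoc V C w z X))" "gr V (inv_arr (under V C) (tn_assoc V C w z X)) = \<one>"
    using ti(1) by simp_all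
  note [simp] = tr(1-4) ti(2,3)
  let ?e = "gcomp V C (eta w (tn_obj V C z X)) (eta z X)"
  let ?P = "\<lambda>t. t \<in> hom (under V C) (tn_obj V C w c) (cst_obj V C b P wZ) \<and>
    t \<cdot>\<^bsub>under V C\<^esub> tn_right V C w (cq V C b P Z) =
        cq V C b P wZ \<cdot>\<^bsub>under V C\<^esub> inv_arr (under V C) (tn_assoc V C w z X)"
  let ?Q = "\<lambda>t. garr V C t \<and> gr V t = \<one> \<and> gdom t = tn_obj V C w c \<and> gcod t = cst_obj V C b P wZ \<and>
    gcomp V C (gpost V C t (eta w c)) (K P Z) = K P wZ"
  have KX: "K P Z = gpost V C (cq V C b P Z) (eta z X)" "K P wZ = gpost V C (cq V C b P wZ) (eta (w \<odot> z) X)"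
    by (simp_all add: K_def X_def z_def)
  have PQ: "?P t \<longleftrightarrow> ?Q t" for t
  proof (cases "garr V C t \<and> gr V t = \<one> \<and> gdom t = tn_obj V C w c \<and> gcod t = cst_obj V C b P wZ")
    case True
    let ?l = "gpost V C t (tn_right V C w (cq V C b P Z))"
    let ?r = "gpost V C (cq V C b P wZ) (inv_arr (under V C) (tn_assoc V C w z X))"
    have "gpost V C ?l ?e = gpost V C t (gcomp V C (gpost V C (tn_right V C w (cq V C b P Z)) (eta w (tn_obj V C z X))) (eta z X))"
      using True by (simp add: gpost_gpost gcomp_gpost)
    also have "\<dots> = gcomp V C (gpost V C t (eta w c)) (K P Z)"
      using True by (simp add: tr(5) gcomp_gpre gcomp_gpost KX)
    finally have l: "gpost V C ?l ?e = gcomp V C (gpost V C t (eta w c)) (K P Z)" .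
    have r: "gpost V C ?r ?e = K P wZ"
      by (simp add: gpost_gpost ti(4) KX)
    have "?l = ?r \<longleftrightarrow> gpost V C ?l ?e = gpost V C ?r ?e"
      using eta_eta_epi[of w z X ?l ?r] True by auto
    thus ?thesis unfolding l r using True by simp
  qed auto
  \<comment> \<open>The action on the tensored module is the one for which \<open>K P wZ\<close> is
    balanced over \<open>Z\<close> at grade \<open>w\<close>. It factors as an arrow
    \<open>s\<close> of grade \<open>w\<close>, and the tensor turns \<open>s\<close> into a
    morphism.\<close>
  have "gcomp V C (K P wZ) (act P) = gre V (K P wZ) ((Ide V w \<otimes> snd Z) \<cdot> assoc V w (fst Z) B)"
    by (simp add: K_balanced)
  from K_lift[OF P Z w _ _ _ this]
  obtain s where s: "garr V C s" "gdom s = c" "gcod s = cst_obj V C b P wZ" "gr V s = w" "gcomp V C s (K P Z) = K P wZ"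
    unfolding c_def by (auto simp del: split_paired_All)
  obtain t where t: "garr V C t" "gdom t = gcod (eta w c)" "gcod t = gcod s" "gr V t = \<one>" "gpost V C t (eta w c) = s"
    by (rule tuniv_lift_post[OF eta(1)[of w c], of s]) (use s in simp_all)
  have "?Q t" using s t by simp
  moreover have "h = h'" if "?Q h" "?Q h'" for h h'
  proof (rule gepi_post[OF eta_epi[of w c]])
    show "gpost V C h (eta w c) = gpost V C h' (eta w c)"
      by (rule gepiD[OF K_epi[OF P Z]]) (use that in \<open>simp_all add: c_def\<close>)
  qed (use that in simp_all)
  ultimately have "\<exists>!h. ?Q h" by blast
  hence "\<exists>!h. ?P h" using PQ by blast
  moreover have "cst_strength V C b P w Z = (THE t. ?P t)"
    unfolding cst_strength_def Let_def c_def wZ_def X_def z_def ..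
  ultimately have "?Q (cst_strength V C b P w Z)" using theI'[of ?P] unfolding PQ by simp
  thus "garr V C (cst_strength V C b P w Z)" "gr V (cst_strength V C b P w Z) = \<one>"
    "gdom (cst_strength V C b P w Z) = tn_obj V C w (cst_obj V C b P Z)"
    "gcod (cst_strength V C b P w Z) = cst_obj V C b P (mod_tensor V b w Z)"
    "gcomp V C (gpost V C (cst_strength V C b P w Z) (eta w (cst_obj V C b P Z))) (K P Z) = K P (mod_tensor V b w Z)"
    unfolding c_def wZ_def by blast+
qed

lemma lmor_iff:
  "(P \<in> LM \<and> Q \<in> LM \<and> f \<in> hom (under V C) (fst P) (fst Q) \<and>
     f \<cdot>\<^bsub>under V C\<^esub> snd P = snd Q \<cdot>\<^bsub>under V C\<^esub> tn_right V C B f) \<longleftrightarrow> lmor P Q f"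
proof (cases "P \<in> LM \<and> Q \<in> LM \<and> garr V C f \<and> gr V f = \<one> \<and> gdom f = fst P \<and> gcod f = fst Q")
  case True
  hence [simp]: "P \<in> LM" "Q \<in> LM" "garr V C f" "gr V f = \<one>" "gdom f = fst P" "gcod f = fst Q" by simp_all
  note tr = tn_right[of f "fst P" B]
  note [simp] = tr(1-4)
  let ?l = "gpost V C f (snd P)" and ?r = "gpost V C (snd Q) (tn_right V C B f)"
  have "?l = ?r \<longleftrightarrow> gpost V C ?l (eta B (fst P)) = gpost V C ?r (eta B (fst P))"
    using gepi_post[OF eta_epi[of B "fst P"], of ?l ?r] by auto
  also have "\<dots> \<longleftrightarrow> gpost V C f (act P) = gpre V C (act Q) f"
    by (simp add: gpost_gpost tr(5) gpost_gpre mact_def)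
  finally show ?thesis by (simp add: lmor_def)
qed (auto simp: lmor_def)

section \<open>The category of left module objects\<close>

lemma LMod_simps [simp]:
  "Obj (LMod V C b) = LM" "(P, Q, f) \<in> Arr (LMod V C b) \<longleftrightarrow> lmor P Q f"
  "Dom (LMod V C b) a = fst a" "Cod (LMod V C b) a = fst (snd a)"
  "Ide (LMod V C b) P = (P, P, gid C (fst P))"
  "lmor P Q f \<Longrightarrow> lmor Q R g \<Longrightarrow> (Q, R, g) \<cdot>\<^bsub>LMod V C b\<^esub> (P, Q, f) = (P, R, gpost V C g f)"
proof -
  show "Obj (LMod V C b) = LM" "Dom (LMod V C b) a = fst a" "Cod (LMod V C b) a = fst (snd a)"
    "Ide (LMod V C b) P = (P, P, gid C (fst P))"
    by (simp_all add: LMod_def Let_def split_beta)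
  show "(P, Q, f) \<in> Arr (LMod V C b) \<longleftrightarrow> lmor P Q f"
    unfolding lmor_iff[symmetric] by (simp add: LMod_def Let_def)
  assume "lmor P Q f" "lmor Q R g"
  note lmorD[OF this(1)] lmorD[OF this(2)]
  thus "(Q, R, g) \<cdot>\<^bsub>LMod V C b\<^esub> (P, Q, f) = (P, R, gpost V C g f)"
    by (simp add: LMod_def Let_def)
qed

lemma lmor_gid: "P \<in> LM \<Longrightarrow> lmor P P (gid C (fst P))"
  by (simp add: lmor_def gpost_gid gpre_gid)

lemma lmor_comp:
  assumes "lmor P Q f" "lmor Q R g" shows "lmor P R (gpost V C g f)"
proof -
  note f = lmorD[OF assms(1)] and g = lmorD[OF assms(2)]
  have "gpost V C (gpost V C g f) (act P) = gpost V C g (gpre V C (act Q) f)"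
    using f g by (simp add: gpost_gpost)
  also have "\<dots> = gpre V C (gpost V C g (act Q)) f"
    using f(1-6) g(1-6) by (subst gpost_gpre) simp_all
  also have "\<dots> = gpre V C (act R) (gpost V C g f)"
    using f(1-6) g by (simp add: gpre_gpre)
  finally show ?thesis using f(1-6) g(1-6) by (simp add: lmor_def)
qed

lemma category_LMod: "category (LMod V C b)"
proof
  fix f P Q assume "f \<in> hom (LMod V C b) P Q"
  then obtain f0 where f: "f = (P, Q, f0)" and l: "lmor P Q f0" by (cases f) auto
  note lm = lmorD[OF l]
  show "f \<cdot>\<^bsub>LMod V C b\<^esub> Ide (LMod V C b) P = f" "Ide (LMod V C b) Q \<cdot>\<^bsub>LMod V C b\<^esub> f = f"
    using lm l by (simp_all add: f lmor_gid gpost_gid gpost_gid_right)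
next
  fix f g P Q R assume "f \<in> hom (LMod V C b) P Q" "g \<in> hom (LMod V C b) Q R"
  then obtain f0 g0 where "f = (P, Q, f0)" "lmor P Q f0" "g = (Q, R, g0)" "lmor Q R g0"
    by (cases f; cases g) auto
  thus "g \<cdot>\<^bsub>LMod V C b\<^esub> f \<in> hom (LMod V C b) P R" by (simp add: lmor_comp)
next
  fix f g h P Q R S assume "f \<in> hom (LMod V C b) P Q" "g \<in> hom (LMod V C b) Q R" "h \<in> hom (LMod V C b) R S"
  then obtain f0 g0 h0 where *: "f = (P, Q, f0)" "lmor P Q f0" "g = (Q, R, g0)" "lmor Q R g0" "h = (R, S, h0)" "lmor R S h0"
    by (cases f; cases g; cases h) auto
  note lmorD[OF *(2)] lmorD[OF *(4)] lmorD[OF *(6)]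
  thus "(h \<cdot>\<^bsub>LMod V C b\<^esub> g) \<cdot>\<^bsub>LMod V C b\<^esub> f = h \<cdot>\<^bsub>LMod V C b\<^esub> g \<cdot>\<^bsub>LMod V C b\<^esub> f"
    using * lmor_comp by (simp add: gpost_gpost)
next
  fix f assume "f \<in> Arr (LMod V C b)"
  then show "Dom (LMod V C b) f \<in> Obj (LMod V C b)" "Cod (LMod V C b) f \<in> Obj (LMod V C b)"
    using lmorD(1,2) by (cases f, simp)+
qed (simp add: lmor_gid)

end

section \<open>The enriched category of right modules\<close>

locale mod_ctx = monoid_ctx V b
  for V :: "('vo, 'va, 'm) smc_scheme" (structure) and b :: "('vo, 'va) mon" +
  assumes equalizers: "f \<in> Arr V \<Longrightarrow> g \<in> Arr V \<Longrightarrow> Dom V f = Dom V g \<Longrightarrow> Cod V f = Cod V g \<Longrightarrow>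
    \<exists>i. is_equalizer V f g i"
begin

abbreviation "M \<equiv> Mod V b"
abbreviation "inc \<equiv> mod_incl V b"

text \<open>The module morphisms from \<open>mod_tensor V b w X\<close> to \<open>Y\<close>; these
  are what the hom object of modules represents.\<close>

definition modmap :: "'vo \<times> 'va \<Rightarrow> 'vo \<times> 'va \<Rightarrow> 'vo \<Rightarrow> 'va \<Rightarrow> bool" where
  "modmap X Y w g \<longleftrightarrow> w \<in> Obj V \<and> g \<in> Arr V \<and> Dom V g = w \<odot> fst X \<and> Cod V g = fst Y \<and>
     g \<cdot> (Ide V w \<otimes> snd X) \<cdot> assoc V w (fst X) B = snd Y \<cdot> (g \<otimes> Ide V B)"

lemma Mod_simps [simp]: "VObj M = RM" "VHom M X Y = Dom V (inc X Y)"
  by (simp_all add: Mod_def Let_def)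

text \<open>Uncurrying the two legs of the equalizer and moving one associator gives the two sides
  of the module condition.\<close>

lemma equalizing_iff:
  assumes [simp]: "X \<in> RM" "Y \<in> RM" and f [simp]: "f \<in> Arr V" "Cod V f = ihom V (fst X) (fst Y)"
  shows "ihom_pre V (snd X) (fst Y) \<cdot> f = (ihom_post V (fst X \<odot> B) (snd Y) \<cdot> ihom_ten V B (fst X) (fst Y)) \<cdot> f \<longleftrightarrow>
    modmap X Y (Dom V f) (unc (fst X) (fst Y) f)"
proof -
  let ?u = "unc (fst X) (fst Y) f" and ?U = "unc (fst X \<odot> B) (fst Y)"
  let ?l = "ihom_pre V (snd X) (fst Y) \<cdot> f"
  let ?r = "ihom_post V (fst X \<odot> B) (snd Y) \<cdot> ihom_ten V B (fst X) (fst Y) \<cdot> f"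
  have l: "?U ?l = ?u \<cdot> (Ide V (Dom V f) \<otimes> snd X)"
    using unc_ihom_pre[of "snd X" "fst Y" f "fst X \<odot> B"] by simp
  have r: "?U ?r = snd Y \<cdot> (?u \<otimes> Ide V B) \<cdot> assoc' (Dom V f) (fst X) B"
    using unc_ihom_post[of "snd Y" "fst X \<odot> B" "ihom_ten V B (fst X) (fst Y) \<cdot> f" "fst Y"]
      unc_ihom_ten[of B "fst X" "fst Y" f] by simp
  have "?l = ?r \<longleftrightarrow> ?U ?l = ?U ?r"
    by (rule iffI, simp, rule unc_inj[of _ _ "fst X \<odot> B" "fst Y"]) simp_all
  also have "\<dots> \<longleftrightarrow> ?U ?l \<cdot> assoc V (Dom V f) (fst X) B = ?U ?r \<cdot> assoc V (Dom V f) (fst X) B"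
    by (rule iso_cancel_right_iff[symmetric]) simp_all
  also have "\<dots> \<longleftrightarrow> modmap X Y (Dom V f) ?u"
    unfolding l r modmap_def by simp
  finally show ?thesis by simp
qed

lemma inc_equalizer:
  assumes [simp]: "X \<in> RM" "Y \<in> RM"
  shows "is_equalizer V (ihom_pre V (snd X) (fst Y))
     (ihom_post V (fst X \<odot> B) (snd Y) \<cdot> ihom_ten V B (fst X) (fst Y)) (inc X Y)"
proof -
  have "\<exists>i. is_equalizer V (ihom_pre V (snd X) (fst Y))
     (ihom_post V (fst X \<odot> B) (snd Y) \<cdot> ihom_ten V B (fst X) (fst Y)) i"
    by (rule equalizers) simp_all
  thus ?thesis unfolding mod_incl_def split_beta by (rule someI_ex)
qed

lemma inc [simp]:
  assumes "X \<in> RM" "Y \<in> RM"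
  shows "inc X Y \<in> Arr V" "Cod V (inc X Y) = ihom V (fst X) (fst Y)"
  using inc_equalizer[OF assms] assms by (simp_all add: is_equalizer_def)

lemma inc_lift:
  assumes [simp]: "X \<in> RM" "Y \<in> RM" and g: "modmap X Y w g"
  shows "\<exists>!p. p \<in> hom V w (Dom V (inc X Y)) \<and> inc X Y \<cdot> p = curry V w (fst X) (fst Y) g"
proof -
  have [simp]: "w \<in> Obj V" "g \<in> Arr V" "Dom V g = w \<odot> fst X" "Cod V g = fst Y"
    using g by (simp_all add: modmap_def)
  let ?k = "curry V w (fst X) (fst Y) g"
  have "ihom_pre V (snd X) (fst Y) \<cdot> ?k = (ihom_post V (fst X \<odot> B) (snd Y) \<cdot> ihom_ten V B (fst X) (fst Y)) \<cdot> ?k"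
    by (subst equalizing_iff) (simp_all add: g)
  moreover have "?k \<in> Arr V" "Cod V ?k = Dom V (ihom_pre V (snd X) (fst Y))" by simp_all
  ultimately have "\<exists>!h. h \<in> hom V (Dom V ?k) (Dom V (inc X Y)) \<and> inc X Y \<cdot> h = ?k"
    using inc_equalizer[OF assms(1,2)] unfolding is_equalizer_def by blast
  thus ?thesis by simp
qed

lemma modmap_inc:
  assumes [simp]: "X \<in> RM" "Y \<in> RM" and p [simp]: "p \<in> Arr V" "Cod V p = Dom V (inc X Y)"
  shows "modmap X Y (Dom V p) (unc (fst X) (fst Y) (inc X Y \<cdot> p))"
proof -
  let ?l = "ihom_pre V (snd X) (fst Y)" and ?r = "ihom_post V (fst X \<odot> B) (snd Y) \<cdot> ihom_ten V B (fst X) (fst Y)"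
  have eq: "?l \<cdot> inc X Y = ?r \<cdot> inc X Y"
    using inc_equalizer[OF assms(1,2)] unfolding is_equalizer_def by blast
  have "?l \<cdot> inc X Y \<cdot> p = (?l \<cdot> inc X Y) \<cdot> p" by simp
  also have "\<dots> = ?r \<cdot> inc X Y \<cdot> p" unfolding eq by simp
  finally have "modmap X Y (Dom V (inc X Y \<cdot> p)) (unc (fst X) (fst Y) (inc X Y \<cdot> p))"
    by (subst (asm) equalizing_iff) simp_all
  thus ?thesis by simp
qed

lemma inc_cancel:
  assumes [simp]: "X \<in> RM" "Y \<in> RM" and pq: "p \<in> Arr V" "Cod V p = Dom V (inc X Y)" "q \<in> Arr V" "Cod V q = Dom V (inc X Y)"
    "Dom V p = Dom V q" and eq: "inc X Y \<cdot> p = inc X Y \<cdot> q"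
  shows "p = q"
proof -
  let ?g = "unc (fst X) (fst Y) (inc X Y \<cdot> q)"
  have "curry V (Dom V q) (fst X) (fst Y) ?g = inc X Y \<cdot> q"
    by (rule unc_inj[of _ _ "fst X" "fst Y"]) (use pq(3,4) in simp_all)
  hence "\<exists>!p. p \<in> hom V (Dom V q) (Dom V (inc X Y)) \<and> inc X Y \<cdot> p = inc X Y \<cdot> q"
    using inc_lift[OF assms(1,2) modmap_inc[OF assms(1,2) pq(3,4)]] by simp
  thus ?thesis using pq eq by auto
qed

lemma modmap_lunit:
  assumes [simp]: "X \<in> RM" shows "modmap X X \<one> (lunit V (fst X))"
proof -
  have "(lunit V (fst X) \<cdot> (Ide V \<one> \<otimes> snd X)) \<cdot> assoc V \<one> (fst X) B =
      snd X \<cdot> (lunit V (fst X \<odot> B) \<cdot> assoc V \<one> (fst X) B)"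
    by (subst lunit_nat_arr) simp_all
  also have "\<dots> = snd X \<cdot> (lunit V (fst X) \<otimes> Ide V B)"
    by (subst lunit_ten) simp_all
  finally show ?thesis by (simp add: modmap_def)
qed

lemma modmap_comp:
  assumes [simp]: "X \<in> RM" "Y \<in> RM" "Z \<in> RM" and g: "modmap Y Z w' g" and f: "modmap X Y w f"
  shows "modmap X Z (w' \<odot> w) (g \<cdot> (Ide V w' \<otimes> f) \<cdot> assoc V w' w (fst X))"
proof -
  have g' [simp]: "w' \<in> Obj V" "g \<in> Arr V" "Dom V g = w' \<odot> fst Y" "Cod V g = fst Z"
    and f' [simp]: "w \<in> Obj V" "f \<in> Arr V" "Dom V f = w \<odot> fst X" "Cod V f = fst Y"
    and ge: "g \<cdot> (Ide V w' \<otimes> snd Y) \<cdot> assoc V w' (fst Y) B = snd Z \<cdot> (g \<otimes> Ide V B)"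
    and fe: "f \<cdot> (Ide V w \<otimes> snd X) \<cdot> assoc V w (fst X) B = snd Y \<cdot> (f \<otimes> Ide V B)"
    using g f by (simp_all add: modmap_def)
  let ?x = "fst X" and ?\<gamma> = "snd X"
  have "(g \<cdot> (Ide V w' \<otimes> f) \<cdot> assoc V w' w ?x) \<cdot> (Ide V (w' \<odot> w) \<otimes> ?\<gamma>) \<cdot> assoc V (w' \<odot> w) ?x B =
     g \<cdot> (Ide V w' \<otimes> f) \<cdot> (assoc V w' w ?x \<cdot> ((Ide V w' \<otimes> Ide V w) \<otimes> ?\<gamma>)) \<cdot> assoc V (w' \<odot> w) ?x B"
    by simp
  also have "\<dots> = g \<cdot> (Ide V w' \<otimes> (f \<cdot> (Ide V w \<otimes> ?\<gamma>))) \<cdot> assoc V w' w (?x \<odot> B) \<cdot> assoc V (w' \<odot> w) ?x B"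
    by (subst assoc_nat_arr) simp_all
  also have "\<dots> = g \<cdot> (Ide V w' \<otimes> (f \<cdot> (Ide V w \<otimes> ?\<gamma>) \<cdot> assoc V w ?x B)) \<cdot> assoc V w' (w \<odot> ?x) B \<cdot> (assoc V w' w ?x \<otimes> Ide V B)"
    by (subst pentagon) simp_all
  also have "\<dots> = g \<cdot> (Ide V w' \<otimes> snd Y) \<cdot> ((Ide V w' \<otimes> f \<otimes> Ide V B) \<cdot> assoc V w' (w \<odot> ?x) B) \<cdot> (assoc V w' w ?x \<otimes> Ide V B)"
    unfolding fe by simp
  also have "\<dots> = g \<cdot> (Ide V w' \<otimes> snd Y) \<cdot> (assoc V w' (fst Y) B \<cdot> ((Ide V w' \<otimes> f) \<otimes> Ide V B)) \<cdot> (assoc V w' w ?x \<otimes> Ide V B)"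
    by (subst assoc_nat_arr) simp_all
  also have "\<dots> = (g \<cdot> (Ide V w' \<otimes> snd Y) \<cdot> assoc V w' (fst Y) B) \<cdot> (((Ide V w' \<otimes> f) \<cdot> assoc V w' w ?x) \<otimes> Ide V B)"
    by simp
  also have "\<dots> = snd Z \<cdot> ((g \<cdot> (Ide V w' \<otimes> f) \<cdot> assoc V w' w ?x) \<otimes> Ide V B)"
    unfolding ge by simp
  finally show ?thesis by (simp add: modmap_def)
qed

lemma Mod_id:
  assumes X [simp]: "X \<in> RM"
  shows "VId M X \<in> Arr V" "Dom V (VId M X) = \<one>" "Cod V (VId M X) = Dom V (inc X X)"
    "inc X X \<cdot> VId M X = VId (self_enriched V) (fst X)"
proof -
  have *: "VId M X = (THE f. f \<in> hom V \<one> (Dom V (inc X X)) \<and> inc X X \<cdot> f = curry V \<one> (fst X) (fst X) (lunit V (fst X)))"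
    by (simp add: Mod_def Let_def self_enriched_def)
  show "VId M X \<in> Arr V" "Dom V (VId M X) = \<one>" "Cod V (VId M X) = Dom V (inc X X)"
    "inc X X \<cdot> VId M X = VId (self_enriched V) (fst X)"
    unfolding * using theI'[OF inc_lift[OF X X modmap_lunit[OF X]]] by (simp_all add: self_enriched_def)
qed

lemma Mod_comp:
  assumes [simp]: "X \<in> RM" "Y \<in> RM" "Z \<in> RM"
  shows "VComp M X Y Z \<in> Arr V" "Dom V (VComp M X Y Z) = Dom V (inc Y Z) \<odot> Dom V (inc X Y)"
    "Cod V (VComp M X Y Z) = Dom V (inc X Z)"
    "inc X Z \<cdot> VComp M X Y Z = VComp (self_enriched V) (fst X) (fst Y) (fst Z) \<cdot> (inc Y Z \<otimes> inc X Y)"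
proof -
  let ?s = "VComp (self_enriched V) (fst X) (fst Y) (fst Z) \<cdot> (inc Y Z \<otimes> inc X Y)"
  let ?w = "Dom V (inc Y Z) \<odot> Dom V (inc X Y)"
  have "modmap Y Z (Dom V (inc Y Z)) (unc (fst Y) (fst Z) (inc Y Z))"
    "modmap X Y (Dom V (inc X Y)) (unc (fst X) (fst Y) (inc X Y))"
    using modmap_inc[of Y Z "Ide V (Dom V (inc Y Z))"] modmap_inc[of X Y "Ide V (Dom V (inc X Y))"] by simp_all
  from modmap_comp[OF assms this]
  have mm: "modmap X Z ?w (unc (fst X) (fst Z) ?s)"
    by (subst unc_self_comp) simp_all
  have c: "curry V ?w (fst X) (fst Z) (unc (fst X) (fst Z) ?s) = ?s"
    by (rule unc_inj[of _ _ "fst X" "fst Z"]) simp_all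
  have *: "VComp M X Y Z = (THE f. f \<in> hom V ?w (Dom V (inc X Z)) \<and> inc X Z \<cdot> f = ?s)"
    by (simp add: Mod_def Let_def)
  show "VComp M X Y Z \<in> Arr V" "Dom V (VComp M X Y Z) = ?w" "Cod V (VComp M X Y Z) = Dom V (inc X Z)"
    "inc X Z \<cdot> VComp M X Y Z = ?s"
    unfolding * using theI'[OF inc_lift[OF assms(1,3) mm]] unfolding c by simp_all
qed

lemma inc_comp_eq:
  assumes "X \<in> RM" "Y \<in> RM" "Z \<in> RM" "k \<in> Arr V" "Cod V k = Dom V (inc Y Z) \<odot> Dom V (inc X Y)"
  shows "inc X Z \<cdot> VComp M X Y Z \<cdot> k = VComp (self_enriched V) (fst X) (fst Y) (fst Z) \<cdot> (inc Y Z \<otimes> inc X Y) \<cdot> k"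
proof -
  have "inc X Z \<cdot> VComp M X Y Z \<cdot> k = (inc X Z \<cdot> VComp M X Y Z) \<cdot> k"
    using assms by (simp add: Mod_comp(1-3))
  thus ?thesis using assms by (simp add: Mod_comp)
qed

text \<open>The inclusion of hom objects into internal homs can be cancelled by
  \<open>inc_cancel\<close> and respects units and composition, so each law is inherited from the
  self-enrichment.\<close>

lemma enriched_Mod: "enriched_category V M"
proof (intro enriched_category.intro enriched_category_axioms.intro closed_symmetric_monoidal_axioms, goal_cases)
  case (4 W X Y Z)
  hence [simp]: "W \<in> RM" "X \<in> RM" "Y \<in> RM" "Z \<in> RM" by simp_all
  interpret S: enriched_category V "self_enriched V" by (rule enriched_self)
  let ?S = "VComp (self_enriched V)"
  note [simp] = Mod_comp(1-3)
  have "inc W Z \<cdot> VComp M W X Z \<cdot> (VComp M X Y Z \<otimes> Ide V (Dom V (inc W X))) =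
      ?S (fst W) (fst X) (fst Z) \<cdot> ((inc X Z \<cdot> VComp M X Y Z) \<otimes> inc W X)"
    by (simp add: inc_comp_eq del: Mod_simps)
  also have "\<dots> = (?S (fst W) (fst X) (fst Z) \<cdot> (?S (fst X) (fst Y) (fst Z) \<otimes> Ide V (ihom V (fst W) (fst X)))) \<cdot>
      ((inc Y Z \<otimes> inc X Y) \<otimes> inc W X)"
    by (simp add: Mod_comp(4))
  also have "\<dots> = ?S (fst W) (fst Y) (fst Z) \<cdot> (Ide V (ihom V (fst Y) (fst Z)) \<otimes> ?S (fst W) (fst X) (fst Y)) \<cdot>
      (assoc V (ihom V (fst Y) (fst Z)) (ihom V (fst X) (fst Y)) (ihom V (fst W) (fst X)) \<cdot> ((inc Y Z \<otimes> inc X Y) \<otimes> inc W X))"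
    using S.VComp_assoc[of "fst W" "fst X" "fst Y" "fst Z"] by simp
  also have "\<dots> = ?S (fst W) (fst Y) (fst Z) \<cdot> (inc Y Z \<otimes> (?S (fst W) (fst X) (fst Y) \<cdot> (inc X Y \<otimes> inc W X))) \<cdot>
      assoc V (Dom V (inc Y Z)) (Dom V (inc X Y)) (Dom V (inc W X))"
    by (subst assoc_nat_arr) simp_all
  also have "\<dots> = ?S (fst W) (fst Y) (fst Z) \<cdot> (inc Y Z \<otimes> (inc W Y \<cdot> VComp M W X Y)) \<cdot>
      assoc V (Dom V (inc Y Z)) (Dom V (inc X Y)) (Dom V (inc W X))"
    by (simp add: Mod_comp(4))
  also have "\<dots> = inc W Z \<cdot> VComp M W Y Z \<cdot> (Ide V (Dom V (inc Y Z)) \<otimes> VComp M W X Y) \<cdot>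
      assoc V (Dom V (inc Y Z)) (Dom V (inc X Y)) (Dom V (inc W X))"
    by (simp add: inc_comp_eq)
  finally show ?case
    unfolding Mod_simps by (rule inc_cancel[rotated -1]) simp_all
next
  case (5 X Y)
  hence [simp]: "X \<in> RM" "Y \<in> RM" by simp_all
  interpret S: enriched_category V "self_enriched V" by (rule enriched_self)
  note [simp] = Mod_comp(1-3) Mod_id
  have "inc X Y \<cdot> VComp M X Y Y \<cdot> (VId M Y \<otimes> Ide V (Dom V (inc X Y))) =
      (VComp (self_enriched V) (fst X) (fst Y) (fst Y) \<cdot> (VId (self_enriched V) (fst Y) \<otimes> Ide V (ihom V (fst X) (fst Y)))) \<cdot>
      (Ide V \<one> \<otimes> inc X Y)"
    by (simp add: inc_comp_eq)
  also have "\<dots> = lunit V (ihom V (fst X) (fst Y)) \<cdot> (Ide V \<one> \<otimes> inc X Y)"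
    using S.VId_left[of "fst X" "fst Y"] by simp
  also have "\<dots> = inc X Y \<cdot> lunit V (Dom V (inc X Y))"
    by (rule lunit_nat_arr) simp_all
  finally show ?case
    unfolding Mod_simps by (rule inc_cancel[rotated -1]) simp_all
next
  case (6 X Y)
  hence [simp]: "X \<in> RM" "Y \<in> RM" by simp_all
  interpret S: enriched_category V "self_enriched V" by (rule enriched_self)
  note [simp] = Mod_comp(1-3) Mod_id
  have "inc X Y \<cdot> VComp M X X Y \<cdot> (Ide V (Dom V (inc X Y)) \<otimes> VId M X) =
      (VComp (self_enriched V) (fst X) (fst X) (fst Y) \<cdot> (Ide V (ihom V (fst X) (fst Y)) \<otimes> VId (self_enriched V) (fst X))) \<cdot>
      (inc X Y \<otimes> Ide V \<one>)"
    by (simp add: inc_comp_eq)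
  also have "\<dots> = runit V (ihom V (fst X) (fst Y)) \<cdot> (inc X Y \<otimes> Ide V \<one>)"
    using S.VId_right[of "fst X" "fst Y"] by simp
  also have "\<dots> = inc X Y \<cdot> runit V (Dom V (inc X Y))"
    by (rule runit_nat_arr) simp_all
  finally show ?case
    unfolding Mod_simps by (rule inc_cancel[rotated -1]) simp_all
qed (simp_all add: Mod_id Mod_comp)

section \<open>Graded arrows between right modules\<close>

sublocale Mod: enriched_category V M by (rule enriched_Mod)

text \<open>Identifies arrows of grade \<open>w\<close> in \<open>Mod\<close> with elements of
  \<open>modmap X Y w\<close>, by \<open>mu_modmap\<close>, \<open>mu_inj\<close> and
  \<open>mu_lift\<close>. Computations with modules are carried out on \<open>mu\<close>, hence in
  \<open>V\<close>.\<close>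

definition mu :: "('vo \<times> 'va) \<times> ('vo \<times> 'va) \<times> 'va \<Rightarrow> 'va" where
  "mu p = unc (fst (gdom p)) (fst (gcod p)) (inc (gdom p) (gcod p) \<cdot> gmor p)"

lemma garr_Mod [simp]:
  assumes "garr V M p"
  shows "gdom p \<in> RM" "gcod p \<in> RM" "gmor p \<in> Arr V" "Cod V (gmor p) = Dom V (inc (gdom p) (gcod p))"
  using Mod.garr_simps[OF assms] by simp_all

lemma mu_modmap: "garr V M p \<Longrightarrow> modmap (gdom p) (gcod p) (gr V p) (mu p)"
  unfolding mu_def by (intro modmap_inc) simp_all

lemma mu_arr [simp]:
  assumes "garr V M p"
  shows "mu p \<in> Arr V" "Dom V (mu p) = gr V p \<odot> fst (gdom p)" "Cod V (mu p) = fst (gcod p)"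
  using mu_modmap[OF assms] by (simp_all add: modmap_def)

lemma mu_balanced:
  assumes "garr V M p"
  shows "mu p \<cdot> (Ide V (gr V p) \<otimes> snd (gdom p)) \<cdot> assoc V (gr V p) (fst (gdom p)) B = snd (gcod p) \<cdot> (mu p \<otimes> Ide V B)"
  using mu_modmap[OF assms] by (simp add: modmap_def)

lemma mu_inj:
  assumes pq: "garr V M p" "garr V M q" "gdom p = gdom q" "gcod p = gcod q" "gr V p = gr V q" and mu: "mu p = mu q"
  shows "p = q"
proof (rule g_eqI)
  have "inc (gdom q) (gcod q) \<cdot> gmor p = inc (gdom q) (gcod q) \<cdot> gmor q"
    by (rule unc_inj[of _ _ "fst (gdom q)" "fst (gcod q)"])
      (use pq mu garr_Mod(4)[OF pq(1)] in \<open>simp_all add: mu_def\<close>)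
  thus "gmor p = gmor q"
    by (rule inc_cancel[rotated -1, of "gdom q" "gcod q"]) (use pq garr_Mod(4)[OF pq(1)] in simp_all)
qed (use pq in simp_all)

lemma mu_lift:
  assumes [simp]: "X \<in> RM" "Y \<in> RM" and g: "modmap X Y w g"
  obtains p where "garr V M p" "gdom p = X" "gcod p = Y" "gr V p = w" "mu p = g"
proof -
  have [simp]: "w \<in> Obj V" "g \<in> Arr V" "Dom V g = w \<odot> fst X" "Cod V g = fst Y"
    using g by (simp_all add: modmap_def)
  obtain p where p: "p \<in> hom V w (Dom V (inc X Y))" "inc X Y \<cdot> p = curry V w (fst X) (fst Y) g"
    using inc_lift[OF assms] by blast
  show ?thesis
    by (rule that[of "(X, Y, p)"]) (use p in \<open>simp_all add: mu_def\<close>)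
qed

lemma mu_gre:
  assumes "garr V M p" "s \<in> Arr V" "Cod V s = gr V p"
  shows "mu (gre V p s) = mu p \<cdot> (s \<otimes> Ide V (fst (gdom p)))"
proof -
  have "mu (gre V p s) = unc (fst (gdom p)) (fst (gcod p)) ((inc (gdom p) (gcod p) \<cdot> gmor p) \<cdot> s)"
    using assms by (simp add: mu_def)
  also have "\<dots> = mu p \<cdot> (s \<otimes> Ide V (fst (gdom p)))"
    using assms unfolding mu_def by (intro unc_comp) simp_all
  finally show ?thesis .
qed

lemma mu_gid: "X \<in> RM \<Longrightarrow> mu (gid M X) = lunit V (fst X)"
  by (simp add: mu_def Mod_id)

lemma mu_gcomp:
  assumes "garr V M q" "garr V M p" "gcod p = gdom q"
  shows "mu (gcomp V M q p) = mu q \<cdot> (Ide V (gr V q) \<otimes> mu p) \<cdot> assoc V (gr V q) (gr V p) (fst (gdom p))"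
proof -
  obtain X Y Z f g where eq: "p = (X, Y, f)" "q = (Y, Z, g)"
    using assms(3) by (cases p; cases q) auto
  have [simp]: "X \<in> RM" "Y \<in> RM" "Z \<in> RM" "f \<in> Arr V" "g \<in> Arr V" "Cod V f = Dom V (inc X Y)" "Cod V g = Dom V (inc Y Z)"
    using assms unfolding eq by auto
  have "inc X Z \<cdot> VComp M X Y Z \<cdot> (g \<otimes> f) = VComp (self_enriched V) (fst X) (fst Y) (fst Z) \<cdot> ((inc Y Z \<cdot> g) \<otimes> (inc X Y \<cdot> f))"
    by (subst inc_comp_eq) simp_all
  thus ?thesis
    using unc_self_comp[of "inc Y Z \<cdot> g" "inc X Y \<cdot> f" "fst Y" "fst Z" "fst X"]
    by (simp add: mu_def gcomp_def eq)
qed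

text \<open>The arrow of grade \<open>z\<close> from the regular module to \<open>Z\<close> whose
  underlying map is the action \<open>z \<odot> b \<rightarrow> z\<close>. At the regular module
  itself it is the multiplication.\<close>

definition zhat :: "'vo \<times> 'va \<Rightarrow> ('vo \<times> 'va) \<times> ('vo \<times> 'va) \<times> 'va" where
  "zhat Z = (SOME p. garr V M p \<and> gdom p = (B, m) \<and> gcod p = Z \<and> gr V p = fst Z \<and> mu p = snd Z)"

lemma zhat [simp]:
  assumes "Z \<in> RM"
  shows "garr V M (zhat Z)" "gdom (zhat Z) = (B, m)" "gcod (zhat Z) = Z" "gr V (zhat Z) = fst Z" "mu (zhat Z) = snd Z"
proof -
  have "modmap (B, m) Z (fst Z) (snd Z)"
    using module_laws(1)[OF assms] assms by (simp add: modmap_def)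
  from mu_lift[OF regular_module assms this]
  have "\<exists>p. garr V M p \<and> gdom p = (B, m) \<and> gcod p = Z \<and> gr V p = fst Z \<and> mu p = snd Z" by metis
  from someI_ex[OF this] show "garr V M (zhat Z)" "gdom (zhat Z) = (B, m)" "gcod (zhat Z) = Z" "gr V (zhat Z) = fst Z" "mu (zhat Z) = snd Z"
    unfolding zhat_def by blast+
qed

abbreviation "mhat \<equiv> zhat (B, m)"

lemmas [simp] = regular_module

text \<open>Read through \<open>mu\<close>, naturality of \<open>zhat\<close> is the module
  condition on \<open>mu p\<close>.\<close>

lemma zhat_nat:
  assumes p: "garr V M p"
  shows "gcomp V M p (zhat (gdom p)) = gre V (zhat (gcod p)) (mu p)"
proof (rule mu_inj)
  show "mu (gcomp V M p (zhat (gdom p))) = mu (gre V (zhat (gcod p)) (mu p))"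
    using p mu_balanced[OF p] by (simp add: mu_gcomp mu_gre)
qed (use p in simp_all)

lemma zhat_balanced:
  assumes "Z \<in> RM" shows "gcomp V M (zhat Z) mhat = gre V (zhat Z) (snd Z)"
  using zhat_nat[of "zhat Z"] assms by simp

text \<open>The left action of \<open>b\<close> on itself inside \<open>Mod\<close>. Enriched
  functors preserve it, which is where the module structure on their value at \<open>b\<close> comes
  from.\<close>

lemma mhat_action: "gaction V M b mhat"
proof -
  have "gre V mhat u = gid M (B, m)"
    by (rule mu_inj) (simp_all add: mu_gre mu_gid monoid_laws)
  thus ?thesis
    using zhat_balanced[of "(B, m)"] by (simp add: gaction_def)
qed

text \<open>Evaluation at the unit of \<open>b\<close> recovers \<open>mu h\<close>; this gives
  uniqueness of factorisations through \<open>zhat Z\<close>.\<close>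

lemma zhat_unit:
  assumes Z [simp]: "Z \<in> RM" and h [simp]: "garr V M h" "gdom h = Z"
  shows "mu (gcomp V M h (zhat Z)) \<cdot> (Ide V (gr V h \<odot> fst Z) \<otimes> u) = mu h \<cdot> runit V (gr V h \<odot> fst Z)"
proof -
  let ?w = "gr V h"
  have [simp]: "?w \<in> Obj V" by simp
  have "mu (gcomp V M h (zhat Z)) \<cdot> (Ide V (?w \<odot> fst Z) \<otimes> u) =
     mu h \<cdot> (Ide V ?w \<otimes> snd Z) \<cdot> (assoc V ?w (fst Z) B \<cdot> ((Ide V ?w \<otimes> Ide V (fst Z)) \<otimes> u))"
    by (simp add: mu_gcomp)
  also have "\<dots> = mu h \<cdot> (Ide V ?w \<otimes> (snd Z \<cdot> (Ide V (fst Z) \<otimes> u))) \<cdot> assoc V ?w (fst Z) \<one>"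
    by (subst assoc_nat_arr) simp_all
  also have "\<dots> = mu h \<cdot> runit V (?w \<odot> fst Z)"
    unfolding module_laws(2)[OF Z] by (subst runit_ten) simp_all
  finally show ?thesis .
qed

text \<open>Every right module is the colimit of the free module \<open>b\<close> weighted by itself.\<close>

lemma zhat_univ:
  assumes Z [simp]: "Z \<in> RM"
  shows "buniv V M mhat (snd Z) (zhat Z)"
  unfolding buniv_def
proof (intro conjI allI impI, simp, simp, simp add: zhat_balanced, elim conjE)
  fix w f assume f: "w \<in> Obj V" "garr V M f" "gdom f = gdom mhat" "gr V f = w \<odot> gr V (zhat Z)"
    "gcomp V M f mhat = gre V f ((Ide V w \<otimes> snd Z) \<cdot> assoc V w (gr V (zhat Z)) (gr V mhat))"
  define z \<gamma> Y where "z = fst Z" and "\<gamma> = snd Z" and "Y = gcod f"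
  have [simp]: "z \<in> Obj V" "\<gamma> \<in> Arr V" "Dom V \<gamma> = z \<odot> B" "Cod V \<gamma> = z" "Y \<in> RM" "w \<in> Obj V"
    using f by (simp_all add: z_def \<gamma>_def Y_def)
  have f' [simp]: "garr V M f" "gdom f = (B, m)" "gcod f = Y" "gr V f = w \<odot> z"
    and fb: "gcomp V M f mhat = gre V f ((Ide V w \<otimes> \<gamma>) \<cdot> assoc V w z B)"
    using f by (simp_all add: z_def \<gamma>_def Y_def)
  define F where "F = mu f"
  have F [simp]: "F \<in> Arr V" "Dom V F = (w \<odot> z) \<odot> B" "Cod V F = fst Y"
    and F_bal: "F \<cdot> (Ide V (w \<odot> z) \<otimes> m) \<cdot> assoc V (w \<odot> z) B B = snd Y \<cdot> (F \<otimes> Ide V B)"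
    using mu_balanced[of f] by (simp_all add: F_def)
  let ?G = "(Ide V w \<otimes> \<gamma>) \<cdot> assoc V w z B"
  have FG: "F \<cdot> (Ide V (w \<odot> z) \<otimes> m) \<cdot> assoc V (w \<odot> z) B B = F \<cdot> (?G \<otimes> Ide V B)"
    using arg_cong[OF fb, of mu] by (simp add: mu_gcomp mu_gre F_def)
  \<comment> \<open>A module map out of the regular module is determined by its value at the unit of
    \<open>b\<close>, so the factorisation has to be \<open>F\<close> evaluated there.\<close>
  define g where "g = F \<cdot> (Ide V (w \<odot> z) \<otimes> u) \<cdot> runit' (w \<odot> z)"
  have g [simp]: "g \<in> Arr V" "Dom V g = w \<odot> z" "Cod V g = fst Y" by (simp_all add: g_def)
  \<comment> \<open>Both sides of the module condition for \<open>g\<close> are shown to equal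
    \<open>F\<close>. Here balancing of \<open>f\<close> moves the action of \<open>z\<close> onto
    the multiplication of \<open>b\<close>, where the right unit law applies; for the other side the
    module condition on \<open>F\<close> and the left unit law are used.\<close>
  have "g \<cdot> ?G = F \<cdot> (Ide V (w \<odot> z) \<otimes> u) \<cdot> (runit' (w \<odot> z) \<cdot> ?G)"
    by (simp add: g_def)
  also have "\<dots> = F \<cdot> (Ide V (w \<odot> z) \<otimes> u) \<cdot> (?G \<otimes> Ide V \<one>) \<cdot> runit' ((w \<odot> z) \<odot> B)"
    by (subst runit'_nat) simp_all
  also have "\<dots> = (F \<cdot> (?G \<otimes> Ide V B)) \<cdot> (Ide V ((w \<odot> z) \<odot> B) \<otimes> u) \<cdot> runit' ((w \<odot> z) \<odot> B)"
    by simp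
  also have "\<dots> = F \<cdot> (Ide V (w \<odot> z) \<otimes> m) \<cdot> (assoc V (w \<odot> z) B B \<cdot> ((Ide V (w \<odot> z) \<otimes> Ide V B) \<otimes> u)) \<cdot> runit' ((w \<odot> z) \<odot> B)"
    unfolding FG[symmetric] by simp
  also have "\<dots> = F \<cdot> (Ide V (w \<odot> z) \<otimes> (m \<cdot> (Ide V B \<otimes> u))) \<cdot> assoc V (w \<odot> z) B \<one> \<cdot> runit' ((w \<odot> z) \<odot> B)"
    by (subst assoc_nat_arr) simp_all
  also have "\<dots> = F \<cdot> ((Ide V (w \<odot> z) \<otimes> runit V B) \<cdot> assoc V (w \<odot> z) B \<one>) \<cdot> runit' ((w \<odot> z) \<odot> B)"
    unfolding monoid_laws by simp
  also have "\<dots> = F"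
    by (subst runit_ten) simp_all
  finally have gG: "g \<cdot> ?G = F" .
  have "snd Y \<cdot> (g \<otimes> Ide V B) = (snd Y \<cdot> (F \<otimes> Ide V B)) \<cdot> (((Ide V (w \<odot> z) \<otimes> u) \<cdot> runit' (w \<odot> z)) \<otimes> Ide V B)"
    by (simp add: g_def)
  also have "\<dots> = F \<cdot> (Ide V (w \<odot> z) \<otimes> m) \<cdot> (assoc V (w \<odot> z) B B \<cdot> ((Ide V (w \<odot> z) \<otimes> u) \<otimes> Ide V B)) \<cdot> (runit' (w \<odot> z) \<otimes> Ide V B)"
    unfolding F_bal[symmetric] by simp
  also have "\<dots> = F \<cdot> (Ide V (w \<odot> z) \<otimes> (m \<cdot> (u \<otimes> Ide V B))) \<cdot> (assoc V (w \<odot> z) \<one> B \<cdot> (runit' (w \<odot> z) \<otimes> Ide V B))"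
    by (subst assoc_nat_arr) simp_all
  also have "\<dots> = F"
    unfolding monoid_laws by (subst assoc_runit'_lunit') simp_all
  finally have "modmap Z Y w g"
    using gG by (simp add: modmap_def z_def \<gamma>_def)
  then obtain h where h [simp]: "garr V M h" "gdom h = Z" "gcod h = Y" "gr V h = w" and mu_h: "mu h = g"
    using mu_lift[OF Z \<open>Y \<in> RM\<close>] by metis
  have hz: "gcomp V M h (zhat Z) = f"
  proof (rule mu_inj)
    show "mu (gcomp V M h (zhat Z)) = mu f"
      using gG by (simp add: mu_gcomp mu_h F_def z_def \<gamma>_def)
  qed (simp_all add: z_def)
  show "\<exists>!h. garr V M h \<and> gdom h = gcod (zhat Z) \<and> gcod h = gcod f \<and> gr V h = w \<and> gcomp V M h (zhat Z) = f"
  proof (rule ex1I[of _ h])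
    show "garr V M h \<and> gdom h = gcod (zhat Z) \<and> gcod h = gcod f \<and> gr V h = w \<and> gcomp V M h (zhat Z) = f"
      using hz by simp
  next
    fix h' assume h': "garr V M h' \<and> gdom h' = gcod (zhat Z) \<and> gcod h' = gcod f \<and> gr V h' = w \<and> gcomp V M h' (zhat Z) = f"
    have "mu h' \<cdot> runit V (w \<odot> z) = mu h \<cdot> runit V (w \<odot> z)"
      using zhat_unit[of Z h'] zhat_unit[of Z h] h' hz by (simp add: z_def)
    hence "mu h' = mu h"
      by (rule iso_cancel_right[rotated -1]) (use h' in \<open>simp_all add: z_def\<close>)
    thus "h' = h" by (rule mu_inj[rotated -1]) (use h' in simp_all)
  qed
qed

end

section \<open>The functor and its right adjoint\<close>

locale cst_ctx = bmod V C b + mod_ctx V b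
  for V :: "('vo, 'va, 'm) smc_scheme" (structure) and C :: "('o, 'vo, 'va) vcat" and b :: "('vo, 'va) mon"
begin

abbreviation "cs \<equiv> cst V C b"

section \<open>The effect of the functor on graded arrows\<close>

lemma cst_simps [simp]: "Z \<in> RM \<Longrightarrow> f_obj (cs P) Z = cst_obj V C b P Z"
  by (simp add: cst_def)

text \<open>The hom action is the strength followed by the map that evaluation induces. Tested on
  \<open>K P Z\<close>, the strength yields \<open>K\<close> at the tensored module, and evaluation
  then restricts \<open>K P Z'\<close> along \<open>mu\<close> of the generic arrow.\<close>

lemma cst_gen:
  assumes P [simp]: "P \<in> LM" and Z [simp]: "Z \<in> RM" "Z' \<in> RM"
  defines "\<phi> \<equiv> (cst_obj V C b P Z, cst_obj V C b P Z', f_hom (cs P) Z Z')"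
  shows "garr V C \<phi>" "gr V \<phi> = Dom V (inc Z Z')" "gcomp V C \<phi> (K P Z) = gre V (K P Z') (mu (gen V M Z Z'))"
proof -
  define w where "w = Dom V (inc Z Z')"
  define c where "c = cst_obj V C b P Z"
  define wZ where "wZ = mod_tensor V b w Z"
  define ev where "ev = mu (gen V M Z Z')"
  have [simp]: "w \<in> Obj V" "c \<in> VObj C" by (simp_all add: w_def c_def)
  have wZ [simp]: "wZ \<in> RM" "fst wZ = w \<odot> fst Z" "snd wZ = (Ide V w \<otimes> snd Z) \<cdot> assoc V w (fst Z) B"
    using mod_tensor_module[of Z w] by (simp_all add: wZ_def)
  have ev [simp]: "ev \<in> Arr V" "Dom V ev = w \<odot> fst Z" "Cod V ev = fst Z'"
    and ev_bal: "ev \<cdot> snd wZ = snd Z' \<cdot> (ev \<otimes> Ide V B)"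
    using mu_arr[of "gen V M Z Z'"] mu_balanced[of "gen V M Z Z'"] by (simp_all add: ev_def w_def)
  have ev_eq: "ev = eval V (fst Z) (fst Z') \<cdot> (inc Z Z' \<otimes> Ide V (fst Z))"
    by (simp add: ev_def mu_def unc_def)
  define L where "L = cst_left V C b P wZ Z' ev"
  define S where "S = cst_strength V C b P w Z"
  have L [simp]: "garr V C L" "gr V L = \<one>" "gdom L = cst_obj V C b P wZ" "gcod L = cst_obj V C b P Z'"
    and LK: "gpost V C L (K P wZ) = gre V (K P Z') ev"
    unfolding L_def by (rule cst_left; simp add: ev_bal del: wZ(3))+
  have S [simp]: "garr V C S" "gr V S = \<one>" "gdom S = tn_obj V C w c" "gcod S = cst_obj V C b P wZ"
    and SK: "gcomp V C (gpost V C S (eta w c)) (K P Z) = K P wZ"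
    using cst_strength[of P Z w] by (simp_all add: S_def c_def wZ_def)
  have h: "L \<cdot>\<^bsub>under V C\<^esub> S = gpost V C L S" by (rule under_comp) simp_all
  have "f_hom (cs P) Z Z' = hom_post V C c (L \<cdot>\<^bsub>under V C\<^esub> S) \<cdot> tn_unit V C w c"
    by (simp add: cst_def Let_def L_def S_def wZ_def w_def c_def ev_eq)
  also have "\<dots> = gmor (gpost V C (gpost V C L S) (eta w c))"
    unfolding h using hom_post(4)[of "gpost V C L S" c "eta w c"] by (simp add: gmor_eta)
  finally have \<phi>: "\<phi> = gpost V C (gpost V C L S) (eta w c)"
    by (intro g_eqI) (simp_all add: \<phi>_def c_def)
  show "garr V C \<phi>" "gr V \<phi> = Dom V (inc Z Z')"
    unfolding \<phi> by (simp_all add: w_def)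
  show "gcomp V C \<phi> (K P Z) = gre V (K P Z') (mu (gen V M Z Z'))"
    unfolding \<phi> ev_def[symmetric] using SK LK by (simp add: gpost_gpost gcomp_gpost c_def)
qed

text \<open>Extends \<open>cst_gen\<close> from the generic arrow by restriction. Since
  \<open>K\<close> can be cancelled, it determines the action of \<open>cs P\<close> on arrows
  completely.\<close>

lemma fapp_cst:
  assumes P [simp]: "P \<in> LM" and p [simp]: "garr V M p"
  shows "garr V C (fapp V (cs P) p)" "gr V (fapp V (cs P) p) = gr V p"
    "gcomp V C (fapp V (cs P) p) (K P (gdom p)) = gre V (K P (gcod p)) (mu p)"
proof -
  let ?\<phi> = "(cst_obj V C b P (gdom p), cst_obj V C b P (gcod p), f_hom (cs P) (gdom p) (gcod p))"
  note g = cst_gen[OF P garr_Mod(1,2)[OF p]]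
  have eq: "fapp V (cs P) p = gre V ?\<phi> (gmor p)"
    by (rule g_eqI) (simp_all add: fapp_def)
  show "garr V C (fapp V (cs P) p)" "gr V (fapp V (cs P) p) = gr V p"
    unfolding eq using garr_gre[OF g(1), of "gmor p"] g(2) by simp_all
  have "gcomp V C (fapp V (cs P) p) (K P (gdom p)) = gre V (gcomp V C ?\<phi> (K P (gdom p))) (gmor p \<otimes> Ide V (fst (gdom p)))"
    unfolding eq using g(1,2) by (subst gcomp_gre_left) simp_all
  also have "\<dots> = gre V (K P (gcod p)) (mu (gen V M (gdom p) (gcod p)) \<cdot> (gmor p \<otimes> Ide V (fst (gdom p))))"
    unfolding g(3) by simp
  also have "mu (gen V M (gdom p) (gcod p)) \<cdot> (gmor p \<otimes> Ide V (fst (gdom p))) = mu (gre V (gen V M (gdom p) (gcod p)) (gmor p))"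
    by (subst mu_gre) simp_all
  also have "\<dots> = mu p" using Mod.gen_gmor[OF p] by simp
  finally show "gcomp V C (fapp V (cs P) p) (K P (gdom p)) = gre V (K P (gcod p)) (mu p)" .
qed

text \<open>After composing with \<open>K P Z\<close> the functor laws become the formulas for
  \<open>mu\<close> of an identity and of a composite.\<close>

lemma enriched_cst:
  assumes P [simp]: "P \<in> LM"
  shows "enriched_functor V M C (cs P)"
proof (rule enriched_functorI)
  show "enriched_category V M" by (rule enriched_Mod)
  show "enriched_category V C" by (rule enriched_category_axioms)
  fix Z Z' Z'' assume "Z \<in> VObj M" "Z' \<in> VObj M" "Z'' \<in> VObj M"
  hence [simp]: "Z \<in> RM" "Z' \<in> RM" "Z'' \<in> RM" by simp_all
  show "f_obj (cs P) Z \<in> VObj C" by simp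
  show "f_hom (cs P) Z Z' \<in> hom V (VHom M Z Z') (VHom C (f_obj (cs P) Z) (f_obj (cs P) Z'))"
    using cst_gen(1,2)[of P Z Z'] by simp
  show "fapp V (cs P) (gid M Z) = gid C (f_obj (cs P) Z)"
  proof (rule gepiD[OF K_epi[of P Z]])
    show "gcomp V C (fapp V (cs P) (gid M Z)) (K P Z) = gcomp V C (gid C (f_obj (cs P) Z)) (K P Z)"
      using fapp_cst(3)[of P "gid M Z"] by (simp add: mu_gid gcomp_gid)
  qed (use fapp_cst(1,2)[of P "gid M Z"] in simp_all)
  let ?q = "gen V M Z' Z''" and ?p = "gen V M Z Z'"
  note q = fapp_cst[of P ?q] and p = fapp_cst[of P ?p] and qp = fapp_cst[of P "gcomp V M ?q ?p"]
  show "fapp V (cs P) (gcomp V M ?q ?p) = gcomp V C (fapp V (cs P) ?q) (fapp V (cs P) ?p)"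
  proof (rule gepiD[OF K_epi[of P Z]])
    have "gcomp V C (gcomp V C (fapp V (cs P) ?q) (fapp V (cs P) ?p)) (K P Z) =
      gre V (gcomp V C (fapp V (cs P) ?q) (gcomp V C (fapp V (cs P) ?p) (K P Z))) (assoc V (gr V ?q) (gr V ?p) (fst Z))"
      using p(1,2) q(1,2) by (subst gcomp_assoc) simp_all
    also have "gcomp V C (fapp V (cs P) ?p) (K P Z) = gre V (K P Z') (mu ?p)"
      using p(3) by simp
    also have "gcomp V C (fapp V (cs P) ?q) (gre V (K P Z') (mu ?p)) =
        gre V (gre V (K P Z'') (mu ?q)) (Ide V (gr V ?q) \<otimes> mu ?p)"
      using q by simp
    also have "gre V (gre V (gre V (K P Z'') (mu ?q)) (Ide V (gr V ?q) \<otimes> mu ?p)) (assoc V (gr V ?q) (gr V ?p) (fst Z)) =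
      gcomp V C (fapp V (cs P) (gcomp V M ?q ?p)) (K P Z)"
      using qp(3) by (simp add: mu_gcomp)
    finally show "gcomp V C (fapp V (cs P) (gcomp V M ?q ?p)) (K P Z) =
        gcomp V C (gcomp V C (fapp V (cs P) ?q) (fapp V (cs P) ?p)) (K P Z)" by simp
  qed (use p(1,2) q(1,2) qp(1,2) in simp_all)
qed

lemma cst_vfunctors: "P \<in> LM \<Longrightarrow> cs P \<in> vfunctors V M C"
  using enriched_cst by (simp add: vfunctors_def cst_def Let_def)

section \<open>Transformations out of the functor of a module object\<close>

sublocale VF: vfunct_ctx V M C
  by (intro vfunct_ctx.intro enriched_Mod enriched_category_axioms)

text \<open>The morphism \<open>X \<rightarrow> b \<circledast> X\<close> induced by the unit of
  \<open>b\<close>; its inverse is \<open>counitor\<close>.\<close>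

definition unitor :: "'o \<times> 'o \<times> 'o \<times> 'va \<Rightarrow> 'o \<times> 'o \<times> 'va" where
  "unitor P = gre V (K P (B, m)) u"

lemma unitor [simp]:
  assumes "P \<in> LM"
  shows "garr V C (unitor P)" "gr V (unitor P) = \<one>" "gdom (unitor P) = fst P" "gcod (unitor P) = cst_obj V C b P (B, m)"
  using assms by (simp_all add: unitor_def)

text \<open>The image of \<open>zhat Z\<close> restricts \<open>K P Z\<close> along the action of
  \<open>Z\<close>, and the unit law of \<open>Z\<close> absorbs the unit contained in
  \<open>unitor\<close>.\<close>

lemma cst_zhat_unitor:
  assumes [simp]: "P \<in> LM" "Z \<in> RM"
  shows "gpre V C (fapp V (cs P) (zhat Z)) (unitor P) = K P Z"
proof -
  interpret F: enriched_functor V M C "cs P" by (rule enriched_cst) simp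
  have "gcomp V C (fapp V (cs P) (zhat Z)) (unitor P) =
      gre V (gcomp V C (fapp V (cs P) (zhat Z)) (K P (B, m))) (Ide V (fst Z) \<otimes> u)"
    by (simp add: unitor_def)
  also have "\<dots> = gre V (K P Z) (snd Z \<cdot> (Ide V (fst Z) \<otimes> u))"
    using fapp_cst(3)[of P "zhat Z"] by simp
  also have "\<dots> = gre V (K P Z) (runit V (fst Z))"
    by (simp add: module_laws)
  finally show ?thesis by (simp add: gpre_def gre_ide)
qed

text \<open>Balancing turns the action into the multiplication of \<open>b\<close>, and the left
  unit law absorbs the unit contained in \<open>unitor\<close>.\<close>

lemma unitor_act:
  assumes [simp]: "P \<in> LM"
  shows "gpost V C (unitor P) (act P) = K P (B, m)"
proof -
  have "gcomp V C (unitor P) (act P) = gre V (K P (B, m)) (m \<cdot> (u \<otimes> Ide V B))"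
    using K_balanced[of P "(B, m)"] by (simp add: unitor_def)
  thus ?thesis by (simp add: gpost_def monoid_laws gre_ide)
qed

text \<open>\<open>K P Z\<close> is the image of \<open>zhat Z\<close> precomposed with
  \<open>unitor P\<close>, so naturality at \<open>zhat Z\<close> expresses the component at
  \<open>Z\<close> through the one at the regular module.\<close>

lemma nat_on_K:
  assumes P [simp]: "P \<in> LM" and Z [simp]: "Z \<in> RM" and G: "enriched_functor V M C G"
    and \<alpha>: "enriched_nat_trans V M C (cs P) G \<alpha>"
  shows "gpost V C (component (cs P) G \<alpha> Z) (K P Z) =
    gpre V C (fapp V G (zhat Z)) (gpost V C (component (cs P) G \<alpha> (B, m)) (unitor P))"
proof -
  interpret F: enriched_functor V M C "cs P" by (rule enriched_cst) simp
  interpret G: enriched_functor V M C G by (rule G)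
  note F = F.enriched_functor_axioms
  note [simp] = VF.natD(1,2)[OF F G \<alpha>]
  have "gpost V C (component (cs P) G \<alpha> Z) (K P Z) =
      gpre V C (gpost V C (component (cs P) G \<alpha> Z) (fapp V (cs P) (zhat Z))) (unitor P)"
    by (subst gpost_gpre[symmetric]) (simp_all add: cst_zhat_unitor)
  also have "gpost V C (component (cs P) G \<alpha> Z) (fapp V (cs P) (zhat Z)) =
      gpre V C (fapp V G (zhat Z)) (component (cs P) G \<alpha> (B, m))"
    using VF.natD(3)[OF F G \<alpha>, of "zhat Z"] by simp
  also have "gpre V C \<dots> (unitor P) = gpre V C (fapp V G (zhat Z)) (gpost V C (component (cs P) G \<alpha> (B, m)) (unitor P))"
    by (subst gpre_gpre) simp_all
  finally show ?thesis .
qed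

text \<open>Tested on \<open>K\<close>, one path restricts along \<open>mu p\<close> and the other
  precomposes with \<open>f\<close>; these operations commute.\<close>

lemma cst_right_nat:
  assumes lm: "lmor P Q f"
  shows "enriched_nat_trans V M C (cs P) (cs Q) (\<lambda>Z \<in> RM. gmor (cst_right V C b P Q f Z))"
    and "Z \<in> RM \<Longrightarrow> component (cs P) (cs Q) (\<lambda>Z \<in> RM. gmor (cst_right V C b P Q f Z)) Z = cst_right V C b P Q f Z"
proof -
  note f [simp] = lmorD(1-6)[OF lm]
  let ?\<alpha> = "\<lambda>Z \<in> RM. gmor (cst_right V C b P Q f Z)"
  note r = cst_right[OF lm]
  note [simp] = r(1-4)
  show c: "component (cs P) (cs Q) ?\<alpha> Z = cst_right V C b P Q f Z" if "Z \<in> RM" for Z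
    using that by (intro g_eqI) (simp_all add: component_mor)
  interpret F: enriched_functor V M C "cs P" by (rule enriched_cst) simp
  interpret G: enriched_functor V M C "cs Q" by (rule enriched_cst) simp
  have "gpost V C (cst_right V C b P Q f (gcod p)) (fapp V (cs P) p) = gpre V C (fapp V (cs Q) p) (cst_right V C b P Q f (gdom p))"
    if p [simp]: "garr V M p" for p
  proof (rule gepiD[OF K_epi[of P "gdom p"]])
    have "gcomp V C (gpost V C (cst_right V C b P Q f (gcod p)) (fapp V (cs P) p)) (K P (gdom p)) =
        gpost V C (cst_right V C b P Q f (gcod p)) (gre V (K P (gcod p)) (mu p))"
      using fapp_cst(3)[of P p] by (simp add: gcomp_gpost)
    also have "\<dots> = gre V (gpre V C (K Q (gcod p)) f) (mu p)"
      by (simp add: r(5))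
    also have "\<dots> = gpre V C (gcomp V C (fapp V (cs Q) p) (K Q (gdom p))) f"
      using fapp_cst(3)[of Q p] by simp
    also have "\<dots> = gcomp V C (gpre V C (fapp V (cs Q) p) (cst_right V C b P Q f (gdom p))) (K P (gdom p))"
      by (simp add: gpre_gcomp gcomp_gpre r(5))
    finally show "gcomp V C (gpost V C (cst_right V C b P Q f (gcod p)) (fapp V (cs P) p)) (K P (gdom p)) =
      gcomp V C (gpre V C (fapp V (cs Q) p) (cst_right V C b P Q f (gdom p))) (K P (gdom p))" .
  qed simp_all
  thus "enriched_nat_trans V M C (cs P) (cs Q) ?\<alpha>"
    unfolding enriched_nat_trans_iff[OF F.enriched_functor_axioms G.enriched_functor_axioms] by (simp add: c)
qed

lemma cst_nat_ext:
  assumes P [simp]: "P \<in> LM" and G: "enriched_functor V M C G"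
    and \<alpha>: "enriched_nat_trans V M C (cs P) G \<alpha>" and \<beta>: "enriched_nat_trans V M C (cs P) G \<beta>"
    and eq: "gpost V C (component (cs P) G \<alpha> (B, m)) (unitor P) = gpost V C (component (cs P) G \<beta> (B, m)) (unitor P)"
    and Z [simp]: "Z \<in> RM"
  shows "component (cs P) G \<alpha> Z = component (cs P) G \<beta> Z"
proof (rule gepi_post[OF K_epi[OF P Z]])
  show "gpost V C (component (cs P) G \<alpha> Z) (K P Z) = gpost V C (component (cs P) G \<beta> Z) (K P Z)"
    unfolding nat_on_K[OF P Z G \<alpha>] nat_on_K[OF P Z G \<beta>] eq ..
qed (use VF.natD(1,2)[OF enriched_cst[OF P] G \<alpha>] VF.natD(1,2)[OF enriched_cst[OF P] G \<beta>] in simp_all)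

lemma cst_right_unitor:
  assumes lm: "lmor P Q f"
  shows "gpost V C (cst_right V C b P Q f (B, m)) (unitor P) = gpost V C (unitor Q) f"
proof -
  note [simp] = lmorD(1-6)[OF lm] cst_right(1-4)[OF lm]
  have "gpost V C (cst_right V C b P Q f (B, m)) (unitor P) = gre V (gpre V C (K Q (B, m)) f) u"
    by (simp add: unitor_def cst_right(5)[OF lm])
  also have "\<dots> = gpre V C (unitor Q) f"
    by (simp add: unitor_def)
  also have "\<dots> = gpost V C (unitor Q) f"
    by (subst gpost_eq_gpre) simp_all
  finally show ?thesis .
qed

text \<open>The action arrow is balanced over the multiplication, hence factors through
  \<open>K P (B, m)\<close>; this is the factor.\<close>

definition counitor :: "'o \<times> 'o \<times> 'o \<times> 'va \<Rightarrow> 'o \<times> 'o \<times> 'va" where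
  "counitor P = (SOME h. garr V C h \<and> gdom h = cst_obj V C b P (B, m) \<and> gcod h = fst P \<and> gr V h = \<one> \<and>
     gpost V C h (K P (B, m)) = act P)"

lemma counitor [simp]:
  assumes P: "P \<in> LM"
  shows "garr V C (counitor P)" "gdom (counitor P) = cst_obj V C b P (B, m)" "gcod (counitor P) = fst P"
    "gr V (counitor P) = \<one>" "gpost V C (counitor P) (K P (B, m)) = act P"
    "gpost V C (counitor P) (unitor P) = gid C (fst P)" "gpost V C (unitor P) (counitor P) = gid C (cst_obj V C b P (B, m))"
proof -
  have [simp]: "P \<in> LM" by fact
  have "gcomp V C (act P) (act P) = gre V (act P) (snd (B, m))"
    using left_module(12)[OF P] by simp
  from K_lift_post[OF P regular_module _ _ _ this]
  have "\<exists>h. garr V C h \<and> gdom h = cst_obj V C b P (B, m) \<and> gcod h = fst P \<and> gr V h = \<one> \<and>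
     gpost V C h (K P (B, m)) = act P"
    by (auto simp del: split_paired_Ex)
  from someI_ex[OF this]
  show c [simp]: "garr V C (counitor P)" "gdom (counitor P) = cst_obj V C b P (B, m)" "gcod (counitor P) = fst P"
    "gr V (counitor P) = \<one>" and ca: "gpost V C (counitor P) (K P (B, m)) = act P"
    unfolding counitor_def by blast+
  show "gpost V C (counitor P) (unitor P) = gid C (fst P)"
    using left_module(11)[OF P] by (simp add: unitor_def ca)
  show "gpost V C (unitor P) (counitor P) = gid C (cst_obj V C b P (B, m))"
    by (rule gepi_post[OF K_epi[OF P regular_module]]) (simp_all add: gpost_gpost ca unitor_act gpost_gid)
qed

text \<open>A transformation is determined by its component at the regular module, and conjugating
  this component by the isomorphisms \<open>X \<cong> b \<circledast> X\<close> gives the only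
  candidate for \<open>f\<close>.\<close>

lemma cst_fully_faithful:
  assumes P [simp]: "P \<in> LM" and Q [simp]: "Q \<in> LM" and \<alpha>: "enriched_nat_trans V M C (cs P) (cs Q) \<alpha>"
  shows "\<exists>!f. lmor P Q f \<and> (\<forall>Z \<in> RM. cst_right V C b P Q f Z = component (cs P) (cs Q) \<alpha> Z)"
proof -
  note F = enriched_cst[OF P] and G = enriched_cst[OF Q]
  interpret G: enriched_functor V M C "cs Q" by (rule G)
  note n [simp] = VF.natD(1,2)[OF F G \<alpha>]
  let ?a = "component (cs P) (cs Q) \<alpha> (B, m)"
  have a: "gpost V C ?a (unitor P) = gpost V C (unitor Q) f"
    if "f = gpost V C (counitor Q) (gpost V C ?a (unitor P))" for f
  proof -
    have "gpost V C (unitor Q) f = gpost V C (gpost V C (unitor Q) (counitor Q)) (gpost V C ?a (unitor P))"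
      unfolding that by (subst gpost_gpost) simp_all
    thus ?thesis by (simp add: gpost_gid)
  qed
  define f where "f = gpost V C (counitor Q) (gpost V C ?a (unitor P))"
  have f [simp]: "garr V C f" "gr V f = \<one>" "gdom f = fst P" "gcod f = fst Q" by (simp_all add: f_def)
  \<comment> \<open>Naturality at the multiplication of \<open>b\<close>; it makes \<open>f\<close>
    compatible with the actions.\<close>
  have aK: "gpost V C ?a (K P (B, m)) = gpre V C (K Q (B, m)) f"
  proof -
    have "gpost V C ?a (K P (B, m)) = gpre V C (fapp V (cs Q) mhat) (gpost V C (unitor Q) f)"
      using nat_on_K[OF P regular_module G \<alpha>] a[OF f_def] by simp
    also have "\<dots> = gpre V C (gpre V C (fapp V (cs Q) mhat) (unitor Q)) f"
      by (subst gpre_gpre) simp_all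
    finally show ?thesis by (simp add: cst_zhat_unitor)
  qed
  have "gpost V C f (act P) = gpost V C (counitor Q) (gpost V C ?a (gpost V C (unitor P) (act P)))"
    by (simp add: f_def gpost_gpost)
  also have "\<dots> = gpost V C (counitor Q) (gpre V C (K Q (B, m)) f)"
    by (simp add: unitor_act aK)
  also have "\<dots> = gpre V C (act Q) f"
    by (simp add: gpost_gpre)
  finally have lm: "lmor P Q f" by (simp add: lmor_def)
  have comp: "component (cs P) (cs Q) (\<lambda>Z \<in> RM. gmor (cst_right V C b P Q f Z)) Z = component (cs P) (cs Q) \<alpha> Z" if "Z \<in> RM" for Z
    by (rule cst_nat_ext[OF P G cst_right_nat(1)[OF lm] \<alpha> _ that])
      (use cst_right_nat(2)[OF lm regular_module] cst_right_unitor[OF lm] a[OF f_def] in simp)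
  show ?thesis
  proof (rule ex1I[of _ f])
    show "lmor P Q f \<and> (\<forall>Z \<in> RM. cst_right V C b P Q f Z = component (cs P) (cs Q) \<alpha> Z)"
      using lm comp cst_right_nat(2)[OF lm] by simp
  next
    fix f' assume f': "lmor P Q f' \<and> (\<forall>Z \<in> RM. cst_right V C b P Q f' Z = component (cs P) (cs Q) \<alpha> Z)"
    note l [simp] = lmorD(3-6)[OF conjunct1[OF f']]
    have "gpost V C (unitor Q) f' = gpost V C ?a (unitor P)"
      using cst_right_unitor[OF conjunct1[OF f']] f' by simp
    also have "\<dots> = gpost V C (unitor Q) f" by (rule a) (rule f_def)
    finally have "gpost V C (counitor Q) (gpost V C (unitor Q) f') = gpost V C (counitor Q) (gpost V C (unitor Q) f)" by simp
    thus "f' = f"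
      by (simp add: gpost_gpost[symmetric] gpost_gid)
  qed
qed

section \<open>The right adjoint C(X,-) and cocontinuity\<close>

definition rmod :: "'o \<times> 'o \<times> 'o \<times> 'va \<Rightarrow> 'o \<Rightarrow> 'vo \<times> 'va" where
  "rmod P Y = (VHom C (fst P) Y, gmor (gcomp V C (gen V C (fst P) Y) (act P)))"

text \<open>Restricting from the generic arrow, composition of \<open>f\<close> with the action
  arrow is the module structure of \<open>C(X,Y)\<close> applied to \<open>f\<close>.\<close>

lemma gcomp_act:
  assumes [simp]: "P \<in> LM" and f [simp]: "garr V C f" "gdom f = fst P"
  shows "gmor (gcomp V C f (act P)) = snd (rmod P (gcod f)) \<cdot> (gmor f \<otimes> Ide V B)"
proof -
  have Y [simp]: "gcod f \<in> VObj C" by (rule garr_simps) simp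
  have "gcomp V C f (act P) = gcomp V C (gre V (gen V C (fst P) (gcod f)) (gmor f)) (act P)"
    using gen_gmor[OF f(1)] by simp
  also have "\<dots> = gre V (gcomp V C (gen V C (fst P) (gcod f)) (act P)) (gmor f \<otimes> Ide V B)"
    by (subst gcomp_gre_left) simp_all
  finally show ?thesis by (simp add: rmod_def)
qed

text \<open>\<open>b\<close> acts on \<open>C(X,Y)\<close> by precomposition with the action arrow
  of \<open>X\<close>, so the module laws follow from the action laws and associativity of graded
  composition.\<close>

lemma rmod [simp]:
  assumes P [simp]: "P \<in> LM" and Y [simp]: "Y \<in> VObj C"
  shows "rmod P Y \<in> RM" "fst (rmod P Y) = VHom C (fst P) Y"
proof -
  let ?X = "fst P" and ?g = "gen V C (fst P) Y" and ?h = "VHom C (fst P) Y"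
  define p where "p = gcomp V C ?g (act P)"
  have p [simp]: "garr V C p" "gdom p = ?X" "gcod p = Y" "gr V p = ?h \<odot> B" by (simp_all add: p_def)
  have s: "snd (rmod P Y) = gmor p" by (simp add: rmod_def p_def)
  have "gcomp V C p (act P) = gre V (gcomp V C ?g (gcomp V C (act P) (act P))) (assoc V ?h B B)"
    unfolding p_def by (subst gcomp_assoc) simp_all
  also have "\<dots> = gre V p ((Ide V ?h \<otimes> m) \<cdot> assoc V ?h B B)"
    by (simp add: left_module(12) p_def)
  finally have 1: "gmor p \<cdot> (gmor p \<otimes> Ide V B) = gmor p \<cdot> (Ide V ?h \<otimes> m) \<cdot> assoc V ?h B B"
    using gcomp_act[of P p] by (simp add: s)
  have "gre V p (Ide V ?h \<otimes> u) = gcomp V C ?g (gre V (act P) u)"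
    by (simp add: p_def)
  also have "\<dots> = gre V ?g (runit V ?h)"
    by (simp add: left_module(11) gcomp_gid_right)
  finally have "gre V p (Ide V ?h \<otimes> u) = gre V ?g (runit V ?h)" .
  from arg_cong[OF this, of gmor] have 2: "gmor p \<cdot> (Ide V ?h \<otimes> u) = runit V ?h" by simp
  show "rmod P Y \<in> RM" using 1 2 p unfolding rmod_def p_def[symmetric]
    by (intro modulesI) (simp_all del: p(1) add: garr_simps(3,4)[OF p(1)])
  show "fst (rmod P Y) = ?h" by (simp add: rmod_def)
qed

text \<open>The evaluation \<open>C(X,Y) \<circledast> X \<rightarrow> Y\<close>, induced by the
  generic arrow from \<open>X\<close> to \<open>Y\<close>, which is balanced by the choice of action
  on \<open>C(X,Y)\<close>.\<close>

definition rcounit :: "'o \<times> 'o \<times> 'o \<times> 'va \<Rightarrow> 'o \<Rightarrow> 'o \<times> 'o \<times> 'va" where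
  "rcounit P Y = (SOME h. garr V C h \<and> gdom h = cst_obj V C b P (rmod P Y) \<and> gcod h = Y \<and> gr V h = \<one> \<and>
     gpost V C h (K P (rmod P Y)) = gen V C (fst P) Y)"

lemma rcounit [simp]:
  assumes P [simp]: "P \<in> LM" and Y [simp]: "Y \<in> VObj C"
  shows "garr V C (rcounit P Y)" "gdom (rcounit P Y) = cst_obj V C b P (rmod P Y)" "gcod (rcounit P Y) = Y"
    "gr V (rcounit P Y) = \<one>" "gpost V C (rcounit P Y) (K P (rmod P Y)) = gen V C (fst P) Y"
proof -
  have "gcomp V C (gen V C (fst P) Y) (act P) = gre V (gen V C (fst P) Y) (snd (rmod P Y))"
    by (rule g_eqI) (simp_all add: gcomp_act)
  from K_lift_post[OF P rmod(1)[OF P Y] _ _ _ this]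
  have "\<exists>h. garr V C h \<and> gdom h = cst_obj V C b P (rmod P Y) \<and> gcod h = Y \<and> gr V h = \<one> \<and>
     gpost V C h (K P (rmod P Y)) = gen V C (fst P) Y"
    by (auto simp del: split_paired_Ex)
  from someI_ex[OF this]
  show "garr V C (rcounit P Y)" "gdom (rcounit P Y) = cst_obj V C b P (rmod P Y)" "gcod (rcounit P Y) = Y"
    "gr V (rcounit P Y) = \<one>" "gpost V C (rcounit P Y) (K P (rmod P Y)) = gen V C (fst P) Y"
    unfolding rcounit_def by blast+
qed

text \<open>The right adjoint of \<open>- \<circledast> X\<close> is \<open>C(X,-)\<close>.\<close>

lemma rcounit_univ:
  assumes P [simp]: "P \<in> LM" and Y [simp]: "Y \<in> VObj C" and Z [simp]: "Z \<in> RM"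
    and g [simp]: "garr V C g" "gdom g = cst_obj V C b P Z" "gcod g = Y"
  shows "\<exists>!h. garr V M h \<and> gdom h = Z \<and> gcod h = rmod P Y \<and> gr V h = gr V g \<and>
    gpost V C (rcounit P Y) (fapp V (cs P) h) = g"
proof -
  interpret F: enriched_functor V M C "cs P" by (rule enriched_cst) simp
  define f where "f = gcomp V C g (K P Z)"
  have f [simp]: "garr V C f" "gdom f = fst P" "gcod f = Y" "gr V f = gr V g \<odot> fst Z" by (simp_all add: f_def)
  have "gcomp V C f (act P) = gre V f ((Ide V (gr V g) \<otimes> snd Z) \<cdot> assoc V (gr V g) (fst Z) B)"
    by (simp add: f_def gcomp_assoc K_balanced)
  \<comment> \<open>Balanced arrows out of \<open>X\<close> and module maps into
    \<open>C(X,Y)\<close> are the same data.\<close>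
  hence "modmap Z (rmod P Y) (gr V g) (gmor f)"
    using gcomp_act[of P f] garr_simps(3,4)[OF f(1)] by (simp add: modmap_def)
  then obtain h where h [simp]: "garr V M h" "gdom h = Z" "gcod h = rmod P Y" "gr V h = gr V g" and mu_h: "mu h = gmor f"
    using mu_lift[OF Z rmod(1)[OF P Y]] by metis
  have eK: "gcomp V C (gpost V C (rcounit P Y) (fapp V (cs P) h)) (K P Z) = gre V (gen V C (fst P) Y) (mu h)"
    if "garr V M h" "gdom h = Z" "gcod h = rmod P Y" for h
    using that fapp_cst(3)[of P h] mu_arr[OF that(1)] by (simp add: gcomp_gpost)
  show ?thesis
  proof (rule ex1I[of _ h])
    have "gpost V C (rcounit P Y) (fapp V (cs P) h) = g"
    proof (rule gepiD[OF K_epi[OF P Z]])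
      show "gcomp V C (gpost V C (rcounit P Y) (fapp V (cs P) h)) (K P Z) = gcomp V C g (K P Z)"
        using gen_gmor[OF f(1)] by (simp add: eK mu_h f_def[symmetric])
    qed simp_all
    thus "garr V M h \<and> gdom h = Z \<and> gcod h = rmod P Y \<and> gr V h = gr V g \<and> gpost V C (rcounit P Y) (fapp V (cs P) h) = g"
      by simp
  next
    fix h' assume h': "garr V M h' \<and> gdom h' = Z \<and> gcod h' = rmod P Y \<and> gr V h' = gr V g \<and> gpost V C (rcounit P Y) (fapp V (cs P) h') = g"
    hence "gre V (gen V C (fst P) Y) (mu h') = f" using eK[of h'] by (simp add: f_def)
    hence "gmor (gre V (gen V C (fst P) Y) (mu h')) = gmor f" by simp
    hence "mu h' = mu h" using h' mu_arr[of h'] by (simp add: mu_h)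
    thus "h' = h" by (rule mu_inj[rotated -1]) (use h' in simp_all)
  qed
qed

text \<open>Being a left adjoint is invariant under isomorphism: the counit of \<open>cs P\<close>
  is transported along the inverse components \<open>k\<close>, and \<open>cocontinuousI\<close>
  applies.\<close>

lemma cocontinuous_if_iso:
  assumes P [simp]: "P \<in> LM" and G: "enriched_functor V M C G" and \<alpha>: "enriched_nat_trans V M C (cs P) G \<alpha>"
    and k: "\<And>Z. Z \<in> RM \<Longrightarrow> garr V C (k Z) \<and> gr V (k Z) = \<one> \<and> gdom (k Z) = f_obj G Z \<and> gcod (k Z) = cst_obj V C b P Z \<and>
      gpost V C (k Z) (component (cs P) G \<alpha> Z) = gid C (cst_obj V C b P Z) \<and>
      gpost V C (component (cs P) G \<alpha> Z) (k Z) = gid C (f_obj G Z)"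
  shows "cocontinuous TYPE('u) V M C G"
proof (rule cocontinuousI[OF G, where R = "rmod P" and e = "\<lambda>Y. gpost V C (rcounit P Y) (k (rmod P Y))"])
  interpret F: enriched_functor V M C "cs P" by (rule enriched_cst) simp
  interpret G: enriched_functor V M C G by (rule G)
  let ?a = "component (cs P) G \<alpha>"
  note [simp] = VF.natD(1,2)[OF F.enriched_functor_axioms G \<alpha>]
  have [simp]: "garr V C (k Z)" "gr V (k Z) = \<one>" "gdom (k Z) = f_obj G Z" "gcod (k Z) = cst_obj V C b P Z" if "Z \<in> RM" for Z
    using k[OF that] by simp_all
  fix Y assume [simp]: "Y \<in> VObj C"
  show "rmod P Y \<in> VObj M" by simp
  show "garr V C (gpost V C (rcounit P Y) (k (rmod P Y))) \<and> gr V (gpost V C (rcounit P Y) (k (rmod P Y))) = \<one> \<and>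
    gdom (gpost V C (rcounit P Y) (k (rmod P Y))) = f_obj G (rmod P Y) \<and> gcod (gpost V C (rcounit P Y) (k (rmod P Y))) = Y"
    by simp
  fix Z g assume "Z \<in> VObj M" and g [simp]: "garr V C g" "gdom g = f_obj G Z" "gcod g = Y"
  hence [simp]: "Z \<in> RM" by simp
  have "gpost V C (gpost V C (rcounit P Y) (k (rmod P Y))) (fapp V G h) = g \<longleftrightarrow>
      gpost V C (rcounit P Y) (fapp V (cs P) h) = gpre V C g (?a Z)"
    if [simp]: "garr V M h" "gdom h = Z" "gcod h = rmod P Y" for h
  proof -
    have "gpre V C (gpost V C (gpost V C (rcounit P Y) (k (rmod P Y))) (fapp V G h)) (?a Z) =
       gpost V C (rcounit P Y) (gpost V C (k (rmod P Y)) (gpre V C (fapp V G h) (?a Z)))"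
      by (simp add: gpost_gpost gpost_gpre)
    also have "gpre V C (fapp V G h) (?a Z) = gpost V C (?a (rmod P Y)) (fapp V (cs P) h)"
      using VF.natD(3)[OF F.enriched_functor_axioms G \<alpha>, of h] by simp
    also have "gpost V C (k (rmod P Y)) \<dots> = fapp V (cs P) h"
      using k[of "rmod P Y"] by (subst gpost_gpost[symmetric]) (simp_all add: gpost_gid)
    finally have 1: "gpre V C (gpost V C (gpost V C (rcounit P Y) (k (rmod P Y))) (fapp V G h)) (?a Z) =
       gpost V C (rcounit P Y) (fapp V (cs P) h)" .
    have 2: "gpre V C (gpre V C p (?a Z)) (k Z) = p" if "garr V C p" "gdom p = f_obj G Z" for p
      using that k[of Z] by (subst gpre_gpre) (simp_all add: gpre_gid)
    let ?e = "gpost V C (gpost V C (rcounit P Y) (k (rmod P Y))) (fapp V G h)"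
    have "?e = g \<longleftrightarrow> gpre V C ?e (?a Z) = gpre V C g (?a Z)"
    proof
      assume eq: "gpre V C ?e (?a Z) = gpre V C g (?a Z)"
      have "?e = gpre V C (gpre V C ?e (?a Z)) (k Z)" by (rule 2[symmetric]) simp_all
      also have "\<dots> = g" unfolding eq by (rule 2) simp_all
      finally show "?e = g" .
    qed (rule arg_cong)
    thus ?thesis unfolding 1 .
  qed
  moreover have "\<exists>!h. garr V M h \<and> gdom h = Z \<and> gcod h = rmod P Y \<and> gr V h = gr V (gpre V C g (?a Z)) \<and>
      gpost V C (rcounit P Y) (fapp V (cs P) h) = gpre V C g (?a Z)"
    by (rule rcounit_univ) simp_all
  ultimately show "\<exists>!h. garr V M h \<and> gdom h = Z \<and> gcod h = rmod P Y \<and> gr V h = gr V g \<and>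
      gpost V C (gpost V C (rcounit P Y) (k (rmod P Y))) (fapp V G h) = g"
    by (simp cong: conj_cong)
qed

section \<open>Evaluation at the regular module and the counit\<close>

definition robj :: "('vo \<times> 'va, 'o, 'va) vfun \<Rightarrow> 'o \<times> 'o \<times> 'o \<times> 'va" where
  "robj G = (f_obj G (B, m), tn_transpose V C B (f_obj G (B, m)) (f_obj G (B, m)) (gmor (fapp V G mhat)))"

text \<open>An enriched functor preserves the action of \<open>b\<close> on itself from
  \<open>mhat_action\<close>; transposing the image gives a left module structure on its value at
  \<open>b\<close>.\<close>

lemma robj:
  assumes G: "enriched_functor V M C G"
  shows "robj G \<in> LM" "fst (robj G) = f_obj G (B, m)" "act (robj G) = fapp V G mhat"
proof -
  interpret G: enriched_functor V M C G by (rule G)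
  note t = transpose[of "fapp V G mhat" B "f_obj G (B, m)" "f_obj G (B, m)"]
  show 1: "fst (robj G) = f_obj G (B, m)" by (simp add: robj_def)
  show 2: "act (robj G) = fapp V G mhat"
    using t(5) by (simp add: mact_def robj_def)
  have "gaction V C b (fapp V G mhat)"
    using mhat_action by (simp add: gaction_def G.fapp_gcomp[symmetric] G.fapp_gre[symmetric] del: G.fapp_gre)
  thus "robj G \<in> LM"
    using t 2 left_module_iff[OF monoid, of "fst (robj G)" "snd (robj G)"] by (simp add: robj_def)
qed

text \<open>The comparison \<open>z \<circledast> G(b) \<rightarrow> G(Z)\<close>, induced by the
  image of \<open>zhat Z\<close>.\<close>

definition eps :: "('vo \<times> 'va, 'o, 'va) vfun \<Rightarrow> 'vo \<times> 'va \<Rightarrow> 'o \<times> 'o \<times> 'va" where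
  "eps G Z = (SOME h. garr V C h \<and> gdom h = cst_obj V C b (robj G) Z \<and> gcod h = f_obj G Z \<and> gr V h = \<one> \<and>
     gpost V C h (K (robj G) Z) = fapp V G (zhat Z))"

lemma eps:
  assumes G: "enriched_functor V M C G" and Z [simp]: "Z \<in> RM"
  shows "garr V C (eps G Z)" "gdom (eps G Z) = cst_obj V C b (robj G) Z" "gcod (eps G Z) = f_obj G Z" "gr V (eps G Z) = \<one>"
     "gpost V C (eps G Z) (K (robj G) Z) = fapp V G (zhat Z)"
proof -
  interpret G: enriched_functor V M C G by (rule G)
  have "gcomp V C (fapp V G (zhat Z)) (act (robj G)) = gre V (fapp V G (zhat Z)) (snd Z)"
    using robj[OF G] zhat_balanced[OF Z] by (simp add: G.fapp_gcomp[symmetric])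
  from K_lift_post[OF robj(1)[OF G] Z _ _ _ this]
  have "\<exists>h. garr V C h \<and> gdom h = cst_obj V C b (robj G) Z \<and> gcod h = f_obj G Z \<and> gr V h = \<one> \<and>
     gpost V C h (K (robj G) Z) = fapp V G (zhat Z)"
    using robj(2)[OF G] by (auto simp del: split_paired_Ex)
  from someI_ex[OF this]
  show "garr V C (eps G Z)" "gdom (eps G Z) = cst_obj V C b (robj G) Z" "gcod (eps G Z) = f_obj G Z" "gr V (eps G Z) = \<one>"
     "gpost V C (eps G Z) (K (robj G) Z) = fapp V G (zhat Z)"
    unfolding eps_def by blast+
qed

text \<open>Tested on \<open>K\<close>, naturality of the comparison is the image under
  \<open>G\<close> of naturality of \<open>zhat\<close>.\<close>

lemma eps_nat:
  assumes G: "enriched_functor V M C G"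
  shows "enriched_nat_trans V M C (cs (robj G)) G (\<lambda>Z \<in> RM. gmor (eps G Z))"
    and "Z \<in> RM \<Longrightarrow> component (cs (robj G)) G (\<lambda>Z \<in> RM. gmor (eps G Z)) Z = eps G Z"
proof -
  note R [simp] = robj(1,2)[OF G]
  note e [simp] = eps(1-4)[OF G]
  interpret F: enriched_functor V M C "cs (robj G)" by (rule enriched_cst) simp
  interpret G: enriched_functor V M C G by (rule G)
  show c: "component (cs (robj G)) G (\<lambda>Z \<in> RM. gmor (eps G Z)) Z = eps G Z" if "Z \<in> RM" for Z
    using that by (intro g_eqI) (simp_all add: component_mor)
  have "gpost V C (eps G (gcod p)) (fapp V (cs (robj G)) p) = gpre V C (fapp V G p) (eps G (gdom p))"
    if p [simp]: "garr V M p" for p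
  proof (rule gepiD[OF K_epi[of "robj G" "gdom p"]])
    have "gcomp V C (gpost V C (eps G (gcod p)) (fapp V (cs (robj G)) p)) (K (robj G) (gdom p)) =
      gre V (fapp V G (zhat (gcod p))) (mu p)"
      using fapp_cst(3)[of "robj G" p] by (simp add: gcomp_gpost eps(5)[OF G])
    also have "\<dots> = fapp V G (gcomp V M p (zhat (gdom p)))"
      by (simp add: zhat_nat)
    also have "\<dots> = gcomp V C (gpre V C (fapp V G p) (eps G (gdom p))) (K (robj G) (gdom p))"
      by (simp add: G.fapp_gcomp gcomp_gpre eps(5)[OF G])
    finally show "gcomp V C (gpost V C (eps G (gcod p)) (fapp V (cs (robj G)) p)) (K (robj G) (gdom p)) =
      gcomp V C (gpre V C (fapp V G p) (eps G (gdom p))) (K (robj G) (gdom p))" .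
  qed simp_all
  thus "enriched_nat_trans V M C (cs (robj G)) G (\<lambda>Z \<in> RM. gmor (eps G Z))"
    unfolding enriched_nat_trans_iff[OF F.enriched_functor_axioms G] by (simp add: c)
qed

text \<open>The only candidate is the component of \<open>\<alpha>\<close> at the regular module
  composed with \<open>unitor P\<close>; naturality at the multiplication makes it a morphism of
  module objects.\<close>

lemma eps_univ:
  assumes P [simp]: "P \<in> LM" and G: "enriched_functor V M C G" and \<alpha>: "enriched_nat_trans V M C (cs P) G \<alpha>"
  shows "\<exists>!f. lmor P (robj G) f \<and>
    (\<forall>Z \<in> RM. gpost V C (eps G Z) (cst_right V C b P (robj G) f Z) = component (cs P) G \<alpha> Z)"
proof -
  note R [simp] = robj(1,2)[OF G]
  note e [simp] = eps(1-4)[OF G]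
  note F = enriched_cst[OF P]
  interpret F: enriched_functor V M C "cs P" by (rule F)
  interpret G: enriched_functor V M C G by (rule G)
  note n [simp] = VF.natD(1,2)[OF F G \<alpha>]
  let ?a = "component (cs P) G \<alpha>"
  define f where "f = gpost V C (?a (B, m)) (unitor P)"
  have f [simp]: "garr V C f" "gr V f = \<one>" "gdom f = fst P" "gcod f = f_obj G (B, m)" by (simp_all add: f_def)
  have aK: "gpost V C (?a Z) (K P Z) = gpre V C (fapp V G (zhat Z)) f" if "Z \<in> RM" for Z
    using nat_on_K[OF P that G \<alpha>] by (simp add: f_def)
  have "gpost V C f (act P) = gpost V C (?a (B, m)) (gpost V C (unitor P) (act P))"
    by (simp add: f_def gpost_gpost)
  also have "\<dots> = gpre V C (act (robj G)) f"
    by (simp add: unitor_act aK robj(3)[OF G])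
  finally have lm: "lmor P (robj G) f" by (simp add: lmor_def)
  have eK: "gpost V C (gpost V C (eps G Z) (cst_right V C b P (robj G) f Z)) (K P Z) = gpre V C (fapp V G (zhat Z)) f"
    if "lmor P (robj G) f" and [simp]: "Z \<in> RM" for f Z
  proof -
    note [simp] = lmorD(3-6)[OF that(1)] cst_right(1-4)[OF that(1)]
    show ?thesis
      by (simp add: gpost_gpost cst_right(5)[OF that(1)] gpost_gpre eps(5)[OF G])
  qed
  show ?thesis
  proof (rule ex1I[of _ f])
    have "gpost V C (eps G Z) (cst_right V C b P (robj G) f Z) = ?a Z" if [simp]: "Z \<in> RM" for Z
    proof (rule gepi_post[OF K_epi[OF P that]])
      show "gpost V C (gpost V C (eps G Z) (cst_right V C b P (robj G) f Z)) (K P Z) = gpost V C (?a Z) (K P Z)"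
        using eK[OF lm that] aK[OF that] by simp
    qed (use cst_right(1-4)[OF lm that] in simp_all)
    thus "lmor P (robj G) f \<and> (\<forall>Z \<in> RM. gpost V C (eps G Z) (cst_right V C b P (robj G) f Z) = ?a Z)"
      using lm by simp
  next
    fix f' assume f': "lmor P (robj G) f' \<and> (\<forall>Z \<in> RM. gpost V C (eps G Z) (cst_right V C b P (robj G) f' Z) = ?a Z)"
    note lm' = conjunct1[OF f']
    note l [simp] = lmorD(3-6)[OF lm']
    \<comment> \<open>To recover \<open>f'\<close>, the identity of \<open>G(b)\<close> is written
      as the image of the multiplication restricted along the unit of \<open>b\<close>.\<close>
    have "f' = gpre V C (gid C (f_obj G (B, m))) f'"
      using gpost_eq_gpre[of "gid C (f_obj G (B, m))" f'] by (simp add: gpost_gid)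
    also have "gid C (f_obj G (B, m)) = gre V (fapp V G mhat) u"
      using mhat_action by (simp add: gaction_def flip: G.fapp_gre)
    also have "gpre V C (gre V (fapp V G mhat) u) f' = gre V (gpre V C (fapp V G mhat) f') u"
      by simp
    also have "gpre V C (fapp V G mhat) f' = gpost V C (?a (B, m)) (K P (B, m))"
      using eK[OF lm', of "(B, m)"] f' by simp
    also have "gre V (gpost V C (?a (B, m)) (K P (B, m))) u = f"
      by (simp add: f_def unitor_def)
    finally show "f' = f" .
  qed
qed

text \<open>A cocontinuous \<open>G\<close> preserves the universal property of
  \<open>zhat Z\<close>. Its image and \<open>K (robj G) Z\<close> are then universal for the same
  balancing condition, so the comparison between their targets is invertible.\<close>

lemma eps_iso_if_cocontinuous:
  assumes "infinite (UNIV :: 'u set)" and G: "enriched_functor V M C G"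
    and cocont: "cocontinuous TYPE('u) V M C G" and Z [simp]: "Z \<in> RM"
  shows "\<exists>k. garr V C k \<and> gr V k = \<one> \<and> gdom k = f_obj G Z \<and> gcod k = cst_obj V C b (robj G) Z \<and>
      gpost V C k (eps G Z) = gid C (cst_obj V C b (robj G) Z) \<and> gpost V C (eps G Z) k = gid C (f_obj G Z)"
proof -
  note R [simp] = robj(1,2)[OF G]
  note e [simp] = eps(1-4)[OF G]
  interpret G: enriched_functor V M C G by (rule G)
  have bu: "buniv V C (fapp V G mhat) (snd Z) (fapp V G (zhat Z))"
    by (rule cocontinuous_buniv[OF assms(1) G cocont monoid Z mhat_action zhat_univ[OF Z]]) simp
  have "gcomp V C (K (robj G) Z) (fapp V G mhat) = gre V (K (robj G) Z) (snd Z)"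
    using K_balanced[of "robj G" Z] robj(3)[OF G] by simp
  then obtain k where k [simp]: "garr V C k" "gdom k = gcod (fapp V G (zhat Z))" "gcod k = gcod (K (robj G) Z)" "gr V k = \<one>"
    and kK: "gpost V C k (fapp V G (zhat Z)) = K (robj G) Z"
    using buniv_lift_post[OF bu, of "K (robj G) Z"] by auto
  have epi: "gepi (fapp V G (zhat Z))"
    by (rule buniv_gepi[OF bu]) simp_all
  have "gpost V C k (eps G Z) = gid C (cst_obj V C b (robj G) Z)"
    by (rule gepi_post[OF K_epi[OF R(1) Z]]) (simp_all add: gpost_gpost eps(5)[OF G] kK gpost_gid)
  moreover have "gpost V C (eps G Z) k = gid C (f_obj G Z)"
    by (rule gepi_post[OF epi]) (simp_all add: gpost_gpost eps(5)[OF G] kK gpost_gid)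
  ultimately show ?thesis by (intro exI[of _ k]) simp
qed

end

section \<open>Adjunctions from universal arrows\<close>

text \<open>A right adjoint is given on objects only, with a universal arrow at each object. Its
  action on arrows, the unit and the triangle identities all come from unique lifting.\<close>

locale universal_arrows = ordinary_functor C D F
  for C :: "('o, 'a, 'm) cat_scheme" and D :: "('p, 'b, 'n) cat_scheme" and F :: "('o, 'a, 'p, 'b) ftor" +
  fixes R :: "'p \<Rightarrow> 'o" and \<epsilon> :: "'p \<Rightarrow> 'b"
  assumes R_in: "y \<in> Obj D \<Longrightarrow> R y \<in> Obj C"
    and eps_in: "y \<in> Obj D \<Longrightarrow> \<epsilon> y \<in> hom D (on_obj F (R y)) y"
    and univ: "x \<in> Obj C \<Longrightarrow> y \<in> Obj D \<Longrightarrow> g \<in> hom D (on_obj F x) y \<Longrightarrow>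
      \<exists>!f. f \<in> hom C x (R y) \<and> \<epsilon> y \<cdot>\<^bsub>D\<^esub> on_arr F f = g"
begin

lemma functor_arr [simp]:
  assumes "f \<in> Arr C"
  shows "on_arr F f \<in> Arr D" "Dom D (on_arr F f) = on_obj F (Dom C f)" "Cod D (on_arr F f) = on_obj F (Cod C f)"
  using on_arr_in[of f "Dom C f" "Cod C f"] assms by simp_all

lemma functor_obj [simp]: "x \<in> Obj C \<Longrightarrow> on_obj F x \<in> Obj D"
  by (rule on_obj_in)

lemma functor_comp:
  "f \<in> Arr C \<Longrightarrow> g \<in> Arr C \<Longrightarrow> Cod C f = Dom C g \<Longrightarrow> on_arr F (g \<cdot>\<^bsub>C\<^esub> f) = on_arr F g \<cdot>\<^bsub>D\<^esub> on_arr F f"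
  using on_comp[of f "Dom C f" "Cod C f" g "Cod C g"] by simp

lemma eps_arr [simp]:
  assumes "y \<in> Obj D"
  shows "R y \<in> Obj C" "\<epsilon> y \<in> Arr D" "Dom D (\<epsilon> y) = on_obj F (R y)" "Cod D (\<epsilon> y) = y"
  using R_in[OF assms] eps_in[OF assms] by simp_all

definition lift :: "'o \<Rightarrow> 'p \<Rightarrow> 'b \<Rightarrow> 'a" where
  "lift x y g = (THE f. f \<in> hom C x (R y) \<and> \<epsilon> y \<cdot>\<^bsub>D\<^esub> on_arr F f = g)"

lemma lift [simp]:
  assumes "g \<in> Arr D" "Dom D g = on_obj F x" "Cod D g = y" "x \<in> Obj C"
  shows "lift x y g \<in> Arr C" "Dom C (lift x y g) = x" "Cod C (lift x y g) = R y"
    "\<epsilon> y \<cdot>\<^bsub>D\<^esub> on_arr F (lift x y g) = g"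
proof -
  have "y \<in> Obj D" using assms by auto
  from theI'[OF univ[OF assms(4) this, of g]] assms
  show "lift x y g \<in> Arr C" "Dom C (lift x y g) = x" "Cod C (lift x y g) = R y"
    "\<epsilon> y \<cdot>\<^bsub>D\<^esub> on_arr F (lift x y g) = g"
    unfolding lift_def by simp_all
qed

lemma eps_cancel:
  assumes "f \<in> Arr C" "f' \<in> Arr C" "Dom C f = Dom C f'" "Cod C f = R y" "Cod C f' = R y" "y \<in> Obj D"
    "\<epsilon> y \<cdot>\<^bsub>D\<^esub> on_arr F f = \<epsilon> y \<cdot>\<^bsub>D\<^esub> on_arr F f'"
  shows "f = f'"
proof -
  have "\<exists>!h. h \<in> hom C (Dom C f') (R y) \<and> \<epsilon> y \<cdot>\<^bsub>D\<^esub> on_arr F h = \<epsilon> y \<cdot>\<^bsub>D\<^esub> on_arr F f'"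
    by (rule univ) (use assms(1-6) in simp_all)
  thus ?thesis using assms by auto
qed

definition radj :: "('p, 'b, 'o, 'a) ftor" where
  "radj = \<lparr>on_obj = R, on_arr = (\<lambda>g. lift (R (Dom D g)) (Cod D g) (g \<cdot>\<^bsub>D\<^esub> \<epsilon> (Dom D g)))\<rparr>"

definition unit :: "'o \<Rightarrow> 'a" where
  "unit x = lift x (on_obj F x) (Ide D (on_obj F x))"

lemma unit [simp]:
  assumes "x \<in> Obj C"
  shows "unit x \<in> Arr C" "Dom C (unit x) = x" "Cod C (unit x) = R (on_obj F x)"
    "\<epsilon> (on_obj F x) \<cdot>\<^bsub>D\<^esub> on_arr F (unit x) = Ide D (on_obj F x)"
  using assms by (simp_all add: unit_def)

lemma radj_arr:
  assumes "g \<in> Arr D"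
  shows "on_arr radj g \<in> Arr C" "Dom C (on_arr radj g) = R (Dom D g)" "Cod C (on_arr radj g) = R (Cod D g)"
    "\<epsilon> (Cod D g) \<cdot>\<^bsub>D\<^esub> on_arr F (on_arr radj g) = g \<cdot>\<^bsub>D\<^esub> \<epsilon> (Dom D g)"
  using assms by (simp_all add: radj_def)

lemma ordinary_functor_radj: "ordinary_functor D C radj"
proof (intro ordinary_functor.intro D.category_axioms C.category_axioms ordinary_functor_axioms.intro)
  fix y assume y: "y \<in> Obj D"
  show "on_obj radj y \<in> Obj C" using y by (simp add: radj_def)
  show "on_arr radj (Ide D y) = Ide C (on_obj radj y)"
    by (rule eps_cancel[of _ _ y]) (use y radj_arr[of "Ide D y"] in \<open>simp_all add: on_ide\<close>, simp_all add: radj_def on_ide)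
next
  fix f x y assume "f \<in> hom D x y"
  thus "on_arr radj f \<in> hom C (on_obj radj x) (on_obj radj y)"
    using radj_arr[of f] by (auto simp: radj_def)
next
  fix f g x y z assume "f \<in> hom D x y" "g \<in> hom D y z"
  hence fg [simp]: "f \<in> Arr D" "Dom D f = x" "Cod D f = y" "g \<in> Arr D" "Dom D g = y" "Cod D g = z"
    and xyz [simp]: "x \<in> Obj D" "y \<in> Obj D" "z \<in> Obj D"
    using D.dom_cod_obj by auto
  note r = radj_arr[of f] radj_arr[of g] radj_arr[of "g \<cdot>\<^bsub>D\<^esub> f"]
  note [simp] = r(1-3,5-7,9-11)
  have "\<epsilon> z \<cdot>\<^bsub>D\<^esub> on_arr F (on_arr radj g \<cdot>\<^bsub>C\<^esub> on_arr radj f) = (\<epsilon> z \<cdot>\<^bsub>D\<^esub> on_arr F (on_arr radj g)) \<cdot>\<^bsub>D\<^esub> on_arr F (on_arr radj f)"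
    by (simp add: functor_comp)
  also have "\<dots> = g \<cdot>\<^bsub>D\<^esub> (\<epsilon> y \<cdot>\<^bsub>D\<^esub> on_arr F (on_arr radj f))"
    using r(8) by simp
  also have "\<dots> = \<epsilon> z \<cdot>\<^bsub>D\<^esub> on_arr F (on_arr radj (g \<cdot>\<^bsub>D\<^esub> f))"
    using r(4) r(12) by simp
  finally show "on_arr radj (g \<cdot>\<^bsub>D\<^esub> f) = on_arr radj g \<cdot>\<^bsub>C\<^esub> on_arr radj f"
    by (intro eps_cancel[of _ _ z, OF _ _ _ _ _ _ sym]) simp_all
qed

theorem adjunction: "adjunction C D F radj unit \<epsilon>"
  unfolding adjunction_def
proof (intro conjI ballI ordinary_functor_axioms ordinary_functor_radj)
  show "nat_trans C C id_ftor (comp_ftor radj F) unit"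
    unfolding nat_trans_def
  proof (intro conjI ballI)
    fix x y f assume xy [simp]: "x \<in> Obj C" "y \<in> Obj C" and "f \<in> hom C x y"
    hence f [simp]: "f \<in> Arr C" "Dom C f = x" "Cod C f = y" by simp_all
    note r = radj_arr[of "on_arr F f"]
    note [simp] = r(1-3)
    have "\<epsilon> (on_obj F y) \<cdot>\<^bsub>D\<^esub> on_arr F (on_arr radj (on_arr F f) \<cdot>\<^bsub>C\<^esub> unit x) =
        (\<epsilon> (on_obj F y) \<cdot>\<^bsub>D\<^esub> on_arr F (on_arr radj (on_arr F f))) \<cdot>\<^bsub>D\<^esub> on_arr F (unit x)"
      by (simp add: functor_comp)
    also have "\<dots> = on_arr F f \<cdot>\<^bsub>D\<^esub> (\<epsilon> (on_obj F x) \<cdot>\<^bsub>D\<^esub> on_arr F (unit x))"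
      using r(4) by simp
    also have "\<dots> = (\<epsilon> (on_obj F y) \<cdot>\<^bsub>D\<^esub> on_arr F (unit y)) \<cdot>\<^bsub>D\<^esub> on_arr F f"
      unfolding unit(4)[OF xy(1)] unit(4)[OF xy(2)] by simp
    also have "\<dots> = \<epsilon> (on_obj F y) \<cdot>\<^bsub>D\<^esub> on_arr F (unit y \<cdot>\<^bsub>C\<^esub> f)"
      by (simp add: functor_comp del: unit(4))
    finally have "on_arr radj (on_arr F f) \<cdot>\<^bsub>C\<^esub> unit x = unit y \<cdot>\<^bsub>C\<^esub> f"
      by (rule eps_cancel[rotated -1]) simp_all
    thus "unit y \<cdot>\<^bsub>C\<^esub> on_arr id_ftor f = on_arr (comp_ftor radj F) f \<cdot>\<^bsub>C\<^esub> unit x"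
      by (simp add: id_ftor_def comp_ftor_def)
  qed (simp add: id_ftor_def comp_ftor_def radj_def)
  show "nat_trans D D (comp_ftor F radj) id_ftor \<epsilon>"
    unfolding nat_trans_def
  proof (intro conjI ballI)
    fix x y f assume "x \<in> Obj D" "y \<in> Obj D" "f \<in> hom D x y"
    thus "\<epsilon> y \<cdot>\<^bsub>D\<^esub> on_arr (comp_ftor F radj) f = on_arr id_ftor f \<cdot>\<^bsub>D\<^esub> \<epsilon> x"
      using radj_arr(4)[of f] by (auto simp: id_ftor_def comp_ftor_def)
  qed (simp add: id_ftor_def comp_ftor_def radj_def)
  fix x assume "x \<in> Obj C"
  thus "\<epsilon> (on_obj F x) \<cdot>\<^bsub>D\<^esub> on_arr F (unit x) = Ide D (on_obj F x)" by simp
next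
  fix y assume y [simp]: "y \<in> Obj D"
  note r = radj_arr[of "\<epsilon> y"]
  note [simp] = r(1-3)
  have "\<epsilon> y \<cdot>\<^bsub>D\<^esub> on_arr F (on_arr radj (\<epsilon> y) \<cdot>\<^bsub>C\<^esub> unit (R y)) =
     (\<epsilon> y \<cdot>\<^bsub>D\<^esub> on_arr F (on_arr radj (\<epsilon> y))) \<cdot>\<^bsub>D\<^esub> on_arr F (unit (R y))"
    by (simp add: functor_comp)
  also have "\<dots> = \<epsilon> y \<cdot>\<^bsub>D\<^esub> (\<epsilon> (on_obj F (R y)) \<cdot>\<^bsub>D\<^esub> on_arr F (unit (R y)))"
    using r(4) by simp
  also have "\<dots> = \<epsilon> y \<cdot>\<^bsub>D\<^esub> on_arr F (Ide C (R y))"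
    by (simp add: on_ide)
  finally have "on_arr radj (\<epsilon> y) \<cdot>\<^bsub>C\<^esub> unit (R y) = Ide C (R y)"
    by (rule eps_cancel[rotated -1]) simp_all
  thus "on_arr radj (\<epsilon> y) \<cdot>\<^bsub>C\<^esub> unit (on_obj radj y) = Ide C (on_obj radj y)"
    by (simp add: radj_def)
qed

end

section \<open>Full subcategories and fully faithful left adjoints\<close>

lemma full_sub_simps [simp]: "Obj (full_sub D S) = Obj D \<inter> S"
  "f \<in> Arr (full_sub D S) \<longleftrightarrow> f \<in> Arr D \<and> Dom D f \<in> S \<and> Cod D f \<in> S"
  "Dom (full_sub D S) = Dom D" "Cod (full_sub D S) = Cod D" "Ide (full_sub D S) = Ide D"
  "g \<cdot>\<^bsub>full_sub D S\<^esub> f = g \<cdot>\<^bsub>D\<^esub> f"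
  by (simp_all add: full_sub_def)

lemma (in category) category_full_sub: "category (full_sub C S)"
  by unfold_locales auto

lemma (in category) full_sub_iso:
  assumes "is_iso C f" "Dom C f \<in> S" "Cod C f \<in> S"
  shows "is_iso (full_sub C S) f"
  using inverse_inv_arr[OF assms(1)] assms(2,3) iso_arr[OF assms(1)]
  unfolding is_iso_def inverse_arrows_def by (intro exI[of _ "inv_arr C f"]) auto

locale ff_universal_arrows = universal_arrows C D F R \<epsilon>
  for C :: "('o, 'a, 'm) cat_scheme" and D :: "('p, 'b, 'n) cat_scheme" and F :: "('o, 'a, 'p, 'b) ftor"
    and R :: "'p \<Rightarrow> 'o" and \<epsilon> :: "'p \<Rightarrow> 'b" +
  assumes ff: "fully_faithful C D F"
begin

lemma full:
  assumes "x \<in> Obj C" "y \<in> Obj C" "g \<in> Arr D" "Dom D g = on_obj F x" "Cod D g = on_obj F y"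
  obtains f where "f \<in> Arr C" "Dom C f = x" "Cod C f = y" "on_arr F f = g"
proof -
  have "g \<in> on_arr F ` hom C x y"
    using ff assms unfolding fully_faithful_def bij_betw_def by simp
  thus ?thesis using that by auto
qed

lemma faithful:
  assumes "f \<in> Arr C" "g \<in> Arr C" "Dom C f = Dom C g" "Cod C f = Cod C g" "on_arr F f = on_arr F g"
  shows "f = g"
proof -
  have "inj_on (on_arr F) (hom C (Dom C g) (Cod C g))"
    using ff assms(2) unfolding fully_faithful_def bij_betw_def by simp
  thus ?thesis using assms by (auto dest: inj_onD)
qed

text \<open>Fullness lifts the counit at \<open>on_obj F x\<close> to an arrow \<open>i\<close>;
  faithfulness and uniqueness of lifts show that \<open>i\<close> is inverse to the unit.\<close>

lemma unit_iso:
  assumes x [simp]: "x \<in> Obj C"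
  shows "is_iso C (unit x)" "is_iso D (\<epsilon> (on_obj F x))"
proof -
  obtain i where i [simp]: "i \<in> Arr C" "Dom C i = R (on_obj F x)" "Cod C i = x" and Fi: "on_arr F i = \<epsilon> (on_obj F x)"
    by (rule full[of "R (on_obj F x)" x "\<epsilon> (on_obj F x)"]) simp_all
  have 1: "i \<cdot>\<^bsub>C\<^esub> unit x = Ide C x"
    by (rule faithful) (simp_all add: functor_comp Fi on_ide)
  have "\<epsilon> (on_obj F x) \<cdot>\<^bsub>D\<^esub> on_arr F (unit x \<cdot>\<^bsub>C\<^esub> i) = (\<epsilon> (on_obj F x) \<cdot>\<^bsub>D\<^esub> on_arr F (unit x)) \<cdot>\<^bsub>D\<^esub> \<epsilon> (on_obj F x)"
    by (simp add: functor_comp Fi del: unit(4))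
  also have "\<dots> = \<epsilon> (on_obj F x) \<cdot>\<^bsub>D\<^esub> on_arr F (Ide C (R (on_obj F x)))"
    unfolding unit(4)[OF x] by (simp add: on_ide)
  finally have 2: "unit x \<cdot>\<^bsub>C\<^esub> i = Ide C (R (on_obj F x))"
    by (rule eps_cancel[rotated -1]) simp_all
  show "is_iso C (unit x)"
    using 1 2 unfolding is_iso_def inverse_arrows_def by (intro exI[of _ i]) simp
  have "on_arr F (unit x) \<cdot>\<^bsub>D\<^esub> \<epsilon> (on_obj F x) = Ide D (on_obj F (R (on_obj F x)))"
    using arg_cong[OF 2, of "on_arr F"] by (simp add: functor_comp Fi on_ide)
  thus "is_iso D (\<epsilon> (on_obj F x))"
    unfolding is_iso_def inverse_arrows_def by (intro exI[of _ "on_arr F (unit x)"]) simp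
qed

text \<open>Naturality of the counit along an isomorphism from a value of \<open>F\<close> to
  \<open>y\<close> writes \<open>\<epsilon> y\<close> as a composite of isomorphisms.\<close>

lemma ess_image_iff: "y \<in> ess_image C D F \<longleftrightarrow> y \<in> Obj D \<and> is_iso D (\<epsilon> y)"
proof
  assume "y \<in> Obj D \<and> is_iso D (\<epsilon> y)"
  thus "y \<in> ess_image C D F"
    using eps_in[of y] R_in[of y] unfolding ess_image_def isomorphic_def by blast
next
  assume "y \<in> ess_image C D F"
  then obtain x g where y [simp]: "y \<in> Obj D" "x \<in> Obj C" and g: "g \<in> Arr D" "Dom D g = on_obj F x" "Cod D g = y" "is_iso D g"
    by (auto simp: ess_image_def isomorphic_def)
  note [simp] = g(1-3)
  let ?g' = "inv_arr D g"
  have g' [simp]: "?g' \<in> Arr D" "Dom D ?g' = y" "Cod D ?g' = on_obj F x" "g \<cdot>\<^bsub>D\<^esub> ?g' = Ide D y" "?g' \<cdot>\<^bsub>D\<^esub> g = Ide D (on_obj F x)"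
    using D.inv_arr[OF g(4)] by simp_all
  interpret G: ordinary_functor D C radj by (rule ordinary_functor_radj)
  note rg = radj_arr[OF g(1)] and rg' = radj_arr[OF g'(1)]
  note [simp] = rg(1-3) rg'(1-3)
  have R: "on_obj radj z = R z" for z by (simp add: radj_def)
  have "on_arr radj (g \<cdot>\<^bsub>D\<^esub> ?g') = on_arr radj g \<cdot>\<^bsub>C\<^esub> on_arr radj ?g'"
    "on_arr radj (?g' \<cdot>\<^bsub>D\<^esub> g) = on_arr radj ?g' \<cdot>\<^bsub>C\<^esub> on_arr radj g"
    by (rule G.on_comp, simp, simp)+
  hence "on_arr radj g \<cdot>\<^bsub>C\<^esub> on_arr radj ?g' = Ide C (R y)" "on_arr radj ?g' \<cdot>\<^bsub>C\<^esub> on_arr radj g = Ide C (R (on_obj F x))"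
    using G.on_ide[of y] G.on_ide[of "on_obj F x"] by (simp_all add: R)
  hence "on_arr F (on_arr radj g \<cdot>\<^bsub>C\<^esub> on_arr radj ?g') = Ide D (on_obj F (R y))"
    "on_arr F (on_arr radj ?g' \<cdot>\<^bsub>C\<^esub> on_arr radj g) = Ide D (on_obj F (R (on_obj F x)))"
    by (simp_all add: on_ide)
  hence Fg: "on_arr F (on_arr radj g) \<cdot>\<^bsub>D\<^esub> on_arr F (on_arr radj ?g') = Ide D (on_obj F (R y))"
    "on_arr F (on_arr radj ?g') \<cdot>\<^bsub>D\<^esub> on_arr F (on_arr radj g) = Ide D (on_obj F (R (on_obj F x)))"
    by (simp_all add: functor_comp)
  have iso: "is_iso D (on_arr F (on_arr radj ?g'))"
    unfolding is_iso_def inverse_arrows_def using Fg by (intro exI[of _ "on_arr F (on_arr radj g)"]) simp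
  have "\<epsilon> y = \<epsilon> y \<cdot>\<^bsub>D\<^esub> on_arr F (on_arr radj g) \<cdot>\<^bsub>D\<^esub> on_arr F (on_arr radj ?g')"
    unfolding Fg by simp
  also have "\<dots> = (\<epsilon> y \<cdot>\<^bsub>D\<^esub> on_arr F (on_arr radj g)) \<cdot>\<^bsub>D\<^esub> on_arr F (on_arr radj ?g')"
    by simp
  also have "\<dots> = (g \<cdot>\<^bsub>D\<^esub> \<epsilon> (on_obj F x)) \<cdot>\<^bsub>D\<^esub> on_arr F (on_arr radj ?g')"
    using rg(4) by simp
  finally have "\<epsilon> y = (g \<cdot>\<^bsub>D\<^esub> \<epsilon> (on_obj F x)) \<cdot>\<^bsub>D\<^esub> on_arr F (on_arr radj ?g')" .
  moreover have "is_iso D ((g \<cdot>\<^bsub>D\<^esub> \<epsilon> (on_obj F x)) \<cdot>\<^bsub>D\<^esub> on_arr F (on_arr radj ?g'))"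
    by (intro D.iso_comp iso g(4) unit_iso(2) y) simp_all
  ultimately show "y \<in> Obj D \<and> is_iso D (\<epsilon> y)" by simp
qed

text \<open>The coreflection of \<open>y\<close> is \<open>on_obj F (R y)\<close> with
  \<open>\<epsilon> y\<close>. Universality against \<open>x\<close> in the image reduces to
  \<open>univ\<close> at \<open>R x\<close>, since \<open>\<epsilon> x\<close> is
  invertible.\<close>

theorem coreflective_ess_image: "coreflective D (ess_image C D F)"
proof -
  let ?S = "full_sub D (ess_image C D F)"
  have iso: "is_iso D (\<epsilon> x)" if "x \<in> Obj ?S" for x
    using that ess_image_iff by simp
  have FR: "on_obj F x \<in> ess_image C D F" if "x \<in> Obj C" for x
    using that unit_iso(2)[OF that] ess_image_iff by simp
  interpret I: universal_arrows ?S D id_ftor "\<lambda>y. on_obj F (R y)" \<epsilon>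
  proof (intro universal_arrows.intro universal_arrows_axioms.intro ordinary_functor.intro D.category_axioms
      D.category_full_sub ordinary_functor_axioms.intro)
    fix x y g assume x: "x \<in> Obj ?S" and y [simp]: "y \<in> Obj D" and "g \<in> hom D (on_obj id_ftor x) y"
    hence g [simp]: "g \<in> Arr D" "Dom D g = x" "Cod D g = y" and x' [simp]: "x \<in> Obj D" "x \<in> ess_image C D F"
      by (simp_all add: id_ftor_def)
    note i = iso[OF x]
    obtain f where f [simp]: "f \<in> Arr C" "Dom C f = R x" "Cod C f = R y" and \<epsilon>f: "\<epsilon> y \<cdot>\<^bsub>D\<^esub> on_arr F f = g \<cdot>\<^bsub>D\<^esub> \<epsilon> x"
      using univ[of "R x" y "g \<cdot>\<^bsub>D\<^esub> \<epsilon> x"] by auto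
    show "\<exists>!f. f \<in> hom ?S x (on_obj F (R y)) \<and> \<epsilon> y \<cdot>\<^bsub>D\<^esub> on_arr id_ftor f = g"
    proof (rule ex1I[of _ "on_arr F f \<cdot>\<^bsub>D\<^esub> inv_arr D (\<epsilon> x)"])
      have "\<epsilon> y \<cdot>\<^bsub>D\<^esub> on_arr F f \<cdot>\<^bsub>D\<^esub> inv_arr D (\<epsilon> x) = (\<epsilon> y \<cdot>\<^bsub>D\<^esub> on_arr F f) \<cdot>\<^bsub>D\<^esub> inv_arr D (\<epsilon> x)"
        using i by simp
      also have "\<dots> = g" unfolding \<epsilon>f using i by simp
      finally show "on_arr F f \<cdot>\<^bsub>D\<^esub> inv_arr D (\<epsilon> x) \<in> hom ?S x (on_obj F (R y)) \<and>
          \<epsilon> y \<cdot>\<^bsub>D\<^esub> on_arr id_ftor (on_arr F f \<cdot>\<^bsub>D\<^esub> inv_arr D (\<epsilon> x)) = g"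
        using i FR[of "R y"] by (simp add: id_ftor_def)
    next
      fix h assume "h \<in> hom ?S x (on_obj F (R y)) \<and> \<epsilon> y \<cdot>\<^bsub>D\<^esub> on_arr id_ftor h = g"
      hence h: "h \<in> Arr D" "Dom D h = x" "Cod D h = on_obj F (R y)" "\<epsilon> y \<cdot>\<^bsub>D\<^esub> h = g"
        by (simp_all add: id_ftor_def)
      \<comment> \<open>For uniqueness the competitor is moved along \<open>\<epsilon> x\<close> to
        an arrow between values of \<open>F\<close>, which fullness lifts to
        \<open>C\<close>.\<close>
      obtain k where k [simp]: "k \<in> Arr C" "Dom C k = R x" "Cod C k = R y" and Fk: "on_arr F k = h \<cdot>\<^bsub>D\<^esub> \<epsilon> x"
        by (rule full[of "R x" "R y" "h \<cdot>\<^bsub>D\<^esub> \<epsilon> x"]) (use h in simp_all)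
      have "\<epsilon> y \<cdot>\<^bsub>D\<^esub> on_arr F k = (\<epsilon> y \<cdot>\<^bsub>D\<^esub> h) \<cdot>\<^bsub>D\<^esub> \<epsilon> x"
        unfolding Fk using h(1-3) by simp
      also have "\<dots> = \<epsilon> y \<cdot>\<^bsub>D\<^esub> on_arr F f" unfolding h(4) \<epsilon>f ..
      finally have "k = f" by (rule eps_cancel[rotated -1]) simp_all
      have "h = (h \<cdot>\<^bsub>D\<^esub> \<epsilon> x) \<cdot>\<^bsub>D\<^esub> inv_arr D (\<epsilon> x)" using h(1-3) i by simp
      thus "h = on_arr F f \<cdot>\<^bsub>D\<^esub> inv_arr D (\<epsilon> x)" using Fk \<open>k = f\<close> by simp
    qed
  qed (use FR in \<open>auto simp: id_ftor_def\<close>)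
  show ?thesis
    unfolding coreflective_def left_adjoint_def using I.adjunction by blast
qed

text \<open>Shrinking the codomain keeps the universal arrows, and uniqueness of lifts keeps the
  unit. On the image the counit is invertible by \<open>ess_image_iff\<close>.\<close>

theorem adjoint_equivalence_ess_image:
  "\<exists>G \<eta> \<epsilon>. adjoint_equivalence C (full_sub D (ess_image C D F)) F G \<eta> \<epsilon>"
proof -
  let ?S = "full_sub D (ess_image C D F)"
  have FR: "on_obj F x \<in> ess_image C D F" if "x \<in> Obj C" for x
    using that unit_iso(2)[OF that] ess_image_iff by simp
  interpret E: universal_arrows C ?S F R \<epsilon>
  proof (intro universal_arrows.intro universal_arrows_axioms.intro ordinary_functor.intro C.category_axioms
      D.category_full_sub ordinary_functor_axioms.intro)
    fix x y g assume "x \<in> Obj C" "y \<in> Obj ?S" "g \<in> hom ?S (on_obj F x) y"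
    thus "\<exists>!f. f \<in> hom C x (R y) \<and> \<epsilon> y \<cdot>\<^bsub>?S\<^esub> on_arr F f = g"
      using univ[of x y g] by simp
  qed (use FR on_ide functor_comp in auto)
  have "E.unit x = unit x" if "x \<in> Obj C" for x
    using that by (intro eps_cancel[of _ _ "on_obj F x"]) (use E.unit[OF that] FR[OF that] in simp_all)
  moreover have "is_iso ?S (\<epsilon> y)" if "y \<in> Obj ?S" for y
    by (rule D.full_sub_iso) (use that ess_image_iff FR[of "R y"] in simp_all)
  ultimately have "adjoint_equivalence C ?S F E.radj E.unit \<epsilon>"
    using E.adjunction unit_iso(1) unfolding adjoint_equivalence_def by simp
  thus ?thesis by blast
qed

end

section \<open>The theorem\<close>

context cst_ctx begin

section \<open>Functoriality in the left module object\<close>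

lemma cst_functor_simps [simp]: "on_obj (cst_functor V C b) P = cs P"
  "on_arr (cst_functor V C b) (P, Q, f) = (cs P, cs Q, \<lambda>Z \<in> RM. gmor (cst_right V C b P Q f Z))"
  by (simp_all add: cst_functor_def gmor_def)

lemma cst_arr_eq_iff:
  assumes lm: "lmor P Q f" and \<alpha>: "\<alpha> \<in> extensional RM"
  shows "on_arr (cst_functor V C b) (P, Q, f) = (cs P, cs Q, \<alpha>) \<longleftrightarrow>
    (\<forall>Z \<in> RM. cst_right V C b P Q f Z = component (cs P) (cs Q) \<alpha> Z)"
proof -
  have "gmor (cst_right V C b P Q f Z) = \<alpha> Z \<longleftrightarrow> cst_right V C b P Q f Z = component (cs P) (cs Q) \<alpha> Z"
    if "Z \<in> RM" for Z
    using cst_right(3,4)[OF lm that] that by (auto intro: g_eqI simp: component_mor)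
  thus ?thesis
    using \<alpha> by (auto simp: fun_eq_iff extensional_def restrict_def)
qed

lemma cst_right_gid:
  assumes [simp]: "P \<in> LM" "Z \<in> RM"
  shows "cst_right V C b P P (gid C (fst P)) Z = gid C (cst_obj V C b P Z)"
proof (rule gepi_post[OF K_epi[of P Z]])
  note r = cst_right[OF lmor_gid[of P], of Z]
  show "gpost V C (cst_right V C b P P (gid C (fst P)) Z) (K P Z) = gpost V C (gid C (cst_obj V C b P Z)) (K P Z)"
    using r(5) by (simp add: gpre_gid gpost_gid)
qed (use cst_right(1-4)[OF lmor_gid[of P], of Z] in simp_all)

lemma cst_right_comp:
  assumes f: "lmor P Q f" and g: "lmor Q S g" and Z [simp]: "Z \<in> RM"
  shows "cst_right V C b P S (gpost V C g f) Z = gpost V C (cst_right V C b Q S g Z) (cst_right V C b P Q f Z)"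
proof (rule gepi_post[OF K_epi[OF lmorD(1)[OF f] Z]])
  note [simp] = lmorD(1-6)[OF f] lmorD(2-6)[OF g] cst_right(1-4)[OF f Z] cst_right(1-4)[OF g Z]
    cst_right(1-4)[OF lmor_comp[OF f g] Z]
  show "gpost V C (cst_right V C b P S (gpost V C g f) Z) (K P Z) =
      gpost V C (gpost V C (cst_right V C b Q S g Z) (cst_right V C b P Q f Z)) (K P Z)"
    by (simp add: cst_right(5)[OF lmor_comp[OF f g] Z] gpost_gpost cst_right(5)[OF f Z] gpost_gpre
        cst_right(5)[OF g Z] gpre_gpre)
qed (use lmorD(1)[OF f] cst_right(1-4)[OF f Z] cst_right(1-4)[OF g Z] cst_right(1-4)[OF lmor_comp[OF f g] Z] in simp_all)

lemma cst_ordinary_functor: "ordinary_functor (LMod V C b) (vfunct V M C) (cst_functor V C b)"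
proof (intro ordinary_functor.intro category_LMod VF.category_vfunct ordinary_functor_axioms.intro)
  fix P assume "P \<in> Obj (LMod V C b)"
  hence P [simp]: "P \<in> LM" by simp
  show "on_obj (cst_functor V C b) P \<in> Obj (vfunct V M C)" by (simp add: cst_vfunctors)
  have "(\<lambda>Z \<in> RM. gmor (cst_right V C b P P (gid C (fst P)) Z)) = (\<lambda>Z \<in> RM. VId C (cst_obj V C b P Z))"
    by (rule restrict_ext) (simp add: cst_right_gid)
  also have "\<dots> = (\<lambda>Z \<in> VObj M. VId C (f_obj (cs P) Z))"
    by (auto intro!: restrict_ext)
  finally show "on_arr (cst_functor V C b) (Ide (LMod V C b) P) = Ide (vfunct V M C) (on_obj (cst_functor V C b) P)"
    by simp
next
  fix f P Q assume "f \<in> hom (LMod V C b) P Q"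
  then obtain f0 where f: "f = (P, Q, f0)" "lmor P Q f0" by (cases f) auto
  show "on_arr (cst_functor V C b) f \<in> hom (vfunct V M C) (on_obj (cst_functor V C b) P) (on_obj (cst_functor V C b) Q)"
    using lmorD(1,2)[OF f(2)] cst_right_nat(1)[OF f(2)] by (simp add: f(1) cst_vfunctors)
next
  fix f g P Q S assume "f \<in> hom (LMod V C b) P Q" "g \<in> hom (LMod V C b) Q S"
  then obtain f0 g0 where f: "f = (P, Q, f0)" "lmor P Q f0" and g: "g = (Q, S, g0)" "lmor Q S g0"
    by (cases f; cases g) auto
  note n = cst_right_nat[OF f(2)] and n' = cst_right_nat[OF g(2)]
  have "gmor (cst_right V C b P S (gpost V C g0 f0) Z) =
     el_comp V C (f_obj (cs P) Z) (f_obj (cs Q) Z) (f_obj (cs S) Z)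
       ((\<lambda>Z \<in> RM. gmor (cst_right V C b Q S g0 Z)) Z) ((\<lambda>Z \<in> RM. gmor (cst_right V C b P Q f0 Z)) Z)"
    if Z [simp]: "Z \<in> RM" for Z
    using VF.component_comp[OF enriched_cst[OF lmorD(1)[OF f(2)]] enriched_cst[OF lmorD(2)[OF f(2)]]
        enriched_cst[OF lmorD(2)[OF g(2)]] n(1) n'(1), of Z]
    unfolding n(2)[OF Z] n'(2)[OF Z] cst_right_comp[OF f(2) g(2) Z] by simp
  hence "(\<lambda>Z \<in> RM. gmor (cst_right V C b P S (gpost V C g0 f0) Z)) = (\<lambda>Z \<in> VObj M.
     el_comp V C (f_obj (cs P) Z) (f_obj (cs Q) Z) (f_obj (cs S) Z)
       ((\<lambda>Z \<in> RM. gmor (cst_right V C b Q S g0 Z)) Z) ((\<lambda>Z \<in> RM. gmor (cst_right V C b P Q f0 Z)) Z))"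
    unfolding Mod_simps by (rule restrict_ext)
  thus "on_arr (cst_functor V C b) (g \<cdot>\<^bsub>LMod V C b\<^esub> f) =
      on_arr (cst_functor V C b) g \<cdot>\<^bsub>vfunct V M C\<^esub> on_arr (cst_functor V C b) f"
    using f(2) g(2) unfolding f(1) g(1) by (simp only: LMod_simps(6) cst_functor_simps vfunct_simps)
qed

lemma cst_functor_ff: "fully_faithful (LMod V C b) (vfunct V M C) (cst_functor V C b)"
  unfolding fully_faithful_def
proof (intro ballI)
  fix P Q assume "P \<in> Obj (LMod V C b)" "Q \<in> Obj (LMod V C b)"
  hence [simp]: "P \<in> LM" "Q \<in> LM" by simp_all
  let ?F = "on_arr (cst_functor V C b)"
  interpret F: ordinary_functor "LMod V C b" "vfunct V M C" "cst_functor V C b"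
    by (rule cst_ordinary_functor)
  have ex1: "\<exists>!f. lmor P Q f \<and> ?F (P, Q, f) = (cs P, cs Q, \<alpha>)"
    if "enriched_nat_trans V M C (cs P) (cs Q) \<alpha>" "\<alpha> \<in> extensional RM" for \<alpha>
    using cst_fully_faithful[of P Q \<alpha>] cst_arr_eq_iff[OF _ that(2), of P Q] that(1) by (simp cong: conj_cong)
  show "bij_betw ?F (hom (LMod V C b) P Q) (hom (vfunct V M C) (on_obj (cst_functor V C b) P) (on_obj (cst_functor V C b) Q))"
  proof (rule bij_betwI')
    fix f g assume "f \<in> hom (LMod V C b) P Q" "g \<in> hom (LMod V C b) P Q"
    then obtain f0 g0 where f: "f = (P, Q, f0)" "lmor P Q f0" and g: "g = (P, Q, g0)" "lmor P Q g0"
      by (cases f; cases g) auto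
    show "?F f = ?F g \<longleftrightarrow> f = g"
    proof
      assume eq: "?F f = ?F g"
      let ?\<alpha> = "\<lambda>Z \<in> RM. gmor (cst_right V C b P Q g0 Z)"
      have "\<exists>!f. lmor P Q f \<and> ?F (P, Q, f) = (cs P, cs Q, ?\<alpha>)"
        by (rule ex1[OF cst_right_nat(1)[OF g(2)]]) simp
      moreover have "?F (P, Q, f0) = (cs P, cs Q, ?\<alpha>)" "?F (P, Q, g0) = (cs P, cs Q, ?\<alpha>)"
        using eq unfolding f(1) g(1) by simp_all
      ultimately have "f0 = g0" using f(2) g(2) by blast
      thus "f = g" using f(1) g(1) by simp
    qed simp
  next
    fix f assume "f \<in> hom (LMod V C b) P Q"
    thus "?F f \<in> hom (vfunct V M C) (on_obj (cst_functor V C b) P) (on_obj (cst_functor V C b) Q)"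
      by (rule F.on_arr_in)
  next
    fix a assume "a \<in> hom (vfunct V M C) (on_obj (cst_functor V C b) P) (on_obj (cst_functor V C b) Q)"
    then obtain \<alpha> where a: "a = (cs P, cs Q, \<alpha>)" "enriched_nat_trans V M C (cs P) (cs Q) \<alpha>" "\<alpha> \<in> extensional RM"
      by (cases a) auto
    then obtain f where "lmor P Q f" "?F (P, Q, f) = a" using ex1 by blast
    thus "\<exists>f \<in> hom (LMod V C b) P Q. a = ?F f"
      by (intro bexI[of _ "(P, Q, f)"]) simp_all
  qed
qed

text \<open>\<open>eps_univ\<close> in the form of universal arrows in the functor category; the
  adjunction, the coreflection and the equivalence become instances of the general results.\<close>

sublocale FF: ff_universal_arrows "LMod V C b" "vfunct V M C" "cst_functor V C b" robj
  "\<lambda>G. (cs (robj G), G, \<lambda>Z \<in> RM. gmor (eps G Z))"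
proof (intro ff_universal_arrows.intro universal_arrows.intro cst_ordinary_functor universal_arrows_axioms.intro
    ff_universal_arrows_axioms.intro cst_functor_ff)
  fix G assume "G \<in> Obj (vfunct V M C)"
  hence Gv: "G \<in> vfunctors V M C" and G: "enriched_functor V M C G" by (simp_all add: vfunctors_functor)
  show "robj G \<in> Obj (LMod V C b)" using robj(1)[OF G] by simp
  let ?e = "(cs (robj G), G, \<lambda>Z \<in> RM. gmor (eps G Z))"
  show "?e \<in> hom (vfunct V M C) (on_obj (cst_functor V C b) (robj G)) G"
    using Gv eps_nat(1)[OF G] cst_vfunctors[OF robj(1)[OF G]] by simp
  fix P a assume "P \<in> Obj (LMod V C b)" and a: "a \<in> hom (vfunct V M C) (on_obj (cst_functor V C b) P) G"
  hence P [simp]: "P \<in> LM" by simp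
  obtain \<alpha> where a: "a = (cs P, G, \<alpha>)" "enriched_nat_trans V M C (cs P) G \<alpha>" "\<alpha> \<in> extensional RM"
    using a by (cases a) auto
  have eq: "?e \<cdot>\<^bsub>vfunct V M C\<^esub> on_arr (cst_functor V C b) (P, robj G, f) = a \<longleftrightarrow>
      (\<forall>Z \<in> RM. gpost V C (eps G Z) (cst_right V C b P (robj G) f Z) = component (cs P) G \<alpha> Z)"
    if f: "lmor P (robj G) f" for f
  proof -
    note n = cst_right_nat[OF f] and n' = eps_nat[OF G]
    have "el_comp V C (f_obj (cs P) Z) (f_obj (cs (robj G)) Z) (f_obj G Z)
       ((\<lambda>Z \<in> RM. gmor (eps G Z)) Z) ((\<lambda>Z \<in> RM. gmor (cst_right V C b P (robj G) f Z)) Z) =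
       gmor (gpost V C (eps G Z) (cst_right V C b P (robj G) f Z))"
      if Z: "Z \<in> RM" for Z
      using VF.component_comp[OF enriched_cst[OF P] enriched_cst[OF robj(1)[OF G]] G n(1) n'(1), of Z] Z
      unfolding n(2)[OF Z] n'(2)[OF Z] by simp
    hence "(\<lambda>Z \<in> VObj M. el_comp V C (f_obj (cs P) Z) (f_obj (cs (robj G)) Z) (f_obj G Z)
       ((\<lambda>Z \<in> RM. gmor (eps G Z)) Z) ((\<lambda>Z \<in> RM. gmor (cst_right V C b P (robj G) f Z)) Z)) =
       (\<lambda>Z \<in> RM. gmor (gpost V C (eps G Z) (cst_right V C b P (robj G) f Z)))"
      unfolding Mod_simps by (rule restrict_ext)
    hence "?e \<cdot>\<^bsub>vfunct V M C\<^esub> on_arr (cst_functor V C b) (P, robj G, f) =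
       (cs P, G, \<lambda>Z \<in> RM. gmor (gpost V C (eps G Z) (cst_right V C b P (robj G) f Z)))"
      by (simp only: cst_functor_simps vfunct_simps)
    moreover have "gmor (gpost V C (eps G Z) (cst_right V C b P (robj G) f Z)) = \<alpha> Z \<longleftrightarrow>
       gpost V C (eps G Z) (cst_right V C b P (robj G) f Z) = component (cs P) G \<alpha> Z" if "Z \<in> RM" for Z
      using cst_right(3)[OF f that] eps(3)[OF G that] that by (auto intro: g_eqI simp: component_mor)
    ultimately show ?thesis
      using a(3) unfolding a(1) by (auto simp: fun_eq_iff extensional_def restrict_def)
  qed
  let ?T = "\<lambda>f. lmor P (robj G) f \<and> (\<forall>Z \<in> RM. gpost V C (eps G Z) (cst_right V C b P (robj G) f Z) = component (cs P) G \<alpha> Z)"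
  let ?U = "\<lambda>h. h \<in> hom (LMod V C b) P (robj G) \<and> ?e \<cdot>\<^bsub>vfunct V M C\<^esub> on_arr (cst_functor V C b) h = a"
  have "?T f \<longleftrightarrow> ?U (P, robj G, f)" for f
  proof (cases "lmor P (robj G) f")
    case True
    thus ?thesis using eq[OF True] by simp
  qed simp
  moreover have "(P, robj G, snd (snd h)) = h" if "?U h" for h
    using that by (cases h) simp
  ultimately have "(\<exists>!f. ?T f) \<longleftrightarrow> (\<exists>!h. ?U h)"
    by (intro ex1_transfer[where F = "\<lambda>f. (P, robj G, f)" and G = "\<lambda>h. snd (snd h)"]) (assumption | simp)+
  thus "\<exists>!h. ?U h" using eps_univ[OF P G a(2)] by simp
qed

text \<open>An isomorphism with some \<open>cs P\<close> transfers its right adjoint and hence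
  cocontinuity. Conversely cocontinuity inverts the counit at each module, and
  \<open>vfunct_iso\<close> assembles these inverses.\<close>

lemma ess_image_eq_cocont:
  assumes inf: "infinite (UNIV :: 'u set)"
  shows "ess_image (LMod V C b) (vfunct V M C) (cst_functor V C b) = cocont_functors TYPE('u) V M C"
proof (intro equalityI subsetI)
  fix G assume "G \<in> ess_image (LMod V C b) (vfunct V M C) (cst_functor V C b)"
  then obtain P a where Gv: "G \<in> vfunctors V M C" and P: "P \<in> LM"
    and a: "a \<in> hom (vfunct V M C) (cs P) G" "is_iso (vfunct V M C) a"
    by (auto simp: ess_image_def isomorphic_def)
  note G = vfunctors_functor[OF Gv]
  obtain \<alpha> where a_eq: "a = (cs P, G, \<alpha>)" and \<alpha>: "enriched_nat_trans V M C (cs P) G \<alpha>"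
    using a(1) by (cases a) auto
  have "\<exists>k. garr V C k \<and> gr V k = \<one> \<and> gdom k = f_obj G Z \<and> gcod k = cst_obj V C b P Z \<and>
      gpost V C k (component (cs P) G \<alpha> Z) = gid C (cst_obj V C b P Z) \<and>
      gpost V C (component (cs P) G \<alpha> Z) k = gid C (f_obj G Z)" if Z: "Z \<in> RM" for Z
  proof -
    have Z': "Z \<in> VObj M" using Z by simp
    obtain k where "garr V C k" "gr V k = \<one>" "gdom k = f_obj G Z" "gcod k = f_obj (cs P) Z"
      "gpost V C k (component (cs P) G \<alpha> Z) = gid C (f_obj (cs P) Z)"
      "gpost V C (component (cs P) G \<alpha> Z) k = gid C (f_obj G Z)"
      by (rule VF.vfunct_isoD[OF a(2)[unfolded a_eq] Z'])
    thus ?thesis using Z by (intro exI[of _ k]) simp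
  qed
  then obtain k where "\<And>Z. Z \<in> RM \<Longrightarrow> garr V C (k Z) \<and> gr V (k Z) = \<one> \<and> gdom (k Z) = f_obj G Z \<and> gcod (k Z) = cst_obj V C b P Z \<and>
      gpost V C (k Z) (component (cs P) G \<alpha> Z) = gid C (cst_obj V C b P Z) \<and>
      gpost V C (component (cs P) G \<alpha> Z) (k Z) = gid C (f_obj G Z)"
    by metis
  from cocontinuous_if_iso[OF P G \<alpha> this] Gv
  show "G \<in> cocont_functors TYPE('u) V M C" by (simp add: cocont_functors_def)
next
  fix G assume "G \<in> cocont_functors TYPE('u) V M C"
  hence Gv: "G \<in> vfunctors V M C" and cocont: "cocontinuous TYPE('u) V M C G"
    by (simp_all add: cocont_functors_def)
  note G = vfunctors_functor[OF Gv]
  have "is_iso (vfunct V M C) (cs (robj G), G, \<lambda>Z \<in> RM. gmor (eps G Z))"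
  proof (rule VF.vfunct_iso)
    fix Z assume "Z \<in> VObj M"
    hence Z: "Z \<in> RM" by simp
    show "\<exists>k. garr V C k \<and> gr V k = \<one> \<and> gdom k = f_obj G Z \<and> gcod k = f_obj (cs (robj G)) Z \<and>
      gpost V C k (component (cs (robj G)) G (\<lambda>Z \<in> RM. gmor (eps G Z)) Z) = gid C (f_obj (cs (robj G)) Z) \<and>
      gpost V C (component (cs (robj G)) G (\<lambda>Z \<in> RM. gmor (eps G Z)) Z) k = gid C (f_obj G Z)"
      using eps_iso_if_cocontinuous[OF inf G cocont Z] Z unfolding eps_nat(2)[OF G Z] by simp
  qed (use Gv cst_vfunctors[OF robj(1)[OF G]] eps_nat(1)[OF G] in simp_all)
  thus "G \<in> ess_image (LMod V C b) (vfunct V M C) (cst_functor V C b)"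
    using Gv unfolding FF.ess_image_iff by simp
qed

end

theorem theorem3p3:
  fixes V :: "('vo, 'va) smc"
    and b :: "('vo, 'va) mon"
    and C :: "('o, 'vo, 'va) vcat"
  assumes "infinite (UNIV :: 'u set)"
    and "cosmos TYPE('u) V"
    and "monoid_in V b"
    and "enriched_category V C"
    and "enriched_cocomplete TYPE('u) V C"
  shows
    "(ordinary_functor (LMod V C b) (vfunct V (Mod V b) C) (cst_functor V C b) \<and>
      fully_faithful (LMod V C b) (vfunct V (Mod V b) C) (cst_functor V C b) \<and>
      left_adjoint (LMod V C b) (vfunct V (Mod V b) C) (cst_functor V C b)) \<and>
     (ess_image (LMod V C b) (vfunct V (Mod V b) C) (cst_functor V C b) =
        cocont_functors TYPE('u) V (Mod V b) C \<and>
      coreflective (vfunct V (Mod V b) C) (cocont_functors TYPE('u) V (Mod V b) C) \<and>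
      (\<exists>R \<eta> \<epsilon>. adjoint_equivalence (LMod V C b)
        (full_sub (vfunct V (Mod V b) C) (cocont_functors TYPE('u) V (Mod V b) C))
        (cst_functor V C b) R \<eta> \<epsilon>))"
proof -
  interpret E: enriched_category V C by fact
  have complete: "complete TYPE('u) V" using assms(2) by (simp add: cosmos_def)
  \<comment> \<open>The context asks for tensors, universal balanced arrows and equalizers. The
    first two are colimits of one-object diagrams in \<open>C\<close>, the last are limits of
    parallel pairs in \<open>V\<close>.\<close>
  interpret cst_ctx V C b
  proof (intro cst_ctx.intro bmod.intro tensored.intro tensored_axioms.intro bmod_axioms.intro
      mod_ctx.intro mod_ctx_axioms.intro monoid_ctx.intro monoid_ctx_axioms.intro
      E.enriched_category_axioms E.closed_symmetric_monoidal_axioms assms(3))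
    show "\<exists>t \<eta>. is_tensor V C z X t \<eta>" if "z \<in> Obj V" "X \<in> VObj C" for z X
      by (rule E.tensor_exists[OF assms(1,5) that])
    show "\<exists>k. buniv V C r (snd Z) k \<and> gr V k = fst Z" if "gaction V C b r" "Z \<in> right_modules V b" for r Z
    proof -
      interpret one_object_diagram V C b Z r
        by (intro one_object_diagram.intro monoid_ctx.intro monoid_ctx_axioms.intro one_object_diagram_axioms.intro
            E.enriched_category_axioms E.closed_symmetric_monoidal_axioms assms(3) that)
      show ?thesis by (rule buniv_exists[OF assms(1,5)])
    qed
    show "\<exists>i. is_equalizer V f g i" if "f \<in> Arr V" "g \<in> Arr V" "Dom V f = Dom V g" "Cod V f = Cod V g" for f g
      by (rule E.complete_imp_equalizer[OF assms(1) complete that])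
  qed
  note S = ess_image_eq_cocont[OF assms(1)]
  show ?thesis
    using cst_ordinary_functor cst_functor_ff FF.adjunction S
      FF.coreflective_ess_image FF.adjoint_equivalence_ess_image
    unfolding left_adjoint_def S by blast
qed

end
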